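(* Let $(\mathcal C,\mathbb E,\mathfrak s)$ be a $2$-Calabi-Yau extriangulated category over a field $k$, with enough projectives and enough injectives and with (non-zero) cluster tilting objects, and assume that the cluster tilting objects form a cluster structure on $\mathcal C$. Fix a cluster tilting object $T$, put $\mathcal T=\mathrm{add}\,T$, and assume that there is a cluster map $\chi$ from $\mathcal C$ to $\mathscr A(\mathcal T)$. Let $\mathcal I\subseteq\mathcal T$ be a rigid subcategory with $\mathrm{Proj}(\mathcal C)\subseteq\mathcal I$. For a cotorsion pair $(\mathcal X,\mathcal Y)$ with core $\mathcal I$ write $\mathcal T=\mathcal T_{\mathcal X}\oplus\mathcal I\oplus\mathcal T_{\mathcal Y}$ with $\mathcal T_{\mathcal X}\subseteq\mathcal X$, $\mathcal T_{\mathcal Y}\subseteq\mathcal Y$. Then the correspondence $(\mathcal X,\mathcal Y)\mapsto(\mathscr A(\mathcal T_{\mathcal X}\oplus\mathcal I),\mathscr A(\mathcal T_{\mathcal Y}\oplus\mathcal I))$ induced by $\chi$ is a bijection $$\{\text{cotorsion pairs in }\mathcal C\text{ with core }\mathcal I\}\longrightarrow\{\text{complete pairs of rooted cluster subalgebras of }\mathscr A(\mathcal T)\text{ with coefficient set }\chi(\mathcal I)\}.$$ This induces a bijection $$\{t\text{-structures in }\mathcal C\}\longrightarrow\{\text{complete pairs of rooted cluster subalgebras of }\mathscr A(\mathcal T)\text{ with coefficient set }\chi(\mathrm{Proj\text{-}Inj})\},$$ where $\mathrm{Proj\text{-}Inj}$ is the subcategory of projective-injective objects of $\mathcal C$.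
   Context: Conventions: all additive categories are Krull-Schmidt; a subcategory is a full subcategory closed under isomorphisms, finite direct sums and direct summands; $\mathrm{add}\,M$ is the subcategory of direct summands of finite direct sums of copies of $M$. Extriangulated category: a triple $(\mathcal C,\mathbb E,\mathfrak s)$ with $\mathcal C$ additive, $\mathbb E:\mathcal C^{\mathrm{op}}\times\mathcal C\to\mathrm{Ab}$ a biadditive functor, and $\mathfrak s$ assigning to each $\delta\in\mathbb E(C,A)$ an equivalence class $\mathfrak s(\delta)=[A\xrightarrow{x}B\xrightarrow{y}C]$ of sequences (equivalence: an isomorphism of middle terms compatible with the identities of the ends). One says $A\to B\to C$ realizes $\delta$ and calls $A\to B\to C\overset{\delta}{\dashrightarrow}$ an $\mathbb E$-triangle. Write $a_*\delta=\mathbb E(C,a)(\delta)$, $c^*\delta=\mathbb E(c,A)(\delta)$; a morphism $\delta\to\delta'$ with $\delta'\in\mathbb E(C',A')$ is a pair $(a:A\to A',c:C\to C')$ with $a_*\delta=c^*\delta'$. Axioms: every morphism $(a,c):\delta\to\delta'$ is realized by some $b$ with $bx=x'a$, $y'b=cy$; $\mathfrak s(0)$ is the split sequence and $\mathfrak s(\delta\oplus\delta')=\mathfrak s(\delta)\oplus\mathfrak s(\delta')$; (ET3) if $bx=x'a$ there is $c$ with $cy=y'b$ and $(a,c):\delta\to\delta'$ a morphism, and dually (ET3)$^{\rm op}$; (ET4) if $A\xrightarrow{f}B\xrightarrow{f'}D$ realizes $\delta$ and $B\xrightarrow{g}C\xrightarrow{g'}F$ realizes $\delta'$, there are an object $E$,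 morphisms $h':C\to E$, $d:D\to E$, $e:E\to F$ with $h'g=df'$, $eh'=g'$, and $\delta''\in\mathbb E(E,A)$ realized by $A\xrightarrow{gf}C\xrightarrow{h'}E$, such that $D\xrightarrow{d}E\xrightarrow{e}F$ realizes $f'_*\delta'$, $d^*\delta''=\delta$, $f_*\delta''=e^*\delta'$; and dually (ET4)$^{\rm op}$. $P$ is projective if every morphism $P\to C$ lifts along $y$ for every $\mathbb E$-triangle $A\to B\xrightarrow{y}C\dashrightarrow$; injectives are dual. $\mathrm{Proj}(\mathcal C)$, $\mathrm{Inj}(\mathcal C)$ denote the corresponding subcategories. Enough projectives: every $C$ has an $\mathbb E$-triangle $A\to P\to C\dashrightarrow$ with $P$ projective; enough injectives dually. $2$-Calabi-Yau: $\mathcal C$ is $k$-linear, all $\mathrm{Hom}(A,B)$ and $\mathbb E(A,B)$ are finite dimensional, and there is a bifunctorial isomorphism $\mathbb E(A,B)\simeq\mathrm{Hom}_k(\mathbb E(B,A),k)$. (Then, with enough projectives and injectives, projectives and injectives coincide.) A subcategory $\mathcal R$ is rigid if $\mathbb E(\mathcal R,\mathcal R)=0$. It is cluster tilting if it is functorially finite and $M\in\mathcal R\iff\mathbb E(M,\mathcal R)=0\iff\mathbb E(\mathcal R,M)=0$. $T$ is a cluster tilting object if $\mathrm{add}\,T$ is cluster tilting. A cotorsion pair $(\mathcal X,\mathcal Y)$ is a pair of subcategories with $\mathbb E(\mathcal X,\mathcal Y)=0$ such that every $C\in\mathcal C$ admits $\mathbb E$-triangles $Y\to X\to C\dashrightarrow$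 and $C\to Y'\to X'\dashrightarrow$ with $X,X'\in\mathcal X$, $Y,Y'\in\mathcal Y$. Its core is $\mathcal X\cap\mathcal Y$; it is a $t$-structure if its core is $\mathrm{Proj\text{-}Inj}$. For a cotorsion pair with core $\mathcal I\subseteq\mathcal T$, every indecomposable of $\mathcal T$ lies in $\mathcal X$ or $\mathcal Y$; $\mathcal T_{\mathcal X}$ (resp. $\mathcal T_{\mathcal Y}$) is the additive closure of the indecomposables of $\mathcal T$ in $\mathcal X$ (resp. $\mathcal Y$) not in $\mathcal I$. Ice quivers: an ice quiver is a quiver with a subset of frozen vertices; the other vertices are exchangeable; the full subquiver on the exchangeable vertices is the exchangeable part. There are no loops, no $2$-cycles and no arrows between frozen vertices. $Q(\mathcal T)$: vertices are the isomorphism classes of indecomposables of $\mathcal T$, the projective ones being frozen; for $T_i,T_j$ not both frozen the number of arrows $T_i\to T_j$ is $\dim_k \mathrm{rad}(T_i,T_j)/\mathrm{rad}^2(T_i,T_j)$ computed in $\mathcal T$. $Q(\mathcal T_{\mathcal X}\oplus\mathcal I)$ is defined likewise inside $\mathcal T_{\mathcal X}\oplus\mathcal I$, with exchangeable vertices the indecomposables of $\mathcal T_{\mathcal X}$ and frozen vertices those of $\mathcal I$; similarly for $\mathcal Y$. Mutation of an ice quiver at an exchangeable vertex $i$: add an arrow $j\to l$ for each path $j\to i\to l$, reverse all arrows at $i$, remove a maximal collection of disjoint $2$-cycles and all arrows between frozen vertices. A seed is $\Sigma=(\mathbf{ex},\mathbf{fx},Q)$ with $Q$ an ice quiver and $\mathbf{ex}$,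 $\mathbf{fx}$ sets of variables indexed by the exchangeable, respectively frozen vertices. Mutation of seeds mutates $Q$ and replaces $x_i$ by $x_i'$ with $x_ix_i'=\prod_{i\to j}x_j+\prod_{j\to i}x_j$. The cluster algebra is the $\mathbb Z$-subalgebra of the rational function field in the initial variables generated by all variables obtained by iterated mutation. A rooted cluster algebra $\mathscr A(\Sigma)$ is a cluster algebra together with the fixed initial seed $\Sigma$. $\mathscr A(\mathcal T)$, $\mathscr A(\mathcal T_{\mathcal X}\oplus\mathcal I)$, $\mathscr A(\mathcal T_{\mathcal Y}\oplus\mathcal I)$ are the rooted cluster algebras with initial quivers $Q(\mathcal T)$, $Q(\mathcal T_{\mathcal X}\oplus\mathcal I)$, $Q(\mathcal T_{\mathcal Y}\oplus\mathcal I)$, the initial variable at a vertex $M$ being $\chi(M)$. Cluster structure: call extended cluster the set of indecomposable direct summands (up to isomorphism) of a cluster tilting object; the coefficients are the indecomposable projective-injectives, the other elements are cluster variables. The cluster tilting objects form a cluster structure if: (a) for each extended cluster $\mathbf T$ and each cluster variable $M\in\mathbf T$ there is a unique cluster variable $M^*\not\simeq M$ such that $\mathbf T^*=(\mathbf T\setminus\{M\})\cup\{M^*\}$ is an extended cluster; (b) there are $\mathbb E$-triangles $M^*\xrightarrow{f}B\xrightarrow{g}M\dashrightarrow$ and $M\xrightarrow{s}B'\xrightarrow{t}M^*\dashrightarrow$ with $f,s$ minimal left and $g,t$ minimal right $\mathrm{add}(\mathbf T\setminus\{M\})$-approximations; (c) the quiver of every extended cluster has no loops and no $2$-cycles (disregarding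 arrows between coefficients); (d) the quiver of $\mathbf T^*$ is the mutation at $M$ of the quiver of $\mathbf T$. Cluster map $\chi$ from $\mathcal C$ to $\mathscr A(\mathcal T)$: a map, constant on isomorphism classes, from the objects belonging to $\mathrm{add}\,T'$, $T'$ ranging over the cluster tilting objects, to the ambient field of rational functions of $\mathscr A(\mathcal T)$, such that the images of the indecomposable summands of each cluster tilting object form a transcendence basis, those of $T$ being the initial variables of $\mathscr A(\mathcal T)$; $\chi(M)\chi(N)=\chi(B)+\chi(B')$ whenever $M,N$ are indecomposable with $\dim_k\mathbb E(M,N)=1$ and $B,B'$ are the middle terms of the non-split $\mathbb E$-triangles $M\to B\to N\dashrightarrow$, $N\to B'\to M\dashrightarrow$; and $\chi(A\oplus A')=\chi(A)\chi(A')$. $\chi(\mathcal I)$ denotes the set of $\chi(M)$, $M$ indecomposable in $\mathcal I$. Complete pairs: let $\Sigma=(\mathbf{ex},\mathbf{fx},Q)$ be a seed and $\mathbf{ex}'\subseteq\mathbf{ex}$. The freezing of $\Sigma$ at $\mathbf{ex}'$ is $\Sigma_f=(\mathbf{ex}\setminus\mathbf{ex}',\mathbf{fx}\sqcup\mathbf{ex}',Q_f)$, where $Q_f$ is obtained by freezing the vertices of $\mathbf{ex}'$ and deleting arrows between frozen vertices; $\mathbf{fx}_0$ is the set of isolated frozen variables of $\Sigma_f$. An indecomposable component of $\Sigma_f$ is given by a connected component of the exchangeable part of $Q_f$ together with the frozen vertices directly connected to it; gluing components means putting them together by identifying common frozen vertices. A pair $(\mathscr A(\Sigma_1),\mathscr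 A(\Sigma_2))$ with $\Sigma_i=(\mathbf{ex}_i,\mathbf{fx}_i,Q_i)$ is a complete pair of rooted cluster subalgebras of $\mathscr A(\Sigma)$ with coefficient set $\mathbf{fx}\sqcup\mathbf{ex}'$ if (1) both $\Sigma_i$ are gluings of some (possibly no) indecomposable components of $\Sigma_f$; (2) $\mathbf{ex}_1\cap\mathbf{ex}_2=\emptyset$ and $\mathbf{ex}=\mathbf{ex}_1\sqcup\mathbf{ex}_2\sqcup\mathbf{ex}'$; (3) $\mathbf{fx}\cup\mathbf{fx}_0\subseteq\mathbf{fx}_1\cap\mathbf{fx}_2$. Here each $\Sigma_i$ carries the whole coefficient set $\mathbf{fx}\sqcup\mathbf{ex}'$ as frozen variables, the frozen vertices not adjacent to its exchangeable part being isolated. *)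

theory Defs
  imports "HOL-Library.Poly_Mapping" "HOL-Computational_Algebra.Polynomial"
begin

section \<open>Additive categories\<close>

text \<open>
  The objects of the category are the elements of the type \<open>'o\<close>.  Every \<open>Hom A B\<close> is a subset
  of one ambient abelian group \<open>'m\<close> and every \<open>Ext C A\<close> (the group \<open>\<bbbE>(C,A)\<close>) of one ambient
  abelian group \<open>'e\<close>.  This loses no generality: for \<open>'m\<close> and \<open>'e\<close> one may take the direct sums
  of all the groups \<open>Hom A B\<close> and \<open>\<bbbE>(C,A)\<close>.  As zero morphisms (and zero extensions) with
  different end terms may coincide as elements, end terms are always given explicitly.

  \<open>push a \<delta>\<close> is \<open>\<bbbE>(C,a)(\<delta>)\<close>, \<open>pull c \<delta>\<close> is \<open>\<bbbE>(c,A)(\<delta>)\<close>, and \<open>realize C A \<delta>\<close> is the class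
  \<open>\<s>(\<delta>)\<close> as the set of all triples \<open>(B, x, y)\<close> such that \<open>A \<rightarrow> B \<rightarrow> C\<close>, with arrows \<open>x\<close> and \<open>y\<close>,
  belongs to the class.  The scalar multiplications are only used for categories over a field.
\<close>

record ('k, 'o, 'm, 'e) extri_data =
  Hom :: "'o \<Rightarrow> 'o \<Rightarrow> 'm set"
  Id :: "'o \<Rightarrow> 'm"
  Comp :: "'m \<Rightarrow> 'm \<Rightarrow> 'm" (infixl "\<cdot>\<index>" 70)
  scaleH :: "'k \<Rightarrow> 'm \<Rightarrow> 'm"
  Ext :: "'o \<Rightarrow> 'o \<Rightarrow> 'e set"
  push :: "'m \<Rightarrow> 'e \<Rightarrow> 'e"
  pull :: "'m \<Rightarrow> 'e \<Rightarrow> 'e"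
  scaleE :: "'k \<Rightarrow> 'e \<Rightarrow> 'e"
  realize :: "'o \<Rightarrow> 'o \<Rightarrow> 'e \<Rightarrow> ('o \<times> 'm \<times> 'm) set"

definition add_subgroup :: "'a::ab_group_add set \<Rightarrow> bool" where
  "add_subgroup S \<longleftrightarrow> 0 \<in> S \<and> (\<forall>x\<in>S. \<forall>y\<in>S. x - y \<in> S)"

definition zero_object :: "('k, 'o, 'm::ab_group_add, 'e) extri_data \<Rightarrow> 'o \<Rightarrow> bool" where
  "zero_object \<C> Z \<longleftrightarrow> Id \<C> Z = 0"

definition biproduct ::
  "('k, 'o, 'm::ab_group_add, 'e) extri_data \<Rightarrow> 'o \<Rightarrow> 'o \<Rightarrow> 'o \<Rightarrow> 'm \<Rightarrow> 'm \<Rightarrow> 'm \<Rightarrow> 'm \<Rightarrow> bool" where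
  "biproduct \<C> A B S i j p q \<longleftrightarrow>
     i \<in> Hom \<C> A S \<and> j \<in> Hom \<C> B S \<and> p \<in> Hom \<C> S A \<and> q \<in> Hom \<C> S B \<and>
     p \<cdot>\<^bsub>\<C>\<^esub> i = Id \<C> A \<and> q \<cdot>\<^bsub>\<C>\<^esub> j = Id \<C> B \<and> p \<cdot>\<^bsub>\<C>\<^esub> j = 0 \<and> q \<cdot>\<^bsub>\<C>\<^esub> i = 0 \<and>
     i \<cdot>\<^bsub>\<C>\<^esub> p + j \<cdot>\<^bsub>\<C>\<^esub> q = Id \<C> S"

locale additive_category =
  fixes \<C> :: "('k, 'o, 'm::ab_group_add, 'e) extri_data" (structure)
  assumes Id_in_Hom: "Id \<C> A \<in> Hom \<C> A A"
    and Comp_in_Hom: "f \<in> Hom \<C> A B \<Longrightarrow> g \<in> Hom \<C> B C \<Longrightarrow> g \<cdot> f \<in> Hom \<C> A C"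
    and Comp_assoc: "f \<in> Hom \<C> A B \<Longrightarrow> g \<in> Hom \<C> B C \<Longrightarrow> h \<in> Hom \<C> C D \<Longrightarrow>
      h \<cdot> (g \<cdot> f) = (h \<cdot> g) \<cdot> f"
    and Comp_Id_right: "f \<in> Hom \<C> A B \<Longrightarrow> f \<cdot> Id \<C> A = f"
    and Comp_Id_left: "f \<in> Hom \<C> A B \<Longrightarrow> Id \<C> B \<cdot> f = f"
    and Hom_subgroup: "add_subgroup (Hom \<C> A B)"
    and Comp_add_right: "f \<in> Hom \<C> A B \<Longrightarrow> f' \<in> Hom \<C> A B \<Longrightarrow> g \<in> Hom \<C> B C \<Longrightarrow>
      g \<cdot> (f + f') = g \<cdot> f + g \<cdot> f'"
    and Comp_add_left: "f \<in> Hom \<C> A B \<Longrightarrow> g \<in> Hom \<C> B C \<Longrightarrow> g' \<in> Hom \<C> B C \<Longrightarrow>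
      (g + g') \<cdot> f = g \<cdot> f + g' \<cdot> f"
    and ex_zero_object: "\<exists>Z. zero_object \<C> Z"
    and ex_biproduct: "\<exists>S i j p q. biproduct \<C> A B S i j p q"

definition iso_mor :: "('k, 'o, 'm, 'e) extri_data \<Rightarrow> 'o \<Rightarrow> 'o \<Rightarrow> 'm \<Rightarrow> bool" where
  "iso_mor \<C> A B f \<longleftrightarrow>
     f \<in> Hom \<C> A B \<and> (\<exists>g\<in>Hom \<C> B A. g \<cdot>\<^bsub>\<C>\<^esub> f = Id \<C> A \<and> f \<cdot>\<^bsub>\<C>\<^esub> g = Id \<C> B)"

definition isomorphic :: "('k, 'o, 'm, 'e) extri_data \<Rightarrow> 'o \<Rightarrow> 'o \<Rightarrow> bool" where
  "isomorphic \<C> A B \<longleftrightarrow> (\<exists>f. iso_mor \<C> A B f)"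

definition iso_class :: "('k, 'o, 'm, 'e) extri_data \<Rightarrow> 'o \<Rightarrow> 'o set" where
  "iso_class \<C> A = {B. isomorphic \<C> A B}"

definition is_dsum :: "('k, 'o, 'm::ab_group_add, 'e) extri_data \<Rightarrow> 'o \<Rightarrow> 'o \<Rightarrow> 'o \<Rightarrow> bool" where
  "is_dsum \<C> S A B \<longleftrightarrow> (\<exists>i j p q. biproduct \<C> A B S i j p q)"

fun is_dsum_list :: "('k, 'o, 'm::ab_group_add, 'e) extri_data \<Rightarrow> 'o \<Rightarrow> 'o list \<Rightarrow> bool" where
  "is_dsum_list \<C> S [] \<longleftrightarrow> zero_object \<C> S"
| "is_dsum_list \<C> S (A # As) \<longleftrightarrow> (\<exists>S'. is_dsum_list \<C> S' As \<and> is_dsum \<C> S A S')"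

definition indecomposable :: "('k, 'o, 'm::ab_group_add, 'e) extri_data \<Rightarrow> 'o \<Rightarrow> bool" where
  "indecomposable \<C> M \<longleftrightarrow> \<not> zero_object \<C> M \<and>
     (\<forall>A B. is_dsum \<C> M A B \<longrightarrow> zero_object \<C> A \<or> zero_object \<C> B)"

definition local_endomorphism_ring :: "('k, 'o, 'm::ab_group_add, 'e) extri_data \<Rightarrow> 'o \<Rightarrow> bool" where
  "local_endomorphism_ring \<C> M \<longleftrightarrow> \<not> zero_object \<C> M \<and>
     (\<forall>f\<in>Hom \<C> M M. \<forall>g\<in>Hom \<C> M M.
        iso_mor \<C> M M (f + g) \<longrightarrow> iso_mor \<C> M M f \<or> iso_mor \<C> M M g)"

definition krull_schmidt :: "('k, 'o, 'm::ab_group_add, 'e) extri_data \<Rightarrow> bool" where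
  "krull_schmidt \<C> \<longleftrightarrow>
     (\<forall>A. \<exists>As. (\<forall>M\<in>set As. local_endomorphism_ring \<C> M) \<and> is_dsum_list \<C> A As)"

definition subcategory :: "('k, 'o, 'm::ab_group_add, 'e) extri_data \<Rightarrow> 'o set \<Rightarrow> bool" where
  "subcategory \<C> \<X> \<longleftrightarrow>
     (\<forall>A B. A \<in> \<X> \<longrightarrow> isomorphic \<C> A B \<longrightarrow> B \<in> \<X>) \<and>
     (\<forall>Z. zero_object \<C> Z \<longrightarrow> Z \<in> \<X>) \<and>
     (\<forall>S A B. is_dsum \<C> S A B \<longrightarrow> (S \<in> \<X> \<longleftrightarrow> A \<in> \<X> \<and> B \<in> \<X>))"

definition add_closure :: "('k, 'o, 'm::ab_group_add, 'e) extri_data \<Rightarrow> 'o set \<Rightarrow> 'o set" where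
  "add_closure \<C> \<S> =
     {A. \<exists>Bs S B. set Bs \<subseteq> \<S> \<and> is_dsum_list \<C> S Bs \<and> is_dsum \<C> S A B}"

abbreviation add_obj :: "('k, 'o, 'm::ab_group_add, 'e) extri_data \<Rightarrow> 'o \<Rightarrow> 'o set" where
  "add_obj \<C> M \<equiv> add_closure \<C> {M}"

definition subcategory_sum ::
  "('k, 'o, 'm::ab_group_add, 'e) extri_data \<Rightarrow> 'o set \<Rightarrow> 'o set \<Rightarrow> 'o set" where
  "subcategory_sum \<C> \<X> \<Y> = {S. \<exists>A\<in>\<X>. \<exists>B\<in>\<Y>. is_dsum \<C> S A B}"


section \<open>Extriangulated categories\<close>

definition seq_equiv ::
  "('k, 'o, 'm, 'e) extri_data \<Rightarrow> 'o \<times> 'm \<times> 'm \<Rightarrow> 'o \<times> 'm \<times> 'm \<Rightarrow> bool" where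
  "seq_equiv \<C> = (\<lambda>(B, x, y) (B', x', y').
     \<exists>b. iso_mor \<C> B B' b \<and> b \<cdot>\<^bsub>\<C>\<^esub> x = x' \<and> y' \<cdot>\<^bsub>\<C>\<^esub> b = y)"

definition sequences :: "('k, 'o, 'm, 'e) extri_data \<Rightarrow> 'o \<Rightarrow> 'o \<Rightarrow> ('o \<times> 'm \<times> 'm) set" where
  "sequences \<C> A C = {(B, x, y). x \<in> Hom \<C> A B \<and> y \<in> Hom \<C> B C}"

definition etriangle ::
  "('k, 'o, 'm, 'e) extri_data \<Rightarrow> 'o \<Rightarrow> 'o \<Rightarrow> 'o \<Rightarrow> 'm \<Rightarrow> 'm \<Rightarrow> 'e \<Rightarrow> bool" where
  "etriangle \<C> A B C x y \<delta> \<longleftrightarrow> \<delta> \<in> Ext \<C> C A \<and> (B, x, y) \<in> realize \<C> C A \<delta>"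

locale extriangulated_category = additive_category \<C>
  for \<C> :: "('k, 'o, 'm::ab_group_add, 'e::ab_group_add) extri_data" (structure) +
  assumes Ext_subgroup: "add_subgroup (Ext \<C> C A)"
    and push_in_Ext: "a \<in> Hom \<C> A A' \<Longrightarrow> \<delta> \<in> Ext \<C> C A \<Longrightarrow> push \<C> a \<delta> \<in> Ext \<C> C A'"
    and pull_in_Ext: "c \<in> Hom \<C> C' C \<Longrightarrow> \<delta> \<in> Ext \<C> C A \<Longrightarrow> pull \<C> c \<delta> \<in> Ext \<C> C' A"
    and push_Id: "\<delta> \<in> Ext \<C> C A \<Longrightarrow> push \<C> (Id \<C> A) \<delta> = \<delta>"
    and pull_Id: "\<delta> \<in> Ext \<C> C A \<Longrightarrow> pull \<C> (Id \<C> C) \<delta> = \<delta>"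
    and push_Comp: "a \<in> Hom \<C> A A' \<Longrightarrow> a' \<in> Hom \<C> A' A'' \<Longrightarrow> \<delta> \<in> Ext \<C> C A \<Longrightarrow>
      push \<C> (a' \<cdot> a) \<delta> = push \<C> a' (push \<C> a \<delta>)"
    and pull_Comp: "c \<in> Hom \<C> C' C \<Longrightarrow> c' \<in> Hom \<C> C'' C' \<Longrightarrow> \<delta> \<in> Ext \<C> C A \<Longrightarrow>
      pull \<C> (c \<cdot> c') \<delta> = pull \<C> c' (pull \<C> c \<delta>)"
    and push_pull: "a \<in> Hom \<C> A A' \<Longrightarrow> c \<in> Hom \<C> C' C \<Longrightarrow> \<delta> \<in> Ext \<C> C A \<Longrightarrow>
      push \<C> a (pull \<C> c \<delta>) = pull \<C> c (push \<C> a \<delta>)"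
    and push_add_Ext: "a \<in> Hom \<C> A A' \<Longrightarrow> \<delta> \<in> Ext \<C> C A \<Longrightarrow> \<delta>' \<in> Ext \<C> C A \<Longrightarrow>
      push \<C> a (\<delta> + \<delta>') = push \<C> a \<delta> + push \<C> a \<delta>'"
    and pull_add_Ext: "c \<in> Hom \<C> C' C \<Longrightarrow> \<delta> \<in> Ext \<C> C A \<Longrightarrow> \<delta>' \<in> Ext \<C> C A \<Longrightarrow>
      pull \<C> c (\<delta> + \<delta>') = pull \<C> c \<delta> + pull \<C> c \<delta>'"
    and push_add_Hom: "a \<in> Hom \<C> A A' \<Longrightarrow> a' \<in> Hom \<C> A A' \<Longrightarrow> \<delta> \<in> Ext \<C> C A \<Longrightarrow>
      push \<C> (a + a') \<delta> = push \<C> a \<delta> + push \<C> a' \<delta>"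
    and pull_add_Hom: "c \<in> Hom \<C> C' C \<Longrightarrow> c' \<in> Hom \<C> C' C \<Longrightarrow> \<delta> \<in> Ext \<C> C A \<Longrightarrow>
      pull \<C> (c + c') \<delta> = pull \<C> c \<delta> + pull \<C> c' \<delta>"
    and realize_class: "\<delta> \<in> Ext \<C> C A \<Longrightarrow>
      \<exists>t\<in>sequences \<C> A C. realize \<C> C A \<delta> = {t' \<in> sequences \<C> A C. seq_equiv \<C> t t'}"
    and realize_morphism:
      "etriangle \<C> A B C x y \<delta> \<Longrightarrow> etriangle \<C> A' B' C' x' y' \<delta>' \<Longrightarrow>
       a \<in> Hom \<C> A A' \<Longrightarrow> c \<in> Hom \<C> C C' \<Longrightarrow> push \<C> a \<delta> = pull \<C> c \<delta>' \<Longrightarrow>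
       \<exists>b\<in>Hom \<C> B B'. b \<cdot> x = x' \<cdot> a \<and> y' \<cdot> b = c \<cdot> y"
    and realize_zero: "biproduct \<C> A C B i j p q \<Longrightarrow> (B, i, q) \<in> realize \<C> C A 0"
    and realize_dsum:
      "etriangle \<C> A B C x y \<delta> \<Longrightarrow> etriangle \<C> A' B' C' x' y' \<delta>' \<Longrightarrow>
       biproduct \<C> A A' AA i i' p p' \<Longrightarrow> biproduct \<C> B B' BB j j' q q' \<Longrightarrow>
       biproduct \<C> C C' CC l l' r r' \<Longrightarrow>
       (BB, j \<cdot> x \<cdot> p + j' \<cdot> x' \<cdot> p', l \<cdot> y \<cdot> q + l' \<cdot> y' \<cdot> q')
         \<in> realize \<C> CC AA (push \<C> i (pull \<C> r \<delta>) + push \<C> i' (pull \<C> r' \<delta>'))"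
    and ET3:
      "etriangle \<C> A B C x y \<delta> \<Longrightarrow> etriangle \<C> A' B' C' x' y' \<delta>' \<Longrightarrow>
       a \<in> Hom \<C> A A' \<Longrightarrow> b \<in> Hom \<C> B B' \<Longrightarrow> b \<cdot> x = x' \<cdot> a \<Longrightarrow>
       \<exists>c\<in>Hom \<C> C C'. c \<cdot> y = y' \<cdot> b \<and> push \<C> a \<delta> = pull \<C> c \<delta>'"
    and ET3_op:
      "etriangle \<C> A B C x y \<delta> \<Longrightarrow> etriangle \<C> A' B' C' x' y' \<delta>' \<Longrightarrow>
       b \<in> Hom \<C> B B' \<Longrightarrow> c \<in> Hom \<C> C C' \<Longrightarrow> c \<cdot> y = y' \<cdot> b \<Longrightarrow>
       \<exists>a\<in>Hom \<C> A A'. b \<cdot> x = x' \<cdot> a \<and> push \<C> a \<delta> = pull \<C> c \<delta>'"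
    and ET4:
      "etriangle \<C> A B D f f' \<delta> \<Longrightarrow> etriangle \<C> B C F g g' \<delta>' \<Longrightarrow>
       \<exists>E. \<exists>h'\<in>Hom \<C> C E. \<exists>d\<in>Hom \<C> D E. \<exists>e\<in>Hom \<C> E F. \<exists>\<delta>''\<in>Ext \<C> E A.
         h' \<cdot> g = d \<cdot> f' \<and> e \<cdot> h' = g' \<and>
         etriangle \<C> A C E (g \<cdot> f) h' \<delta>'' \<and>
         etriangle \<C> D E F d e (push \<C> f' \<delta>') \<and>
         pull \<C> d \<delta>'' = \<delta> \<and> push \<C> f \<delta>'' = pull \<C> e \<delta>'"
    and ET4_op:
      "etriangle \<C> D B A f' f \<delta> \<Longrightarrow> etriangle \<C> F C B g' g \<delta>' \<Longrightarrow>
       \<exists>E. \<exists>h'\<in>Hom \<C> E C. \<exists>d\<in>Hom \<C> E D. \<exists>e\<in>Hom \<C> F E. \<exists>\<delta>''\<in>Ext \<C> A E.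
         g \<cdot> h' = f' \<cdot> d \<and> h' \<cdot> e = g' \<and>
         etriangle \<C> E C A h' (f \<cdot> g) \<delta>'' \<and>
         etriangle \<C> F E D e d (pull \<C> f' \<delta>') \<and>
         push \<C> d \<delta>'' = \<delta> \<and> pull \<C> f \<delta>'' = push \<C> e \<delta>'"

definition projective :: "('k, 'o, 'm, 'e) extri_data \<Rightarrow> 'o \<Rightarrow> bool" where
  "projective \<C> P \<longleftrightarrow>
     (\<forall>A B C x y \<delta>. etriangle \<C> A B C x y \<delta> \<longrightarrow>
        (\<forall>f\<in>Hom \<C> P C. \<exists>g\<in>Hom \<C> P B. y \<cdot>\<^bsub>\<C>\<^esub> g = f))"

definition injective :: "('k, 'o, 'm, 'e) extri_data \<Rightarrow> 'o \<Rightarrow> bool" where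
  "injective \<C> J \<longleftrightarrow>
     (\<forall>A B C x y \<delta>. etriangle \<C> A B C x y \<delta> \<longrightarrow>
        (\<forall>f\<in>Hom \<C> A J. \<exists>g\<in>Hom \<C> B J. g \<cdot>\<^bsub>\<C>\<^esub> x = f))"

definition Proj :: "('k, 'o, 'm, 'e) extri_data \<Rightarrow> 'o set" where
  "Proj \<C> = {P. projective \<C> P}"

definition Inj :: "('k, 'o, 'm, 'e) extri_data \<Rightarrow> 'o set" where
  "Inj \<C> = {J. injective \<C> J}"

definition ProjInj :: "('k, 'o, 'm, 'e) extri_data \<Rightarrow> 'o set" where
  "ProjInj \<C> = Proj \<C> \<inter> Inj \<C>"

definition enough_projectives :: "('k, 'o, 'm, 'e) extri_data \<Rightarrow> bool" where
  "enough_projectives \<C> \<longleftrightarrow> (\<forall>C. \<exists>A P x y \<delta>. projective \<C> P \<and> etriangle \<C> A P C x y \<delta>)"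

definition enough_injectives :: "('k, 'o, 'm, 'e) extri_data \<Rightarrow> bool" where
  "enough_injectives \<C> \<longleftrightarrow> (\<forall>A. \<exists>J C x y \<delta>. injective \<C> J \<and> etriangle \<C> A J C x y \<delta>)"


section \<open>The 2-Calabi-Yau condition\<close>

definition finite_dimensional :: "('k::field \<Rightarrow> 'v::ab_group_add \<Rightarrow> 'v) \<Rightarrow> 'v set \<Rightarrow> bool" where
  "finite_dimensional scale V \<longleftrightarrow> (\<exists>B. finite B \<and> V = module.span scale B)"

locale linear_extriangulated_category = extriangulated_category \<C>
  for \<C> :: "('k::field, 'o, 'm::ab_group_add, 'e::ab_group_add) extri_data" (structure) +
  assumes vector_space_H: "vector_space (scaleH \<C>)"
    and vector_space_E: "vector_space (scaleE \<C>)"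
    and Hom_subspace: "module.subspace (scaleH \<C>) (Hom \<C> A B)"
    and Ext_subspace: "module.subspace (scaleE \<C>) (Ext \<C> C A)"
    and Comp_scale_left: "f \<in> Hom \<C> A B \<Longrightarrow> g \<in> Hom \<C> B C \<Longrightarrow>
      scaleH \<C> r g \<cdot> f = scaleH \<C> r (g \<cdot> f)"
    and Comp_scale_right: "f \<in> Hom \<C> A B \<Longrightarrow> g \<in> Hom \<C> B C \<Longrightarrow>
      g \<cdot> scaleH \<C> r f = scaleH \<C> r (g \<cdot> f)"
    and push_scale_Hom: "a \<in> Hom \<C> A A' \<Longrightarrow> \<delta> \<in> Ext \<C> C A \<Longrightarrow>
      push \<C> (scaleH \<C> r a) \<delta> = scaleE \<C> r (push \<C> a \<delta>)"
    and push_scale_Ext: "a \<in> Hom \<C> A A' \<Longrightarrow> \<delta> \<in> Ext \<C> C A \<Longrightarrow>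
      push \<C> a (scaleE \<C> r \<delta>) = scaleE \<C> r (push \<C> a \<delta>)"
    and pull_scale_Hom: "c \<in> Hom \<C> C' C \<Longrightarrow> \<delta> \<in> Ext \<C> C A \<Longrightarrow>
      pull \<C> (scaleH \<C> r c) \<delta> = scaleE \<C> r (pull \<C> c \<delta>)"
    and pull_scale_Ext: "c \<in> Hom \<C> C' C \<Longrightarrow> \<delta> \<in> Ext \<C> C A \<Longrightarrow>
      pull \<C> c (scaleE \<C> r \<delta>) = scaleE \<C> r (pull \<C> c \<delta>)"

text \<open>
  Functionals on a subspace \<open>V\<close> are represented by functions on the ambient space that vanish
  outside \<open>V\<close>.
\<close>

definition dual_space :: "('k::field \<Rightarrow> 'v::ab_group_add \<Rightarrow> 'v) \<Rightarrow> 'v set \<Rightarrow> ('v \<Rightarrow> 'k) set" where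
  "dual_space scale V = {\<phi>.
     (\<forall>x\<in>V. \<forall>y\<in>V. \<phi> (x + y) = \<phi> x + \<phi> y) \<and>
     (\<forall>r. \<forall>x\<in>V. \<phi> (scale r x) = r * \<phi> x) \<and>
     (\<forall>x. x \<notin> V \<longrightarrow> \<phi> x = 0)}"

locale two_calabi_yau_category = linear_extriangulated_category \<C>
  for \<C> :: "('k::field, 'o, 'm::ab_group_add, 'e::ab_group_add) extri_data" (structure) +
  assumes Hom_finite: "finite_dimensional (scaleH \<C>) (Hom \<C> A B)"
    and Ext_finite: "finite_dimensional (scaleE \<C>) (Ext \<C> A B)"
    and duality: "\<exists>\<Phi> :: 'o \<Rightarrow> 'o \<Rightarrow> 'e \<Rightarrow> 'e \<Rightarrow> 'k.
      (\<forall>A B. bij_betw (\<Phi> A B) (Ext \<C> A B) (dual_space (scaleE \<C>) (Ext \<C> B A))) \<and>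
      (\<forall>A B. \<forall>\<delta>\<in>Ext \<C> A B. \<forall>\<delta>'\<in>Ext \<C> A B. \<forall>\<epsilon>\<in>Ext \<C> B A.
         \<Phi> A B (\<delta> + \<delta>') \<epsilon> = \<Phi> A B \<delta> \<epsilon> + \<Phi> A B \<delta>' \<epsilon>) \<and>
      (\<forall>A B r. \<forall>\<delta>\<in>Ext \<C> A B. \<forall>\<epsilon>\<in>Ext \<C> B A.
         \<Phi> A B (scaleE \<C> r \<delta>) \<epsilon> = r * \<Phi> A B \<delta> \<epsilon>) \<and>
      (\<forall>A A' B B'. \<forall>a\<in>Hom \<C> A' A. \<forall>b\<in>Hom \<C> B B'. \<forall>\<delta>\<in>Ext \<C> A B. \<forall>\<epsilon>\<in>Ext \<C> B' A'.
         \<Phi> A' B' (push \<C> b (pull \<C> a \<delta>)) \<epsilon> = \<Phi> A B \<delta> (push \<C> a (pull \<C> b \<epsilon>)))"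


section \<open>Cluster tilting and cotorsion pairs\<close>

definition Ext_vanish ::
  "('k, 'o, 'm, 'e::ab_group_add) extri_data \<Rightarrow> 'o set \<Rightarrow> 'o set \<Rightarrow> bool" where
  "Ext_vanish \<C> \<X> \<Y> \<longleftrightarrow> (\<forall>X\<in>\<X>. \<forall>Y\<in>\<Y>. Ext \<C> X Y = {0})"

definition rigid :: "('k, 'o, 'm, 'e::ab_group_add) extri_data \<Rightarrow> 'o set \<Rightarrow> bool" where
  "rigid \<C> \<R> \<longleftrightarrow> Ext_vanish \<C> \<R> \<R>"

definition left_approx ::
  "('k, 'o, 'm, 'e) extri_data \<Rightarrow> 'o set \<Rightarrow> 'o \<Rightarrow> 'o \<Rightarrow> 'm \<Rightarrow> bool" where
  "left_approx \<C> \<D> M B f \<longleftrightarrow> B \<in> \<D> \<and> f \<in> Hom \<C> M B \<and>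
     (\<forall>D\<in>\<D>. \<forall>h\<in>Hom \<C> M D. \<exists>h'\<in>Hom \<C> B D. h' \<cdot>\<^bsub>\<C>\<^esub> f = h)"

definition right_approx ::
  "('k, 'o, 'm, 'e) extri_data \<Rightarrow> 'o set \<Rightarrow> 'o \<Rightarrow> 'o \<Rightarrow> 'm \<Rightarrow> bool" where
  "right_approx \<C> \<D> M B g \<longleftrightarrow> B \<in> \<D> \<and> g \<in> Hom \<C> B M \<and>
     (\<forall>D\<in>\<D>. \<forall>h\<in>Hom \<C> D M. \<exists>h'\<in>Hom \<C> D B. g \<cdot>\<^bsub>\<C>\<^esub> h' = h)"

definition minimal_left_approx ::
  "('k, 'o, 'm, 'e) extri_data \<Rightarrow> 'o set \<Rightarrow> 'o \<Rightarrow> 'o \<Rightarrow> 'm \<Rightarrow> bool" where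
  "minimal_left_approx \<C> \<D> M B f \<longleftrightarrow> left_approx \<C> \<D> M B f \<and>
     (\<forall>h\<in>Hom \<C> B B. h \<cdot>\<^bsub>\<C>\<^esub> f = f \<longrightarrow> iso_mor \<C> B B h)"

definition minimal_right_approx ::
  "('k, 'o, 'm, 'e) extri_data \<Rightarrow> 'o set \<Rightarrow> 'o \<Rightarrow> 'o \<Rightarrow> 'm \<Rightarrow> bool" where
  "minimal_right_approx \<C> \<D> M B g \<longleftrightarrow> right_approx \<C> \<D> M B g \<and>
     (\<forall>h\<in>Hom \<C> B B. g \<cdot>\<^bsub>\<C>\<^esub> h = g \<longrightarrow> iso_mor \<C> B B h)"

definition functorially_finite :: "('k, 'o, 'm, 'e) extri_data \<Rightarrow> 'o set \<Rightarrow> bool" where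
  "functorially_finite \<C> \<D> \<longleftrightarrow>
     (\<forall>M. (\<exists>B f. left_approx \<C> \<D> M B f) \<and> (\<exists>B g. right_approx \<C> \<D> M B g))"

definition cluster_tilting ::
  "('k, 'o, 'm::ab_group_add, 'e::ab_group_add) extri_data \<Rightarrow> 'o set \<Rightarrow> bool" where
  "cluster_tilting \<C> \<R> \<longleftrightarrow> subcategory \<C> \<R> \<and> functorially_finite \<C> \<R> \<and>
     (\<forall>M. (M \<in> \<R> \<longleftrightarrow> Ext_vanish \<C> {M} \<R>) \<and> (M \<in> \<R> \<longleftrightarrow> Ext_vanish \<C> \<R> {M}))"

definition cluster_tilting_object ::
  "('k, 'o, 'm::ab_group_add, 'e::ab_group_add) extri_data \<Rightarrow> 'o \<Rightarrow> bool" where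
  "cluster_tilting_object \<C> T \<longleftrightarrow> cluster_tilting \<C> (add_obj \<C> T)"

definition cotorsion_pair ::
  "('k, 'o, 'm::ab_group_add, 'e::ab_group_add) extri_data \<Rightarrow> 'o set \<Rightarrow> 'o set \<Rightarrow> bool" where
  "cotorsion_pair \<C> \<X> \<Y> \<longleftrightarrow> subcategory \<C> \<X> \<and> subcategory \<C> \<Y> \<and> Ext_vanish \<C> \<X> \<Y> \<and>
     (\<forall>C. (\<exists>Y\<in>\<Y>. \<exists>X\<in>\<X>. \<exists>f g \<delta>. etriangle \<C> Y X C f g \<delta>) \<and>
          (\<exists>Y'\<in>\<Y>. \<exists>X'\<in>\<X>. \<exists>f g \<delta>. etriangle \<C> C Y' X' f g \<delta>))"

definition core :: "'o set \<Rightarrow> 'o set \<Rightarrow> 'o set" where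
  "core \<X> \<Y> = \<X> \<inter> \<Y>"

definition t_structure ::
  "('k, 'o, 'm::ab_group_add, 'e::ab_group_add) extri_data \<Rightarrow> 'o set \<Rightarrow> 'o set \<Rightarrow> bool" where
  "t_structure \<C> \<X> \<Y> \<longleftrightarrow> cotorsion_pair \<C> \<X> \<Y> \<and> core \<X> \<Y> = ProjInj \<C>"

text \<open>
  With \<open>\<U> = \<X>\<close> (resp. \<open>\<U> = \<Y>\<close>) this is the subcategory \<open>\<T>\<^sub>\<X>\<close> (resp. \<open>\<T>\<^sub>\<Y>\<close>) attached to a
  cotorsion pair \<open>(\<X>,\<Y>)\<close> with core \<open>\<I>\<close>.
\<close>

definition tilting_part ::
  "('k, 'o, 'm::ab_group_add, 'e) extri_data \<Rightarrow> 'o set \<Rightarrow> 'o set \<Rightarrow> 'o set \<Rightarrow> 'o set" where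
  "tilting_part \<C> \<T> \<I> \<U> = add_closure \<C> {M \<in> \<T>. indecomposable \<C> M \<and> M \<in> \<U> \<and> M \<notin> \<I>}"


section \<open>Ice quivers\<close>

text \<open>
  \<open>arr Q i j\<close> is the number of arrows from \<open>i\<close> to \<open>j\<close>; all quivers constructed below have
  \<open>arr Q i j = 0\<close> unless \<open>i\<close> and \<open>j\<close> are vertices, so that equality of records is equality of
  ice quivers.
\<close>

record 'v ice_quiver =
  exch :: "'v set"
  frozen :: "'v set"
  arr :: "'v \<Rightarrow> 'v \<Rightarrow> nat"

definition vertices :: "'v ice_quiver \<Rightarrow> 'v set" where
  "vertices Q = exch Q \<union> frozen Q"

definition no_loops_no_2cycles :: "'v ice_quiver \<Rightarrow> bool" where
  "no_loops_no_2cycles Q \<longleftrightarrow> (\<forall>i. arr Q i i = 0) \<and> (\<forall>i j. arr Q i j = 0 \<or> arr Q j i = 0)"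

text \<open>\<open>relabel\<close> is only meaningful for a map \<open>f\<close> that is injective on the vertices.\<close>

definition relabel :: "('v \<Rightarrow> 'w) \<Rightarrow> 'v ice_quiver \<Rightarrow> 'w ice_quiver" where
  "relabel f Q = \<lparr>exch = f ` exch Q, frozen = f ` frozen Q,
     arr = (\<lambda>u v. if u \<in> f ` vertices Q \<and> v \<in> f ` vertices Q
       then arr Q (inv_into (vertices Q) f u) (inv_into (vertices Q) f v) else 0)\<rparr>"

text \<open>
  The truncated difference removes a maximal set of disjoint 2-cycles.
\<close>

definition mutate_quiver :: "'v ice_quiver \<Rightarrow> 'v \<Rightarrow> 'v ice_quiver" where
  "mutate_quiver Q i =
     (let composed = (\<lambda>j l. arr Q j l + arr Q j i * arr Q i l);
          reversed = (\<lambda>j l. if j = i \<or> l = i then arr Q l j else composed j l);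
          reduced = (\<lambda>j l. reversed j l - reversed l j)
      in Q\<lparr>arr := (\<lambda>j l. if j \<in> frozen Q \<and> l \<in> frozen Q then 0 else reduced j l)\<rparr>)"


section \<open>Quivers of subcategories and cluster structures\<close>

definition radical :: "('k, 'o, 'm::ab_group_add, 'e) extri_data \<Rightarrow> 'o \<Rightarrow> 'o \<Rightarrow> 'm set" where
  "radical \<C> A B =
     {f \<in> Hom \<C> A B. \<forall>g\<in>Hom \<C> B A. iso_mor \<C> A A (Id \<C> A - g \<cdot>\<^bsub>\<C>\<^esub> f)}"

text \<open>
  The square of the radical of the full subcategory \<open>\<T>\<close>.  (The radical of \<open>\<T>\<close> itself is the
  restriction of the radical of \<open>\<C>\<close>.)
\<close>

definition radical2 ::
  "('k::field, 'o, 'm::ab_group_add, 'e) extri_data \<Rightarrow> 'o set \<Rightarrow> 'o \<Rightarrow> 'o \<Rightarrow> 'm set" where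
  "radical2 \<C> \<T> A B =
     module.span (scaleH \<C>) {g \<cdot>\<^bsub>\<C>\<^esub> f | g f. \<exists>M\<in>\<T>. f \<in> radical \<C> A M \<and> g \<in> radical \<C> M B}"

text \<open>
  The dimension of \<open>rad(A,B) / rad\<^sup>2(A,B)\<close>; all \<open>Hom\<close> spaces will be finite dimensional.
\<close>

definition irr_dim ::
  "('k::field, 'o, 'm::ab_group_add, 'e) extri_data \<Rightarrow> 'o set \<Rightarrow> 'o \<Rightarrow> 'o \<Rightarrow> nat" where
  "irr_dim \<C> \<T> A B = vector_space.dim (scaleH \<C>) (radical \<C> A B)
     - vector_space.dim (scaleH \<C>) (radical2 \<C> \<T> A B)"

definition ind :: "('k, 'o, 'm::ab_group_add, 'e) extri_data \<Rightarrow> 'o set \<Rightarrow> 'o set" where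
  "ind \<C> \<X> = {M \<in> \<X>. indecomposable \<C> M}"

definition ind_classes :: "('k, 'o, 'm::ab_group_add, 'e) extri_data \<Rightarrow> 'o set \<Rightarrow> 'o set set" where
  "ind_classes \<C> \<X> = iso_class \<C> ` ind \<C> \<X>"

definition rep :: "'o set \<Rightarrow> 'o" where
  "rep c = (SOME M. M \<in> c)"

text \<open>
  The ice quiver whose exchangeable (frozen) vertices are the isomorphism classes of the
  indecomposables in \<open>\<E>\<close> (in \<open>\<F>\<close>), with arrows computed in \<open>\<T>\<close>.
\<close>

definition quiver_of ::
  "('k::field, 'o, 'm::ab_group_add, 'e) extri_data \<Rightarrow> 'o set \<Rightarrow> 'o set \<Rightarrow> 'o set
    \<Rightarrow> 'o set ice_quiver" where
  "quiver_of \<C> \<T> \<E> \<F> = \<lparr>exch = ind_classes \<C> \<E>, frozen = ind_classes \<C> \<F>,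
     arr = (\<lambda>u v. if u \<in> ind_classes \<C> \<E> \<union> ind_classes \<C> \<F> \<and>
                      v \<in> ind_classes \<C> \<E> \<union> ind_classes \<C> \<F> \<and>
                      \<not> (u \<in> ind_classes \<C> \<F> \<and> v \<in> ind_classes \<C> \<F>)
                   then irr_dim \<C> \<T> (rep u) (rep v) else 0)\<rparr>"

definition tilting_quiver ::
  "('k::field, 'o, 'm::ab_group_add, 'e) extri_data \<Rightarrow> 'o set \<Rightarrow> 'o set ice_quiver" where
  "tilting_quiver \<C> \<T> = quiver_of \<C> \<T> (\<T> - Proj \<C>) (\<T> \<inter> Proj \<C>)"

definition part_quiver ::
  "('k::field, 'o, 'm::ab_group_add, 'e) extri_data \<Rightarrow> 'o set \<Rightarrow> 'o set \<Rightarrow> 'o set ice_quiver" where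
  "part_quiver \<C> \<U> \<I> = quiver_of \<C> (subcategory_sum \<C> \<U> \<I>) \<U> \<I>"

definition ind_summands :: "('k, 'o, 'm::ab_group_add, 'e) extri_data \<Rightarrow> 'o \<Rightarrow> 'o set" where
  "ind_summands \<C> T = {M. indecomposable \<C> M \<and> (\<exists>N. is_dsum \<C> T M N)}"

definition extended_clusters ::
  "('k, 'o, 'm::ab_group_add, 'e::ab_group_add) extri_data \<Rightarrow> 'o set set set" where
  "extended_clusters \<C> = {iso_class \<C> ` ind_summands \<C> T | T. cluster_tilting_object \<C> T}"

definition coefficients :: "('k, 'o, 'm::ab_group_add, 'e) extri_data \<Rightarrow> 'o set set" where
  "coefficients \<C> = ind_classes \<C> (ProjInj \<C>)"

definition cluster_variables ::
  "('k, 'o, 'm::ab_group_add, 'e::ab_group_add) extri_data \<Rightarrow> 'o set set" where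
  "cluster_variables \<C> = \<Union> (extended_clusters \<C>) - coefficients \<C>"

definition cluster_quiver ::
  "('k::field, 'o, 'm::ab_group_add, 'e) extri_data \<Rightarrow> 'o set set \<Rightarrow> 'o set ice_quiver" where
  "cluster_quiver \<C> K = tilting_quiver \<C> (add_closure \<C> (\<Union> K))"

definition exchange_cluster :: "'o set set \<Rightarrow> 'o set \<Rightarrow> 'o set \<Rightarrow> 'o set set" where
  "exchange_cluster K m m' = insert m' (K - {m})"

definition exchanges ::
  "('k, 'o, 'm::ab_group_add, 'e::ab_group_add) extri_data
    \<Rightarrow> 'o set set \<Rightarrow> 'o set \<Rightarrow> 'o set \<Rightarrow> bool" where
  "exchanges \<C> K m m' \<longleftrightarrow> m' \<in> cluster_variables \<C> \<and> m' \<noteq> m \<and>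
     exchange_cluster K m m' \<in> extended_clusters \<C>"

definition approx_triangle ::
  "('k, 'o, 'm, 'e) extri_data \<Rightarrow> 'o set \<Rightarrow> 'o \<Rightarrow> 'o \<Rightarrow> bool" where
  "approx_triangle \<C> \<D> A C \<longleftrightarrow> (\<exists>B f g \<delta>. etriangle \<C> A B C f g \<delta> \<and>
     minimal_left_approx \<C> \<D> A B f \<and> minimal_right_approx \<C> \<D> C B g)"

definition cluster_structure ::
  "('k::field, 'o, 'm::ab_group_add, 'e::ab_group_add) extri_data \<Rightarrow> bool" where
  "cluster_structure \<C> \<longleftrightarrow>
     (\<forall>K\<in>extended_clusters \<C>. \<forall>m\<in>K - coefficients \<C>.
        (\<exists>!m'. exchanges \<C> K m m') \<and>
        (\<forall>m'. exchanges \<C> K m m' \<longrightarrow>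
           (\<forall>M\<in>m. \<forall>M'\<in>m'.
              approx_triangle \<C> (add_closure \<C> (\<Union> (K - {m}))) M' M \<and>
              approx_triangle \<C> (add_closure \<C> (\<Union> (K - {m}))) M M') \<and>
           cluster_quiver \<C> (exchange_cluster K m m') =
             relabel (\<lambda>v. if v = m then m' else v) (mutate_quiver (cluster_quiver \<C> K) m))) \<and>
     (\<forall>K\<in>extended_clusters \<C>. no_loops_no_2cycles (cluster_quiver \<C> K))"


section \<open>Rooted cluster algebras\<close>

text \<open>
  All rational function fields are realised inside a field \<open>'f\<close> of characteristic 0 as the
  subfields generated by algebraically independent elements.  In a seed the vertices of the ice
  quiver are the variables themselves: a seed \<open>(ex, fx, Q)\<close> is an ice quiver \<open>\<Sigma>\<close> with
  vertices in \<open>'f\<close>, \<open>ex = exch \<Sigma>\<close> and \<open>fx = frozen \<Sigma>\<close>.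
\<close>

type_synonym 'f seed = "'f ice_quiver"

definition is_subring :: "'f::field set \<Rightarrow> bool" where
  "is_subring R \<longleftrightarrow> 1 \<in> R \<and> (\<forall>x\<in>R. \<forall>y\<in>R. x - y \<in> R \<and> x * y \<in> R)"

definition is_subfield :: "'f::field set \<Rightarrow> bool" where
  "is_subfield K \<longleftrightarrow> is_subring K \<and> (\<forall>x\<in>K. inverse x \<in> K)"

definition mutated_variable :: "'f::field seed \<Rightarrow> 'f \<Rightarrow> 'f" where
  "mutated_variable \<Sigma> x =
     ((\<Prod>v | arr \<Sigma> x v \<noteq> 0. v ^ arr \<Sigma> x v) + (\<Prod>v | arr \<Sigma> v x \<noteq> 0. v ^ arr \<Sigma> v x)) / x"

definition mutate_seed :: "'f::field seed \<Rightarrow> 'f \<Rightarrow> 'f seed" where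
  "mutate_seed \<Sigma> x = relabel (\<lambda>v. if v = x then mutated_variable \<Sigma> x else v) (mutate_quiver \<Sigma> x)"

inductive mutation_equivalent :: "'f::field seed \<Rightarrow> 'f seed \<Rightarrow> bool" for \<Sigma> where
  refl: "mutation_equivalent \<Sigma> \<Sigma>"
| step: "mutation_equivalent \<Sigma> \<Sigma>' \<Longrightarrow> x \<in> exch \<Sigma>' \<Longrightarrow> mutation_equivalent \<Sigma> (mutate_seed \<Sigma>' x)"

definition cluster_algebra :: "'f::field seed \<Rightarrow> 'f set" where
  "cluster_algebra \<Sigma> = is_subring hull (\<Union> {vertices \<Sigma>' | \<Sigma>'. mutation_equivalent \<Sigma> \<Sigma>'})"

definition rooted_cluster_algebra :: "'f::field seed \<Rightarrow> 'f set \<times> 'f seed" where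
  "rooted_cluster_algebra \<Sigma> = (cluster_algebra \<Sigma>, \<Sigma>)"

definition seed_of :: "('o \<Rightarrow> 'f) \<Rightarrow> 'o set ice_quiver \<Rightarrow> 'f seed" where
  "seed_of \<chi> Q = relabel (\<lambda>c. \<chi> (rep c)) Q"


section \<open>Cluster maps\<close>

text \<open>
  Polynomials over the rationals whose variables are elements of \<open>'f\<close>, evaluated by sending each
  variable to itself.
\<close>

definition eval_poly_at_self :: "(('f::field_char_0 \<Rightarrow>\<^sub>0 nat) \<Rightarrow>\<^sub>0 rat) \<Rightarrow> 'f" where
  "eval_poly_at_self p =
     (\<Sum>m\<in>Poly_Mapping.keys p. of_rat (Poly_Mapping.lookup p m) *
        (\<Prod>x\<in>Poly_Mapping.keys m. x ^ Poly_Mapping.lookup m x))"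

definition algebraically_independent :: "'f::field_char_0 set \<Rightarrow> bool" where
  "algebraically_independent S \<longleftrightarrow>
     (\<forall>p. (\<forall>m\<in>Poly_Mapping.keys p. Poly_Mapping.keys m \<subseteq> S) \<longrightarrow> eval_poly_at_self p = 0 \<longrightarrow> p = 0)"

definition algebraic_over :: "'f::field set \<Rightarrow> 'f \<Rightarrow> bool" where
  "algebraic_over K y \<longleftrightarrow> (\<exists>p. p \<noteq> 0 \<and> (\<forall>i. coeff p i \<in> K) \<and> poly p y = 0)"

definition transcendence_basis :: "'f::field_char_0 set \<Rightarrow> 'f set \<Rightarrow> bool" where
  "transcendence_basis F S \<longleftrightarrow> S \<subseteq> F \<and> algebraically_independent S \<and>
     (\<forall>y\<in>F. algebraic_over (is_subfield hull S) y)"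

definition reachable_objects ::
  "('k, 'o, 'm::ab_group_add, 'e::ab_group_add) extri_data \<Rightarrow> 'o set" where
  "reachable_objects \<C> = \<Union> {add_obj \<C> T | T. cluster_tilting_object \<C> T}"

text \<open>
  The ambient field of the rooted cluster algebra of \<open>add T\<close> is the subfield generated by the
  initial variables \<open>\<chi>(M)\<close>; that these are algebraically independent is the case \<open>T' = T\<close> of
  the transcendence basis condition.  The values of \<open>\<chi>\<close> outside \<open>reachable_objects \<C>\<close> are
  irrelevant.
\<close>

definition cluster_map ::
  "('k::field, 'o, 'm::ab_group_add, 'e::ab_group_add) extri_data \<Rightarrow> 'o
    \<Rightarrow> ('o \<Rightarrow> 'f::field_char_0) \<Rightarrow> bool" where
  "cluster_map \<C> T \<chi> \<longleftrightarrow>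
     (let F = is_subfield hull (\<chi> ` ind_summands \<C> T); D = reachable_objects \<C> in
       \<chi> ` D \<subseteq> F \<and>
       (\<forall>A\<in>D. \<forall>B. isomorphic \<C> A B \<longrightarrow> \<chi> A = \<chi> B) \<and>
       (\<forall>T'. cluster_tilting_object \<C> T' \<longrightarrow>
          (\<forall>M\<in>ind_summands \<C> T'. \<forall>N\<in>ind_summands \<C> T'. \<chi> M = \<chi> N \<longrightarrow> isomorphic \<C> M N) \<and>
          transcendence_basis F (\<chi> ` ind_summands \<C> T')) \<and>
       (\<forall>M N B B' f g \<delta> f' g' \<delta>'. {M, N, B, B'} \<subseteq> D \<longrightarrow>
          indecomposable \<C> M \<longrightarrow> indecomposable \<C> N \<longrightarrow>
          vector_space.dim (scaleE \<C>) (Ext \<C> M N) = 1 \<longrightarrow>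
          etriangle \<C> M B N f g \<delta> \<longrightarrow> \<delta> \<noteq> 0 \<longrightarrow>
          etriangle \<C> N B' M f' g' \<delta>' \<longrightarrow> \<delta>' \<noteq> 0 \<longrightarrow>
          \<chi> M * \<chi> N = \<chi> B + \<chi> B') \<and>
       (\<forall>S A A'. S \<in> D \<longrightarrow> is_dsum \<C> S A A' \<longrightarrow> \<chi> S = \<chi> A * \<chi> A'))"


section \<open>Complete pairs of rooted cluster subalgebras\<close>

definition freeze :: "'v ice_quiver \<Rightarrow> 'v set \<Rightarrow> 'v ice_quiver" where
  "freeze Q V = \<lparr>exch = exch Q - V, frozen = frozen Q \<union> V,
     arr = (\<lambda>i j. if i \<in> frozen Q \<union> V \<and> j \<in> frozen Q \<union> V then 0 else arr Q i j)\<rparr>"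

definition isolated_frozen :: "'v ice_quiver \<Rightarrow> 'v set" where
  "isolated_frozen Q = {v \<in> frozen Q. \<forall>w. arr Q v w = 0 \<and> arr Q w v = 0}"

definition exch_components :: "'v ice_quiver \<Rightarrow> 'v set set" where
  "exch_components Q =
     exch Q // {(i, j). i \<in> exch Q \<and> j \<in> exch Q \<and> (arr Q i j \<noteq> 0 \<or> arr Q j i \<noteq> 0)}\<^sup>*"

definition component_at :: "'v ice_quiver \<Rightarrow> 'v set \<Rightarrow> 'v ice_quiver" where
  "component_at Q K =
     (let W = {v \<in> frozen Q. \<exists>i\<in>K. arr Q i v \<noteq> 0 \<or> arr Q v i \<noteq> 0}
      in \<lparr>exch = K, frozen = W,
          arr = (\<lambda>i j. if i \<in> K \<union> W \<and> j \<in> K \<union> W then arr Q i j else 0)\<rparr>)"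

definition indecomposable_components :: "'v ice_quiver \<Rightarrow> 'v ice_quiver set" where
  "indecomposable_components Q = component_at Q ` exch_components Q"

text \<open>
  The gluing along common frozen vertices of a set \<open>\<P>\<close> of indecomposable components of a given
  ice quiver, with the remaining elements of the set \<open>V\<close> of coefficients added as isolated frozen
  vertices.  Every arrow of a component has an exchangeable end, hence lies in exactly one
  component, so at most one summand below is non-zero.
\<close>

definition glue :: "'v set \<Rightarrow> 'v ice_quiver set \<Rightarrow> 'v ice_quiver" where
  "glue V \<P> = \<lparr>exch = (\<Union>P\<in>\<P>. exch P), frozen = V \<union> (\<Union>P\<in>\<P>. frozen P),
     arr = (\<lambda>i j. \<Sum>P | P \<in> \<P> \<and> arr P i j \<noteq> 0. arr P i j)\<rparr>"

definition complete_pair_seeds :: "'f seed \<Rightarrow> 'f set \<Rightarrow> 'f seed \<Rightarrow> 'f seed \<Rightarrow> bool" where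
  "complete_pair_seeds \<Sigma> ex' \<Sigma>\<^sub>1 \<Sigma>\<^sub>2 \<longleftrightarrow>
     (let \<Sigma>f = freeze \<Sigma> ex' in
       (\<exists>\<P>\<subseteq>indecomposable_components \<Sigma>f. \<Sigma>\<^sub>1 = glue (frozen \<Sigma> \<union> ex') \<P>) \<and>
       (\<exists>\<P>\<subseteq>indecomposable_components \<Sigma>f. \<Sigma>\<^sub>2 = glue (frozen \<Sigma> \<union> ex') \<P>) \<and>
       exch \<Sigma>\<^sub>1 \<inter> exch \<Sigma>\<^sub>2 = {} \<and>
       exch \<Sigma> = exch \<Sigma>\<^sub>1 \<union> exch \<Sigma>\<^sub>2 \<union> ex' \<and> (exch \<Sigma>\<^sub>1 \<union> exch \<Sigma>\<^sub>2) \<inter> ex' = {} \<and>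
       frozen \<Sigma> \<union> isolated_frozen \<Sigma>f \<subseteq> frozen \<Sigma>\<^sub>1 \<inter> frozen \<Sigma>\<^sub>2)"

definition complete_pairs ::
  "'f::field seed \<Rightarrow> 'f set \<Rightarrow> (('f set \<times> 'f seed) \<times> ('f set \<times> 'f seed)) set" where
  "complete_pairs \<Sigma> cs =
     {(rooted_cluster_algebra \<Sigma>\<^sub>1, rooted_cluster_algebra \<Sigma>\<^sub>2) | \<Sigma>\<^sub>1 \<Sigma>\<^sub>2.
        \<exists>ex'\<subseteq>exch \<Sigma>. cs = frozen \<Sigma> \<union> ex' \<and> complete_pair_seeds \<Sigma> ex' \<Sigma>\<^sub>1 \<Sigma>\<^sub>2}"

definition subalgebra_pair ::
  "('k::field, 'o, 'm::ab_group_add, 'e) extri_data \<Rightarrow> ('o \<Rightarrow> 'f::field) \<Rightarrow> 'o set \<Rightarrow> 'o set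
    \<Rightarrow> 'o set \<times> 'o set \<Rightarrow> ('f set \<times> 'f seed) \<times> ('f set \<times> 'f seed)" where
  "subalgebra_pair \<C> \<chi> \<T> \<I> = (\<lambda>(\<X>, \<Y>).
     (rooted_cluster_algebra (seed_of \<chi> (part_quiver \<C> (tilting_part \<C> \<T> \<I> \<X>) \<I>)),
      rooted_cluster_algebra (seed_of \<chi> (part_quiver \<C> (tilting_part \<C> \<T> \<I> \<Y>) \<I>))))"

end

theory Submission
  imports Defs
begin

text \<open>
  If \<open>(\<X>, \<Y>)\<close> is a cotorsion pair with core \<open>\<I> \<subseteq> \<T>\<close>, then every morphism between an object of \<open>\<X>\<close>
  and an object of \<open>\<Y>\<close>, in either direction, factors through \<open>\<I>\<close>.  Hence the quiver of \<open>\<T>\<close> has no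
  arrows between the indecomposables of \<open>\<T>\<^sub>\<X>\<close> and those of \<open>\<T>\<^sub>\<Y>\<close>, and the quiver of
  \<open>\<T>\<^sub>\<X> \<oplus> \<I>\<close> is the part of the frozen quiver of \<open>\<T>\<close> lying over \<open>\<T>\<^sub>\<X>\<close>: a complete pair amounts to a
  partition of the exchangeable vertices outside \<open>\<I>\<close> into two sets without arrows between them.  The
  pair is recovered from \<open>\<T> \<inter> \<Y>\<close>, since \<open>\<X>\<close> consists of the objects \<open>M\<close> such that
  \<open>Ext(M, \<T> \<inter> \<Y>) = 0\<close> and every morphism from \<open>\<T> \<inter> \<Y>\<close> to \<open>M\<close> factors through \<open>\<I>\<close>.

  Conversely, if there are no arrows between two sets of indecomposables, Nakayama's lemma shows that
  all morphisms between the two parts \<open>\<A>\<close>, \<open>\<B>\<close> of \<open>\<T>\<close> factor through \<open>\<I>\<close>.  The presentation of an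
  object of the left perpendicular subcategory of \<open>\<I>\<close> by objects of \<open>\<T>\<close> is then diagonal modulo \<open>\<I>\<close>,
  so that this subcategory splits into two parts, and these form a cotorsion pair.
\<close>

section \<open>Additive and Krull-Schmidt categories\<close>

text \<open>The quotient of \<open>U = perp \<C> \<I>\<close> by \<open>\<I>\<close> is never
  formed. Vanishing in it is expressed by \<open>factors \<C> \<I>\<close>, and its shift by
  \<open>susp\<close>. For \<open>D\<close> in \<open>U\<close> and a shift \<open>N\<close> of
  \<open>M\<close>, the condition \<open>Ext \<C> N D = {0}\<close> says that all morphisms from
  \<open>M\<close> to \<open>D\<close> vanish modulo \<open>\<I>\<close>. The two directions between
  \<open>\<X>\<close> and \<open>\<Y>\<close> are of different depth. A morphism from
  \<open>\<X>\<close> to \<open>\<Y>\<close> lifts along a truncation whose middle term lies in the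
  core. For morphisms from \<open>\<Y>\<close> to \<open>\<X>\<close>, the vanishing of extensions
  only controls those into shifts of objects of \<open>\<X>\<close>. So \<open>\<X>\<close> has to
  be resolved by objects that are already shifts, and indeed double shifts, because the second term
  of the resolution is tested against the shift of an object of \<open>\<Y>\<close>. Such
  resolutions come from a subcategory that is cluster tilting inside \<open>\<X>\<close>; the
  cluster tilting subcategory of the whole category and the Calabi-Yau duality provide one and show
  that its shift is one again. The assumptions of the abstract setting are kept self-dual, so that
  arguments are made on one side and transferred by \<open>opp\<close>.\<close>

definition retract :: "('k, 'o, 'm, 'e) extri_data \<Rightarrow> 'o \<Rightarrow> 'o \<Rightarrow> bool" where
  "retract \<C> M Z \<longleftrightarrow> (\<exists>i\<in>Hom \<C> M Z. \<exists>p\<in>Hom \<C> Z M. p \<cdot>\<^bsub>\<C>\<^esub> i = Id \<C> M)"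

definition factors :: "('k, 'o, 'm, 'e) extri_data \<Rightarrow> 'o set \<Rightarrow> 'o \<Rightarrow> 'o \<Rightarrow> 'm \<Rightarrow> bool" where
  "factors \<C> S A B f \<longleftrightarrow> (\<exists>Z\<in>S. \<exists>g\<in>Hom \<C> A Z. \<exists>h\<in>Hom \<C> Z B. f = h \<cdot>\<^bsub>\<C>\<^esub> g)"

text \<open>Finite sums are built in because \<open>G\<close> may be any set of objects, closed
  under nothing. Over a subcategory the notion agrees with \<open>factors\<close>; over a set of
  generators it lets an identity be treated term by term, by rule induction.\<close>

inductive ideal :: "('k, 'o, 'm::ab_group_add, 'e) extri_data \<Rightarrow> 'o set \<Rightarrow> 'o \<Rightarrow> 'o \<Rightarrow> 'm \<Rightarrow> bool"
  for \<C> G A B where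
  ideal_zero: "ideal \<C> G A B 0"
| ideal_comp: "Z \<in> G \<Longrightarrow> g \<in> Hom \<C> A Z \<Longrightarrow> h \<in> Hom \<C> Z B \<Longrightarrow> ideal \<C> G A B (h \<cdot>\<^bsub>\<C>\<^esub> g)"
| ideal_add: "ideal \<C> G A B f \<Longrightarrow> ideal \<C> G A B f' \<Longrightarrow> ideal \<C> G A B (f + f')"

text \<open>
  The identity of \<open>M\<close> is a finite sum of morphisms through \<open>G\<close> iff \<open>M\<close> is a direct summand of a
  finite direct sum of objects of \<open>G\<close>.
\<close>

definition gen :: "('k, 'o, 'm::ab_group_add, 'e) extri_data \<Rightarrow> 'o set \<Rightarrow> 'o set" where
  "gen \<C> G = {M. ideal \<C> G M M (Id \<C> M)}"

context additive_category
begin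

lemma Hom_zero: "0 \<in> Hom \<C> A B"
  using Hom_subgroup by (auto simp: add_subgroup_def)

lemma Hom_diff: "f \<in> Hom \<C> A B \<Longrightarrow> g \<in> Hom \<C> A B \<Longrightarrow> f - g \<in> Hom \<C> A B"
  using Hom_subgroup by (auto simp: add_subgroup_def)

lemma Hom_minus: "f \<in> Hom \<C> A B \<Longrightarrow> - f \<in> Hom \<C> A B"
  using Hom_diff[OF Hom_zero] by fastforce

lemma Hom_add: "f \<in> Hom \<C> A B \<Longrightarrow> g \<in> Hom \<C> A B \<Longrightarrow> f + g \<in> Hom \<C> A B"
  using Hom_diff[OF _ Hom_minus] by fastforce

lemmas hom_intros = Hom_zero Hom_diff Hom_minus Hom_add Id_in_Hom Comp_in_Hom

lemma Comp_zero_right: "g \<in> Hom \<C> B C \<Longrightarrow> g \<cdot> 0 = 0"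
  using Comp_add_right[OF Hom_zero Hom_zero] by fastforce

lemma Comp_zero_left: "f \<in> Hom \<C> A B \<Longrightarrow> 0 \<cdot> f = 0"
  using Comp_add_left[OF _ Hom_zero Hom_zero] by fastforce

lemma Comp_diff_right: "f \<in> Hom \<C> A B \<Longrightarrow> f' \<in> Hom \<C> A B \<Longrightarrow> g \<in> Hom \<C> B C \<Longrightarrow>
    g \<cdot> (f - f') = g \<cdot> f - g \<cdot> f'"
  using Comp_add_right[of "f - f'" A B f' g C] by (simp add: Hom_diff)

lemma Comp_diff_left: "f \<in> Hom \<C> A B \<Longrightarrow> g \<in> Hom \<C> B C \<Longrightarrow> g' \<in> Hom \<C> B C \<Longrightarrow>
    (g - g') \<cdot> f = g \<cdot> f - g' \<cdot> f"
  using Comp_add_left[of f A B "g - g'" C g'] by (simp add: Hom_diff)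

lemma Comp_minus_right: "f \<in> Hom \<C> A B \<Longrightarrow> g \<in> Hom \<C> B C \<Longrightarrow> g \<cdot> (- f) = - (g \<cdot> f)"
  using Comp_diff_right[OF Hom_zero] Comp_zero_right by fastforce

lemma Comp_minus_left: "f \<in> Hom \<C> A B \<Longrightarrow> g \<in> Hom \<C> B C \<Longrightarrow> (- g) \<cdot> f = - (g \<cdot> f)"
  using Comp_diff_left[OF _ Hom_zero] Comp_zero_left by fastforce

lemma zero_object_Hom_from: "zero_object \<C> Z \<Longrightarrow> f \<in> Hom \<C> Z B \<Longrightarrow> f = 0"
  by (metis Comp_Id_right Comp_zero_right zero_object_def)

lemma is_dsum_zero: "zero_object \<C> Z \<Longrightarrow> iso_mor \<C> A B f \<Longrightarrow> is_dsum \<C> B A Z"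
proof -
  assume Z: "zero_object \<C> Z" and "iso_mor \<C> A B f"
  then obtain g where g: "f \<in> Hom \<C> A B" "g \<in> Hom \<C> B A" "g \<cdot> f = Id \<C> A" "f \<cdot> g = Id \<C> B"
    by (auto simp: iso_mor_def)
  have "biproduct \<C> A Z B f 0 g 0"
    unfolding biproduct_def using Z g Comp_zero_right[OF g(2)] Comp_zero_left[OF g(1)]
      Comp_zero_left[OF Hom_zero] by (simp add: Hom_zero zero_object_def)
  then show ?thesis by (auto simp: is_dsum_def)
qed

lemma iso_mor_Id: "iso_mor \<C> A A (Id \<C> A)"
  unfolding iso_mor_def using Id_in_Hom Comp_Id_left by blast

lemma iso_mor_inv:
  assumes "iso_mor \<C> A B f"
  obtains g where "iso_mor \<C> B A g" "g \<cdot> f = Id \<C> A" "f \<cdot> g = Id \<C> B" "f \<in> Hom \<C> A B" "g \<in> Hom \<C> B A"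
  using assms unfolding iso_mor_def by blast

text \<open>Associativity is conditional on the end terms, so it cannot serve as an unconditional
  rewrite rule. The usual cancellations in a biproduct are therefore packaged together with their
  typing conditions.\<close>

lemma cancel_Id: "p \<cdot> i = Id \<C> A \<Longrightarrow> i \<in> Hom \<C> A B \<Longrightarrow> p \<in> Hom \<C> B A \<Longrightarrow> f \<in> Hom \<C> D A \<Longrightarrow> p \<cdot> (i \<cdot> f) = f"
  using Comp_assoc[of f D A i B p A] Comp_Id_left by simp

lemma cancel_zero: "p \<cdot> i = 0 \<Longrightarrow> i \<in> Hom \<C> A B \<Longrightarrow> p \<in> Hom \<C> B E \<Longrightarrow> f \<in> Hom \<C> D A \<Longrightarrow> p \<cdot> (i \<cdot> f) = 0"
  using Comp_assoc[of f D A i B p E] Comp_zero_left by simp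

lemma section_comp:
  assumes "i \<in> Hom \<C> L M" "p \<in> Hom \<C> M L" "p \<cdot> i = Id \<C> L"
    and "j \<in> Hom \<C> M N" "q \<in> Hom \<C> N M" "q \<cdot> j = Id \<C> M"
  shows "(p \<cdot> q) \<cdot> (j \<cdot> i) = Id \<C> L"
  using assms cancel_Id[of q j M N i L] Comp_assoc[of "j \<cdot> i" L N q M p L] Comp_in_Hom by simp

lemma iso_mor_comp: "iso_mor \<C> A B f \<Longrightarrow> iso_mor \<C> B D g \<Longrightarrow> iso_mor \<C> A D (g \<cdot> f)"
proof -
  assume "iso_mor \<C> A B f" "iso_mor \<C> B D g"
  then obtain f' g' where a: "f \<in> Hom \<C> A B" "f' \<in> Hom \<C> B A" "f' \<cdot> f = Id \<C> A" "f \<cdot> f' = Id \<C> B"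
    and b: "g \<in> Hom \<C> B D" "g' \<in> Hom \<C> D B" "g' \<cdot> g = Id \<C> B" "g \<cdot> g' = Id \<C> D"
    by (auto simp: iso_mor_def)
  have "(f' \<cdot> g') \<cdot> (g \<cdot> f) = Id \<C> A" "(g \<cdot> f) \<cdot> (f' \<cdot> g') = Id \<C> D"
    using section_comp[of f A B f' g D g'] section_comp[of g' D B g f' A f] a b by auto
  then show ?thesis unfolding iso_mor_def using a b Comp_in_Hom by blast
qed

lemma isomorphic_refl: "isomorphic \<C> A A"
  using iso_mor_Id by (auto simp: isomorphic_def)

lemma isomorphic_sym: "isomorphic \<C> A B \<Longrightarrow> isomorphic \<C> B A"
  unfolding isomorphic_def by (meson iso_mor_inv)

lemma isomorphic_trans: "isomorphic \<C> A B \<Longrightarrow> isomorphic \<C> B D \<Longrightarrow> isomorphic \<C> A D"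
  unfolding isomorphic_def by (meson iso_mor_comp)

text \<open>Closure under isomorphisms follows from closure under sums, since an object isomorphic
  to \<open>A\<close> is a direct sum of \<open>A\<close> and a zero object.\<close>

lemma subcategoryI:
  assumes "\<And>Z. zero_object \<C> Z \<Longrightarrow> Z \<in> \<X>"
    and "\<And>S A B. is_dsum \<C> S A B \<Longrightarrow> A \<in> \<X> \<Longrightarrow> B \<in> \<X> \<Longrightarrow> S \<in> \<X>"
    and "\<And>S A B. is_dsum \<C> S A B \<Longrightarrow> S \<in> \<X> \<Longrightarrow> A \<in> \<X> \<and> B \<in> \<X>"
  shows "subcategory \<C> \<X>"
  unfolding subcategory_def isomorphic_def
  using assms is_dsum_zero ex_zero_object by meson

lemma is_dsum_sym: "is_dsum \<C> S A B \<Longrightarrow> is_dsum \<C> S B A"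
  unfolding is_dsum_def biproduct_def by (metis add.commute)

lemma retract_refl: "retract \<C> M M"
  unfolding retract_def using Id_in_Hom Comp_Id_left by blast

lemma retract_trans: "retract \<C> L M \<Longrightarrow> retract \<C> M N \<Longrightarrow> retract \<C> L N"
proof -
  assume "retract \<C> L M" "retract \<C> M N"
  then obtain i p j q where a: "i \<in> Hom \<C> L M" "p \<in> Hom \<C> M L" "p \<cdot> i = Id \<C> L"
     and b: "j \<in> Hom \<C> M N" "q \<in> Hom \<C> N M" "q \<cdot> j = Id \<C> M"
    unfolding retract_def by blast
  then show ?thesis unfolding retract_def using a b Comp_in_Hom section_comp[OF a b] by blast
qed

lemma isomorphic_retract: "isomorphic \<C> A B \<Longrightarrow> retract \<C> A B"
  unfolding isomorphic_def iso_mor_def retract_def by blast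

lemma is_dsum_retract: "is_dsum \<C> S A B \<Longrightarrow> retract \<C> A S \<and> retract \<C> B S"
  unfolding is_dsum_def biproduct_def retract_def by blast

lemma ideal_Hom: "ideal \<C> G A B f \<Longrightarrow> f \<in> Hom \<C> A B"
  by (induction rule: ideal.induct) (blast intro: hom_intros)+

lemma ideal_left: "ideal \<C> G A B f \<Longrightarrow> k \<in> Hom \<C> B D \<Longrightarrow> ideal \<C> G A D (k \<cdot> f)"
proof (induction rule: ideal.induct)
  case ideal_zero
  then show ?case using Comp_zero_right[of k B D] ideal.ideal_zero by fastforce
next
  case (ideal_comp Z g h)
  then show ?case
    using Comp_assoc[of g A Z h B k D] ideal.ideal_comp[of Z G g \<C> A "k \<cdot> h" D] Comp_in_Hom by simp
next
  case (ideal_add f f')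
  then show ?case
    using Comp_add_right[of f A B f' k D] ideal.ideal_add ideal_Hom by fastforce
qed

lemma ideal_right: "ideal \<C> G A B f \<Longrightarrow> k \<in> Hom \<C> D A \<Longrightarrow> ideal \<C> G D B (f \<cdot> k)"
proof (induction rule: ideal.induct)
  case ideal_zero
  then show ?case using Comp_zero_left[of k D A] ideal.ideal_zero by fastforce
next
  case (ideal_comp Z g h)
  then show ?case
    using Comp_assoc[of k D A g Z h B] ideal.ideal_comp[of Z G "g \<cdot> k" \<C> D h B] Comp_in_Hom by simp
next
  case (ideal_add f f')
  then show ?case
    using Comp_add_left[of k D A f B f'] ideal.ideal_add ideal_Hom by fastforce
qed

lemma retract_ideal: "retract \<C> A S \<Longrightarrow> ideal \<C> G S S (Id \<C> S) \<Longrightarrow> ideal \<C> G A A (Id \<C> A)"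
  unfolding retract_def
proof (elim bexE)
  fix i p assume "i \<in> Hom \<C> A S" "p \<in> Hom \<C> S A" "p \<cdot> i = Id \<C> A" "ideal \<C> G S S (Id \<C> S)"
  then show ?thesis
    using ideal_left[OF ideal_right[of G S S "Id \<C> S" i A], of p A]
    by (simp add: Comp_Id_left)
qed

lemma gen_retract: "retract \<C> A S \<Longrightarrow> S \<in> gen \<C> G \<Longrightarrow> A \<in> gen \<C> G"
  using retract_ideal by (auto simp: gen_def)

lemma gen_base: "G \<subseteq> gen \<C> G"
proof
  fix Z assume Z: "Z \<in> G"
  then show "Z \<in> gen \<C> G"
    using ideal_comp[OF Z, of "Id \<C> Z" \<C> Z "Id \<C> Z" Z] Id_in_Hom
    by (simp add: gen_def Comp_Id_left[OF Id_in_Hom])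
qed

lemma gen_subcategory: "subcategory \<C> (gen \<C> G)"
proof (rule subcategoryI)
  show "Z \<in> gen \<C> G" if "zero_object \<C> Z" for Z
    using that ideal_zero by (simp add: gen_def zero_object_def)
next
  fix S A B assume S: "is_dsum \<C> S A B" and AB: "A \<in> gen \<C> G" "B \<in> gen \<C> G"
  then obtain i j p q where b: "biproduct \<C> A B S i j p q" by (auto simp: is_dsum_def)
  then have "ideal \<C> G S S (i \<cdot> p + j \<cdot> q)"
    using ideal_left[OF ideal_right, of G A A "Id \<C> A" p S i S]
      ideal_left[OF ideal_right, of G B B "Id \<C> B" q S j S] AB
      ideal_add[of \<C> G S S "i \<cdot> p" "j \<cdot> q"]
    by (auto simp: gen_def biproduct_def Comp_Id_left)
  with b show "S \<in> gen \<C> G" by (simp add: gen_def biproduct_def)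
qed (meson is_dsum_retract gen_retract)

lemma subcategoryD:
  assumes "subcategory \<C> \<X>"
  shows "zero_object \<C> Z \<Longrightarrow> Z \<in> \<X>"
    and "is_dsum \<C> S A B \<Longrightarrow> A \<in> \<X> \<Longrightarrow> B \<in> \<X> \<Longrightarrow> S \<in> \<X>"
    and "is_dsum \<C> S A B \<Longrightarrow> S \<in> \<X> \<Longrightarrow> A \<in> \<X>"
    and "is_dsum \<C> S A B \<Longrightarrow> S \<in> \<X> \<Longrightarrow> B \<in> \<X>"
    and "isomorphic \<C> A B \<Longrightarrow> A \<in> \<X> \<Longrightarrow> B \<in> \<X>"
  using assms unfolding subcategory_def by meson+

lemma ex_dsum: "\<exists>S. is_dsum \<C> S A B"
  using ex_biproduct by (simp add: is_dsum_def)

lemma factors_ideal: "factors \<C> S A B f \<Longrightarrow> ideal \<C> S A B f"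
  unfolding factors_def by (auto intro: ideal_comp)

text \<open>Factorizations through \<open>Z\<close> and \<open>Z'\<close> add up to one through
  their direct sum, with components \<open>g\<close>, \<open>g'\<close> of the first map and
  \<open>h\<close>, \<open>h'\<close> of the second.\<close>

lemma factors_add:
  assumes "subcategory \<C> S" "factors \<C> S A B f" "factors \<C> S A B f'"
  shows "factors \<C> S A B (f + f')"
proof -
  obtain Z g h Z' g' h' where a: "Z \<in> S" "g \<in> Hom \<C> A Z" "h \<in> Hom \<C> Z B" "f = h \<cdot> g"
    "Z' \<in> S" "g' \<in> Hom \<C> A Z'" "h' \<in> Hom \<C> Z' B" "f' = h' \<cdot> g'"
    using assms unfolding factors_def by blast
  obtain D i j p q where bp: "biproduct \<C> Z Z' D i j p q" using ex_biproduct by blast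
  then have "is_dsum \<C> D Z Z'" by (auto simp: is_dsum_def)
  then have D: "D \<in> S" using subcategoryD(2)[OF assms(1)] a by blast
  note b = bp[unfolded biproduct_def]
  have G: "i \<cdot> g + j \<cdot> g' \<in> Hom \<C> A D" "h \<cdot> p + h' \<cdot> q \<in> Hom \<C> D B"
    using a b by (blast intro: hom_intros)+
  have 1: "p \<cdot> (i \<cdot> g + j \<cdot> g') = g"
  proof -
    have "p \<cdot> (i \<cdot> g + j \<cdot> g') = p \<cdot> (i \<cdot> g) + p \<cdot> (j \<cdot> g')"
      using a b by (intro Comp_add_right[of _ A D _ _ Z]) (blast intro: hom_intros)+
    also have "p \<cdot> (i \<cdot> g) = g" using a b cancel_Id[of p i Z D g A] by simp
    also have "p \<cdot> (j \<cdot> g') = 0" using a b cancel_zero[of p j Z' D Z g' A] by simp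
    finally show ?thesis by simp
  qed
  have 2: "q \<cdot> (i \<cdot> g + j \<cdot> g') = g'"
  proof -
    have "q \<cdot> (i \<cdot> g + j \<cdot> g') = q \<cdot> (i \<cdot> g) + q \<cdot> (j \<cdot> g')"
      using a b by (intro Comp_add_right[of _ A D _ _ Z']) (blast intro: hom_intros)+
    also have "q \<cdot> (i \<cdot> g) = 0" using a b cancel_zero[of q i Z D Z' g A] by simp
    also have "q \<cdot> (j \<cdot> g') = g'" using a b cancel_Id[of q j Z' D g' A] by simp
    finally show ?thesis by simp
  qed
  have "(h \<cdot> p + h' \<cdot> q) \<cdot> (i \<cdot> g + j \<cdot> g')
      = (h \<cdot> p) \<cdot> (i \<cdot> g + j \<cdot> g') + (h' \<cdot> q) \<cdot> (i \<cdot> g + j \<cdot> g')"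
    using a b G by (intro Comp_add_left[of _ A D _ B]) (blast intro: hom_intros)+
  also have "\<dots> = h \<cdot> g + h' \<cdot> g'"
    using a b 1 2 Comp_assoc[OF G(1), of p Z h B] Comp_assoc[OF G(1), of q Z' h' B] by simp
  finally show ?thesis using D G a unfolding factors_def by metis
qed

lemma ideal_factors:
  assumes "subcategory \<C> S" "ideal \<C> S A B f"
  shows "factors \<C> S A B f"
  using assms(2)
proof (induction rule: ideal.induct)
  case ideal_zero
  obtain Z where "zero_object \<C> Z" using ex_zero_object by blast
  then show ?case unfolding factors_def
    using subcategoryD(1)[OF assms(1)] Hom_zero Comp_zero_left[OF Hom_zero] by metis
next
  case (ideal_comp Z g h)
  then show ?case by (auto simp: factors_def)
next
  case (ideal_add f f')
  then show ?case using factors_add[OF assms(1)] by blast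
qed

lemma factors_left: "factors \<C> S A B f \<Longrightarrow> k \<in> Hom \<C> B D \<Longrightarrow> factors \<C> S A D (k \<cdot> f)"
  unfolding factors_def using Comp_assoc[of _ A _ _ B k D] Comp_in_Hom[of _ _ B k D] by blast

lemma factors_right: "factors \<C> S A B f \<Longrightarrow> k \<in> Hom \<C> D A \<Longrightarrow> factors \<C> S D B (f \<cdot> k)"
  unfolding factors_def using Comp_assoc[of k D A] Comp_in_Hom[of k D A] by metis


text \<open>Direct sums are a relation, not an operation, so both bracketings come with chosen
  objects \<open>R\<close> and \<open>D\<close>. The maps \<open>I\<close>, \<open>J\<close>,
  \<open>P\<close>, \<open>Q\<close> are the usual ones, rewritten through these choices.\<close>

lemma is_dsum_assoc:
  assumes "is_dsum \<C> S A R" "is_dsum \<C> R B C" "is_dsum \<C> D A B"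
  shows "is_dsum \<C> S D C"
proof -
  obtain i j p q where "biproduct \<C> A R S i j p q" using assms by (auto simp: is_dsum_def)
  note s = this[unfolded biproduct_def]
  obtain k l r t where "biproduct \<C> B C R k l r t" using assms by (auto simp: is_dsum_def)
  note s' = this[unfolded biproduct_def]
  obtain u v w z where "biproduct \<C> A B D u v w z" using assms by (auto simp: is_dsum_def)
  note s'' = this[unfolded biproduct_def]
  note H = s s' s''
  define I J P Q where "I = i \<cdot> w + (j \<cdot> k) \<cdot> z" and "J = j \<cdot> l"
    and "P = u \<cdot> p + v \<cdot> (r \<cdot> q)" and "Q = t \<cdot> q"
  note D = I_def J_def P_def Q_def
  have h: "i \<cdot> w \<in> Hom \<C> D S" "j \<cdot> k \<in> Hom \<C> B S" "(j \<cdot> k) \<cdot> z \<in> Hom \<C> D S" "k \<cdot> z \<in> Hom \<C> D R"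
    "u \<cdot> p \<in> Hom \<C> S D" "r \<cdot> q \<in> Hom \<C> S B" "v \<cdot> (r \<cdot> q) \<in> Hom \<C> S D" "J \<in> Hom \<C> C S" "Q \<in> Hom \<C> S C"
    using H D by (blast intro: hom_intros)+
  have IP: "I \<in> Hom \<C> D S" "P \<in> Hom \<C> S D" using h D Hom_add by auto
  have pI: "p \<cdot> I = w"
    using Comp_add_right[OF h(1,3), of p A] H h cancel_Id[of p i A S w D] cancel_zero[of p j R S A "k \<cdot> z" D]
      Comp_assoc[of z D B k R j S] unfolding D by simp
  have qI: "q \<cdot> I = k \<cdot> z"
    using Comp_add_right[OF h(1,3), of q R] H h cancel_zero[of q i A S R w D] cancel_Id[of q j R S "k \<cdot> z" D]
      Comp_assoc[of z D B k R j S] unfolding D by simp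
  have pJ: "p \<cdot> J = 0" "q \<cdot> J = l"
    using H cancel_zero[of p j R S A l C] cancel_Id[of q j R S l C] unfolding D by auto
  have "P \<cdot> I = (u \<cdot> p) \<cdot> I + (v \<cdot> (r \<cdot> q)) \<cdot> I"
    using Comp_add_left[OF IP(1) h(5,7)] D by simp
  also have "(u \<cdot> p) \<cdot> I = u \<cdot> w" using Comp_assoc[OF IP(1), of p A u D] H pI by simp
  also have "(v \<cdot> (r \<cdot> q)) \<cdot> I = v \<cdot> z"
    using Comp_assoc[OF IP(1) h(6), of v D] Comp_assoc[OF IP(1), of q R r B] H pI qI
      cancel_Id[of r k B R z D] by simp
  finally have 1: "P \<cdot> I = Id \<C> D" using H by simp
  have 2: "Q \<cdot> J = Id \<C> C"
    using Comp_assoc[OF h(8), of q R t C] pJ H D by simp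
  have "P \<cdot> J = (u \<cdot> p) \<cdot> J + (v \<cdot> (r \<cdot> q)) \<cdot> J"
    using Comp_add_left[OF h(8) h(5,7)] D by simp
  also have "(u \<cdot> p) \<cdot> J = 0" using Comp_assoc[OF h(8), of p A u D] H pJ Comp_zero_right by metis
  also have "(v \<cdot> (r \<cdot> q)) \<cdot> J = 0"
    using Comp_assoc[OF h(8) h(6), of v D] Comp_assoc[OF h(8), of q R r B] H pJ
      Comp_zero_right[of v B D] by simp
  finally have 3: "P \<cdot> J = 0" by simp
  have 4: "Q \<cdot> I = 0"
    using Comp_assoc[OF IP(1), of q R t C] qI H cancel_zero[of t k B R C z D] D by simp
  have "I \<cdot> P = (i \<cdot> w) \<cdot> P + ((j \<cdot> k) \<cdot> z) \<cdot> P"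
    using Comp_add_left[OF IP(2) h(1,3)] D by simp
  also have "w \<cdot> P = p"
    using Comp_add_right[OF h(5,7), of w A] H h cancel_Id[of w u A D p S] cancel_zero[of w v B D A "r \<cdot> q" S]
     D by simp
  then have "(i \<cdot> w) \<cdot> P = i \<cdot> p" using Comp_assoc[OF IP(2), of w A i S] H by simp
  also have "z \<cdot> P = r \<cdot> q"
    using Comp_add_right[OF h(5,7), of z B] H h cancel_zero[of z u A D B p S] cancel_Id[of z v B D "r \<cdot> q" S]
     D by simp
  then have "((j \<cdot> k) \<cdot> z) \<cdot> P = j \<cdot> ((k \<cdot> r) \<cdot> q)"
    using Comp_assoc[OF IP(2), of z B "j \<cdot> k" S] Comp_assoc[OF h(6), of k R j S]
      Comp_assoc[of q S R r B k R] H h by simp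
  finally have "I \<cdot> P = i \<cdot> p + j \<cdot> ((k \<cdot> r) \<cdot> q)" .
  moreover have "J \<cdot> Q = j \<cdot> ((l \<cdot> t) \<cdot> q)"
    using Comp_assoc[OF h(9), of l R j S] Comp_assoc[of q S R t C l R] H D by simp
  moreover have k: "k \<cdot> r \<in> Hom \<C> R R" "l \<cdot> t \<in> Hom \<C> R R" using H Comp_in_Hom by blast+
  then have "(k \<cdot> r) \<cdot> q + (l \<cdot> t) \<cdot> q = q"
    using Comp_add_left[of q S R "k \<cdot> r" R "l \<cdot> t"] H Comp_Id_left[of q S R] by simp
  then have "j \<cdot> ((k \<cdot> r) \<cdot> q) + j \<cdot> ((l \<cdot> t) \<cdot> q) = j \<cdot> q"
    using Comp_add_right[of "(k \<cdot> r) \<cdot> q" S R "(l \<cdot> t) \<cdot> q" j S] H k Comp_in_Hom by metis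
  ultimately have 5: "I \<cdot> P + J \<cdot> Q = Id \<C> S" using H by (simp add: add.assoc)
  have "biproduct \<C> D C S I J P Q"
    unfolding biproduct_def using 1 2 3 4 5 IP h by simp
  then show ?thesis by (auto simp: is_dsum_def)
qed

lemma is_dsum_swap:
  assumes S: "is_dsum \<C> S S1 S2" and S1: "is_dsum \<C> S1 A1 B1" and S2: "is_dsum \<C> S2 A2 B2"
    and A: "is_dsum \<C> A A1 A2" and B: "is_dsum \<C> B B1 B2"
  shows "is_dsum \<C> S A B"
proof -
  obtain D where D: "is_dsum \<C> D S2 A1" using ex_dsum by blast
  have "is_dsum \<C> S D B1" using is_dsum_assoc[OF is_dsum_sym[OF S] S1 D] .
  moreover have "is_dsum \<C> D A B2" using is_dsum_assoc[OF is_dsum_sym[OF D] S2 A] .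
  ultimately show ?thesis
    using is_dsum_assoc[of S B1 D B2 A B] B is_dsum_sym by blast
qed

abbreviation "loc \<equiv> local_endomorphism_ring \<C>"

text \<open>In a local ring a sum is invertible only if one of its terms is. So a single term,
  through one object \<open>Z\<close> of \<open>G\<close>, is an isomorphism, and this splits
  \<open>M\<close> off \<open>Z\<close>.\<close>

lemma loc_ideal_iso:
  assumes "loc M" "ideal \<C> G M M f" "iso_mor \<C> M M f"
  shows "\<exists>Z\<in>G. retract \<C> M Z"
  using assms(2,3)
proof (induction rule: ideal.induct)
  case ideal_zero
  then have "Id \<C> M = 0" by (metis iso_mor_def Comp_zero_left)
  then show ?case using assms(1) by (simp add: local_endomorphism_ring_def zero_object_def)
next
  case (ideal_comp Z g h)
  then obtain k where k: "k \<in> Hom \<C> M M" "k \<cdot> (h \<cdot> g) = Id \<C> M" by (auto simp: iso_mor_def)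
  then have "(k \<cdot> h) \<cdot> g = Id \<C> M" using ideal_comp Comp_assoc[of g M Z h M k M] by simp
  then show ?case using ideal_comp k Comp_in_Hom unfolding retract_def by blast
next
  case (ideal_add f f')
  then have "iso_mor \<C> M M f \<or> iso_mor \<C> M M f'"
    using assms(1) ideal_Hom unfolding local_endomorphism_ring_def by blast
  then show ?case using ideal_add by blast
qed

lemma loc_gen: "loc M \<Longrightarrow> M \<in> gen \<C> G \<Longrightarrow> \<exists>Z\<in>G. retract \<C> M Z"
  unfolding gen_def using loc_ideal_iso iso_mor_Id by blast

text \<open>The idempotent \<open>i \<cdot> p\<close> of the local endomorphism ring of
  \<open>L\<close> is zero or the identity; it is not zero because \<open>N\<close> is not.\<close>

lemma retract_loc_isomorphic:
  assumes "retract \<C> N L" "loc L" "\<not> zero_object \<C> N"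
  shows "isomorphic \<C> N L"
proof -
  obtain i p where ip: "i \<in> Hom \<C> N L" "p \<in> Hom \<C> L N" "p \<cdot> i = Id \<C> N"
    using assms by (auto simp: retract_def)
  let ?e = "i \<cdot> p"
  have e: "?e \<in> Hom \<C> L L" using ip Comp_in_Hom by blast
  have "iso_mor \<C> L L (?e + (Id \<C> L - ?e))" using iso_mor_Id by simp
  then consider "iso_mor \<C> L L ?e" | "iso_mor \<C> L L (Id \<C> L - ?e)"
    using assms(2) e Hom_diff[OF Id_in_Hom e] unfolding local_endomorphism_ring_def by blast
  then show ?thesis
  proof cases
    case 1
    then obtain k where k: "k \<in> Hom \<C> L L" "k \<cdot> ?e = Id \<C> L" by (auto simp: iso_mor_def)
    have pe: "p \<cdot> ?e = p" using cancel_Id[of p i N L p L] ip by simp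
    have "?e \<cdot> ?e = ?e" using Comp_assoc[OF e ip(2) ip(1)] pe by simp
    then have "?e = k \<cdot> ?e" using Comp_assoc[OF e e k(1)] k Comp_Id_left[OF e] by simp
    then have "?e = Id \<C> L" using k by simp
    then have "iso_mor \<C> N L i" using ip unfolding iso_mor_def by blast
    then show ?thesis by (auto simp: isomorphic_def)
  next
    case 2
    then obtain k where k: "k \<in> Hom \<C> L L" "k \<cdot> (Id \<C> L - ?e) = Id \<C> L" by (auto simp: iso_mor_def)
    have "(Id \<C> L - ?e) \<cdot> i = 0"
      using Comp_diff_left[OF ip(1) Id_in_Hom e] Comp_assoc[OF ip(1) ip(2) ip(1)] ip
        Comp_Id_left[OF ip(1)] Comp_Id_right[OF ip(1)] by simp
    then have "k \<cdot> 0 = i"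
      using Comp_assoc[OF ip(1) Hom_diff[OF Id_in_Hom e] k(1)] k(2) Comp_Id_left[OF ip(1)] by simp
    then have "i = 0" using Comp_zero_right[OF k(1)] by simp
    then have "Id \<C> N = 0" using ip Comp_zero_right[OF ip(2)] by simp
    then show ?thesis using assms by (simp add: zero_object_def)
  qed
qed

lemma gen_mono_ideal: "ideal \<C> G A B f \<Longrightarrow> G \<subseteq> gen \<C> H \<Longrightarrow> ideal \<C> H A B f"
proof (induction rule: ideal.induct)
  case (ideal_comp Z g h)
  then have "ideal \<C> H Z Z (Id \<C> Z)" by (auto simp: gen_def)
  then show ?case
    using ideal_left[OF ideal_right, of H Z Z "Id \<C> Z" g A h B] ideal_comp Comp_Id_left by simp
qed (auto intro: ideal.intros)

lemma gen_gen: "G \<subseteq> gen \<C> H \<Longrightarrow> gen \<C> G \<subseteq> gen \<C> H"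
  using gen_mono_ideal by (auto simp: gen_def)

lemma zero_object_not_loc: "loc M \<Longrightarrow> \<not> zero_object \<C> M"
  by (simp add: local_endomorphism_ring_def)

end

section \<open>Reduction to objects with local endomorphism rings\<close>

locale krull_schmidt_category = additive_category +
  assumes krull_schmidt: "krull_schmidt \<C>"
begin

text \<open>A property stable under direct sums need only be checked on objects with local
  endomorphism ring. Both summands come with membership in \<open>S\<close>, as subcategories are
  closed under summands.\<close>

lemma KS_induct [consumes 2, case_names loc zero dsum]:
  assumes S: "subcategory \<C> S" and M: "M \<in> S"
    and l: "\<And>N. N \<in> S \<Longrightarrow> loc N \<Longrightarrow> P N"
    and z: "\<And>Z. zero_object \<C> Z \<Longrightarrow> P Z"
    and d: "\<And>D A B. is_dsum \<C> D A B \<Longrightarrow> A \<in> S \<Longrightarrow> B \<in> S \<Longrightarrow> P A \<Longrightarrow> P B \<Longrightarrow> P D"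
  shows "P M"
proof -
  obtain As where "\<forall>N\<in>set As. loc N" "is_dsum_list \<C> M As"
    using krull_schmidt by (auto simp: krull_schmidt_def)
  then show ?thesis using M
  proof (induction As arbitrary: M)
    case (Cons A As)
    then obtain S' where S': "is_dsum_list \<C> S' As" "is_dsum \<C> M A S'" by auto
    then have "A \<in> S" "S' \<in> S" using Cons.prems(3) subcategoryD(3,4)[OF S] by blast+
    then show ?case using d[OF S'(2)] Cons.IH[OF _ S'(1)] Cons.prems l by simp
  qed (simp add: z)
qed

lemma UNIV_subcategory: "subcategory \<C> UNIV"
  by (simp add: subcategory_def)

lemma subcategory_loc_ideal:
  assumes S: "subcategory \<C> S" "M \<in> S"
  shows "M \<in> gen \<C> {L \<in> S. loc L}"
  using assms
proof (induction rule: KS_induct)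
  case (loc N)
  then show ?case using gen_base[of "{L \<in> S. loc L}"] by blast
next
  case (zero Z)
  then show ?case using gen_subcategory subcategoryD(1) by blast
next
  case (dsum D A B)
  then show ?case using gen_subcategory subcategoryD(2) by blast
qed

text \<open>A retraction provides no complement, so closure under summands does not apply directly.
  Instead each local summand \<open>N\<close> of \<open>M\<close> is a retract of \<open>Z\<close>,
  hence of some local \<open>L\<close> in \<open>S\<close>, hence isomorphic to
  \<open>L\<close>.\<close>

lemma retract_in:
  assumes S: "subcategory \<C> S" and Z: "Z \<in> S" and r: "retract \<C> M Z"
  shows "M \<in> S"
proof -
  have "retract \<C> M Z \<longrightarrow> M \<in> S"
    using UNIV_subcategory UNIV_I
  proof (induction rule: KS_induct)
    case (loc N)
    show ?case
    proof
      assume r: "retract \<C> N Z"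
      have "N \<in> gen \<C> {L \<in> S. loc L}" using gen_retract[OF r] subcategory_loc_ideal[OF S Z] .
      then obtain L where L: "L \<in> S" "loc L" "retract \<C> N L" using loc_gen[OF loc(2)] by blast
      then show "N \<in> S"
        using retract_loc_isomorphic zero_object_not_loc[OF loc(2)] isomorphic_sym subcategoryD(5)[OF S] by blast
    qed
  next
    case (zero Z)
    then show ?case using subcategoryD(1)[OF S] by blast
  next
    case (dsum D A B)
    then show ?case using subcategoryD(2)[OF S] is_dsum_retract retract_trans by blast
  qed
  then show ?thesis using r by blast
qed

lemma gen_subset: "subcategory \<C> S \<Longrightarrow> G \<subseteq> S \<Longrightarrow> gen \<C> G \<subseteq> S"
proof
  fix M assume S: "subcategory \<C> S" "G \<subseteq> S" and M: "M \<in> gen \<C> G"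
  from gen_subcategory[of G] M show "M \<in> S"
  proof (induction rule: KS_induct)
    case (loc N)
    then show ?case using loc_gen[OF loc(2,1)] retract_in[OF S(1)] S(2) by blast
  next
    case (zero Z)
    then show ?case using subcategoryD(1)[OF S(1)] by blast
  next
    case (dsum D A B)
    then show ?case using subcategoryD(2)[OF S(1)] by blast
  qed
qed

lemma subcategory_eq_gen: "subcategory \<C> S \<Longrightarrow> S = gen \<C> {L \<in> S. loc L}"
  using subcategory_loc_ideal[of S] gen_subset[of S "{L \<in> S. loc L}"] by (intro equalityI subsetI) auto

text \<open>Each generator is replaced by the finitely many local terms of a decomposition. They are
  retracts of it, so the generated subcategory does not change.\<close>

lemma gen_loc_finite:
  assumes "finite G"
  shows "\<exists>H. finite H \<and> (\<forall>L\<in>H. loc L) \<and> gen \<C> H = gen \<C> G"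
proof -
  have one: "\<exists>H. finite H \<and> (\<forall>L\<in>H. loc L \<and> retract \<C> L M) \<and> M \<in> gen \<C> H" for M
    using UNIV_subcategory UNIV_I
  proof (induction rule: KS_induct)
    case (loc N)
    have "N \<in> gen \<C> {N}" using gen_base[of "{N}"] by simp
    then show ?case using loc retract_refl by (intro exI[of _ "{N}"]) simp
  next
    case (zero Z)
    then have "Z \<in> gen \<C> {}" using subcategoryD(1)[OF gen_subcategory] by blast
    then show ?case by (intro exI[of _ "{}"]) simp
  next
    case (dsum D A B)
    then obtain H H' where *: "finite H" "\<forall>L\<in>H. loc L \<and> retract \<C> L A" "A \<in> gen \<C> H"
      "finite H'" "\<forall>L\<in>H'. loc L \<and> retract \<C> L B" "B \<in> gen \<C> H'" by blast
    have "A \<in> gen \<C> (H \<union> H')" "B \<in> gen \<C> (H \<union> H')"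
      using * gen_gen[of H "H \<union> H'"] gen_gen[of H' "H \<union> H'"] gen_base[of "H \<union> H'"] by blast+
    then have "D \<in> gen \<C> (H \<union> H')" using subcategoryD(2)[OF gen_subcategory dsum(1)] by blast
    moreover have "loc L \<and> retract \<C> L D" if "L \<in> H \<union> H'" for L
      using that * is_dsum_retract[OF dsum(1)] retract_trans[of L A D] retract_trans[of L B D] by blast
    ultimately show ?case using * by (intro exI[of _ "H \<union> H'"]) simp
  qed
  then obtain h where h: "\<And>M. finite (h M)" "\<And>M L. L \<in> h M \<Longrightarrow> loc L" "\<And>M L. L \<in> h M \<Longrightarrow> retract \<C> L M"
    "\<And>M. M \<in> gen \<C> (h M)" by metis
  let ?H = "\<Union> (h ` G)"
  have "?H \<subseteq> gen \<C> G" using h(3) gen_base[of G] retract_in[OF gen_subcategory] by blast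
  moreover have "G \<subseteq> gen \<C> ?H"
  proof
    fix M assume "M \<in> G"
    then have "h M \<subseteq> gen \<C> ?H" using gen_base[of ?H] by blast
    then show "M \<in> gen \<C> ?H" using gen_gen h(4) by blast
  qed
  ultimately have "gen \<C> ?H = gen \<C> G" using gen_gen by blast
  then show ?thesis using h assms by (intro exI[of _ ?H]) auto
qed

lemma gen_loc_isomorphic: "\<forall>L\<in>H. loc L \<Longrightarrow> M \<in> gen \<C> H \<Longrightarrow> loc M \<Longrightarrow> \<exists>L\<in>H. isomorphic \<C> M L"
  using loc_gen retract_loc_isomorphic zero_object_not_loc by blast

text \<open>Up to isomorphism every local object of \<open>S\<close> is one of the finitely many
  local generators \<open>H\<close>, and those lying in \<open>S\<close> generate it. In this way
  \<open>\<I>\<close>, contained in a cluster tilting subcategory, is finitely generated.\<close>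

lemma gen_subcategory_finite:
  assumes "finite G" "subcategory \<C> S" "S \<subseteq> gen \<C> G"
  shows "\<exists>H. finite H \<and> (\<forall>L\<in>H. loc L) \<and> S = gen \<C> H"
proof -
  obtain H where H: "finite H" "\<forall>L\<in>H. loc L" "gen \<C> H = gen \<C> G" using gen_loc_finite[OF assms(1)] by blast
  have "{L \<in> S. loc L} \<subseteq> gen \<C> (H \<inter> S)"
  proof
    fix M assume M: "M \<in> {L \<in> S. loc L}"
    then obtain L where L: "L \<in> H" "isomorphic \<C> M L" using gen_loc_isomorphic[OF H(2)] H(3) assms(3) by blast
    then have "L \<in> gen \<C> (H \<inter> S)" using M subcategoryD(5)[OF assms(2)] gen_base[of "H \<inter> S"] by blast
    then show "M \<in> gen \<C> (H \<inter> S)" using L isomorphic_sym subcategoryD(5)[OF gen_subcategory] by blast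
  qed
  then have "S \<subseteq> gen \<C> (H \<inter> S)" using subcategory_eq_gen[OF assms(2)] gen_gen by blast
  then have "S = gen \<C> (H \<inter> S)" using gen_subset[OF assms(2), of "H \<inter> S"] by blast
  then show ?thesis using H by (intro exI[of _ "H \<inter> S"]) auto
qed

text \<open>From left to right, the identity is the sum of the two idempotents of a decomposition,
  and the one that is invertible kills the other summand. From right to left, a Krull-Schmidt
  decomposition of \<open>M\<close> starts with a local \<open>A\<close> whose complement is zero,
  and locality is carried over along \<open>i\<close> and \<open>p\<close>.\<close>

lemma loc_iff_indecomposable: "loc M \<longleftrightarrow> indecomposable \<C> M"
proof
  assume M: "loc M"
  have "zero_object \<C> A \<or> zero_object \<C> B" if dM: "is_dsum \<C> M A B" for A B
  proof -
    obtain i j p q where "biproduct \<C> A B M i j p q" using dM by (auto simp: is_dsum_def)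
    note b = this[unfolded biproduct_def]
    have "retract \<C> A M" "retract \<C> B M" using is_dsum_retract[OF dM] by auto
    have "iso_mor \<C> M M (i \<cdot> p) \<or> iso_mor \<C> M M (j \<cdot> q)"
      using M b iso_mor_Id[of M] Comp_in_Hom[of p M A i M] Comp_in_Hom[of q M B j M]
      unfolding local_endomorphism_ring_def by metis
    moreover have "zero_object \<C> B" if ip: "iso_mor \<C> M M (i \<cdot> p)"
    proof -
      obtain k where k: "k \<in> Hom \<C> M M" "(i \<cdot> p) \<cdot> k = Id \<C> M" using ip by (auto simp: iso_mor_def)
      have "q \<cdot> (i \<cdot> (p \<cdot> k)) = 0" using cancel_zero[of q i A M B "p \<cdot> k" M] b k Comp_in_Hom by blast
      then have "q \<cdot> Id \<C> M = 0" using k b Comp_assoc[of k M M p A i M] by simp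
      then have "q = 0" using b Comp_Id_right[of q M B] by simp
      then show ?thesis using b Comp_zero_left[of j B M] by (simp add: zero_object_def)
    qed
    moreover have "zero_object \<C> A" if jq: "iso_mor \<C> M M (j \<cdot> q)"
    proof -
      obtain k where k: "k \<in> Hom \<C> M M" "(j \<cdot> q) \<cdot> k = Id \<C> M" using jq by (auto simp: iso_mor_def)
      have "p \<cdot> (j \<cdot> (q \<cdot> k)) = 0" using cancel_zero[of p j B M A "q \<cdot> k" M] b k Comp_in_Hom by blast
      then have "p \<cdot> Id \<C> M = 0" using k b Comp_assoc[of k M M q B j M] by simp
      then have "p = 0" using b Comp_Id_right[of p M A] by simp
      then show ?thesis using b Comp_zero_left[of i A M] by (simp add: zero_object_def)
    qed
    ultimately show ?thesis by blast
  qed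
  then show "indecomposable \<C> M" using zero_object_not_loc[OF M] by (auto simp: indecomposable_def)
next
  assume M: "indecomposable \<C> M"
  obtain As where As: "\<forall>N\<in>set As. loc N" "is_dsum_list \<C> M As"
    using krull_schmidt by (auto simp: krull_schmidt_def)
  then obtain A As' where *: "As = A # As'" using M by (cases As) (auto simp: indecomposable_def)
  then obtain S' where S': "is_dsum \<C> M A S'" using As by auto
  have A: "loc A" using As * by simp
  then have "zero_object \<C> S'" using S' M zero_object_not_loc by (auto simp: indecomposable_def)
  obtain i j p q where "biproduct \<C> A S' M i j p q" using S' by (auto simp: is_dsum_def)
  note b = this[unfolded biproduct_def]
  have "j = 0" using zero_object_Hom_from[OF \<open>zero_object \<C> S'\<close>] b by blast
  then have ip: "i \<cdot> p = Id \<C> M" using b Comp_zero_left[of q M S'] by simp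
  have iso: "iso_mor \<C> A A (p \<cdot> (f \<cdot> i)) \<Longrightarrow> iso_mor \<C> M M f" if f: "f \<in> Hom \<C> M M" for f
  proof -
    assume "iso_mor \<C> A A (p \<cdot> (f \<cdot> i))"
    moreover have "iso_mor \<C> A M i" "iso_mor \<C> M A p" using b ip unfolding iso_mor_def by blast+
    ultimately have "iso_mor \<C> M M (i \<cdot> ((p \<cdot> (f \<cdot> i)) \<cdot> p))" using iso_mor_comp by blast
    moreover have "i \<cdot> ((p \<cdot> (f \<cdot> i)) \<cdot> p) = f"
    proof -
      have fi: "f \<cdot> i \<in> Hom \<C> A M" using f b Comp_in_Hom by blast
      have "(f \<cdot> i) \<cdot> p = f" using Comp_assoc[of p M A i M f M] b f ip Comp_Id_right[of f M M] by simp
      moreover have "i \<cdot> (p \<cdot> f) = f" using cancel_Id[of i p M A f M] b f ip by simp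
      ultimately show ?thesis using Comp_assoc[of p M A "f \<cdot> i" M p A] b fi by simp
    qed
    ultimately show ?thesis by simp
  qed
  show "loc M" unfolding local_endomorphism_ring_def
  proof (intro conjI ballI impI)
    show "\<not> zero_object \<C> M" using M by (simp add: indecomposable_def)
    fix f g assume fg: "f \<in> Hom \<C> M M" "g \<in> Hom \<C> M M" "iso_mor \<C> M M (f + g)"
    have h: "f \<cdot> i \<in> Hom \<C> A M" "g \<cdot> i \<in> Hom \<C> A M" "p \<cdot> (f \<cdot> i) \<in> Hom \<C> A A" "p \<cdot> (g \<cdot> i) \<in> Hom \<C> A A"
      using fg b Comp_in_Hom by blast+
    have "iso_mor \<C> A M i" "iso_mor \<C> M A p" using b ip unfolding iso_mor_def by blast+
    then have "iso_mor \<C> A A (p \<cdot> ((f + g) \<cdot> i))" using fg iso_mor_comp by blast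
    also have "p \<cdot> ((f + g) \<cdot> i) = p \<cdot> (f \<cdot> i) + p \<cdot> (g \<cdot> i)"
      using Comp_add_left[of i A M f M g] Comp_add_right[OF h(1,2), of p A] fg b by simp
    finally show "iso_mor \<C> M M f \<or> iso_mor \<C> M M g"
      using A h iso fg unfolding local_endomorphism_ring_def by blast
  qed
qed

end

section \<open>Duality and homotopy pullbacks\<close>

text \<open>Duality is a construction on the data: a locale that is stable under it yields its dual
  lemmas by instantiation. In \<open>realize\<close> the two maps of a sequence change places
  together with the end terms.\<close>

definition opp :: "('k, 'o, 'm, 'e) extri_data \<Rightarrow> ('k, 'o, 'm, 'e) extri_data" where
  "opp \<C> = \<lparr>Hom = (\<lambda>A B. Hom \<C> B A), Id = Id \<C>, Comp = (\<lambda>g f. f \<cdot>\<^bsub>\<C>\<^esub> g), scaleH = scaleH \<C>,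
     Ext = (\<lambda>A B. Ext \<C> B A), push = pull \<C>, pull = push \<C>, scaleE = scaleE \<C>,
     realize = (\<lambda>C A \<delta>. {(B, x, y). (B, y, x) \<in> realize \<C> A C \<delta>})\<rparr>"

lemma opp_simps [simp]:
  "Hom (opp \<C>) A B = Hom \<C> B A" "Id (opp \<C>) = Id \<C>" "g \<cdot>\<^bsub>opp \<C>\<^esub> f = f \<cdot>\<^bsub>\<C>\<^esub> g"
  "scaleH (opp \<C>) = scaleH \<C>" "Ext (opp \<C>) A B = Ext \<C> B A" "push (opp \<C>) = pull \<C>" "pull (opp \<C>) = push \<C>"
  "scaleE (opp \<C>) = scaleE \<C>"
  by (simp_all add: opp_def)

lemma etriangle_opp [simp]: "etriangle (opp \<C>) A B C x y \<delta> \<longleftrightarrow> etriangle \<C> C B A y x \<delta>"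
  by (auto simp: etriangle_def opp_def)

lemma zero_object_opp [simp]: "zero_object (opp \<C>) = zero_object \<C>"
  by (auto simp: zero_object_def fun_eq_iff)

lemma biproduct_opp [simp]: "biproduct (opp \<C>) A B S i j p q \<longleftrightarrow> biproduct \<C> A B S p q i j"
  by (auto simp: biproduct_def)

lemma is_dsum_opp [simp]: "is_dsum (opp \<C>) = is_dsum \<C>"
  by (auto simp: is_dsum_def fun_eq_iff)

lemma iso_mor_opp [simp]: "iso_mor (opp \<C>) A B f \<longleftrightarrow> iso_mor \<C> B A f"
  by (auto simp: iso_mor_def)

lemma isomorphic_opp [simp]: "isomorphic (opp \<C>) A B \<longleftrightarrow> isomorphic \<C> B A"
  by (auto simp: isomorphic_def)

lemma retract_opp [simp]: "retract (opp \<C>) A B \<longleftrightarrow> retract \<C> A B"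
  by (auto simp: retract_def)

lemma ideal_opp [simp]: "ideal (opp \<C>) S A B f \<longleftrightarrow> ideal \<C> S B A f"
proof
  show "ideal \<C> S B A f" if "ideal (opp \<C>) S A B f"
    using that
  proof (induction rule: ideal.induct)
    case (ideal_comp Z g h)
    then show ?case using ideal.ideal_comp[of Z S h \<C> B g A] by simp
  qed (auto intro: ideal.intros)
  show "ideal (opp \<C>) S A B f" if "ideal \<C> S B A f"
    using that
  proof (induction rule: ideal.induct)
    case (ideal_comp Z g h)
    then show ?case using ideal.ideal_comp[of Z S h "opp \<C>" A g B] by simp
  qed (auto intro: ideal.intros)
qed

lemma gen_opp [simp]: "gen (opp \<C>) G = gen \<C> G"
  by (simp add: gen_def)

lemma loc_opp [simp]: "local_endomorphism_ring (opp \<C>) M \<longleftrightarrow> local_endomorphism_ring \<C> M"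
  by (simp add: local_endomorphism_ring_def)

lemma subcategory_opp [simp]: "subcategory (opp \<C>) S \<longleftrightarrow> subcategory \<C> (S :: 'o set)" if "additive_category \<C>"
  for \<C> :: "('k, 'o, 'm::ab_group_add, 'e) extri_data"
  unfolding subcategory_def by (auto dest: additive_category.isomorphic_sym[OF that])

lemma is_dsum_list_opp [simp]: "is_dsum_list (opp \<C>) S As \<longleftrightarrow> is_dsum_list \<C> S As"
  by (induction As arbitrary: S) auto

lemma krull_schmidt_opp [simp]: "krull_schmidt (opp \<C>) \<longleftrightarrow> krull_schmidt \<C>"
  by (simp add: krull_schmidt_def)

lemma (in additive_category) additive_category_opp: "additive_category (opp \<C>)"
proof
  show "\<exists>S i j p q. biproduct (opp \<C>) A B S i j p q" for A B
    using ex_biproduct[of A B] by (metis biproduct_opp)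
qed (use Comp_assoc ex_zero_object in \<open>auto intro: hom_intros simp: Comp_Id_right Comp_Id_left Hom_subgroup Comp_add_left Comp_add_right\<close>)

context extriangulated_category
begin

lemma etriangleD:
  assumes "etriangle \<C> A B C x y \<delta>"
  shows "x \<in> Hom \<C> A B" "y \<in> Hom \<C> B C" "\<delta> \<in> Ext \<C> C A"
  using assms realize_class[of \<delta> C A] by (auto simp: etriangle_def sequences_def)

lemma seq_equiv_refl: "(B, x, y) \<in> sequences \<C> A C \<Longrightarrow> seq_equiv \<C> (B, x, y) (B, x, y)"
  unfolding seq_equiv_def sequences_def using iso_mor_Id[of B] Comp_Id_left[of x A B] Comp_Id_right[of y B C] by auto

lemma ex_etriangle: "\<delta> \<in> Ext \<C> C A \<Longrightarrow> \<exists>B x y. etriangle \<C> A B C x y \<delta>"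
proof -
  assume d: "\<delta> \<in> Ext \<C> C A"
  obtain t where t: "t \<in> sequences \<C> A C"
    "realize \<C> C A \<delta> = {t' \<in> sequences \<C> A C. seq_equiv \<C> t t'}"
    using realize_class[OF d] by blast
  obtain B x y where "t = (B, x, y)" by (cases t)
  then have "etriangle \<C> A B C x y \<delta>" using d t seq_equiv_refl[of B x y A C] by (simp add: etriangle_def)
  then show ?thesis by blast
qed

text \<open>In the opposite category the comparison of middle terms runs backwards, so it is
  replaced by its inverse.\<close>

lemma seq_equiv_opp:
  assumes "x \<in> Hom \<C> B A" "y \<in> Hom \<C> C B" "x' \<in> Hom \<C> B' A" "y' \<in> Hom \<C> C B'"
  shows "seq_equiv (opp \<C>) (B, x, y) (B', x', y') \<longleftrightarrow> seq_equiv \<C> (B, y, x) (B', y', x')"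
proof
  assume "seq_equiv (opp \<C>) (B, x, y) (B', x', y')"
  then obtain b where b: "iso_mor \<C> B' B b" "x \<cdot> b = x'" "b \<cdot> y' = y" by (auto simp: seq_equiv_def)
  from iso_mor_inv[OF b(1)] obtain c where c: "iso_mor \<C> B B' c" "c \<cdot> b = Id \<C> B'" "b \<cdot> c = Id \<C> B"
    "b \<in> Hom \<C> B' B" "c \<in> Hom \<C> B B'" by blast
  have "c \<cdot> y = y'" using cancel_Id[of c b B' B y' C] c b assms by simp
  moreover have "x' \<cdot> c = x" using Comp_assoc[of c B B' b B x A] c b assms Comp_Id_right[of x B A] by simp
  ultimately show "seq_equiv \<C> (B, y, x) (B', y', x')" using c by (auto simp: seq_equiv_def)
next
  assume "seq_equiv \<C> (B, y, x) (B', y', x')"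
  then obtain b where b: "iso_mor \<C> B B' b" "b \<cdot> y = y'" "x' \<cdot> b = x" by (auto simp: seq_equiv_def)
  from iso_mor_inv[OF b(1)] obtain c where c: "iso_mor \<C> B' B c" "c \<cdot> b = Id \<C> B" "b \<cdot> c = Id \<C> B'"
    "b \<in> Hom \<C> B B'" "c \<in> Hom \<C> B' B" by blast
  have "c \<cdot> y' = y" using cancel_Id[of c b B B' y C] c b assms by simp
  moreover have "x \<cdot> c = x'" using Comp_assoc[of c B' B b B' x' A] c b assms Comp_Id_right[of x' B' A] by simp
  ultimately show "seq_equiv (opp \<C>) (B, x, y) (B', x', y')" using c by (auto simp: seq_equiv_def)
qed

lemma realize_class_opp:
  assumes "\<delta> \<in> Ext \<C> A C"
  shows "\<exists>t\<in>sequences (opp \<C>) A C. realize (opp \<C>) C A \<delta> = {t' \<in> sequences (opp \<C>) A C. seq_equiv (opp \<C>) t t'}"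
proof -
  obtain t where t: "t \<in> sequences \<C> C A"
    "realize \<C> A C \<delta> = {t' \<in> sequences \<C> C A. seq_equiv \<C> t t'}"
    using realize_class[OF assms] by blast
  obtain B y x where "t = (B, y, x)" by (cases t)
  with t have B: "(B, y, x) \<in> sequences \<C> C A"
    "realize \<C> A C \<delta> = {t' \<in> sequences \<C> C A. seq_equiv \<C> (B, y, x) t'}" by auto
  have "realize (opp \<C>) C A \<delta> = {t' \<in> sequences (opp \<C>) A C. seq_equiv (opp \<C>) (B, x, y) t'}"
    using B seq_equiv_opp[of x B A y C] by (auto simp: opp_def sequences_def)
  then show ?thesis using B by (intro bexI[of _ "(B, x, y)"]) (auto simp: sequences_def)
qed

text \<open>(ET3) and (ET4) change places with their opposite versions, and the morphism axiom is
  self-dual. For the sum of two realizations the composites are re-bracketed and \<open>push\<close>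
  is commuted with \<open>pull\<close>.\<close>

lemma extriangulated_category_opp: "extriangulated_category (opp \<C>)"
proof (intro extriangulated_category.intro extriangulated_category_axioms.intro)
  show "additive_category (opp \<C>)" by (rule additive_category_opp)
  show "add_subgroup (Ext (opp \<C>) C A)" for C A by (simp add: Ext_subgroup)
next
  fix A B C x y \<delta> A' B' C' x' y' \<delta>' AA i i' p p' BB j j' q q' CC l l' r r'
  assume t: "etriangle (opp \<C>) A B C x y \<delta>" "etriangle (opp \<C>) A' B' C' x' y' \<delta>'"
    and b: "biproduct (opp \<C>) A A' AA i i' p p'" "biproduct (opp \<C>) B B' BB j j' q q'"
      "biproduct (opp \<C>) C C' CC l l' r r'"
  note t' = t[unfolded etriangle_opp] and b' = b[unfolded biproduct_opp]
  note d = etriangleD[OF t'(1)] etriangleD[OF t'(2)] and bb = b'[unfolded biproduct_def]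
  have R: "(BB, (q \<cdot> y) \<cdot> l + (q' \<cdot> y') \<cdot> l', (p \<cdot> x) \<cdot> j + (p' \<cdot> x') \<cdot> j') \<in> realize \<C> AA CC
       (push \<C> r (pull \<C> i \<delta>) + push \<C> r' (pull \<C> i' \<delta>'))"
    using realize_dsum[OF t' b'(3) b'(2) b'(1)] .
  have "(q \<cdot> y) \<cdot> l = q \<cdot> (y \<cdot> l)" "(q' \<cdot> y') \<cdot> l' = q' \<cdot> (y' \<cdot> l')"
    "(p \<cdot> x) \<cdot> j = p \<cdot> (x \<cdot> j)" "(p' \<cdot> x') \<cdot> j' = p' \<cdot> (x' \<cdot> j')"
    using Comp_assoc[of l CC C y B q BB] Comp_assoc[of l' CC C' y' B' q' BB]
      Comp_assoc[of j BB B x A p AA] Comp_assoc[of j' BB B' x' A' p' AA] bb d by auto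
  moreover have "push \<C> r (pull \<C> i \<delta>) = pull \<C> i (push \<C> r \<delta>)" "push \<C> r' (pull \<C> i' \<delta>') = pull \<C> i' (push \<C> r' \<delta>')"
    using push_pull[of r C CC i AA A \<delta>] push_pull[of r' C' CC i' AA A' \<delta>'] bb d by auto
  ultimately show "(BB, (j \<cdot>\<^bsub>opp \<C>\<^esub> x) \<cdot>\<^bsub>opp \<C>\<^esub> p + (j' \<cdot>\<^bsub>opp \<C>\<^esub> x') \<cdot>\<^bsub>opp \<C>\<^esub> p',
       (l \<cdot>\<^bsub>opp \<C>\<^esub> y) \<cdot>\<^bsub>opp \<C>\<^esub> q + (l' \<cdot>\<^bsub>opp \<C>\<^esub> y') \<cdot>\<^bsub>opp \<C>\<^esub> q')
    \<in> realize (opp \<C>) CC AA (push (opp \<C>) i (pull (opp \<C>) r \<delta>) + push (opp \<C>) i' (pull (opp \<C>) r' \<delta>'))"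
    using R by (simp add: opp_def)
next
  fix A B C x y \<delta> A' B' C' x' y' \<delta>' a c
  assume "etriangle (opp \<C>) A B C x y \<delta>" "etriangle (opp \<C>) A' B' C' x' y' \<delta>'"
    "a \<in> Hom (opp \<C>) A A'" "c \<in> Hom (opp \<C>) C C'" "push (opp \<C>) a \<delta> = pull (opp \<C>) c \<delta>'"
  then show "\<exists>b\<in>Hom (opp \<C>) B B'. b \<cdot>\<^bsub>opp \<C>\<^esub> x = x' \<cdot>\<^bsub>opp \<C>\<^esub> a \<and> y' \<cdot>\<^bsub>opp \<C>\<^esub> b = c \<cdot>\<^bsub>opp \<C>\<^esub> y"
    using realize_morphism[of C' B' A' y' x' \<delta>' C B A y x \<delta> c a] by fastforce
next
  fix A C B i j p q assume "biproduct (opp \<C>) A C B i j p q"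
  then have "biproduct \<C> C A B q p j i" by (auto simp: biproduct_def add.commute)
  then show "(B, i, q) \<in> realize (opp \<C>) C A 0" using realize_zero by (simp add: opp_def)
next
  fix A B C x y \<delta> A' B' C' x' y' \<delta>' a b
  assume "etriangle (opp \<C>) A B C x y \<delta>" "etriangle (opp \<C>) A' B' C' x' y' \<delta>'"
    "a \<in> Hom (opp \<C>) A A'" "b \<in> Hom (opp \<C>) B B'" "b \<cdot>\<^bsub>opp \<C>\<^esub> x = x' \<cdot>\<^bsub>opp \<C>\<^esub> a"
  then show "\<exists>c\<in>Hom (opp \<C>) C C'. c \<cdot>\<^bsub>opp \<C>\<^esub> y = y' \<cdot>\<^bsub>opp \<C>\<^esub> b \<and> push (opp \<C>) a \<delta> = pull (opp \<C>) c \<delta>'"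
    using ET3_op[of C' B' A' y' x' \<delta>' C B A y x \<delta> b a] by fastforce
next
  fix A B C x y \<delta> A' B' C' x' y' \<delta>' b c
  assume "etriangle (opp \<C>) A B C x y \<delta>" "etriangle (opp \<C>) A' B' C' x' y' \<delta>'"
    "b \<in> Hom (opp \<C>) B B'" "c \<in> Hom (opp \<C>) C C'" "c \<cdot>\<^bsub>opp \<C>\<^esub> y = y' \<cdot>\<^bsub>opp \<C>\<^esub> b"
  then show "\<exists>a\<in>Hom (opp \<C>) A A'. b \<cdot>\<^bsub>opp \<C>\<^esub> x = x' \<cdot>\<^bsub>opp \<C>\<^esub> a \<and> push (opp \<C>) a \<delta> = pull (opp \<C>) c \<delta>'"
    using ET3[of C' B' A' y' x' \<delta>' C B A y x \<delta> c b] by simp metis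
next
  fix A B D f f' \<delta> C F g g' \<delta>'
  assume "etriangle (opp \<C>) A B D f f' \<delta>" "etriangle (opp \<C>) B C F g g' \<delta>'"
  then have "\<exists>E. \<exists>h'\<in>Hom \<C> E C. \<exists>d\<in>Hom \<C> E D. \<exists>e\<in>Hom \<C> F E. \<exists>\<delta>''\<in>Ext \<C> A E.
         g \<cdot> h' = f' \<cdot> d \<and> h' \<cdot> e = g' \<and>
         etriangle \<C> E C A h' (f \<cdot> g) \<delta>'' \<and>
         etriangle \<C> F E D e d (pull \<C> f' \<delta>') \<and>
         push \<C> d \<delta>'' = \<delta> \<and> pull \<C> f \<delta>'' = push \<C> e \<delta>'"
    using ET4_op[of D B A f' f \<delta> F C g' g \<delta>'] by simp
  then show "\<exists>E. \<exists>h'\<in>Hom (opp \<C>) C E. \<exists>d\<in>Hom (opp \<C>) D E. \<exists>e\<in>Hom (opp \<C>) E F. \<exists>\<delta>''\<in>Ext (opp \<C>) E A.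
         h' \<cdot>\<^bsub>opp \<C>\<^esub> g = d \<cdot>\<^bsub>opp \<C>\<^esub> f' \<and> e \<cdot>\<^bsub>opp \<C>\<^esub> h' = g' \<and>
         etriangle (opp \<C>) A C E (g \<cdot>\<^bsub>opp \<C>\<^esub> f) h' \<delta>'' \<and>
         etriangle (opp \<C>) D E F d e (push (opp \<C>) f' \<delta>') \<and>
         pull (opp \<C>) d \<delta>'' = \<delta> \<and> push (opp \<C>) f \<delta>'' = pull (opp \<C>) e \<delta>'"
    by simp
next
  fix D B A f' f \<delta> F C g' g \<delta>'
  assume "etriangle (opp \<C>) D B A f' f \<delta>" "etriangle (opp \<C>) F C B g' g \<delta>'"
  then have "\<exists>E. \<exists>h'\<in>Hom \<C> C E. \<exists>d\<in>Hom \<C> D E. \<exists>e\<in>Hom \<C> E F. \<exists>\<delta>''\<in>Ext \<C> E A.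
         h' \<cdot> g = d \<cdot> f' \<and> e \<cdot> h' = g' \<and>
         etriangle \<C> A C E (g \<cdot> f) h' \<delta>'' \<and>
         etriangle \<C> D E F d e (push \<C> f' \<delta>') \<and>
         pull \<C> d \<delta>'' = \<delta> \<and> push \<C> f \<delta>'' = pull \<C> e \<delta>'"
    using ET4[of A B D f f' \<delta> C F g g' \<delta>'] by simp
  then show "\<exists>E. \<exists>h'\<in>Hom (opp \<C>) E C. \<exists>d\<in>Hom (opp \<C>) E D. \<exists>e\<in>Hom (opp \<C>) F E. \<exists>\<delta>''\<in>Ext (opp \<C>) A E.
         g \<cdot>\<^bsub>opp \<C>\<^esub> h' = f' \<cdot>\<^bsub>opp \<C>\<^esub> d \<and> h' \<cdot>\<^bsub>opp \<C>\<^esub> e = g' \<and>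
         etriangle (opp \<C>) E C A h' (f \<cdot>\<^bsub>opp \<C>\<^esub> g) \<delta>'' \<and>
         etriangle (opp \<C>) F E D e d (pull (opp \<C>) f' \<delta>') \<and>
         push (opp \<C>) d \<delta>'' = \<delta> \<and> pull (opp \<C>) f \<delta>'' = push (opp \<C>) e \<delta>'"
    by simp
qed (use push_Comp pull_Comp push_pull realize_class_opp in \<open>auto simp: push_in_Ext pull_in_Ext push_Id pull_Id push_add_Ext pull_add_Ext push_add_Hom pull_add_Hom\<close>)

section \<open>Exact sequences attached to an \<bbbE>-triangle\<close>

lemma Ext_zero: "0 \<in> Ext \<C> C A"
  using Ext_subgroup by (auto simp: add_subgroup_def)

lemma Ext_diff: "\<delta> \<in> Ext \<C> C A \<Longrightarrow> \<epsilon> \<in> Ext \<C> C A \<Longrightarrow> \<delta> - \<epsilon> \<in> Ext \<C> C A"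
  using Ext_subgroup by (auto simp: add_subgroup_def)

lemma Ext_minus: "\<delta> \<in> Ext \<C> C A \<Longrightarrow> - \<delta> \<in> Ext \<C> C A"
  using Ext_diff[OF Ext_zero, of \<delta> C A] by simp

lemma Ext_add: "\<delta> \<in> Ext \<C> C A \<Longrightarrow> \<epsilon> \<in> Ext \<C> C A \<Longrightarrow> \<delta> + \<epsilon> \<in> Ext \<C> C A"
  using Ext_diff[of \<delta> C A "- \<epsilon>"] Ext_minus[of \<epsilon> C A] by simp

lemma push_zero: "a \<in> Hom \<C> A A' \<Longrightarrow> push \<C> a 0 = 0"
  using push_add_Ext[OF _ Ext_zero Ext_zero, of a A A'] by simp

lemma pull_zero: "c \<in> Hom \<C> C' C \<Longrightarrow> pull \<C> c 0 = 0"
  using pull_add_Ext[OF _ Ext_zero Ext_zero, of c C' C] by simp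

lemma push_zero_Hom: "\<delta> \<in> Ext \<C> C A \<Longrightarrow> push \<C> 0 \<delta> = 0"
  using push_add_Hom[OF Hom_zero Hom_zero, of \<delta> C A] by simp

lemma pull_zero_Hom: "\<delta> \<in> Ext \<C> C A \<Longrightarrow> pull \<C> 0 \<delta> = 0"
  using pull_add_Hom[OF Hom_zero Hom_zero, of \<delta> C A] by simp

lemma push_diff_Hom: "a \<in> Hom \<C> A A' \<Longrightarrow> a' \<in> Hom \<C> A A' \<Longrightarrow> \<delta> \<in> Ext \<C> C A \<Longrightarrow>
    push \<C> (a - a') \<delta> = push \<C> a \<delta> - push \<C> a' \<delta>"
  using push_add_Hom[OF Hom_diff, of a A A' a' a' \<delta> C] by simp

lemma pull_diff_Hom: "c \<in> Hom \<C> C' C \<Longrightarrow> c' \<in> Hom \<C> C' C \<Longrightarrow> \<delta> \<in> Ext \<C> C A \<Longrightarrow>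
    pull \<C> (c - c') \<delta> = pull \<C> c \<delta> - pull \<C> c' \<delta>"
  using pull_add_Hom[OF Hom_diff, of c C' C c' c' \<delta> A] by simp

lemma etriangle_zero: "biproduct \<C> A C B i j p q \<Longrightarrow> etriangle \<C> A B C i q 0"
  using realize_zero[of A C B i j p q] Ext_zero by (simp add: etriangle_def)

lemma etriangle_zero_right: "zero_object \<C> Z \<Longrightarrow> etriangle \<C> A A Z (Id \<C> A) 0 0"
  by (rule etriangle_zero[where j = 0 and p = "Id \<C> A"])
    (simp add: biproduct_def Id_in_Hom Hom_zero Comp_Id_left[OF Id_in_Hom] zero_object_def
      Comp_zero_left[OF Id_in_Hom] Comp_zero_left[OF Hom_zero] Comp_Id_left[OF Hom_zero])

lemma etriangle_zero_left: "zero_object \<C> Z \<Longrightarrow> etriangle \<C> Z A A 0 (Id \<C> A) 0"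
  by (rule etriangle_zero[where j = "Id \<C> A" and p = 0])
    (simp add: biproduct_def Id_in_Hom Hom_zero Comp_Id_left[OF Id_in_Hom] zero_object_def
      Comp_zero_left[OF Id_in_Hom] Comp_zero_left[OF Hom_zero] Comp_Id_left[OF Hom_zero])

text \<open>This is the opposite version of (ET3) for a morphism from the trivial triangle
  \<open>W \<rightarrow> W \<rightarrow> 0\<close> to the given one.\<close>

lemma kernel_factors:
  assumes tri: "etriangle \<C> A B C x y \<delta>" and f: "f \<in> Hom \<C> W B" "y \<cdot> f = 0"
  shows "\<exists>g\<in>Hom \<C> W A. f = x \<cdot> g"
proof -
  obtain Z where Z: "zero_object \<C> Z" using ex_zero_object by blast
  have "0 \<cdot> 0 = y \<cdot> f" using f Comp_zero_left[OF Hom_zero] by simp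
  then obtain a where "a \<in> Hom \<C> W A" "f \<cdot> Id \<C> W = x \<cdot> a"
    using ET3_op[OF etriangle_zero_right[OF Z, of W] tri f(1) Hom_zero] by blast
  then show ?thesis using Comp_Id_right[OF f(1)] by auto
qed

text \<open>Exactness of \<open>Hom(W,B) \<rightarrow> Hom(W,C) \<rightarrow> \<bbbE>(W,A)\<close>.
  A lift gives a morphism from the trivial triangle
  \<open>0 \<rightarrow> W \<rightarrow> W\<close>. Conversely, if the pullback vanishes, the
  identity of \<open>A\<close> and \<open>c\<close> are the ends of a morphism from the split
  triangle on \<open>A\<close> and \<open>W\<close>; its middle component, restricted to
  \<open>W\<close>, is the lift.\<close>

lemma lift_iff:
  assumes tri: "etriangle \<C> A B C x y \<delta>" and c: "c \<in> Hom \<C> W C"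
  shows "(\<exists>f\<in>Hom \<C> W B. y \<cdot> f = c) \<longleftrightarrow> pull \<C> c \<delta> = 0"
proof
  note t = etriangleD[OF tri]
  assume "\<exists>f\<in>Hom \<C> W B. y \<cdot> f = c"
  then obtain f where f: "f \<in> Hom \<C> W B" "y \<cdot> f = c" by blast
  obtain Z where Z: "zero_object \<C> Z" using ex_zero_object by blast
  have "c \<cdot> Id \<C> W = y \<cdot> f" using f Comp_Id_right[OF c] by simp
  then obtain a where "a \<in> Hom \<C> Z A" "push \<C> a 0 = pull \<C> c \<delta>"
    using ET3_op[OF etriangle_zero_left[OF Z, of W] tri f(1) c] by blast
  then show "pull \<C> c \<delta> = 0" using push_zero by simp
next
  note t = etriangleD[OF tri]
  assume 0: "pull \<C> c \<delta> = 0"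
  obtain S i j p q where bp: "biproduct \<C> A W S i j p q" using ex_biproduct by blast
  note b = bp[unfolded biproduct_def]
  have "push \<C> (Id \<C> A) 0 = pull \<C> c \<delta>" using 0 push_zero[OF Id_in_Hom] by simp
  then obtain g where g: "g \<in> Hom \<C> S B" "y \<cdot> g = c \<cdot> q"
    using realize_morphism[OF etriangle_zero[OF bp] tri Id_in_Hom c] by blast
  have "y \<cdot> (g \<cdot> j) = (c \<cdot> q) \<cdot> j" using Comp_assoc[of j W S g B y C] b g t by simp
  also have "\<dots> = c" using Comp_assoc[of j W S q W c C] b c Comp_Id_right[OF c] by simp
  finally show "\<exists>f\<in>Hom \<C> W B. y \<cdot> f = c" using b g Comp_in_Hom by blast
qed

text \<open>The opposite version of (ET4), applied to a realization of \<open>\<epsilon>\<close>,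
  gives \<open>W \<rightarrow> E' \<rightarrow> A\<close> realizing
  \<open>pull \<C> x \<epsilon> = 0\<close> and a class in \<open>\<bbbE>(C,E')\<close>; a
  retraction of \<open>W \<rightarrow> E'\<close> carries this class to the required one. The
  retraction is assumed here and supplied later by \<open>extend_iff\<close>, which is obtained by
  duality.\<close>

lemma exact_Ext_pull:
  assumes tri: "etriangle \<C> A B C x y \<delta>" and e: "\<epsilon> \<in> Ext \<C> B W" "pull \<C> x \<epsilon> = 0"
    and ext: "\<And>E e d. etriangle \<C> W E A e d 0 \<Longrightarrow> \<exists>r\<in>Hom \<C> E W. r \<cdot> e = Id \<C> W"
  shows "\<exists>\<epsilon>'\<in>Ext \<C> C W. \<epsilon> = pull \<C> y \<epsilon>'"
proof -
  note t = etriangleD[OF tri]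
  obtain E f g where tri': "etriangle \<C> W E B f g \<epsilon>" using ex_etriangle[OF e(1)] by blast
  obtain E' e d \<delta>'' where E': "e \<in> Hom \<C> W E'" "\<delta>'' \<in> Ext \<C> C E'"
    "etriangle \<C> W E' A e d (pull \<C> x \<epsilon>)" "pull \<C> y \<delta>'' = push \<C> e \<epsilon>"
    using ET4_op[OF tri tri'] by blast
  obtain r where r: "r \<in> Hom \<C> E' W" "r \<cdot> e = Id \<C> W" using ext E'(3) assms(3) by metis
  have "\<epsilon> = push \<C> (r \<cdot> e) \<epsilon>" using r push_Id[OF assms(2)] by simp
  also have "\<dots> = push \<C> r (pull \<C> y \<delta>'')" using push_Comp[OF E'(1) r(1) assms(2)] E'(4) by simp
  also have "\<dots> = pull \<C> y (push \<C> r \<delta>'')" using push_pull[OF r(1) t(2) E'(2)] .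
  finally show ?thesis using push_in_Ext[OF r(1) E'(2)] by blast
qed

lemma cokernel_factors:
  assumes "etriangle \<C> A B C x y \<delta>" "f \<in> Hom \<C> B W" "f \<cdot> x = 0"
  shows "\<exists>g\<in>Hom \<C> C W. f = g \<cdot> y"
  using extriangulated_category.kernel_factors[OF extriangulated_category_opp, of C B A y x \<delta> f W] assms by simp

lemma extend_iff:
  assumes "etriangle \<C> A B C x y \<delta>" "a \<in> Hom \<C> A W"
  shows "(\<exists>f\<in>Hom \<C> B W. f \<cdot> x = a) \<longleftrightarrow> push \<C> a \<delta> = 0"
  using extriangulated_category.lift_iff[OF extriangulated_category_opp, of C B A y x \<delta> a W] assms by simp

lemma Ext_pull_exact:
  assumes "etriangle \<C> A B C x y \<delta>" "\<epsilon> \<in> Ext \<C> B W" "pull \<C> x \<epsilon> = 0"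
  shows "\<exists>\<epsilon>'\<in>Ext \<C> C W. \<epsilon> = pull \<C> y \<epsilon>'"
  using assms
proof (rule exact_Ext_pull)
  fix E e d assume "etriangle \<C> W E A e d 0"
  then show "\<exists>r\<in>Hom \<C> E W. r \<cdot> e = Id \<C> W"
    using extend_iff[of W E A e d 0 "Id \<C> W" W] push_zero[OF Id_in_Hom] Id_in_Hom by blast
qed

lemma Ext_push_exact:
  assumes "etriangle \<C> A B C x y \<delta>" "\<epsilon> \<in> Ext \<C> W B" "push \<C> y \<epsilon> = 0"
  shows "\<exists>\<epsilon>'\<in>Ext \<C> W A. \<epsilon> = push \<C> x \<epsilon>'"
  using extriangulated_category.Ext_pull_exact[OF extriangulated_category_opp, of C B A y x \<delta> \<epsilon> W] assms by simp

text \<open>Exactness at \<open>\<bbbE>(W,A)\<close>: the vanishing of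
  \<open>push \<C> x \<epsilon>\<close> extends \<open>x\<close> over the middle term of
  \<open>\<epsilon>\<close>, and (ET3) then produces \<open>c\<close> on the third terms.\<close>

lemma push_kernel:
  assumes tri: "etriangle \<C> A B C x y \<delta>" and e: "\<epsilon> \<in> Ext \<C> W A" "push \<C> x \<epsilon> = 0"
  shows "\<exists>c\<in>Hom \<C> W C. \<epsilon> = pull \<C> c \<delta>"
proof -
  note t = etriangleD[OF tri]
  obtain E f g where tri': "etriangle \<C> A E W f g \<epsilon>" using ex_etriangle[OF e(1)] by blast
  obtain h where h: "h \<in> Hom \<C> E B" "h \<cdot> f = x" using extend_iff[OF tri' t(1)] e by blast
  then have "h \<cdot> f = x \<cdot> Id \<C> A" using Comp_Id_right[OF t(1)] by simp
  then obtain c where "c \<in> Hom \<C> W C" "push \<C> (Id \<C> A) \<epsilon> = pull \<C> c \<delta>"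
    using ET3[OF tri' tri Id_in_Hom h(1)] by blast
  then show ?thesis using push_Id[OF e(1)] by auto
qed

lemma pull_kernel:
  assumes "etriangle \<C> A B C x y \<delta>" "\<epsilon> \<in> Ext \<C> C W" "pull \<C> y \<epsilon> = 0"
  shows "\<exists>a\<in>Hom \<C> A W. \<epsilon> = push \<C> a \<delta>"
  using extriangulated_category.push_kernel[OF extriangulated_category_opp, of C B A y x \<delta> \<epsilon> W] assms by simp

text \<open>
  (ET4)\<open>\<^sup>o\<^sup>p\<close> applied to the split triangle \<open>C' \<rightarrow> C \<oplus> C' \<rightarrow> C\<close> with second map \<open>(1, -c)\<close> and to
  \<open>A \<rightarrow> B \<oplus> C' \<rightarrow> C \<oplus> C'\<close>.
\<close>

lemma homotopy_pullback:
  assumes tri: "etriangle \<C> A B C x y \<delta>" and c: "c \<in> Hom \<C> C' C" and bp: "biproduct \<C> B C' Z j j' q q'"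
  shows "\<exists>E e d h \<delta>''. etriangle \<C> A E C' e d (pull \<C> c \<delta>) \<and> etriangle \<C> E Z C h (y \<cdot> q - c \<cdot> q') \<delta>''"
proof -
  note t = etriangleD[OF tri] and b = bp[unfolded biproduct_def]
  obtain S l l' r r' where bs: "biproduct \<C> C C' S l l' r r'" using ex_biproduct by blast
  note s = bs[unfolded biproduct_def]
  obtain O' where O': "zero_object \<C> O'" using ex_zero_object by blast
  \<comment> \<open>\<open>A\<close> is read as the sum of \<open>A\<close> and a zero object, so
    that adding the trivial triangle \<open>0 \<rightarrow> C' \<rightarrow> C'\<close> leaves the
    first term unchanged.\<close>
  have "biproduct \<C> A O' A (Id \<C> A) 0 (Id \<C> A) 0"
    using O' by (simp add: biproduct_def Id_in_Hom Hom_zero Comp_Id_left[OF Id_in_Hom] zero_object_def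
      Comp_zero_left[OF Id_in_Hom] Comp_zero_left[OF Hom_zero] Comp_Id_left[OF Hom_zero])
  from realize_dsum[OF tri etriangle_zero_left[OF O', of C'] this bp bs]
  have R: "(Z, j \<cdot> x \<cdot> Id \<C> A + j' \<cdot> 0 \<cdot> 0, l \<cdot> y \<cdot> q + l' \<cdot> Id \<C> C' \<cdot> q')
     \<in> realize \<C> S A (push \<C> (Id \<C> A) (pull \<C> r \<delta>) + push \<C> 0 (pull \<C> r' 0))" .
  have jx: "j \<cdot> x \<in> Hom \<C> A Z" and ly: "l \<cdot> y \<in> Hom \<C> B S" and pr: "pull \<C> r \<delta> \<in> Ext \<C> S A"
    using b t s Comp_in_Hom pull_in_Ext by blast+
  have j0: "j' \<cdot> 0 = 0" using Comp_zero_right b by blast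
  have "push \<C> 0 (pull \<C> r' 0) = 0" using pull_zero[of r' S C'] push_zero[OF Hom_zero] s by simp
  then have R: "etriangle \<C> A Z S (j \<cdot> x) (l \<cdot> y \<cdot> q + l' \<cdot> q') (pull \<C> r \<delta>)"
    using R pr s Comp_Id_right[OF jx] Comp_Id_right[of l' C' S] push_Id[OF pr] j0 Comp_zero_left[OF Hom_zero]
    by (simp add: etriangle_def)
  have h: "l \<cdot> c \<in> Hom \<C> C' S" "c \<cdot> r' \<in> Hom \<C> S C" "l' + l \<cdot> c \<in> Hom \<C> C' S" "r - c \<cdot> r' \<in> Hom \<C> S C"
    "r \<in> Hom \<C> S C" "r' \<in> Hom \<C> S C'" "l \<in> Hom \<C> C S" "l' \<in> Hom \<C> C' S"
    using c s by (blast intro: hom_intros)+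
  have 1: "r' \<cdot> (l' + l \<cdot> c) = Id \<C> C'"
    using Comp_add_right[OF h(8) h(1) h(6)] cancel_zero[of r' l C S C' c C'] s c by simp
  have 2: "(r - c \<cdot> r') \<cdot> l = Id \<C> C"
    using Comp_diff_left[OF h(7) h(5) h(2)] Comp_assoc[OF h(7) h(6) c] s Comp_zero_right[OF c] by simp
  have 3: "(r - c \<cdot> r') \<cdot> (l' + l \<cdot> c) = 0"
    using Comp_diff_left[OF h(3) h(5) h(2)] Comp_assoc[OF h(3) h(6) c] 1 Comp_Id_right[OF c]
      Comp_add_right[OF h(8) h(1) h(5)] cancel_Id[of r l C S c C'] s c by simp
  have 4: "(l' + l \<cdot> c) \<cdot> r' + l \<cdot> (r - c \<cdot> r') = Id \<C> S"
    using Comp_add_left[OF h(6) h(8) h(1)] Comp_diff_right[OF h(5) h(2) h(7)] Comp_assoc[OF h(6) c h(7)]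
      s by (simp add: add.commute)
  have bp': "biproduct \<C> C' C S (l' + l \<cdot> c) l r' (r - c \<cdot> r')"
    unfolding biproduct_def using 1 2 3 4 h s by simp
  obtain E h' d e \<delta>'' where E: "etriangle \<C> E Z C h' ((r - c \<cdot> r') \<cdot> (l \<cdot> y \<cdot> q + l' \<cdot> q')) \<delta>''"
    "etriangle \<C> A E C' e d (pull \<C> (l' + l \<cdot> c) (pull \<C> r \<delta>))"
    using ET4_op[OF etriangle_zero[OF bp'] R] by blast
  have g: "l \<cdot> y \<cdot> q \<in> Hom \<C> Z S" "l' \<cdot> q' \<in> Hom \<C> Z S" "y \<cdot> q \<in> Hom \<C> Z C"
    using ly b h t by (blast intro: hom_intros)+
  have "l \<cdot> y \<cdot> q = l \<cdot> (y \<cdot> q)" using Comp_assoc[of q Z B y C l S] b t h by simp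
  moreover have "r \<cdot> (l \<cdot> (y \<cdot> q)) = y \<cdot> q" "r' \<cdot> (l \<cdot> (y \<cdot> q)) = 0" "r \<cdot> (l' \<cdot> q') = 0" "r' \<cdot> (l' \<cdot> q') = q'"
    using cancel_Id[of r l C S "y \<cdot> q" Z] cancel_zero[of r' l C S C' "y \<cdot> q" Z] cancel_zero[of r l' C' S C q' Z]
      cancel_Id[of r' l' C' S q' Z] s b g by auto
  ultimately have "r \<cdot> (l \<cdot> y \<cdot> q + l' \<cdot> q') = y \<cdot> q" "r' \<cdot> (l \<cdot> y \<cdot> q + l' \<cdot> q') = q'"
    using Comp_add_right[OF g(1,2) h(5)] Comp_add_right[OF g(1,2) h(6)] by auto
  then have "(r - c \<cdot> r') \<cdot> (l \<cdot> y \<cdot> q + l' \<cdot> q') = y \<cdot> q - c \<cdot> q'"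
    using Comp_diff_left[OF Hom_add[OF g(1,2)] h(5) h(2)] Comp_assoc[OF Hom_add[OF g(1,2)] h(6) c] by simp
  moreover have "pull \<C> (l' + l \<cdot> c) (pull \<C> r \<delta>) = pull \<C> c \<delta>"
  proof -
    have "r \<cdot> (l' + l \<cdot> c) = c"
      using Comp_add_right[OF h(8) h(1) h(5)] cancel_Id[of r l C S c C'] s c by simp
    then show ?thesis using pull_Comp[OF h(5) h(3) t(3)] by simp
  qed
  ultimately show ?thesis using E by auto
qed

lemma homotopy_pushout:
  assumes "etriangle \<C> A B C x y \<delta>" "a \<in> Hom \<C> A A'" "biproduct \<C> B A' Z j j' q q'"
  shows "\<exists>E e d h \<delta>''. etriangle \<C> A' E C d e (push \<C> a \<delta>) \<and> etriangle \<C> A Z E (j \<cdot> x - j' \<cdot> a) h \<delta>''"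
  using extriangulated_category.homotopy_pullback[OF extriangulated_category_opp, of C B A y x \<delta> a A' Z q q' j j'] assms
  by simp

lemma etriangle_unique:
  assumes "etriangle \<C> A B C x y \<delta>" "etriangle \<C> A B' C x' y' \<delta>"
  shows "isomorphic \<C> B B'"
proof -
  have d: "\<delta> \<in> Ext \<C> C A" using assms by (simp add: etriangle_def)
  obtain t where t: "t \<in> sequences \<C> A C"
    "realize \<C> C A \<delta> = {t' \<in> sequences \<C> A C. seq_equiv \<C> t t'}"
    using realize_class[OF d] by blast
  obtain D u v where "t = (D, u, v)" by (cases t)
  then have "isomorphic \<C> D B" "isomorphic \<C> D B'"
    using t assms by (auto simp: etriangle_def seq_equiv_def isomorphic_def)
  then show ?thesis using isomorphic_sym isomorphic_trans by blast
qed

lemma diff_swap: "a = n \<Longrightarrow> a = p - m \<Longrightarrow> m = p - (n::'m)"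
  by (simp add: algebra_simps)

text \<open>The comparison maps \<open>b\<close> and \<open>b'\<close> of the middle terms need not
  be mutually inverse. But \<open>n = Id - b' \<cdot> b\<close> satisfies
  \<open>n \<cdot> x' = 0\<close> and \<open>y' \<cdot> n = 0\<close>, so it factors through
  \<open>y'\<close> and has square zero; hence \<open>(Id + n) \<cdot> b'\<close> is a left inverse
  of \<open>b\<close>. A retraction is what \<open>triangle_KS\<close> asks for.\<close>

lemma etriangle_iso_right:
  assumes tri: "etriangle \<C> A B C x y \<delta>" and iso: "isomorphic \<C> C' C"
  shows "\<exists>B' x' y' \<delta>'. etriangle \<C> A B' C' x' y' \<delta>' \<and> retract \<C> B' B"
proof -
  obtain f g where fg: "f \<in> Hom \<C> C' C" "g \<in> Hom \<C> C C'" "g \<cdot> f = Id \<C> C'" "f \<cdot> g = Id \<C> C"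
    using iso by (auto simp: isomorphic_def iso_mor_def)
  note t = etriangleD[OF tri]
  have fd: "pull \<C> f \<delta> \<in> Ext \<C> C' A" using pull_in_Ext fg t by blast
  then obtain B' x' y' where tri': "etriangle \<C> A B' C' x' y' (pull \<C> f \<delta>)" using ex_etriangle by blast
  note t' = etriangleD[OF tri']
  obtain b where b: "b \<in> Hom \<C> B' B" "b \<cdot> x' = x \<cdot> Id \<C> A" "y \<cdot> b = f \<cdot> y'"
    using realize_morphism[OF tri' tri Id_in_Hom fg(1)] push_Id[OF fd] by blast
  have "push \<C> (Id \<C> A) \<delta> = pull \<C> g (pull \<C> f \<delta>)"
    using push_Id[OF t(3)] pull_Comp[OF fg(1,2) t(3)] fg(4) pull_Id[OF t(3)] by simp
  then obtain b' where b': "b' \<in> Hom \<C> B B'" "b' \<cdot> x = x' \<cdot> Id \<C> A" "y' \<cdot> b' = g \<cdot> y"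
    using realize_morphism[OF tri tri' Id_in_Hom fg(2)] by blast
  let ?m = "b' \<cdot> b" and ?n = "Id \<C> B' - b' \<cdot> b"
  have m: "?m \<in> Hom \<C> B' B'" using b b' Comp_in_Hom by blast
  have n: "?n \<in> Hom \<C> B' B'" using Hom_diff[OF Id_in_Hom m] .
  have "?m \<cdot> x' = x'"
    using Comp_assoc[OF t'(1) b(1) b'(1)] b b' Comp_Id_right[OF t(1)] Comp_Id_right[OF t'(1)] by simp
  then have "?n \<cdot> x' = 0" using Comp_diff_left[OF t'(1) Id_in_Hom m] Comp_Id_left[OF t'(1)] by simp
  then obtain r where r: "r \<in> Hom \<C> C' B'" "?n = r \<cdot> y'" using cokernel_factors[OF tri' n] by blast
  have "y' \<cdot> ?m = (g \<cdot> y) \<cdot> b" using Comp_assoc[OF b(1) b'(1) t'(2)] b' by simp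
  also have "\<dots> = y'" using Comp_assoc[OF b(1) t(2) fg(2)] b cancel_Id[OF fg(3,1,2) t'(2)] by simp
  finally have yn: "y' \<cdot> ?n = 0" using Comp_diff_right[OF Id_in_Hom m t'(2)] Comp_Id_right[OF t'(2)] by simp
  then have nn: "?n \<cdot> ?n = 0"
    using Comp_assoc[OF n t'(2) r(1)] r(2) Comp_zero_right[OF r(1)] by simp
  let ?p = "Id \<C> B' + ?n"
  have p: "?p \<in> Hom \<C> B' B'" using Hom_add[OF Id_in_Hom n] .
  have "?p \<cdot> ?n = ?n" using Comp_add_left[OF n Id_in_Hom n] Comp_Id_left[OF n] nn by simp
  moreover have "?p \<cdot> ?n = ?p - ?p \<cdot> ?m" using Comp_diff_right[OF Id_in_Hom m p] Comp_Id_right[OF p] by simp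
  ultimately have "?p \<cdot> ?m = ?p - ?n" by (rule diff_swap)
  then have "?p \<cdot> ?m = Id \<C> B'" by simp
  then have "(?p \<cdot> b') \<cdot> b = Id \<C> B'" using Comp_assoc[OF b(1) b'(1) p] by simp
  then have "retract \<C> B' B" unfolding retract_def using b Comp_in_Hom[OF b'(1) p] by blast
  then show ?thesis using tri' by blast
qed

lemma etriangle_dsum:
  assumes t1: "etriangle \<C> A B C x y \<delta>" and t2: "etriangle \<C> A' B' C' x' y' \<delta>'"
    and "is_dsum \<C> AA A A'" "is_dsum \<C> BB B B'" "is_dsum \<C> CC C C'"
  shows "\<exists>x y \<delta>. etriangle \<C> AA BB CC x y \<delta>"
proof -
  obtain i i' p p' where a: "biproduct \<C> A A' AA i i' p p'" using assms by (auto simp: is_dsum_def)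
  obtain j j' q q' where b: "biproduct \<C> B B' BB j j' q q'" using assms by (auto simp: is_dsum_def)
  obtain l l' r r' where c: "biproduct \<C> C C' CC l l' r r'" using assms by (auto simp: is_dsum_def)
  have "push \<C> i (pull \<C> r \<delta>) \<in> Ext \<C> CC AA" "push \<C> i' (pull \<C> r' \<delta>') \<in> Ext \<C> CC AA"
    using a c etriangleD[OF t1] etriangleD[OF t2] push_in_Ext pull_in_Ext unfolding biproduct_def by metis+
  then show ?thesis using realize_dsum[OF t1 t2 a b c] Ext_add unfolding etriangle_def by blast
qed

lemma pull_ideal:
  assumes "\<forall>Z\<in>G. Ext \<C> Z W = {0}"
  shows "ideal \<C> G A B f \<Longrightarrow> \<epsilon> \<in> Ext \<C> B W \<Longrightarrow> pull \<C> f \<epsilon> = 0"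
proof (induction rule: ideal.induct)
  case ideal_zero
  then show ?case using pull_zero_Hom by blast
next
  case (ideal_comp Z g h)
  then have "pull \<C> h \<epsilon> = 0" using assms pull_in_Ext by blast
  then show ?case using ideal_comp pull_Comp[of h Z B g A \<epsilon> W] pull_zero by simp
next
  case (ideal_add f f')
  then show ?case using pull_add_Hom[of f A B f' \<epsilon> W] ideal_Hom by simp
qed

lemma push_ideal:
  assumes "\<forall>Z\<in>G. Ext \<C> W Z = {0}"
  shows "ideal \<C> G A B f \<Longrightarrow> \<epsilon> \<in> Ext \<C> W A \<Longrightarrow> push \<C> f \<epsilon> = 0"
  using extriangulated_category.pull_ideal[OF extriangulated_category_opp, of G W B A f \<epsilon>] assms by simp

lemma Ext_gen_left: "\<forall>Z\<in>G. Ext \<C> Z W = {0} \<Longrightarrow> M \<in> gen \<C> G \<Longrightarrow> Ext \<C> M W = {0}"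
  using pull_ideal[of G W M M "Id \<C> M"] pull_Id[of _ M W] Ext_zero by (auto simp: gen_def)

lemma Ext_gen_right: "\<forall>Z\<in>G. Ext \<C> W Z = {0} \<Longrightarrow> M \<in> gen \<C> G \<Longrightarrow> Ext \<C> W M = {0}"
  using push_ideal[of G W M M "Id \<C> M"] push_Id[of _ W M] Ext_zero by (auto simp: gen_def)

lemma Ext_retract_left: "Ext \<C> Z W = {0} \<Longrightarrow> retract \<C> M Z \<Longrightarrow> Ext \<C> M W = {0}"
  using Ext_gen_left[of "{Z}" W M] gen_retract[of M Z "{Z}"] gen_base[of "{Z}"] by blast

lemma Ext_retract_right: "Ext \<C> W Z = {0} \<Longrightarrow> retract \<C> M Z \<Longrightarrow> Ext \<C> W M = {0}"
  using Ext_gen_right[of "{Z}" W M] gen_retract[of M Z "{Z}"] gen_base[of "{Z}"] by blast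

lemma is_dsum_gen: "is_dsum \<C> S A B \<Longrightarrow> S \<in> gen \<C> {A, B}"
  using gen_base[of "{A, B}"] subcategoryD(2)[OF gen_subcategory, of S A B "{A, B}"] by blast

lemma Ext_dsum_left:
  assumes "is_dsum \<C> S A B"
  shows "Ext \<C> S W = {0} \<longleftrightarrow> Ext \<C> A W = {0} \<and> Ext \<C> B W = {0}"
proof
  show "Ext \<C> A W = {0} \<and> Ext \<C> B W = {0}" if "Ext \<C> S W = {0}"
    using Ext_retract_left[OF that, of A] Ext_retract_left[OF that, of B] is_dsum_retract[OF assms] by simp
  show "Ext \<C> S W = {0}" if "Ext \<C> A W = {0} \<and> Ext \<C> B W = {0}"
    using Ext_gen_left[OF _ is_dsum_gen[OF assms], of W] that by simp
qed

lemma Ext_dsum_right: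
  assumes "is_dsum \<C> S A B"
  shows "Ext \<C> W S = {0} \<longleftrightarrow> Ext \<C> W A = {0} \<and> Ext \<C> W B = {0}"
proof
  show "Ext \<C> W A = {0} \<and> Ext \<C> W B = {0}" if "Ext \<C> W S = {0}"
    using Ext_retract_right[OF that, of A] Ext_retract_right[OF that, of B] is_dsum_retract[OF assms] by simp
  show "Ext \<C> W S = {0}" if "Ext \<C> W A = {0} \<and> Ext \<C> W B = {0}"
    using Ext_gen_right[OF _ is_dsum_gen[OF assms], of W] that by simp
qed

lemma split_right:
  assumes "etriangle \<C> A B C x y \<delta>" "Ext \<C> C A = {0}"
  shows "retract \<C> C B"
  using lift_iff[OF assms(1) Id_in_Hom] pull_Id etriangleD[OF assms(1)] assms(2) Id_in_Hom
  unfolding retract_def by auto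

lemma Ext_extension_right:
  assumes "etriangle \<C> A B C x y \<delta>" "Ext \<C> W A = {0}" "Ext \<C> W C = {0}"
  shows "Ext \<C> W B = {0}"
proof -
  note t = etriangleD[OF assms(1)]
  have "\<epsilon> = 0" if e: "\<epsilon> \<in> Ext \<C> W B" for \<epsilon>
  proof -
    have "push \<C> y \<epsilon> = 0" using push_in_Ext[OF t(2) e] assms by simp
    then obtain \<epsilon>' where "\<epsilon>' \<in> Ext \<C> W A" "\<epsilon> = push \<C> x \<epsilon>'" using Ext_push_exact[OF assms(1) e] by blast
    then show ?thesis using assms push_zero[OF t(1)] by simp
  qed
  then show ?thesis using Ext_zero by blast
qed

end

section \<open>Rigid subcategories and suspensions\<close>

text \<open>Vanishing is asked on the left; in a \<open>cy_category\<close> this is the same as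
  vanishing on the right, so \<open>perp\<close> is invariant under \<open>opp\<close>.\<close>

definition perp :: "('k, 'o, 'm, 'e::ab_group_add) extri_data \<Rightarrow> 'o set \<Rightarrow> 'o set" where
  "perp \<C> \<I> = {M. \<forall>Z\<in>\<I>. Ext \<C> M Z = {0}}"

text \<open>The shift in the quotient of \<open>perp \<C> \<I>\<close> by \<open>\<I>\<close>.
  Requiring \<open>N\<close> to lie in \<open>perp \<C> \<I>\<close> makes the map from
  \<open>M\<close> to \<open>Z\<close> a left \<open>\<I>\<close>-approximation.\<close>

definition susp :: "('k, 'o, 'm, 'e::ab_group_add) extri_data \<Rightarrow> 'o set \<Rightarrow> 'o set \<Rightarrow> 'o set" where
  "susp \<C> \<I> S = {N \<in> perp \<C> \<I>. \<exists>M\<in>S. \<exists>Z\<in>\<I>. \<exists>x y \<delta>. etriangle \<C> M Z N x y \<delta>}"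

definition fin_gen :: "('k, 'o, 'm::ab_group_add, 'e) extri_data \<Rightarrow> 'o set \<Rightarrow> bool" where
  "fin_gen \<C> S \<longleftrightarrow> (\<exists>G. finite G \<and> S = gen \<C> G)"

text \<open>Cluster tilting for finitely generated subcategories. Finite generation provides the
  approximations, and rigidity is the inclusion opposite to
  \<open>perp \<C> \<R> \<subseteq> \<R>\<close>.\<close>

definition fin_tilting :: "('k, 'o, 'm::ab_group_add, 'e::ab_group_add) extri_data \<Rightarrow> 'o set \<Rightarrow> bool" where
  "fin_tilting \<C> \<R> \<longleftrightarrow> fin_gen \<C> \<R> \<and> rigid \<C> \<R> \<and> perp \<C> \<R> \<subseteq> \<R>"

text \<open>The same notion relative to \<open>\<X>\<close>: maximality is tested on objects of
  \<open>\<X>\<close>.\<close>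

definition tilting_in ::
  "('k, 'o, 'm::ab_group_add, 'e::ab_group_add) extri_data \<Rightarrow> 'o set \<Rightarrow> 'o set \<Rightarrow> 'o set \<Rightarrow> bool" where
  "tilting_in \<C> \<I> \<X> S \<longleftrightarrow> fin_gen \<C> S \<and> \<I> \<subseteq> S \<and> S \<subseteq> \<X> \<and> rigid \<C> S \<and> perp \<C> S \<inter> \<X> \<subseteq> S"

text \<open>The form of the 2-Calabi-Yau condition after the field is forgotten: symmetric vanishing
  of extensions, and the fact that \<open>push \<C> y\<close> and \<open>pull \<C> y\<close> are
  transposes of each other, so that one is zero when the other is. Projective and injective objects
  appear through the vanishing of their extensions. Each assumption is self-dual or comes with its
  dual.\<close>

locale cy_category = extriangulated_category \<C> + krull_schmidt_category \<C>
  for \<C> :: "('k, 'o, 'm::ab_group_add, 'e::ab_group_add) extri_data" (structure) +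
  assumes Ext_sym: "Ext \<C> A B = {0} \<Longrightarrow> Ext \<C> B A = {0}"
    and pull_push_adj: "y \<in> Hom \<C> X T \<Longrightarrow> (\<And>\<epsilon>. \<epsilon> \<in> Ext \<C> T W \<Longrightarrow> pull \<C> y \<epsilon> = 0) \<Longrightarrow>
      \<omega> \<in> Ext \<C> W X \<Longrightarrow> push \<C> y \<omega> = 0"
    and push_pull_adj: "y \<in> Hom \<C> X T \<Longrightarrow> (\<And>\<epsilon>. \<epsilon> \<in> Ext \<C> W X \<Longrightarrow> push \<C> y \<epsilon> = 0) \<Longrightarrow>
      \<omega> \<in> Ext \<C> T W \<Longrightarrow> pull \<C> y \<omega> = 0"
    and ex_right_approx: "finite G \<Longrightarrow> \<exists>B f. right_approx \<C> (gen \<C> G) M B f"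
    and ex_left_approx: "finite G \<Longrightarrow> \<exists>B f. left_approx \<C> (gen \<C> G) M B f"
    and enough_proj: "\<exists>A P x y \<delta>. (\<forall>W. Ext \<C> P W = {0}) \<and> etriangle \<C> A P M x y \<delta>"
    and enough_inj: "\<exists>J C x y \<delta>. (\<forall>W. Ext \<C> W J = {0}) \<and> etriangle \<C> M J C x y \<delta>"
begin

lemma Ext_sym_iff: "Ext \<C> A B = {0} \<longleftrightarrow> Ext \<C> B A = {0}"
  using Ext_sym by blast

lemma cy_category_opp: "cy_category (opp \<C>)"
proof (intro cy_category.intro cy_category_axioms.intro)
  show "extriangulated_category (opp \<C>)" by (rule extriangulated_category_opp)
  show "krull_schmidt_category (opp \<C>)"
    by (intro krull_schmidt_category.intro krull_schmidt_category_axioms.intro)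
      (simp_all add: additive_category_opp krull_schmidt)
next
  fix M and G :: "'o set" assume "finite G"
  then show "\<exists>B f. right_approx (opp \<C>) (gen (opp \<C>) G) M B f" "\<exists>B f. left_approx (opp \<C>) (gen (opp \<C>) G) M B f"
    using ex_left_approx[of G M] ex_right_approx[of G M] by (simp_all add: left_approx_def right_approx_def)
next
  fix M show "\<exists>A P x y \<delta>. (\<forall>W. Ext (opp \<C>) P W = {0}) \<and> etriangle (opp \<C>) A P M x y \<delta>"
     "\<exists>J C x y \<delta>. (\<forall>W. Ext (opp \<C>) W J = {0}) \<and> etriangle (opp \<C>) M J C x y \<delta>"
    using enough_proj[of M] enough_inj[of M] by (simp_all, meson+)
next
  fix y X T W \<omega> assume "y \<in> Hom (opp \<C>) X T" "\<And>\<epsilon>. \<epsilon> \<in> Ext (opp \<C>) T W \<Longrightarrow> pull (opp \<C>) y \<epsilon> = 0" "\<omega> \<in> Ext (opp \<C>) W X"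
  then show "push (opp \<C>) y \<omega> = 0" using push_pull_adj[of y T X W \<omega>] by simp
next
  fix y X T W \<omega> assume "y \<in> Hom (opp \<C>) X T" "\<And>\<epsilon>. \<epsilon> \<in> Ext (opp \<C>) W X \<Longrightarrow> push (opp \<C>) y \<epsilon> = 0" "\<omega> \<in> Ext (opp \<C>) T W"
  then show "pull (opp \<C>) y \<omega> = 0" using pull_push_adj[of y T X W \<omega>] by simp
qed (use Ext_sym in auto)

lemma perp_opp: "perp (opp \<C>) S = perp \<C> S"
  by (auto simp: perp_def Ext_sym_iff)

lemma fin_gen_opp [simp]: "fin_gen (opp \<C>) S \<longleftrightarrow> fin_gen \<C> S"
  by (simp add: fin_gen_def)

lemma rigid_opp [simp]: "rigid (opp \<C>) S \<longleftrightarrow> rigid \<C> S"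
  by (auto simp: rigid_def Ext_vanish_def)

lemma fin_tilting_opp: "fin_tilting (opp \<C>) S \<longleftrightarrow> fin_tilting \<C> S"
  by (simp add: fin_tilting_def perp_opp)

lemma tilting_in_opp: "tilting_in (opp \<C>) \<I> \<X> S \<longleftrightarrow> tilting_in \<C> \<I> \<X> S"
  by (simp add: tilting_in_def perp_opp)

lemma fin_gen_subcategory: "fin_gen \<C> S \<Longrightarrow> subcategory \<C> S"
  using gen_subcategory by (auto simp: fin_gen_def)

lemma rigidD: "rigid \<C> S \<Longrightarrow> A \<in> S \<Longrightarrow> B \<in> S \<Longrightarrow> Ext \<C> A B = {0}"
  by (simp add: rigid_def Ext_vanish_def)

lemma perp_subcategory: "subcategory \<C> (perp \<C> S)"
proof (rule subcategoryI)
  fix Z assume Z: "zero_object \<C> Z"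
  have "Ext \<C> Z W = {0}" for W
    using pull_Id[of _ Z W] pull_zero_Hom[of _ Z W] Z Ext_zero[of Z W] by (auto simp: zero_object_def)
  then show "Z \<in> perp \<C> S" by (simp add: perp_def)
qed (simp_all add: perp_def Ext_dsum_left)

text \<open>Exactness of \<open>Hom(Z,D) \<rightarrow> Hom(M,D) \<rightarrow> \<bbbE>(N,D)
  \<rightarrow> \<bbbE>(Z,D)\<close>: a class dies on \<open>Z\<close>, hence comes from a morphism
  on \<open>M\<close>, and this morphism extends.\<close>

lemma Ext_cone:
  assumes tri: "etriangle \<C> M Z N x y \<delta>" and ext: "\<And>f. f \<in> Hom \<C> M D \<Longrightarrow> \<exists>g\<in>Hom \<C> Z D. g \<cdot> x = f"
    and Z: "Ext \<C> Z D = {0}"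
  shows "Ext \<C> N D = {0}"
proof -
  note t = etriangleD[OF tri]
  have "\<epsilon> = 0" if e: "\<epsilon> \<in> Ext \<C> N D" for \<epsilon>
  proof -
    have "pull \<C> y \<epsilon> = 0" using pull_in_Ext[OF t(2) e] Z by simp
    then obtain a where a: "a \<in> Hom \<C> M D" "\<epsilon> = push \<C> a \<delta>" using pull_kernel[OF tri e] by blast
    then show ?thesis using extend_iff[OF tri a(1)] ext by simp
  qed
  then show ?thesis using Ext_zero by blast
qed

lemma Ext_cone_extend:
  assumes "etriangle \<C> M Z N x y \<delta>" "Ext \<C> N D = {0}" "f \<in> Hom \<C> M D"
  shows "\<exists>g\<in>Hom \<C> Z D. g \<cdot> x = f"
  using assms extend_iff[OF assms(1,3)] push_in_Ext etriangleD(3)[OF assms(1)] by blast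

lemma Ext_cocone:
  assumes "etriangle \<C> A B C x y \<delta>" "\<And>f. f \<in> Hom \<C> D C \<Longrightarrow> \<exists>g\<in>Hom \<C> D B. y \<cdot> g = f" "Ext \<C> D B = {0}"
  shows "Ext \<C> D A = {0}"
  using cy_category.Ext_cone[OF cy_category_opp, of C B A y x \<delta> D] assms by simp

lemma Ext_cocone_lift:
  assumes "etriangle \<C> A B C x y \<delta>" "Ext \<C> D A = {0}" "f \<in> Hom \<C> D C"
  shows "\<exists>g\<in>Hom \<C> D B. y \<cdot> g = f"
  using assms lift_iff[OF assms(1,3)] pull_in_Ext etriangleD(3)[OF assms(1)] by blast

text \<open>A left approximation \<open>u\<close> need not be the first map of a triangle. Combined
  with such a map into an injective object \<open>J\<close> it becomes one, by a homotopy pushout.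
  \<open>J\<close> lies in \<open>S\<close> by \<open>proj\<close>, because objects without
  extensions on one side have none on the other.\<close>

lemma left_approx_triangle:
  assumes S: "fin_gen \<C> S" and proj: "\<And>P. \<forall>W. Ext \<C> P W = {0} \<Longrightarrow> P \<in> S"
  shows "\<exists>Z N x y \<delta>. etriangle \<C> M Z N x y \<delta> \<and> Z \<in> S \<and> (\<forall>D\<in>S. \<forall>f\<in>Hom \<C> M D. \<exists>g\<in>Hom \<C> Z D. g \<cdot> x = f)"
proof -
  obtain J C' x0 y0 \<delta>0 where J: "\<forall>W. Ext \<C> W J = {0}" and tri: "etriangle \<C> M J C' x0 y0 \<delta>0"
    using enough_inj by blast
  note t = etriangleD[OF tri]
  have JS: "J \<in> S" using J proj Ext_sym by blast
  obtain B u where "left_approx \<C> S M B u" using S ex_left_approx unfolding fin_gen_def by blast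
  then have u: "B \<in> S" "u \<in> Hom \<C> M B" "\<And>D f. D \<in> S \<Longrightarrow> f \<in> Hom \<C> M D \<Longrightarrow> \<exists>k\<in>Hom \<C> B D. k \<cdot> u = f"
    by (auto simp: left_approx_def)
  obtain Z j j' q q' where bp: "biproduct \<C> J B Z j j' q q'" using ex_biproduct by blast
  note b = bp[unfolded biproduct_def]
  obtain E h \<delta> where E: "etriangle \<C> M Z E (j \<cdot> x0 - j' \<cdot> u) h \<delta>"
    using homotopy_pushout[OF tri u(2) bp] by blast
  have "is_dsum \<C> Z J B" using bp by (auto simp: is_dsum_def)
  then have "Z \<in> S" using subcategoryD(2)[OF fin_gen_subcategory[OF S]] JS u(1) by blast
  moreover have "\<exists>g\<in>Hom \<C> Z D. g \<cdot> (j \<cdot> x0 - j' \<cdot> u) = f" if "D \<in> S" "f \<in> Hom \<C> M D" for D f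
  proof -
    obtain k where k: "k \<in> Hom \<C> B D" "k \<cdot> u = f" using u(3) \<open>D \<in> S\<close> \<open>f \<in> Hom \<C> M D\<close> by blast
    have h: "j \<cdot> x0 \<in> Hom \<C> M Z" "j' \<cdot> u \<in> Hom \<C> M Z" "k \<cdot> q' \<in> Hom \<C> Z D" "q' \<in> Hom \<C> Z B"
      using b t u k Comp_in_Hom by blast+
    have "q' \<cdot> (j \<cdot> x0 - j' \<cdot> u) = - u"
      using Comp_diff_right[OF h(1,2,4)] cancel_zero[of q' j J Z B x0 M] cancel_Id[of q' j' B Z u M] b t u by simp
    then have "(k \<cdot> q') \<cdot> (j \<cdot> x0 - j' \<cdot> u) = - f"
      using Comp_assoc[OF Hom_diff[OF h(1,2)] h(4) k(1)] Comp_minus_right[OF u(2) k(1)] k by simp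
    \<comment> \<open>The second component of the new map is \<open>- u\<close>, so the extension
      carries the opposite sign.\<close>
    then have "(- (k \<cdot> q')) \<cdot> (j \<cdot> x0 - j' \<cdot> u) = f"
      using Comp_minus_left[OF Hom_diff[OF h(1,2)] h(3)] by simp
    then show ?thesis using Hom_minus[OF h(3)] by blast
  qed
  ultimately show ?thesis using E by blast
qed

lemma right_approx_triangle:
  assumes "fin_gen \<C> S" "\<And>P. \<forall>W. Ext \<C> P W = {0} \<Longrightarrow> P \<in> S"
  shows "\<exists>N Z x y \<delta>. etriangle \<C> N Z M x y \<delta> \<and> Z \<in> S \<and> (\<forall>D\<in>S. \<forall>f\<in>Hom \<C> D M. \<exists>g\<in>Hom \<C> D Z. y \<cdot> g = f)"
proof -
  have "P \<in> S" if "\<forall>W. Ext (opp \<C>) P W = {0}" for P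
    using that assms(2) Ext_sym by simp
  from cy_category.left_approx_triangle[OF cy_category_opp, of S M, OF _ this] show ?thesis
    using assms(1) by simp blast
qed

text \<open>A form of Schanuel's lemma. The classes \<open>\<delta>\<close> and
  \<open>\<delta>'\<close> are pushed to each other by some \<open>a\<close> and \<open>b\<close>,
  so \<open>Id - b \<cdot> a\<close> kills \<open>\<delta>'\<close> and factors through
  \<open>x'\<close>. Thus the identity of \<open>M'\<close> is a sum of a morphism through
  \<open>M\<close> and one through \<open>I2\<close>.\<close>

lemma compare_cocones:
  assumes tri: "etriangle \<C> M I1 N x y \<delta>" and tri': "etriangle \<C> M' I2 N x' y' \<delta>'"
    and e: "Ext \<C> I1 M' = {0}" "Ext \<C> I2 M = {0}"
  shows "M' \<in> gen \<C> {M, I2}"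
proof -
  note t = etriangleD[OF tri] and t' = etriangleD[OF tri']
  have "pull \<C> y' \<delta> = 0" "pull \<C> y \<delta>' = 0" using e pull_in_Ext[OF t'(2) t(3)] pull_in_Ext[OF t(2) t'(3)] by auto
  then obtain a b where ab: "a \<in> Hom \<C> M' M" "\<delta> = push \<C> a \<delta>'" "b \<in> Hom \<C> M M'" "\<delta>' = push \<C> b \<delta>"
    using pull_kernel[OF tri t'(3)] pull_kernel[OF tri' t(3)] by blast
  have ba: "b \<cdot> a \<in> Hom \<C> M' M'" using ab Comp_in_Hom by blast
  have "push \<C> (b \<cdot> a) \<delta>' = \<delta>'" using push_Comp[OF ab(1,3) t'(3)] ab(2,4) by metis
  then have "push \<C> (Id \<C> M' - b \<cdot> a) \<delta>' = 0"
    using push_diff_Hom[OF Id_in_Hom ba t'(3)] push_Id[OF t'(3)] by simp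
  then obtain g where g: "g \<in> Hom \<C> I2 M'" "g \<cdot> x' = Id \<C> M' - b \<cdot> a"
    using extend_iff[OF tri' Hom_diff[OF Id_in_Hom ba]] by blast
  have "ideal \<C> {M, I2} M' M' (b \<cdot> a + g \<cdot> x')"
    using ab(1,3) g t' by (intro ideal_add ideal_comp) auto
  then show ?thesis using g by (simp add: gen_def)
qed

lemma compare_cones:
  assumes "etriangle \<C> M I1 N x y \<delta>" "etriangle \<C> M I2 N' x' y' \<delta>'"
    "Ext \<C> N' I1 = {0}" "Ext \<C> N I2 = {0}"
  shows "N' \<in> gen \<C> {N, I2}"
  using cy_category.compare_cocones[OF cy_category_opp, of N I1 M y x \<delta> N' I2 y' x' \<delta>'] assms by simp

text \<open>The existence of such triangles is additive in the third term and invariant under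
  isomorphism, so it is enough to know it for local generators.\<close>

lemma triangle_KS:
  assumes A: "subcategory \<C> \<A>" and B: "subcategory \<C> \<B>" and H: "\<forall>L\<in>H. loc L"
    and P: "\<And>L. L \<in> H \<Longrightarrow> \<exists>A\<in>\<A>. \<exists>B\<in>\<B>. \<exists>x y \<delta>. etriangle \<C> A B L x y \<delta>" and T: "T \<in> gen \<C> H"
  shows "\<exists>A\<in>\<A>. \<exists>B\<in>\<B>. \<exists>x y \<delta>. etriangle \<C> A B T x y \<delta>"
  using gen_subcategory T
proof (induction rule: KS_induct)
  case (loc N)
  then obtain L where L: "L \<in> H" "isomorphic \<C> N L" using gen_loc_isomorphic[OF H] by blast
  then obtain A B x y \<delta> where AB: "A \<in> \<A>" "B \<in> \<B>" "etriangle \<C> A B L x y \<delta>" using P by blast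
  then show ?case using etriangle_iso_right[OF AB(3) L(2)] retract_in[OF B AB(2)] by blast
next
  case (zero Z)
  then have "etriangle \<C> Z Z Z (Id \<C> Z) 0 0" using etriangle_zero_right by blast
  then show ?case using zero subcategoryD(1)[OF A] subcategoryD(1)[OF B] by blast
next
  case (dsum D D1 D2)
  then obtain A1 B1 x1 y1 d1 A2 B2 x2 y2 d2 where
    1: "A1 \<in> \<A>" "B1 \<in> \<B>" "etriangle \<C> A1 B1 D1 x1 y1 d1" and
    2: "A2 \<in> \<A>" "B2 \<in> \<B>" "etriangle \<C> A2 B2 D2 x2 y2 d2" by blast
  obtain AA BB where S: "is_dsum \<C> AA A1 A2" "is_dsum \<C> BB B1 B2" using ex_dsum by meson
  then have "AA \<in> \<A>" "BB \<in> \<B>" using 1 2 subcategoryD(2)[OF A] subcategoryD(2)[OF B] by blast+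
  then show ?case using etriangle_dsum[OF 1(3) 2(3) S dsum(1)] by blast
qed

lemma triangle_KS_left:
  assumes "subcategory \<C> \<A>" "subcategory \<C> \<B>" "\<forall>L\<in>H. loc L"
    and "\<And>L. L \<in> H \<Longrightarrow> \<exists>A\<in>\<A>. \<exists>B\<in>\<B>. \<exists>x y \<delta>. etriangle \<C> L B A x y \<delta>" and "T \<in> gen \<C> H"
  shows "\<exists>A\<in>\<A>. \<exists>B\<in>\<B>. \<exists>x y \<delta>. etriangle \<C> T B A x y \<delta>"
proof -
  have "\<exists>A\<in>\<A>. \<exists>B\<in>\<B>. \<exists>x y \<delta>. etriangle (opp \<C>) A B L x y \<delta>" if "L \<in> H" for L
    using assms(4)[OF that] by simp blast
  from cy_category.triangle_KS[OF cy_category_opp, of \<A> \<B> H T, OF _ _ _ this]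
  show ?thesis using assms by (simp add: additive_category_axioms) blast
qed

text \<open>A Wakamatsu-type argument. A class in \<open>\<bbbE>(W,N)\<close> comes from some
  \<open>\<epsilon>'\<close> in \<open>\<bbbE>(W,A)\<close>, which dies in
  \<open>\<bbbE>(W,B)\<close> and is therefore a pullback of \<open>\<delta>\<close> along some
  \<open>f\<close>. Since \<open>f\<close> factors through the approximation \<open>g\<close>, the
  class \<open>\<epsilon>'\<close> is a pullback of the class of \<open>N\<close>, which
  \<open>e\<close> kills.\<close>

lemma approx_pullback_Ext:
  assumes tri: "etriangle \<C> A B C x y \<delta>" and g: "g \<in> Hom \<C> B' C"
    and ap: "\<And>f. f \<in> Hom \<C> W C \<Longrightarrow> \<exists>h\<in>Hom \<C> W B'. g \<cdot> h = f"
    and e: "Ext \<C> W B = {0}" "Ext \<C> W B' = {0}" and N: "etriangle \<C> A N B' e d (pull \<C> g \<delta>)"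
  shows "Ext \<C> W N = {0}"
proof -
  note t = etriangleD[OF tri] and n = etriangleD[OF N]
  have e0: "push \<C> e (pull \<C> g \<delta>) = 0"
    using extend_iff[OF N n(1)] Id_in_Hom Comp_Id_left[OF n(1)] by blast
  have "\<epsilon> = 0" if eps: "\<epsilon> \<in> Ext \<C> W N" for \<epsilon>
  proof -
    have "push \<C> d \<epsilon> = 0" using push_in_Ext[OF n(2) eps] e by simp
    then obtain \<epsilon>' where e': "\<epsilon>' \<in> Ext \<C> W A" "\<epsilon> = push \<C> e \<epsilon>'" using Ext_push_exact[OF N eps] by blast
    then have "push \<C> x \<epsilon>' = 0" using push_in_Ext[OF t(1) e'(1)] e by simp
    then obtain f where f: "f \<in> Hom \<C> W C" "\<epsilon>' = pull \<C> f \<delta>" using push_kernel[OF tri e'(1)] by blast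
    obtain h where h: "h \<in> Hom \<C> W B'" "g \<cdot> h = f" using ap f by blast
    have "\<epsilon>' = pull \<C> h (pull \<C> g \<delta>)" using pull_Comp[OF g h(1) t(3)] f h by simp
    then have "\<epsilon> = pull \<C> h (push \<C> e (pull \<C> g \<delta>))" using push_pull[OF n(1) h(1) n(3)] e' by simp
    then show ?thesis using e0 pull_zero[OF h(1)] by simp
  qed
  then show ?thesis using Ext_zero by blast
qed

lemma factors_Id_in: "subcategory \<C> S \<Longrightarrow> factors \<C> S M M (Id \<C> M) \<Longrightarrow> M \<in> S"
  using retract_in[of S _ M] unfolding factors_def retract_def by metis

end

lemma etriangle_opp_eta: "etriangle (opp \<C>) A B C x y = etriangle \<C> C B A y x"
  by (simp add: fun_eq_iff)

locale cy_core = cy_category \<C>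
  for \<C> :: "('k, 'o, 'm::ab_group_add, 'e::ab_group_add) extri_data" (structure) +
  fixes \<I> :: "'o set"
  assumes fin_I: "fin_gen \<C> \<I>" and rigid_I: "rigid \<C> \<I>"
    and proj_I: "\<forall>W. Ext \<C> P W = {0} \<Longrightarrow> P \<in> \<I>"
begin

abbreviation "U \<equiv> perp \<C> \<I>"

lemma I_subcategory: "subcategory \<C> \<I>"
  using fin_gen_subcategory[OF fin_I] .

lemma cy_core_opp: "cy_core (opp \<C>) \<I>"
  by (intro cy_core.intro cy_core_axioms.intro cy_category_opp)
    (use fin_I rigid_I proj_I in \<open>auto simp: Ext_sym_iff[of _ W for W]\<close>)

lemma I_sub_U: "\<I> \<subseteq> U"
  using rigidD[OF rigid_I] by (auto simp: perp_def)

lemma U_right: "M \<in> U \<Longrightarrow> Z \<in> \<I> \<Longrightarrow> Ext \<C> M Z = {0}"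
  by (simp add: perp_def)

lemma U_left: "M \<in> U \<Longrightarrow> Z \<in> \<I> \<Longrightarrow> Ext \<C> Z M = {0}"
  by (simp add: perp_def Ext_sym_iff[of Z])

text \<open>The cone of a left \<open>\<I>\<close>-approximation has no extensions by
  \<open>\<I>\<close>, as \<open>\<I>\<close> is rigid.\<close>

lemma shift_up: "\<exists>N\<in>U. \<exists>Z\<in>\<I>. \<exists>x y \<delta>. etriangle \<C> M Z N x y \<delta>"
proof -
  obtain Z N x y \<delta> where Z: "etriangle \<C> M Z N x y \<delta>" "Z \<in> \<I>"
    "\<And>D f. D \<in> \<I> \<Longrightarrow> f \<in> Hom \<C> M D \<Longrightarrow> \<exists>g\<in>Hom \<C> Z D. g \<cdot> x = f"
    using left_approx_triangle[OF fin_I proj_I, of M] by blast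
  have "N \<in> U" using Ext_cone[OF Z(1) Z(3)] rigidD[OF rigid_I Z(2)] by (simp add: perp_def)
  then show ?thesis using Z by blast
qed

lemma shift_down: "\<exists>N\<in>U. \<exists>Z\<in>\<I>. \<exists>x y \<delta>. etriangle \<C> N Z M x y \<delta>"
  using cy_core.shift_up[OF cy_core_opp, of M] by (simp add: perp_opp) blast

text \<open>With \<open>N\<close> in \<open>U\<close> the map \<open>x\<close> has the extension
  property with respect to \<open>\<I>\<close>. Together with \<open>Ext_cone\<close> this turns
  vanishing modulo \<open>\<I>\<close> of morphisms on \<open>M\<close> into vanishing of extensions
  on its shift \<open>N\<close>.\<close>

lemma factors_extend:
  assumes "etriangle \<C> M Z N x y \<delta>" "N \<in> U" "factors \<C> \<I> M D f"
  shows "\<exists>g\<in>Hom \<C> Z D. g \<cdot> x = f"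
proof -
  note t = etriangleD[OF assms(1)]
  obtain Z' g h where g: "Z' \<in> \<I>" "g \<in> Hom \<C> M Z'" "h \<in> Hom \<C> Z' D" "f = h \<cdot> g"
    using assms(3) unfolding factors_def by blast
  obtain k where k: "k \<in> Hom \<C> Z Z'" "k \<cdot> x = g"
    using Ext_cone_extend[OF assms(1) U_right[OF assms(2) g(1)] g(2)] by blast
  have "(h \<cdot> k) \<cdot> x = f" using Comp_assoc[OF t(1) k(1) g(3)] k g by simp
  then show ?thesis using Comp_in_Hom[OF k(1) g(3)] by blast
qed

lemma susp_sub_U: "susp \<C> \<I> S \<subseteq> U"
  by (auto simp: susp_def)

lemma suspI: "N \<in> U \<Longrightarrow> M \<in> S \<Longrightarrow> Z \<in> \<I> \<Longrightarrow> etriangle \<C> M Z N x y \<delta> \<Longrightarrow> N \<in> susp \<C> \<I> S"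
  unfolding susp_def by blast

text \<open>Cocones of \<open>N\<close> with middle term in \<open>\<I>\<close> agree up to summands
  in \<open>\<I>\<close>, so membership in \<open>susp\<close> may be tested on any one of
  them.\<close>

lemma suspD:
  assumes S: "subcategory \<C> S" "\<I> \<subseteq> S" "S \<subseteq> U"
    and N: "N \<in> susp \<C> \<I> S" and K: "etriangle \<C> K Z N x y \<delta>" "K \<in> U" "Z \<in> \<I>"
  shows "K \<in> S"
proof -
  obtain M Z' x' y' \<delta>' where M: "M \<in> S" "Z' \<in> \<I>" "etriangle \<C> M Z' N x' y' \<delta>'"
    using N by (auto simp: susp_def)
  then have "K \<in> gen \<C> {M, Z}" using compare_cocones[OF M(3) K(1)] U_left[OF K(2)] U_left[of M] K S by blast
  moreover have "gen \<C> {M, Z} \<subseteq> S" using gen_subset[OF S(1), of "{M, Z}"] M(1) K(3) S(2) by blast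
  ultimately show ?thesis by blast
qed

lemma I_sub_susp: "subcategory \<C> S \<Longrightarrow> \<I> \<subseteq> susp \<C> \<I> S"
proof
  fix Z assume S: "subcategory \<C> S" and Z: "Z \<in> \<I>"
  obtain O' where O': "zero_object \<C> O'" using ex_zero_object by blast
  show "Z \<in> susp \<C> \<I> S"
    using suspI[OF _ _ Z etriangle_zero_left[OF O', of Z], of S] Z I_sub_U subcategoryD(1)[OF S O'] by blast
qed

text \<open>For closure under summands, cocones of \<open>A\<close> and of \<open>B\<close> are
  taken separately. Their sum is a cocone of \<open>D\<close>, hence in \<open>S\<close> by
  \<open>suspD\<close>, and \<open>S\<close> is closed under summands.\<close>

lemma susp_subcategory:
  assumes S: "subcategory \<C> S" "\<I> \<subseteq> S" "S \<subseteq> U"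
  shows "subcategory \<C> (susp \<C> \<I> S)"
proof (rule subcategoryI)
  fix Z assume "zero_object \<C> Z"
  then show "Z \<in> susp \<C> \<I> S" using I_sub_susp[OF S(1)] subcategoryD(1)[OF I_subcategory] by blast
next
  fix D A B assume D: "is_dsum \<C> D A B" and "A \<in> susp \<C> \<I> S" "B \<in> susp \<C> \<I> S"
  then obtain M1 Z1 x1 y1 d1 M2 Z2 x2 y2 d2 where
    1: "A \<in> U" "M1 \<in> S" "Z1 \<in> \<I>" "etriangle \<C> M1 Z1 A x1 y1 d1" and
    2: "B \<in> U" "M2 \<in> S" "Z2 \<in> \<I>" "etriangle \<C> M2 Z2 B x2 y2 d2" by (auto simp: susp_def)
  obtain M Z where MZ: "is_dsum \<C> M M1 M2" "is_dsum \<C> Z Z1 Z2" using ex_dsum by meson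
  have "M \<in> S" "Z \<in> \<I>" "D \<in> U"
    using subcategoryD(2)[OF S(1) MZ(1) 1(2) 2(2)] subcategoryD(2)[OF I_subcategory MZ(2) 1(3) 2(3)]
      subcategoryD(2)[OF perp_subcategory D 1(1) 2(1)] by auto
  then show "D \<in> susp \<C> \<I> S" using etriangle_dsum[OF 1(4) 2(4) MZ D] suspI by blast
next
  fix D A B assume D: "is_dsum \<C> D A B" and p: "D \<in> susp \<C> \<I> S"
  obtain M1 Z1 x1 y1 d1 where 1: "M1 \<in> U" "Z1 \<in> \<I>" "etriangle \<C> M1 Z1 A x1 y1 d1" using shift_down by blast
  obtain M2 Z2 x2 y2 d2 where 2: "M2 \<in> U" "Z2 \<in> \<I>" "etriangle \<C> M2 Z2 B x2 y2 d2" using shift_down by blast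
  obtain M Z where MZ: "is_dsum \<C> M M1 M2" "is_dsum \<C> Z Z1 Z2" using ex_dsum by meson
  obtain x y \<delta> where t: "etriangle \<C> M Z D x y \<delta>" using etriangle_dsum[OF 1(3) 2(3) MZ D] by blast
  have "Z \<in> \<I>" "M \<in> U"
    using subcategoryD(2)[OF I_subcategory MZ(2) 1(2) 2(2)] subcategoryD(2)[OF perp_subcategory MZ(1) 1(1) 2(1)] by auto
  then have "M \<in> S" using suspD[OF S p t] by blast
  then have "M1 \<in> S" "M2 \<in> S" using subcategoryD(3,4)[OF S(1) MZ(1)] by auto
  moreover have "D \<in> U" using p susp_sub_U by blast
  then have "A \<in> U" "B \<in> U" using subcategoryD(3,4)[OF perp_subcategory D] by auto
  ultimately show "A \<in> susp \<C> \<I> S \<and> B \<in> susp \<C> \<I> S"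
    using suspI[OF _ _ 1(2) 1(3)] suspI[OF _ _ 2(2) 2(3)] by blast
qed

lemma susp_mono: "S \<subseteq> S' \<Longrightarrow> susp \<C> \<I> S \<subseteq> susp \<C> \<I> S'"
  unfolding susp_def by blast

lemma fin_gen_subset:
  "fin_gen \<C> R \<Longrightarrow> subcategory \<C> S \<Longrightarrow> S \<subseteq> R \<Longrightarrow> fin_gen \<C> S"
  using gen_subcategory_finite unfolding fin_gen_def by metis

text \<open>In the quotient by \<open>\<I>\<close> the shift preserves extensions; here this is made
  explicit. For rigidity, a morphism from \<open>M\<close> to \<open>N'\<close> lifts to the term in
  \<open>\<I>\<close> of the triangle of \<open>N'\<close>, as \<open>M\<close> and
  \<open>M'\<close> have no extensions; so it factors through \<open>\<I>\<close> and extends over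
  \<open>Z\<close>.\<close>

lemma susp_fin_tilting:
  assumes R: "fin_tilting \<C> R" and IR: "\<I> \<subseteq> R"
  shows "fin_tilting \<C> (susp \<C> \<I> R)"
proof -
  have rig: "rigid \<C> R" and fin: "fin_gen \<C> R" and sub: "subcategory \<C> R"
    using R fin_gen_subcategory by (auto simp: fin_tilting_def)
  have RU: "R \<subseteq> U" using rigidD[OF rig] IR by (auto simp: perp_def)
  have "rigid \<C> (susp \<C> \<I> R)"
    unfolding rigid_def Ext_vanish_def
  proof (intro ballI)
    fix N N' assume N: "N \<in> susp \<C> \<I> R" and N': "N' \<in> susp \<C> \<I> R"
    obtain M Z x y \<delta> where M: "M \<in> R" "Z \<in> \<I>" "etriangle \<C> M Z N x y \<delta>" using N by (auto simp: susp_def)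
    obtain M' Z' x' y' \<delta>' where M': "M' \<in> R" "Z' \<in> \<I>" "etriangle \<C> M' Z' N' x' y' \<delta>'" using N' by (auto simp: susp_def)
    have U: "N \<in> U" "N' \<in> U" using N N' susp_sub_U by auto
    show "Ext \<C> N N' = {0}"
    proof (rule Ext_cone[OF M(3)])
      show "Ext \<C> Z N' = {0}" using U_left[OF U(2) M(2)] .
      fix f assume f: "f \<in> Hom \<C> M N'"
      have "Ext \<C> M M' = {0}" using rigidD[OF rig M(1) M'(1)] .
      then obtain g where "g \<in> Hom \<C> M Z'" "y' \<cdot> g = f" using Ext_cocone_lift[OF M'(3) _ f] by blast
      then have "factors \<C> \<I> M N' f" using M'(2) etriangleD(2)[OF M'(3)] unfolding factors_def by blast
      then show "\<exists>g\<in>Hom \<C> Z N'. g \<cdot> x = f" using factors_extend[OF M(3) U(1)] by blast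
    qed
  qed
  moreover have "perp \<C> (susp \<C> \<I> R) \<subseteq> susp \<C> \<I> R"
  proof
    fix M assume M: "M \<in> perp \<C> (susp \<C> \<I> R)"
    then have MU: "M \<in> U" using I_sub_susp[OF sub] by (auto simp: perp_def)
    obtain K Z x y \<delta> where K: "K \<in> U" "Z \<in> \<I>" "etriangle \<C> K Z M x y \<delta>" using shift_down by blast
    \<comment> \<open>A morphism from \<open>r\<close> to \<open>M\<close> extends over
      \<open>r \<rightarrow> Z'\<close>, because \<open>M\<close> has no extensions with the shift
      \<open>N\<close> of \<open>r\<close>. The extended morphism lifts to \<open>Z\<close> because
      \<open>K\<close> lies in \<open>U\<close>.\<close>
    have "Ext \<C> r K = {0}" if r: "r \<in> R" for r
    proof (rule Ext_cocone[OF K(3)])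
      have rU: "r \<in> U" using r RU by blast
      then show "Ext \<C> r Z = {0}" using U_right[OF rU K(2)] by blast
      obtain N Z' x' y' \<delta>' where N: "N \<in> U" "Z' \<in> \<I>" "etriangle \<C> r Z' N x' y' \<delta>'" using shift_up by blast
      have "Ext \<C> N M = {0}" using M suspI[OF N(1) r N(2,3)] Ext_sym unfolding perp_def by blast
      fix f assume f: "f \<in> Hom \<C> r M"
      obtain g where g: "g \<in> Hom \<C> Z' M" "g \<cdot> x' = f" using Ext_cone_extend[OF N(3) \<open>Ext \<C> N M = {0}\<close> f] by blast
      obtain h where h: "h \<in> Hom \<C> Z' Z" "y \<cdot> h = g" using Ext_cocone_lift[OF K(3) U_left[OF K(1) N(2)] g(1)] by blast
      have "y \<cdot> (h \<cdot> x') = f"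
        using Comp_assoc[OF etriangleD(1)[OF N(3)] h(1) etriangleD(2)[OF K(3)]] g h by simp
      then show "\<exists>g\<in>Hom \<C> r Z. y \<cdot> g = f" using Comp_in_Hom[OF etriangleD(1)[OF N(3)] h(1)] by blast
    qed
    then have "K \<in> perp \<C> R" using Ext_sym unfolding perp_def by blast
    then have "K \<in> R" using R unfolding fin_tilting_def by blast
    then show "M \<in> susp \<C> \<I> R" using suspI[OF MU _ K(2,3)] by blast
  qed
  moreover have "fin_gen \<C> (susp \<C> \<I> R)"
  proof -
    obtain G where "finite G" "R = gen \<C> G" using fin by (auto simp: fin_gen_def)
    then obtain H where H: "finite H" "\<forall>L\<in>H. loc L" "R = gen \<C> H" using gen_loc_finite by metis
    obtain GI where GI: "finite GI" "\<I> = gen \<C> GI" using fin_I by (auto simp: fin_gen_def)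
    obtain n where n: "\<And>M. n M \<in> U" "\<And>M. \<exists>Z\<in>\<I>. \<exists>x y \<delta>. etriangle \<C> M Z (n M) x y \<delta>"
      using shift_up by metis
    \<comment> \<open>One chosen cone for each of the finitely many local generators. The generators
      of \<open>\<I>\<close> are added because cones are determined only up to summands in
      \<open>\<I>\<close>.\<close>
    let ?V = "gen \<C> (n ` H \<union> GI)"
    have VU: "?V \<subseteq> U" using gen_subset[OF perp_subcategory, of "n ` H \<union> GI" \<I>] n(1) GI(2) gen_base[of GI] I_sub_U by blast
    have IV: "\<I> \<subseteq> ?V" using gen_gen[of GI "n ` H \<union> GI"] gen_base[of "n ` H \<union> GI"] GI(2) by blast
    have "susp \<C> \<I> R \<subseteq> ?V"
    proof
      fix N assume N: "N \<in> susp \<C> \<I> R"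
      then obtain M Z x y \<delta> where M: "M \<in> R" "Z \<in> \<I>" "etriangle \<C> M Z N x y \<delta>" by (auto simp: susp_def)
      have "\<exists>A\<in>?V. \<exists>B\<in>\<I>. \<exists>x y \<delta>. etriangle \<C> L B A x y \<delta>" if "L \<in> H" for L
        using n(2)[of L] gen_base[of "n ` H \<union> GI"] that by blast
      from triangle_KS_left[OF gen_subcategory I_subcategory H(2) this] M(1) H(3)
      obtain A B x' y' \<delta>' where A: "A \<in> ?V" "B \<in> \<I>" "etriangle \<C> M B A x' y' \<delta>'" by blast
      have "N \<in> U" "A \<in> U" using N susp_sub_U A(1) VU by auto
      then have "N \<in> gen \<C> {A, Z}"
        using compare_cones[OF A(3) M(3) U_right[OF _ A(2)] U_right[OF _ M(2)]] by blast
      moreover have "gen \<C> {A, Z} \<subseteq> ?V" using gen_gen[of "{A, Z}" "n ` H \<union> GI"] A(1) M(2) IV by blast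
      ultimately show "N \<in> ?V" by blast
    qed
    moreover have "fin_gen \<C> ?V" unfolding fin_gen_def using H(1) GI(1) by (intro exI[of _ "n ` H \<union> GI"]) simp
    ultimately show ?thesis using fin_gen_subset susp_subcategory[OF sub IR RU] by blast
  qed
  ultimately show ?thesis by (simp add: fin_tilting_def)
qed

end

section \<open>Cotorsion pairs and tilting subcategories\<close>

locale cy_cotorsion = cy_core \<C> \<I>
  for \<C> :: "('k, 'o, 'm::ab_group_add, 'e::ab_group_add) extri_data" (structure) and \<I> +
  fixes \<X> \<Y> :: "'o set"
  assumes cotorsion: "cotorsion_pair \<C> \<X> \<Y>" and core: "\<X> \<inter> \<Y> = \<I>"
begin

lemma cy_cotorsion_opp: "cy_cotorsion (opp \<C>) \<I> \<Y> \<X>"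
proof (intro cy_cotorsion.intro cy_cotorsion_axioms.intro cy_core_opp)
  show "cotorsion_pair (opp \<C>) \<Y> \<X>"
    using cotorsion unfolding cotorsion_pair_def Ext_vanish_def
    by (simp add: additive_category_axioms etriangle_opp_eta) meson
  show "\<Y> \<inter> \<X> = \<I>" using core by blast
qed

lemma XY: "subcategory \<C> \<X>" "subcategory \<C> \<Y>" "X \<in> \<X> \<Longrightarrow> Y \<in> \<Y> \<Longrightarrow> Ext \<C> X Y = {0}"
  "X \<in> \<X> \<Longrightarrow> Y \<in> \<Y> \<Longrightarrow> Ext \<C> Y X = {0}" "\<I> \<subseteq> \<X>" "\<I> \<subseteq> \<Y>" "\<X> \<subseteq> U" "\<Y> \<subseteq> U"
proof -
  show *: "subcategory \<C> \<X>" "subcategory \<C> \<Y>" "\<I> \<subseteq> \<X>" "\<I> \<subseteq> \<Y>" using cotorsion core by (auto simp: cotorsion_pair_def)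
  show **: "X \<in> \<X> \<Longrightarrow> Y \<in> \<Y> \<Longrightarrow> Ext \<C> X Y = {0}" for X Y using cotorsion by (simp add: cotorsion_pair_def Ext_vanish_def)
  then show ***: "X \<in> \<X> \<Longrightarrow> Y \<in> \<Y> \<Longrightarrow> Ext \<C> Y X = {0}" for X Y using Ext_sym by blast
  show "\<X> \<subseteq> U" using ** *(4) unfolding perp_def by blast
  show "\<Y> \<subseteq> U" using *** *(3) unfolding perp_def by blast
qed

lemma ex_X_triangle: "\<exists>Y\<in>\<Y>. \<exists>X\<in>\<X>. \<exists>f g \<delta>. etriangle \<C> Y X M f g \<delta>"
  using cotorsion by (simp add: cotorsion_pair_def)

lemma in_X: "(\<And>Y. Y \<in> \<Y> \<Longrightarrow> Ext \<C> M Y = {0}) \<Longrightarrow> M \<in> \<X>"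
  using ex_X_triangle[of M] split_right retract_in[OF XY(1)] by blast

lemma in_Y: "(\<And>X. X \<in> \<X> \<Longrightarrow> Ext \<C> X M = {0}) \<Longrightarrow> M \<in> \<Y>"
  using cy_cotorsion.in_X[OF cy_cotorsion_opp, of M] by simp

lemma Y_extension: "etriangle \<C> A B D x y \<delta> \<Longrightarrow> A \<in> \<Y> \<Longrightarrow> D \<in> \<Y> \<Longrightarrow> B \<in> \<Y>"
  using in_Y[of B] Ext_extension_right XY(3) by blast

text \<open>In a truncation \<open>Y' \<rightarrow> X' \<rightarrow> Y\<close> the middle term lies
  in \<open>\<X>\<close> and, as an extension of objects of \<open>\<Y>\<close>, also in
  \<open>\<Y>\<close>, so it lies in the core. Morphisms from \<open>\<X>\<close> lift to it because
  they have no obstruction in \<open>Y'\<close>.\<close>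

lemma factors_XY:
  assumes X: "X \<in> \<X>" and Y: "Y \<in> \<Y>" and f: "f \<in> Hom \<C> X Y"
  shows "factors \<C> \<I> X Y f"
proof -
  obtain Y' X' x y \<delta> where t: "Y' \<in> \<Y>" "X' \<in> \<X>" "etriangle \<C> Y' X' Y x y \<delta>" using ex_X_triangle by blast
  have "X' \<in> \<I>" using Y_extension[OF t(3,1) Y] t(2) core by blast
  moreover obtain g where "g \<in> Hom \<C> X X'" "y \<cdot> g = f" using Ext_cocone_lift[OF t(3) XY(3)[OF X t(1)] f] by blast
  ultimately show ?thesis using etriangleD(2)[OF t(3)] unfolding factors_def by blast
qed

text \<open>Morphisms from \<open>M\<close> to \<open>\<Y>\<close> factor through
  \<open>\<I>\<close>, so they extend over \<open>Z\<close> and leave no extensions of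
  \<open>N\<close> by \<open>\<Y>\<close>.\<close>

lemma susp_X: "susp \<C> \<I> \<X> \<subseteq> \<X>"
proof
  fix N assume N: "N \<in> susp \<C> \<I> \<X>"
  then obtain M Z x y \<delta> where M: "M \<in> \<X>" "Z \<in> \<I>" "etriangle \<C> M Z N x y \<delta>" "N \<in> U" by (auto simp: susp_def)
  show "N \<in> \<X>"
  proof (rule in_X)
    fix Y assume Y: "Y \<in> \<Y>"
    show "Ext \<C> N Y = {0}"
    proof (rule Ext_cone[OF M(3)])
      show "Ext \<C> Z Y = {0}" using XY(3,5) M(2) Y by blast
    qed (use factors_extend[OF M(3,4)] factors_XY[OF M(1) Y] in blast)
  qed
qed

text \<open>First \<open>pull \<C> y\<close> is zero on \<open>\<bbbE>(T,X')\<close>: a class there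
  comes from \<open>\<bbbE>(T,Y')\<close>, since \<open>T\<close> and \<open>T'\<close> have no
  extensions, and its pullback to \<open>X\<close> lies in \<open>\<bbbE>(X,Y') = 0\<close>. By
  transposition \<open>push \<C> y\<close> is zero on \<open>\<bbbE>(X',X)\<close>, so each class
  there comes from \<open>\<bbbE>(X',Y)\<close>, which is zero.\<close>

lemma rigid_truncation:
  assumes t: "etriangle \<C> Y X T x y \<delta>" "Y \<in> \<Y>" "X \<in> \<X>"
    and t': "etriangle \<C> Y' X' T' x' y' \<delta>'" "Y' \<in> \<Y>" "X' \<in> \<X>" and T: "Ext \<C> T T' = {0}"
  shows "Ext \<C> X' X = {0}"
proof -
  note h = etriangleD[OF t(1)] and h' = etriangleD[OF t'(1)]
  have z: "pull \<C> y e = 0" if e: "e \<in> Ext \<C> T X'" for e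
  proof -
    have "push \<C> y' e = 0" using push_in_Ext[OF h'(2) e] T by simp
    then obtain e' where e': "e' \<in> Ext \<C> T Y'" "e = push \<C> x' e'" using Ext_push_exact[OF t'(1) e] by blast
    have "pull \<C> y e' = 0" using pull_in_Ext[OF h(2) e'(1)] XY(3)[OF t(3) t'(2)] by simp
    then show ?thesis using push_pull[OF h'(1) h(2) e'(1)] e' push_zero[OF h'(1)] by simp
  qed
  have "w = 0" if w: "w \<in> Ext \<C> X' X" for w
  proof -
    have "push \<C> y w = 0" using pull_push_adj[OF h(2) z w] .
    then obtain w' where w': "w' \<in> Ext \<C> X' Y" "w = push \<C> x w'" using Ext_push_exact[OF t(1) w] by blast
    then show ?thesis using XY(3)[OF t'(3) t(2)] push_zero[OF h(1)] by simp
  qed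
  then show ?thesis using Ext_zero by blast
qed

text \<open>
  Resolve \<open>M\<close> by the tilting subcategory and replace both terms by their truncations, which is two
  homotopy pushouts; the resulting triangle \<open>Y\<^sub>0 \<rightarrow> Y\<^sub>1 \<oplus> X\<^sub>0 \<rightarrow> X\<^sub>1 \<oplus> M\<close> splits.
\<close>

lemma truncation_tilting:
  assumes T: "fin_tilting \<C> \<T>" and S: "subcategory \<C> S" "\<I> \<subseteq> S" "S \<subseteq> \<X>"
    and tr: "\<And>T. T \<in> \<T> \<Longrightarrow> \<exists>Y\<in>\<Y>. \<exists>X\<in>S. \<exists>x y \<delta>. etriangle \<C> Y X T x y \<delta>"
    and M: "M \<in> \<X>" "M \<in> perp \<C> S"
  shows "M \<in> S"
proof -
  have Tf: "fin_gen \<C> \<T>" "rigid \<C> \<T>" "perp \<C> \<T> \<subseteq> \<T>" using T by (auto simp: fin_tilting_def)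
  have proj: "P \<in> \<T>" if "\<forall>W. Ext \<C> P W = {0}" for P using that Tf(3) by (auto simp: perp_def)
  obtain T0 T1 u v \<theta> where t: "etriangle \<C> M T0 T1 u v \<theta>" "T0 \<in> \<T>"
    "\<And>D f. D \<in> \<T> \<Longrightarrow> f \<in> Hom \<C> M D \<Longrightarrow> \<exists>g\<in>Hom \<C> T0 D. g \<cdot> u = f"
    using left_approx_triangle[OF Tf(1) proj, of M] by blast
  have "T1 \<in> perp \<C> \<T>" using Ext_cone[OF t(1) t(3)] rigidD[OF Tf(2) t(2)] by (simp add: perp_def)
  then have T1: "T1 \<in> \<T>" using Tf(3) by blast
  obtain Y1 X1 a1 b1 n1 where t1: "Y1 \<in> \<Y>" "X1 \<in> S" "etriangle \<C> Y1 X1 T1 a1 b1 n1" using tr[OF T1] by blast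
  \<comment> \<open>As \<open>M\<close> has no extensions with \<open>S\<close>, the class
    \<open>\<theta>\<close> vanishes on the truncation \<open>X1\<close> of \<open>T1\<close>. So it
    is the image, under some \<open>m : Y1 \<rightarrow> M\<close>, of the class of that
    truncation.\<close>
  have "Ext \<C> X1 M = {0}" using M(2) t1(2) Ext_sym unfolding perp_def by blast
  then have "pull \<C> b1 \<theta> = 0" using pull_in_Ext[OF etriangleD(2)[OF t1(3)] etriangleD(3)[OF t(1)]] by simp
  then obtain m where m: "m \<in> Hom \<C> Y1 M" "\<theta> = push \<C> m n1"
    using pull_kernel[OF t1(3) etriangleD(3)[OF t(1)]] by blast
  obtain W i j p q where bp: "biproduct \<C> X1 M W i j p q" using ex_biproduct by blast
  obtain E d e h \<kappa> where E: "etriangle \<C> M E T1 d e \<theta>" "etriangle \<C> Y1 W E (i \<cdot> a1 - j \<cdot> m) h \<kappa>"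
    using homotopy_pushout[OF t1(3) m(1) bp] m(2) by blast
  \<comment> \<open>\<open>E\<close> and \<open>T0\<close> are both middle terms of
    \<open>\<theta>\<close>.\<close>
  have "E \<in> \<T>" using etriangle_unique[OF t(1) E(1)] t(2) subcategoryD(5)[OF fin_gen_subcategory[OF Tf(1)]] by blast
  then obtain Y0 X0 a0 b0 n0 where t0: "Y0 \<in> \<Y>" "X0 \<in> S" "etriangle \<C> Y0 X0 E a0 b0 n0" using tr by blast
  have "pull \<C> b0 \<kappa> = 0"
    using pull_in_Ext[OF etriangleD(2)[OF t0(3)] etriangleD(3)[OF E(2)]] XY(3)[of X0 Y1] t0(2) t1(1) S(3) by auto
  then obtain n where n: "n \<in> Hom \<C> Y0 Y1" "\<kappa> = push \<C> n n0"
    using pull_kernel[OF t0(3) etriangleD(3)[OF E(2)]] by blast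
  obtain W' i' j' p' q' where bp': "biproduct \<C> X0 Y1 W' i' j' p' q'" using ex_biproduct by blast
  obtain E' d' e' h' \<kappa>' where E': "etriangle \<C> Y1 E' E d' e' \<kappa>" "etriangle \<C> Y0 W' E' (i' \<cdot> a0 - j' \<cdot> n) h' \<kappa>'"
    using homotopy_pushout[OF t0(3) n(1) bp'] n(2) by blast
  have W: "is_dsum \<C> W X1 M" and W': "is_dsum \<C> W' X0 Y1" using bp bp' by (auto simp: is_dsum_def)
  have "W \<in> \<X>" using subcategoryD(2)[OF XY(1) W] t1(2) S(3) M(1) by blast
  moreover have iso: "isomorphic \<C> W E'" using etriangle_unique[OF E(2) E'(1)] .
  ultimately have "E' \<in> \<X>" using subcategoryD(5)[OF XY(1)] by blast
  then have "retract \<C> E' W'" using split_right[OF E'(2) XY(3)] t0(1) by blast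
  then have "retract \<C> M W'"
    using is_dsum_retract[OF W] isomorphic_retract[OF iso] retract_trans by blast
  then have "M \<in> gen \<C> {X0, Y1}" using gen_retract is_dsum_gen[OF W'] by blast
  then have "ideal \<C> {X0, Y1} M M (Id \<C> M)" by (simp add: gen_def)
  \<comment> \<open>Morphisms from \<open>M\<close> to \<open>Y1\<close> factor through
    \<open>\<I>\<close>, so the term through \<open>Y1\<close> can be rerouted through an object of
    \<open>S\<close>.\<close>
  then have "ideal \<C> S M M (Id \<C> M)"
  proof (induction rule: ideal.induct)
    case (ideal_comp Z g h)
    show ?case
    proof (cases "Z = X0")
      case True
      then show ?thesis using ideal_comp t0(2) by (auto intro: ideal.ideal_comp)
    next
      case False
      then have "factors \<C> \<I> M Z g" using factors_XY[OF M(1) t1(1)] ideal_comp by simp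
      then have "factors \<C> \<I> M M (h \<cdot> g)" using factors_left ideal_comp by blast
      then show ?thesis using S(2) factors_ideal unfolding factors_def by (blast intro: ideal.ideal_comp)
    qed
  qed (auto intro: ideal.intros)
  then show ?thesis using gen_subset[OF S(1) subset_refl] by (auto simp: gen_def)
qed

text \<open>It suffices to truncate the finitely many local generators of \<open>\<T>\<close>, as
  \<open>triangle_KS\<close> extends the truncations to all of \<open>\<T>\<close>. The generators
  of \<open>\<I>\<close> are added to have \<open>\<I>\<close> inside the result.\<close>

lemma ex_tilting_in_X:
  assumes T: "fin_tilting \<C> \<T>"
  shows "\<exists>S. tilting_in \<C> \<I> \<X> S"
proof -
  have Tf: "fin_gen \<C> \<T>" "rigid \<C> \<T>" using T by (auto simp: fin_tilting_def)
  obtain G where "finite G" "\<T> = gen \<C> G" using Tf by (auto simp: fin_gen_def)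
  then obtain H where H: "finite H" "\<forall>L\<in>H. loc L" "\<T> = gen \<C> H" using gen_loc_finite by metis
  obtain GI where GI: "finite GI" "\<I> = gen \<C> GI" using fin_I by (auto simp: fin_gen_def)
  obtain r where r: "\<And>M. r M \<in> \<X>" "\<And>M. \<exists>Y\<in>\<Y>. \<exists>x y \<delta>. etriangle \<C> Y (r M) M x y \<delta>"
    using ex_X_triangle by metis
  let ?S = "gen \<C> (r ` H \<union> GI)"
  have fin: "fin_gen \<C> ?S" unfolding fin_gen_def using H(1) GI(1) by (intro exI[of _ "r ` H \<union> GI"]) simp
  have SX: "?S \<subseteq> \<X>" using gen_subset[OF XY(1), of "r ` H \<union> GI"] r(1) GI(2) gen_base[of GI] XY(5) by blast
  have IS: "\<I> \<subseteq> ?S" using gen_gen[of GI "r ` H \<union> GI"] gen_base[of "r ` H \<union> GI"] GI(2) by blast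
  have tr: "\<exists>Y\<in>\<Y>. \<exists>X\<in>?S. \<exists>x y \<delta>. etriangle \<C> Y X T x y \<delta>" if T: "T \<in> \<T>" for T
  proof -
    have "\<exists>Y\<in>\<Y>. \<exists>X\<in>?S. \<exists>x y \<delta>. etriangle \<C> Y X L x y \<delta>" if "L \<in> H" for L
      using r(2)[of L] gen_base[of "r ` H \<union> GI"] that by blast
    from triangle_KS[OF XY(2) gen_subcategory H(2) this] T H(3) show ?thesis by blast
  qed
  have "Ext \<C> A B = {0}" if "A \<in> r ` H \<union> GI" "B \<in> r ` H \<union> GI" for A B
  proof -
    have G: "GI \<subseteq> \<I>" using GI(2) gen_base[of GI] by blast
    have "Ext \<C> (r L) (r L') = {0}" if L: "L \<in> H" "L' \<in> H" for L L'
    proof -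
      obtain Y x y \<delta> where t: "Y \<in> \<Y>" "etriangle \<C> Y (r L) L x y \<delta>" using r(2)[of L] by blast
      obtain Y' x' y' \<delta>' where t': "Y' \<in> \<Y>" "etriangle \<C> Y' (r L') L' x' y' \<delta>'" using r(2)[of L'] by blast
      have "L \<in> \<T>" "L' \<in> \<T>" using gen_base[of H] H(3) L by auto
      then show ?thesis
        using rigid_truncation[OF t'(2,1) r(1) t(2,1) r(1)] rigidD[OF Tf(2)] by blast
    qed
    moreover have "Ext \<C> (r L) Z = {0}" "Ext \<C> Z (r L) = {0}" if "Z \<in> GI" for L Z
      using XY(3)[OF r(1), of Z L] XY(4)[OF r(1), of Z L] G XY(6) that by auto
    moreover have "Ext \<C> Z Z' = {0}" if "Z \<in> GI" "Z' \<in> GI" for Z Z'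
      using rigidD[OF rigid_I] G that by blast
    ultimately show ?thesis using that by auto
  qed
  then have "rigid \<C> ?S"
    unfolding rigid_def Ext_vanish_def using Ext_gen_left[of "r ` H \<union> GI"] Ext_gen_right[of "r ` H \<union> GI"] by metis
  moreover have "perp \<C> ?S \<inter> \<X> \<subseteq> ?S"
    using truncation_tilting[OF T gen_subcategory IS SX tr] by blast
  ultimately show ?thesis using fin SX IS unfolding tilting_in_def by blast
qed

lemma ex_tilting_in_Y: "fin_tilting \<C> \<T> \<Longrightarrow> \<exists>S. tilting_in \<C> \<I> \<Y> S"
  using cy_cotorsion.ex_tilting_in_X[OF cy_cotorsion_opp, of \<T>] by (simp add: fin_tilting_opp tilting_in_opp)

end

text \<open>In the quotient by \<open>\<I>\<close>: no morphisms from \<open>\<B>\<close> to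
  \<open>M\<close>, and none from \<open>M\<close> to the shift of \<open>\<B>\<close>. The same
  formula recovers \<open>\<X>\<close> from \<open>\<T> \<inter> \<Y>\<close> and constructs it from
  one half of a partition of \<open>\<T>\<close>.\<close>

definition side :: "('k, 'o, 'm, 'e::ab_group_add) extri_data \<Rightarrow> 'o set \<Rightarrow> 'o set \<Rightarrow> 'o set" where
  "side \<C> \<I> \<B> = {M. \<forall>B\<in>\<B>. Ext \<C> M B = {0} \<and> (\<forall>f\<in>Hom \<C> B M. factors \<C> \<I> B M f)}"

lemma (in cy_core) side_subcategory: "subcategory \<C> (side \<C> \<I> \<B>)"
proof (rule subcategoryI)
  fix Z assume Z: "zero_object \<C> Z"
  then have ZI: "Z \<in> \<I>" using subcategoryD(1)[OF I_subcategory] by blast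
  show "Z \<in> side \<C> \<I> \<B>"
    unfolding side_def
  proof (intro CollectI ballI conjI)
    fix B assume "B \<in> \<B>"
    show "Ext \<C> Z B = {0}" using subcategoryD(1)[OF perp_subcategory[of "{B}"] Z] by (simp add: perp_def)
    fix f assume "f \<in> Hom \<C> B Z"
    then show "factors \<C> \<I> B Z f"
      unfolding factors_def using ZI Id_in_Hom[of Z] Comp_Id_left[of f B Z] by metis
  qed
next
  fix D A B assume D: "is_dsum \<C> D A B" and A: "A \<in> side \<C> \<I> \<B>" and B: "B \<in> side \<C> \<I> \<B>"
  obtain i j p q where "biproduct \<C> A B D i j p q" using D by (auto simp: is_dsum_def)
  note b = this[unfolded biproduct_def]
  show "D \<in> side \<C> \<I> \<B>"
    unfolding side_def
  proof (intro CollectI ballI conjI)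
    fix W assume W: "W \<in> \<B>"
    show "Ext \<C> D W = {0}" using A B W Ext_dsum_left[OF D, of W] by (simp add: side_def)
    fix f assume f: "f \<in> Hom \<C> W D"
    have h: "p \<cdot> f \<in> Hom \<C> W A" "q \<cdot> f \<in> Hom \<C> W B" "i \<cdot> p \<in> Hom \<C> D D" "j \<cdot> q \<in> Hom \<C> D D" using b f Comp_in_Hom by blast+
    have "factors \<C> \<I> W A (p \<cdot> f)" "factors \<C> \<I> W B (q \<cdot> f)" using A B W h by (auto simp: side_def)
    then have "factors \<C> \<I> W D (i \<cdot> (p \<cdot> f))" "factors \<C> \<I> W D (j \<cdot> (q \<cdot> f))" using factors_left b by blast+
    then have "factors \<C> \<I> W D (i \<cdot> (p \<cdot> f) + j \<cdot> (q \<cdot> f))" using factors_add[OF I_subcategory] by blast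
    moreover have "i \<cdot> (p \<cdot> f) + j \<cdot> (q \<cdot> f) = f"
      using Comp_add_left[OF f h(3,4)] Comp_assoc[of f W D p A i D] Comp_assoc[of f W D q B j D] b f Comp_Id_left[OF f] by simp
    ultimately show "factors \<C> \<I> W D f" by simp
  qed
next
  fix D A B assume D: "is_dsum \<C> D A B" and S: "D \<in> side \<C> \<I> \<B>"
  have "A \<in> side \<C> \<I> \<B>" if A: "is_dsum \<C> D A B" for A B
  proof -
    obtain i j p q where "biproduct \<C> A B D i j p q" using A by (auto simp: is_dsum_def)
    note b = this[unfolded biproduct_def]
    show ?thesis
      unfolding side_def
    proof (intro CollectI ballI conjI)
      fix W assume W: "W \<in> \<B>"
      show "Ext \<C> A W = {0}" using S W Ext_dsum_left[OF A, of W] by (simp add: side_def)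
      fix f assume f: "f \<in> Hom \<C> W A"
      then have "i \<cdot> f \<in> Hom \<C> W D" using b Comp_in_Hom by blast
      then have "factors \<C> \<I> W D (i \<cdot> f)" using S W by (simp add: side_def)
      then have "factors \<C> \<I> W A (p \<cdot> (i \<cdot> f))" using factors_left b by blast
      then show "factors \<C> \<I> W A f" using cancel_Id[of p i A D f W] f b by simp
    qed
  qed
  then show "A \<in> side \<C> \<I> \<B> \<and> B \<in> side \<C> \<I> \<B>" using D is_dsum_sym by blast
qed

section \<open>Tilting parts of a cotorsion pair and their shifts\<close>

context cy_cotorsion
begin

text \<open>Let \<open>M\<close> be perpendicular to both parts. The term \<open>X\<close> of its
  truncation has no extensions with \<open>S\<close>, so it lies in \<open>S\<close>. Pulling the
  truncation back along a right \<open>S'\<close>-approximation \<open>g : B \<rightarrow> M\<close>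
  gives an \<open>N\<close> in \<open>\<Y>\<close> without extensions with \<open>S'\<close>, hence
  in \<open>S'\<close>, hence without extensions with \<open>M\<close>. This yields \<open>u\<close>
  such that \<open>g \<cdot> u\<close> fixes \<open>\<delta>\<close>, and
  \<open>Id - g \<cdot> u\<close> lifts to \<open>X\<close>; so the identity of \<open>M\<close>
  passes through \<open>B\<close> and \<open>X\<close>.\<close>

lemma fin_tilting_union:
  assumes S: "tilting_in \<C> \<I> \<X> S" and S': "tilting_in \<C> \<I> \<Y> S'"
  shows "fin_tilting \<C> (gen \<C> (S \<union> S'))" (is "fin_tilting \<C> ?R")
proof -
  have s: "fin_gen \<C> S" "\<I> \<subseteq> S" "S \<subseteq> \<X>" "rigid \<C> S" "perp \<C> S \<inter> \<X> \<subseteq> S"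
    and s': "fin_gen \<C> S'" "\<I> \<subseteq> S'" "S' \<subseteq> \<Y>" "rigid \<C> S'" "perp \<C> S' \<inter> \<Y> \<subseteq> S'"
    using S S' by (auto simp: tilting_in_def)
  obtain G G' where G: "finite G" "S = gen \<C> G" "finite G'" "S' = gen \<C> G'"
    using s(1) s'(1) by (auto simp: fin_gen_def)
  have "G \<subseteq> gen \<C> (G \<union> G')" "G' \<subseteq> gen \<C> (G \<union> G')" using gen_base[of "G \<union> G'"] by auto
  then have "S \<union> S' \<subseteq> gen \<C> (G \<union> G')" using gen_gen[of G "G \<union> G'"] gen_gen[of G' "G \<union> G'"] G by blast
  moreover have "G \<union> G' \<subseteq> ?R" using gen_base[of G] gen_base[of G'] gen_base[of "S \<union> S'"] G by blast
  ultimately have "?R = gen \<C> (G \<union> G')"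
    using gen_gen[of "S \<union> S'" "G \<union> G'"] gen_gen[of "G \<union> G'" "S \<union> S'"] by blast
  then have "fin_gen \<C> ?R" unfolding fin_gen_def using G by (intro exI[of _ "G \<union> G'"]) simp
  moreover have "rigid \<C> ?R"
  proof -
    have "Ext \<C> A B = {0}" if "A \<in> S \<union> S'" "B \<in> S \<union> S'" for A B
      using that rigidD[OF s(4), of A B] rigidD[OF s'(4), of A B] XY(3)[of A B] XY(4)[of B A] s(3) s'(3) by blast
    then show ?thesis
      unfolding rigid_def Ext_vanish_def using Ext_gen_left[of "S \<union> S'"] Ext_gen_right[of "S \<union> S'"] by metis
  qed
  moreover have "perp \<C> ?R \<subseteq> ?R"
  proof
    fix M assume M: "M \<in> perp \<C> ?R"
    have MS: "Ext \<C> M A = {0}" "Ext \<C> A M = {0}" if "A \<in> S \<union> S'" for A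
    proof -
      have "A \<in> ?R" using gen_base[of "S \<union> S'"] that by blast
      then show "Ext \<C> M A = {0}" using M by (simp add: perp_def)
      then show "Ext \<C> A M = {0}" by (rule Ext_sym)
    qed
    obtain Y X x y \<delta> where t: "Y \<in> \<Y>" "X \<in> \<X>" "etriangle \<C> Y X M x y \<delta>" using ex_X_triangle by blast
    have "Ext \<C> X A = {0}" if A: "A \<in> S" for A
    proof (rule Ext_sym, rule Ext_extension_right[OF t(3)])
      show "Ext \<C> A Y = {0}" using XY(3) t(1) s(3) A by blast
      show "Ext \<C> A M = {0}" using MS(2) A by simp
    qed
    then have XS: "X \<in> S" using s(5) t(2) by (auto simp: perp_def)
    obtain B g where "right_approx \<C> S' M B g" using ex_right_approx[of G' M] G by blast
    then have g: "B \<in> S'" "g \<in> Hom \<C> B M" "\<And>W f. W \<in> S' \<Longrightarrow> f \<in> Hom \<C> W M \<Longrightarrow> \<exists>h\<in>Hom \<C> W B. g \<cdot> h = f"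
      by (auto simp: right_approx_def)
    have gd: "pull \<C> g \<delta> \<in> Ext \<C> B Y" using pull_in_Ext[OF g(2) etriangleD(3)[OF t(3)]] .
    then obtain N e d where N: "etriangle \<C> Y N B e d (pull \<C> g \<delta>)" using ex_etriangle by blast
    have NY: "N \<in> \<Y>" using Y_extension[OF N t(1)] g(1) s'(3) by blast
    have "Ext \<C> W N = {0}" if W: "W \<in> S'" for W
    proof (rule approx_pullback_Ext[OF t(3) g(2) _ _ _ N])
      show "Ext \<C> W X = {0}" using XY(4) t(2) W s'(3) by blast
      show "Ext \<C> W B = {0}" using rigidD[OF s'(4) W g(1)] .
    qed (rule g(3)[OF W])
    then have "N \<in> perp \<C> S'" using Ext_sym by (simp add: perp_def)
    then have "N \<in> S'" using s'(5) NY by blast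
    then have "Ext \<C> M N = {0}" using MS by blast
    then have "push \<C> e \<delta> = 0" using push_in_Ext[OF etriangleD(1)[OF N] etriangleD(3)[OF t(3)]] by simp
    then obtain u where u: "u \<in> Hom \<C> M B" "\<delta> = pull \<C> u (pull \<C> g \<delta>)"
      using push_kernel[OF N etriangleD(3)[OF t(3)]] by blast
    have gu: "g \<cdot> u \<in> Hom \<C> M M" using Comp_in_Hom[OF u(1) g(2)] .
    have "pull \<C> (g \<cdot> u) \<delta> = \<delta>" using pull_Comp[OF g(2) u(1) etriangleD(3)[OF t(3)]] u(2) by metis
    then have "pull \<C> (Id \<C> M - g \<cdot> u) \<delta> = 0"
      using pull_diff_Hom[OF Id_in_Hom gu etriangleD(3)[OF t(3)]] pull_Id[OF etriangleD(3)[OF t(3)]] by simp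
    then obtain v where v: "v \<in> Hom \<C> M X" "y \<cdot> v = Id \<C> M - g \<cdot> u"
      using lift_iff[OF t(3) Hom_diff[OF Id_in_Hom gu]] by blast
    have "ideal \<C> (S \<union> S') M M (y \<cdot> v + g \<cdot> u)"
      using XS g(1,2) u(1) v(1) etriangleD(2)[OF t(3)] by (intro ideal_add ideal_comp) auto
    then show "M \<in> ?R" using v(2) by (simp add: gen_def)
  qed
  ultimately show ?thesis by (simp add: fin_tilting_def)
qed

text \<open>The subcategory generated by \<open>S\<close> and \<open>S'\<close> is cluster tilting,
  and so is its shift, whose local objects lie in the shift of \<open>S\<close> or of
  \<open>S'\<close>. Objects of both kinds have truncations with terms in \<open>\<Y>\<close> and in
  the shift of \<open>S\<close>, so \<open>truncation_tilting\<close> applies to the latter. The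
  second conclusion keeps a tilting part of \<open>\<Y>\<close> at hand, so that the lemma can be
  applied again to the shift.\<close>

lemma tilting_in_susp:
  assumes S: "tilting_in \<C> \<I> \<X> S" and S': "tilting_in \<C> \<I> \<Y> S'"
  shows "tilting_in \<C> \<I> \<X> (susp \<C> \<I> S)" "\<exists>S''. tilting_in \<C> \<I> \<Y> S''"
proof -
  have s: "fin_gen \<C> S" "\<I> \<subseteq> S" "S \<subseteq> \<X>" "rigid \<C> S" "perp \<C> S \<inter> \<X> \<subseteq> S"
    and s': "fin_gen \<C> S'" "\<I> \<subseteq> S'" "S' \<subseteq> \<Y>" "rigid \<C> S'" "perp \<C> S' \<inter> \<Y> \<subseteq> S'"
    using S S' by (auto simp: tilting_in_def)
  note sub = fin_gen_subcategory[OF s(1)] and sub' = fin_gen_subcategory[OF s'(1)]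
  have SU: "S \<subseteq> U" "S' \<subseteq> U" using s(3) s'(3) XY(7,8) by auto
  let ?R = "gen \<C> (S \<union> S')" and ?S = "susp \<C> \<I> S" and ?S' = "susp \<C> \<I> S'"
  have SR: "S \<union> S' \<subseteq> ?R" using gen_base .
  have ct: "fin_tilting \<C> (susp \<C> \<I> ?R)"
    using susp_fin_tilting[OF fin_tilting_union[OF S S']] SR s(2) by blast
  have susp: "subcategory \<C> ?S" "subcategory \<C> ?S'"
    using susp_subcategory[OF sub s(2) SU(1)] susp_subcategory[OF sub' s'(2) SU(2)] by auto
  have SX: "?S \<subseteq> \<X>" using susp_mono[OF s(3)] susp_X by blast
  have R: "\<exists>N\<in>gen \<C> (?S \<union> ?S'). \<exists>Z\<in>\<I>. \<exists>x y \<delta>. etriangle \<C> M Z N x y \<delta>" if M: "M \<in> ?R" for M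
  proof -
    have "\<exists>N\<in>gen \<C> (?S \<union> ?S'). \<exists>Z\<in>\<I>. \<exists>x y \<delta>. etriangle \<C> L Z N x y \<delta>" if L: "L \<in> {L \<in> ?R. loc L}" for L
    proof -
      obtain L' where "L' \<in> S \<union> S'" "retract \<C> L L'" using loc_gen[of L "S \<union> S'"] L by blast
      then have "L \<in> S \<union> S'" using retract_in[OF sub] retract_in[OF sub'] by blast
      moreover obtain N Z x y \<delta> where N: "N \<in> U" "Z \<in> \<I>" "etriangle \<C> L Z N x y \<delta>" using shift_up by blast
      ultimately have "N \<in> ?S \<union> ?S'" using suspI[OF N(1) _ N(2,3)] by blast
      then show ?thesis using N gen_base[of "?S \<union> ?S'"] by blast
    qed
    from triangle_KS_left[OF gen_subcategory I_subcategory _ this, of "{L \<in> ?R. loc L}" M]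
    show ?thesis using M subcategory_loc_ideal[OF gen_subcategory M] by blast
  qed
  have genU: "gen \<C> (?S \<union> ?S') \<subseteq> U" using gen_subset[OF perp_subcategory] susp_sub_U by (metis Un_least)
  have T: "\<exists>Y\<in>\<Y>. \<exists>X\<in>?S. \<exists>x y \<delta>. etriangle \<C> Y X T x y \<delta>" if T: "T \<in> susp \<C> \<I> ?R" for T
  proof -
    have sR: "subcategory \<C> (susp \<C> \<I> ?R)" using ct fin_gen_subcategory by (simp add: fin_tilting_def)
    have "\<exists>Y\<in>\<Y>. \<exists>X\<in>?S. \<exists>x y \<delta>. etriangle \<C> Y X L x y \<delta>" if L: "L \<in> {L \<in> susp \<C> \<I> ?R. loc L}" for L
    proof -
      obtain M Z x y \<delta> where M: "M \<in> ?R" "Z \<in> \<I>" "etriangle \<C> M Z L x y \<delta>" using L by (auto simp: susp_def)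
      obtain N Z' x' y' \<delta>' where N: "N \<in> gen \<C> (?S \<union> ?S')" "Z' \<in> \<I>" "etriangle \<C> M Z' N x' y' \<delta>'" using R[OF M(1)] by blast
      have "L \<in> U" "N \<in> U" using L susp_sub_U N(1) genU by auto
      then have "L \<in> gen \<C> {N, Z}" using compare_cones[OF N(3) M(3) U_right[OF _ N(2)] U_right[OF _ M(2)]] by blast
      moreover have "Z \<in> gen \<C> (?S \<union> ?S')" using I_sub_susp[OF sub] M(2) gen_base[of "?S \<union> ?S'"] by blast
      ultimately have "L \<in> gen \<C> (?S \<union> ?S')" using gen_gen[of "{N, Z}" "?S \<union> ?S'"] N(1) by blast
      then obtain L' where "L' \<in> ?S \<union> ?S'" "retract \<C> L L'" using loc_gen[of L "?S \<union> ?S'"] L by blast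
      then consider "L \<in> ?S" | "L \<in> ?S'" using retract_in[OF susp(1)] retract_in[OF susp(2)] by blast
      then show ?thesis
      proof cases
        case 1
        obtain O' where O': "zero_object \<C> O'" using ex_zero_object by blast
        then show ?thesis using 1 etriangle_zero_left[OF O', of L] subcategoryD(1)[OF XY(2) O'] by blast
      next
        case 2
        \<comment> \<open>The triangle that makes \<open>L\<close> a shift is already a truncation:
          \<open>M\<close> lies in \<open>\<Y>\<close>, and \<open>Z\<close> in \<open>\<I>\<close>,
          which is contained in the shift of \<open>S\<close>.\<close>
        then obtain M Z x y \<delta> where "M \<in> S'" "Z \<in> \<I>" "etriangle \<C> M Z L x y \<delta>" by (auto simp: susp_def)
        then show ?thesis using s'(3) I_sub_susp[OF sub] by blast
      qed
    qed
    from triangle_KS[OF XY(2) susp(1) _ this, of "{L \<in> susp \<C> \<I> ?R. loc L}" T]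
    show ?thesis using subcategory_loc_ideal[OF sR T] by blast
  qed
  have SR': "?S \<subseteq> susp \<C> \<I> ?R" using susp_mono SR by (metis Un_subset_iff)
  have "fin_gen \<C> ?S" using fin_gen_subset[OF _ susp(1) SR'] ct by (simp add: fin_tilting_def)
  moreover have "rigid \<C> ?S" using ct SR' rigidD unfolding fin_tilting_def rigid_def Ext_vanish_def by blast
  moreover have "perp \<C> ?S \<inter> \<X> \<subseteq> ?S"
    using truncation_tilting[OF ct susp(1) I_sub_susp[OF sub] SX T] by blast
  ultimately show "tilting_in \<C> \<I> \<X> ?S" using I_sub_susp[OF sub] SX by (simp add: tilting_in_def)
  show "\<exists>S''. tilting_in \<C> \<I> \<Y> S''" using ex_tilting_in_Y[OF ct] .
qed

text \<open>The cone of a left \<open>S\<close>-approximation has no extensions with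
  \<open>S\<close>. It stays in \<open>\<X>\<close> because morphisms from \<open>M\<close> to
  \<open>\<Y>\<close> factor through \<open>\<I> \<subseteq> S\<close> and so extend along the
  approximation. Maximality then places it in \<open>S\<close>.\<close>

lemma tilting_in_coresolution:
  assumes S: "tilting_in \<C> \<I> \<X> S" and M: "M \<in> \<X>"
  shows "\<exists>A\<in>S. \<exists>B\<in>S. \<exists>x y \<delta>. etriangle \<C> M A B x y \<delta>"
proof -
  have s: "fin_gen \<C> S" "\<I> \<subseteq> S" "S \<subseteq> \<X>" "rigid \<C> S" "perp \<C> S \<inter> \<X> \<subseteq> S"
    using S by (auto simp: tilting_in_def)
  have proj: "P \<in> S" if "\<forall>W. Ext \<C> P W = {0}" for P using proj_I[OF that] s(2) by blast
  obtain A B x y \<delta> where t: "etriangle \<C> M A B x y \<delta>" "A \<in> S"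
    "\<And>D f. D \<in> S \<Longrightarrow> f \<in> Hom \<C> M D \<Longrightarrow> \<exists>g\<in>Hom \<C> A D. g \<cdot> x = f"
    using left_approx_triangle[OF s(1) proj, of M] by blast
  have "B \<in> \<X>"
  proof (rule in_X)
    fix Y assume Y: "Y \<in> \<Y>"
    show "Ext \<C> B Y = {0}"
    proof (rule Ext_cone[OF t(1)])
      show "Ext \<C> A Y = {0}" using XY(3) t(2) s(3) Y by blast
      fix f assume "f \<in> Hom \<C> M Y"
      then obtain Z g h where g: "Z \<in> \<I>" "g \<in> Hom \<C> M Z" "h \<in> Hom \<C> Z Y" "f = h \<cdot> g"
        using factors_XY[OF M Y] unfolding factors_def by blast
      then obtain k where k: "k \<in> Hom \<C> A Z" "k \<cdot> x = g" using t(3)[of Z g] s(2) by blast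
      then have "(h \<cdot> k) \<cdot> x = f" using Comp_assoc[OF etriangleD(1)[OF t(1)] k(1) g(3)] g by simp
      then show "\<exists>g\<in>Hom \<C> A Y. g \<cdot> x = f" using Comp_in_Hom[OF k(1) g(3)] by blast
    qed
  qed
  moreover have "B \<in> perp \<C> S"
    using Ext_cone[OF t(1) t(3)] rigidD[OF s(4) t(2)] by (simp add: perp_def)
  ultimately show ?thesis using t s(5) by blast
qed

text \<open>A morphism from \<open>Y\<close> to the shift \<open>A\<close> of \<open>A'\<close>
  lifts to the term in \<open>\<I>\<close>, because \<open>Y\<close> and \<open>A'\<close> have no
  extensions. So it factors through \<open>\<I>\<close> and extends over \<open>Z\<close>.\<close>

lemma Ext_susp_X:
  assumes Y: "Y \<in> \<Y>" and N: "etriangle \<C> Y Z N x y \<delta>" "N \<in> U" "Z \<in> \<I>"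
    and A: "A \<in> susp \<C> \<I> W" "W \<subseteq> \<X>"
  shows "Ext \<C> N A = {0}"
proof (rule Ext_cone[OF N(1)])
  obtain A' Z' x' y' \<delta>' where t: "A' \<in> W" "Z' \<in> \<I>" "etriangle \<C> A' Z' A x' y' \<delta>'" using A by (auto simp: susp_def)
  have "A \<in> U" using A susp_sub_U by blast
  then show "Ext \<C> Z A = {0}" using U_left N by blast
  fix f assume f: "f \<in> Hom \<C> Y A"
  have "Ext \<C> Y A' = {0}" using XY(4) t(1) A Y by blast
  then obtain g where "g \<in> Hom \<C> Y Z'" "y' \<cdot> g = f" using Ext_cocone_lift[OF t(3) _ f] by blast
  then have "factors \<C> \<I> Y A f" using t(2) etriangleD(2)[OF t(3)] unfolding factors_def by blast
  then show "\<exists>g\<in>Hom \<C> Z A. g \<cdot> x = f" using factors_extend[OF N(1,2)] by blast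
qed

end

section \<open>Morphisms from \<open>\<Y>\<close> to \<open>\<X>\<close> and the splitting of
  \<open>U\<close>\<close>

locale cy_cotorsion_tilting = cy_cotorsion +
  fixes \<T> assumes tilting: "fin_tilting \<C> \<T>" and I_sub_T: "\<I> \<subseteq> \<T>"
begin

text \<open>
  \<open>\<X>\<close> is generated by the double suspension \<open>S\<^sub>2\<close> of a tilting part of \<open>\<X>\<close>, and morphisms from
  \<open>\<Y>\<close> and from its suspension to \<open>S\<^sub>2\<close> and to the suspension \<open>S\<^sub>1\<close> vanish modulo \<open>\<I>\<close>.
\<close>

lemma factors_YX:
  assumes Y: "Y \<in> \<Y>" and M: "M \<in> \<X>" and f: "f \<in> Hom \<C> Y M"
  shows "factors \<C> \<I> Y M f"
proof -
  obtain S S' where S: "tilting_in \<C> \<I> \<X> S" "tilting_in \<C> \<I> \<Y> S'"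
    using ex_tilting_in_X[OF tilting] ex_tilting_in_Y[OF tilting] by blast
  let ?S1 = "susp \<C> \<I> S" and ?S2 = "susp \<C> \<I> (susp \<C> \<I> S)"
  obtain S'' where S1: "tilting_in \<C> \<I> \<X> ?S1" "tilting_in \<C> \<I> \<Y> S''"
    using tilting_in_susp[OF S] by blast
  have S2: "tilting_in \<C> \<I> \<X> ?S2" using tilting_in_susp(1)[OF S1] .
  have SX: "S \<subseteq> \<X>" "?S1 \<subseteq> \<X>" using S S1 by (auto simp: tilting_in_def)
  obtain A B u v \<theta> where t: "A \<in> ?S2" "B \<in> ?S2" "etriangle \<C> M A B u v \<theta>"
    using tilting_in_coresolution[OF S2 M] by blast
  obtain N Z x y \<delta> where N: "N \<in> U" "Z \<in> \<I>" "etriangle \<C> Y Z N x y \<delta>" using shift_up by blast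
  obtain B' Z' x' y' \<delta>' where B': "B' \<in> ?S1" "Z' \<in> \<I>" "etriangle \<C> B' Z' B x' y' \<delta>'"
    using t(2) unfolding susp_def[of \<C> \<I> ?S1] by blast
  have NA: "Ext \<C> N A = {0}" using Ext_susp_X[OF Y N(3,1,2) t(1) SX(2)] .
  have NB: "Ext \<C> N B' = {0}" using Ext_susp_X[OF Y N(3,1,2) B'(1) SX(1)] .
  have "\<epsilon> = 0" if e: "\<epsilon> \<in> Ext \<C> N M" for \<epsilon>
  proof -
    note d = etriangleD[OF t(3)] and d' = etriangleD[OF B'(3)]
    have "push \<C> u \<epsilon> = 0" using push_in_Ext[OF d(1) e] NA by simp
    then obtain c where c: "c \<in> Hom \<C> N B" "\<epsilon> = pull \<C> c \<theta>" using push_kernel[OF t(3) e] by blast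
    obtain c' where c': "c' \<in> Hom \<C> N Z'" "y' \<cdot> c' = c" using Ext_cocone_lift[OF B'(3) NB c(1)] by blast
    have "Ext \<C> Z' M = {0}" using U_left[OF _ B'(2)] M XY(7) by blast
    then have "pull \<C> y' \<theta> = 0" using pull_in_Ext[OF d'(2) d(3)] by simp
    then show ?thesis using pull_Comp[OF d'(2) c'(1) d(3)] c c' pull_zero[OF c'(1)] by simp
  qed
  then have "Ext \<C> N M = {0}" using Ext_zero by blast
  then obtain g where "g \<in> Hom \<C> Z M" "g \<cdot> x = f" using Ext_cone_extend[OF N(3) _ f] by blast
  then show ?thesis using N(2) etriangleD(1)[OF N(3)] unfolding factors_def by blast
qed

text \<open>The argument of \<open>susp_X\<close>, with \<open>factors_YX\<close> in place of
  \<open>factors_XY\<close>.\<close>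

lemma susp_Y:
  assumes "N \<in> susp \<C> \<I> \<Y>"
  shows "N \<in> \<Y>"
proof -
  obtain M Z x y \<delta> where M: "M \<in> \<Y>" "Z \<in> \<I>" "etriangle \<C> M Z N x y \<delta>" "N \<in> U" using assms by (auto simp: susp_def)
  show "N \<in> \<Y>"
  proof (rule in_Y, rule Ext_sym)
    fix X assume X: "X \<in> \<X>"
    show "Ext \<C> N X = {0}"
    proof (rule Ext_cone[OF M(3)])
      show "Ext \<C> Z X = {0}" using XY(4,6) M(2) X by blast
    qed (use factors_extend[OF M(3,4)] factors_YX[OF M(1) X] in blast)
  qed
qed

text \<open>The truncation of \<open>M\<close> splits modulo \<open>\<I>\<close>. Since
  \<open>M\<close> has no extensions by \<open>Z\<close>, the class \<open>\<delta>\<close> is a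
  pullback of \<open>\<eta>\<close>; since \<open>a\<close> factors through \<open>\<I>\<close>, it
  kills \<open>\<eta>\<close>, which is therefore a pullback of \<open>\<delta>\<close>. So the
  identity of \<open>M\<close> is a sum of a morphism through \<open>X\<close> and one through the
  shift \<open>N\<close> of \<open>Y\<close>, which is again in \<open>\<Y>\<close>.\<close>

lemma U_loc:
  assumes M: "M \<in> U" "loc M"
  shows "M \<in> \<X> \<or> M \<in> \<Y>"
proof -
  obtain Y X a b \<delta> where t: "Y \<in> \<Y>" "X \<in> \<X>" "etriangle \<C> Y X M a b \<delta>" using ex_X_triangle by blast
  obtain N Z x y \<eta> where N: "N \<in> U" "Z \<in> \<I>" "etriangle \<C> Y Z N x y \<eta>" using shift_up by blast
  note d = etriangleD[OF t(3)] and n = etriangleD[OF N(3)]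
  have NY: "N \<in> \<Y>" using susp_Y[OF suspI[OF N(1) t(1) N(2,3)]] .
  have "push \<C> x \<delta> = 0" using push_in_Ext[OF n(1) d(3)] U_right[OF M(1) N(2)] by simp
  then obtain u where u: "u \<in> Hom \<C> M N" "\<delta> = pull \<C> u \<eta>" using push_kernel[OF N(3) d(3)] by blast
  have "\<exists>g\<in>Hom \<C> Z X. g \<cdot> x = a" using factors_extend[OF N(3,1) factors_YX[OF t(1,2) d(1)]] .
  then have "push \<C> a \<eta> = 0" using extend_iff[OF N(3) d(1)] by blast
  then obtain c where c: "c \<in> Hom \<C> N M" "\<eta> = pull \<C> c \<delta>" using push_kernel[OF t(3) n(3)] by blast
  have cu: "c \<cdot> u \<in> Hom \<C> M M" using Comp_in_Hom[OF u(1) c(1)] .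
  have "pull \<C> (c \<cdot> u) \<delta> = \<delta>" using pull_Comp[OF c(1) u(1) d(3)] u(2) c(2) by metis
  then have "pull \<C> (Id \<C> M - c \<cdot> u) \<delta> = 0" using pull_diff_Hom[OF Id_in_Hom cu d(3)] pull_Id[OF d(3)] by simp
  then obtain v where v: "v \<in> Hom \<C> M X" "b \<cdot> v = Id \<C> M - c \<cdot> u" using lift_iff[OF t(3) Hom_diff[OF Id_in_Hom cu]] by blast
  have "ideal \<C> {X, N} M M (b \<cdot> v + c \<cdot> u)"
    using c(1) u(1) v(1) d(2) by (intro ideal_add ideal_comp) auto
  then have "M \<in> gen \<C> {X, N}" using v(2) by (simp add: gen_def)
  then have "retract \<C> M X \<or> retract \<C> M N" using loc_gen[OF M(2)] by blast
  then show ?thesis using retract_in[OF XY(1) t(2)] retract_in[OF XY(2) NY] by blast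
qed

lemma T_sub_U: "\<T> \<subseteq> U"
  using tilting I_sub_T rigidD unfolding fin_tilting_def perp_def by blast

lemma T_loc: "M \<in> \<T> \<Longrightarrow> loc M \<Longrightarrow> M \<in> \<X> \<or> M \<in> \<Y>"
  using U_loc T_sub_U by blast

lemma T_subcategory: "subcategory \<C> \<T>"
  using tilting fin_gen_subcategory by (simp add: fin_tilting_def)

text \<open>This makes \<open>\<X>\<close>, hence the cotorsion pair, depend only on \<open>\<T> \<inter> \<Y>\<close>.\<close>

lemma X_characterization: "\<X> = side \<C> \<I> (\<T> \<inter> \<Y>)"
proof (intro equalityI subsetI)
  fix M assume M: "M \<in> \<X>"
  show "M \<in> side \<C> \<I> (\<T> \<inter> \<Y>)"
    unfolding side_def
  proof (intro CollectI conjI ballI)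
    fix B assume B: "B \<in> \<T> \<inter> \<Y>"
    then show "Ext \<C> M B = {0}" using XY(3) M by blast
    fix f assume "f \<in> Hom \<C> B M"
    then show "factors \<C> \<I> B M f" using factors_YX B M by blast
  qed
next
  fix M assume "M \<in> side \<C> \<I> (\<T> \<inter> \<Y>)"
  with side_subcategory show "M \<in> \<X>"
  proof (induction rule: KS_induct)
    case (loc N)
    then have c: "Ext \<C> N B = {0} \<and> (\<forall>f\<in>Hom \<C> B N. factors \<C> \<I> B N f)" if "B \<in> \<T> \<inter> \<Y>" for B
      using that by (simp add: side_def)
    then have NU: "N \<in> U" using I_sub_T XY(6) by (auto simp: perp_def)
    show "N \<in> \<X>"
    proof (cases "N \<in> \<X>")
      case False
      then have NY: "N \<in> \<Y>" using U_loc NU loc by blast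
      \<comment> \<open>\<open>N\<close> lies in \<open>\<Y>\<close>, so it has no extensions with
        the objects of \<open>\<T>\<close> in \<open>\<X>\<close>, and by hypothesis none with those
        in \<open>\<Y>\<close>. Hence it belongs to \<open>\<T> \<inter> \<Y>\<close> itself, and
        the hypothesis for its own identity puts it in \<open>\<I>\<close>.\<close>
      have "Ext \<C> N T = {0}" if T: "T \<in> \<T>" for T
        using T_subcategory T
      proof (induction rule: KS_induct)
        case (loc L)
        then show ?case using T_loc[of L] c[of L] XY(4)[of L N] NY by blast
      next
        case (zero Z)
        then show ?case using U_right[OF NU] subcategoryD(1)[OF I_subcategory] by blast
      next
        case (dsum D A B)
        then show ?case using Ext_dsum_right[OF dsum(1), of N] by blast
      qed
      then have "N \<in> \<T>" using tilting by (auto simp: fin_tilting_def perp_def)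
      then have "factors \<C> \<I> N N (Id \<C> N)" using c[of N] NY Id_in_Hom by blast
      then show ?thesis using factors_Id_in[OF I_subcategory] XY(5) by blast
    qed
  next
    case (zero Z)
    then show ?case using subcategoryD(1)[OF XY(1)] by blast
  next
    case (dsum D A B)
    then show ?case using subcategoryD(2)[OF XY(1)] by blast
  qed
qed

lemma Y_characterization: "M \<in> \<Y> \<longleftrightarrow> (\<forall>X\<in>\<X>. Ext \<C> X M = {0})"
  using in_Y[of M] XY(3) by blast

end

section \<open>From partitions to cotorsion pairs\<close>

text \<open>The local summands are sorted into \<open>\<A>\<close> and \<open>\<B>\<close>, and
  \<open>is_dsum_swap\<close> regroups the sum.\<close>

lemma (in krull_schmidt_category) KS_split:
  assumes S: "subcategory \<C> S" and A: "subcategory \<C> \<A>" and B: "subcategory \<C> \<B>"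
    and l: "\<And>N. N \<in> S \<Longrightarrow> loc N \<Longrightarrow> N \<in> \<A> \<or> N \<in> \<B>" and M: "M \<in> S"
  shows "\<exists>A\<in>\<A>. \<exists>B\<in>\<B>. is_dsum \<C> M A B"
  using S M
proof (induction rule: KS_induct)
  case (loc N)
  obtain Z where Z: "zero_object \<C> Z" using ex_zero_object by blast
  have "is_dsum \<C> N N Z" "is_dsum \<C> N Z N" using is_dsum_zero[OF Z iso_mor_Id, of N] is_dsum_sym by blast+
  then show ?case using l[OF loc] subcategoryD(1)[OF A Z] subcategoryD(1)[OF B Z] by blast
next
  case (zero Z)
  have "is_dsum \<C> Z Z Z" using is_dsum_zero[OF zero iso_mor_Id, of Z] .
  then show ?case using subcategoryD(1)[OF A zero] subcategoryD(1)[OF B zero] by blast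
next
  case (dsum D D1 D2)
  then obtain A1 B1 A2 B2 where *: "A1 \<in> \<A>" "B1 \<in> \<B>" "is_dsum \<C> D1 A1 B1" "A2 \<in> \<A>" "B2 \<in> \<B>" "is_dsum \<C> D2 A2 B2" by blast
  obtain A' B' where AB: "is_dsum \<C> A' A1 A2" "is_dsum \<C> B' B1 B2" using ex_dsum by meson
  then have "is_dsum \<C> D A' B'" using is_dsum_swap[OF dsum(1) *(3,6)] by blast
  then show ?case using subcategoryD(2)[OF A AB(1)] subcategoryD(2)[OF B AB(2)] * by blast
qed

section \<open>Cotorsion pairs from a decomposition of \<open>U\<close>\<close>

locale cy_decomposition = cy_core +
  fixes \<X> \<Y>
  assumes X_sub: "subcategory \<C> \<X>" and Y_sub: "subcategory \<C> \<Y>"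
    and X_U: "\<X> \<subseteq> U" and Y_U: "\<Y> \<subseteq> U"
    and Ext_XY: "X \<in> \<X> \<Longrightarrow> Y \<in> \<Y> \<Longrightarrow> Ext \<C> X Y = {0}"
    and XY_core: "\<X> \<inter> \<Y> = \<I>"
    and U_XY: "M \<in> U \<Longrightarrow> loc M \<Longrightarrow> M \<in> \<X> \<or> M \<in> \<Y>"
begin

lemma cy_decomposition_opp: "cy_decomposition (opp \<C>) \<I> \<Y> \<X>"
proof (intro cy_decomposition.intro cy_decomposition_axioms.intro cy_core_opp)
  show "M \<in> \<Y> \<or> M \<in> \<X>" if "M \<in> perp (opp \<C>) \<I>" "local_endomorphism_ring (opp \<C>) M" for M
    using that U_XY[of M] by (auto simp: perp_opp)
  show "\<Y> \<inter> \<X> = \<I>" using XY_core by blast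
qed (use X_sub Y_sub X_U Y_U Ext_XY in \<open>simp_all add: perp_opp additive_category_axioms\<close>)

text \<open>A local shift \<open>N\<close> outside \<open>\<X>\<close> lies in \<open>\<Y>\<close>
  and so has no extensions with \<open>K\<close>. Its triangle splits, making \<open>N\<close> a
  retract of \<open>Z\<close> and thus an object of \<open>\<I>\<close>, a contradiction.\<close>

lemma susp_sub_X: "susp \<C> \<I> \<X> \<subseteq> \<X>"
proof
  fix N assume N: "N \<in> susp \<C> \<I> \<X>"
  have sub: "subcategory \<C> (susp \<C> \<I> \<X>)" using susp_subcategory[OF X_sub _ X_U] XY_core by blast
  from sub N show "N \<in> \<X>"
  proof (induction rule: KS_induct)
    case (loc N)
    then obtain K Z x y \<delta> where K: "N \<in> U" "K \<in> \<X>" "Z \<in> \<I>" "etriangle \<C> K Z N x y \<delta>" by (auto simp: susp_def)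
    show ?case
    proof (cases "N \<in> \<X>")
      case False
      then have "Ext \<C> N K = {0}" using U_XY[OF K(1) loc(2)] Ext_XY[OF K(2)] Ext_sym by blast
      then have "retract \<C> N Z" using split_right[OF K(4)] by blast
      then show ?thesis using retract_in[OF I_subcategory K(3)] XY_core by blast
    qed
  next
    case (zero Z)
    then show ?case using subcategoryD(1)[OF X_sub] by blast
  next
    case (dsum D A B)
    then show ?case using subcategoryD(2)[OF X_sub] by blast
  qed
qed

text \<open>For a local object of \<open>U\<close> the triangle leads to its shift or is trivial. A
  general \<open>M\<close> first gets a map into some \<open>E\<close> in \<open>U\<close> with cone
  \<open>B\<close> in \<open>\<I>\<close>: a triangle into an injective is pulled back along an
  \<open>\<I>\<close>-approximation of its cone. (ET4) composes this with the triangle of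
  \<open>E\<close>, and the resulting extension of \<open>X\<close> by \<open>B\<close>
  splits.\<close>

lemma ex_Y_triangle: "\<exists>Y\<in>\<Y>. \<exists>X\<in>\<X>. \<exists>f g \<delta>. etriangle \<C> M Y X f g \<delta>"
proof -
  obtain O' where O': "zero_object \<C> O'" using ex_zero_object by blast
  have loc: "\<exists>X\<in>\<X>. \<exists>Y\<in>\<Y>. \<exists>x y \<delta>. etriangle \<C> L Y X x y \<delta>" if L: "L \<in> {L \<in> U. loc L}" for L
  proof (cases "L \<in> \<X>")
    case True
    obtain N Z x y \<delta> where N: "N \<in> U" "Z \<in> \<I>" "etriangle \<C> L Z N x y \<delta>" using shift_up by blast
    then have "N \<in> \<X>" using suspI[OF N(1) True N(2,3)] susp_sub_X by blast
    then show ?thesis using N XY_core by blast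
  next
    case False
    then show ?thesis using U_XY L etriangle_zero_right[OF O', of L] subcategoryD(1)[OF X_sub O'] by blast
  qed
  obtain J C x0 y0 \<delta>0 where J: "\<forall>W. Ext \<C> W J = {0}" "etriangle \<C> M J C x0 y0 \<delta>0" using enough_inj by blast
  obtain B g where "right_approx \<C> \<I> C B g" using fin_I ex_right_approx unfolding fin_gen_def by blast
  then have g: "B \<in> \<I>" "g \<in> Hom \<C> B C" "\<And>W f. W \<in> \<I> \<Longrightarrow> f \<in> Hom \<C> W C \<Longrightarrow> \<exists>h\<in>Hom \<C> W B. g \<cdot> h = f"
    by (auto simp: right_approx_def)
  obtain E e d where E: "etriangle \<C> M E B e d (pull \<C> g \<delta>0)"
    using ex_etriangle pull_in_Ext[OF g(2) etriangleD(3)[OF J(2)]] by blast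
  have "Ext \<C> W E = {0}" if W: "W \<in> \<I>" for W
    using approx_pullback_Ext[OF J(2) g(2) g(3)[OF W] _ rigidD[OF rigid_I W g(1)] E] J(1) by blast
  then have EU: "E \<in> U" using Ext_sym by (simp add: perp_def)
  have "\<exists>X\<in>\<X>. \<exists>Y\<in>\<Y>. \<exists>x y \<delta>. etriangle \<C> E Y X x y \<delta>"
    using triangle_KS_left[OF X_sub Y_sub _ loc, of "{L \<in> U. loc L}" E] subcategory_loc_ideal[OF perp_subcategory EU] by blast
  then obtain X Y x y \<delta> where XY: "X \<in> \<X>" "Y \<in> \<Y>" "etriangle \<C> E Y X x y \<delta>" by blast
  obtain F h' \<delta>'' u v where F: "etriangle \<C> M Y F (x \<cdot> e) h' \<delta>''" "etriangle \<C> B F X u v (push \<C> d \<delta>)"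
    using ET4[OF E XY(3)] by blast
  have "push \<C> d \<delta> = 0" using etriangleD(3)[OF F(2)] U_right[OF _ g(1)] XY(1) X_U by blast
  obtain D i j p q where bp: "biproduct \<C> B X D i j p q" using ex_biproduct by blast
  then have "D \<in> \<X>" using subcategoryD(2)[OF X_sub, of D B X] g(1) XY(1) XY_core unfolding is_dsum_def by blast
  moreover have "isomorphic \<C> D F"
    using etriangle_unique[OF etriangle_zero[OF bp]] F(2) \<open>push \<C> d \<delta> = 0\<close> by simp
  ultimately have "F \<in> \<X>" using subcategoryD(5)[OF X_sub] by blast
  then show ?thesis using F(1) XY(2) by blast
qed

lemma cotorsion_pair: "cotorsion_pair \<C> \<X> \<Y>"
proof -
  have "\<exists>Y\<in>\<Y>. \<exists>X\<in>\<X>. \<exists>f g \<delta>. etriangle \<C> Y X M f g \<delta>" for M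
    using cy_decomposition.ex_Y_triangle[OF cy_decomposition_opp, of M] by (simp add: etriangle_opp_eta) blast
  then show ?thesis
    using X_sub Y_sub Ext_XY ex_Y_triangle by (simp add: cotorsion_pair_def Ext_vanish_def)
qed

end

section \<open>The two sides of a partition of the cluster tilting subcategory\<close>

locale cy_partition = cy_core +
  fixes \<T> \<A> \<B>
  assumes tilting: "fin_tilting \<C> \<T>"
    and A_sub: "subcategory \<C> \<A>" and B_sub: "subcategory \<C> \<B>"
    and I_A: "\<I> \<subseteq> \<A>" and I_B: "\<I> \<subseteq> \<B>" and A_T: "\<A> \<subseteq> \<T>" and B_T: "\<B> \<subseteq> \<T>"
    and T_AB: "T \<in> \<T> \<Longrightarrow> loc T \<Longrightarrow> T \<in> \<A> \<or> T \<in> \<B>"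
    and factors_AB: "A \<in> \<A> \<Longrightarrow> B \<in> \<B> \<Longrightarrow> f \<in> Hom \<C> A B \<Longrightarrow> factors \<C> \<I> A B f"
    and factors_BA: "A \<in> \<A> \<Longrightarrow> B \<in> \<B> \<Longrightarrow> f \<in> Hom \<C> B A \<Longrightarrow> factors \<C> \<I> B A f"
begin

lemma T_facts: "fin_gen \<C> \<T>" "rigid \<C> \<T>" "perp \<C> \<T> \<subseteq> \<T>" "subcategory \<C> \<T>" "\<T> \<subseteq> U"
proof -
  show *: "fin_gen \<C> \<T>" "rigid \<C> \<T>" "perp \<C> \<T> \<subseteq> \<T>" using tilting by (auto simp: fin_tilting_def)
  show "subcategory \<C> \<T>" using fin_gen_subcategory *(1) by blast
  have "\<I> \<subseteq> \<T>" using I_A A_T by blast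
  then show "\<T> \<subseteq> U" using rigidD[OF *(2)] unfolding perp_def by blast
qed

lemma partition_sym: "cy_partition \<C> \<I> \<T> \<B> \<A>"
proof (intro cy_partition.intro cy_partition_axioms.intro cy_core_axioms)
  show "T \<in> \<B> \<or> T \<in> \<A>" if "T \<in> \<T>" "loc T" for T using T_AB[OF that] by blast
qed (use tilting A_sub B_sub I_A I_B A_T B_T factors_AB factors_BA in simp_all)

abbreviation "X \<equiv> side \<C> \<I> \<B>"
abbreviation "Y \<equiv> side \<C> \<I> \<A>"

lemma X_sub_U: "X \<subseteq> U"
  using I_B by (auto simp: side_def perp_def)

lemma A_sub_X: "\<A> \<subseteq> X"
  using rigidD[OF T_facts(2)] A_T B_T factors_BA unfolding side_def by blast

lemma T_resolution: "\<exists>T1\<in>\<T>. \<exists>T0\<in>\<T>. \<exists>x y \<delta>. etriangle \<C> T1 T0 M x y \<delta>"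
proof -
  have proj: "P \<in> \<T>" if "\<forall>W. Ext \<C> P W = {0}" for P using that T_facts(3) by (auto simp: perp_def)
  obtain T1 T0 x y \<delta> where t: "etriangle \<C> T1 T0 M x y \<delta>" "T0 \<in> \<T>"
    "\<And>D f. D \<in> \<T> \<Longrightarrow> f \<in> Hom \<C> D M \<Longrightarrow> \<exists>g\<in>Hom \<C> D T0. y \<cdot> g = f"
    using right_approx_triangle[OF T_facts(1) proj, of M] by blast
  have "Ext \<C> D T1 = {0}" if D: "D \<in> \<T>" for D
    using Ext_cocone[OF t(1) t(3)[OF D]] rigidD[OF T_facts(2) D t(2)] by blast
  then have "T1 \<in> \<T>" using T_facts(3) Ext_sym unfolding perp_def by blast
  then show ?thesis using t by blast
qed

lemma T_ideal: "T \<in> \<T> \<Longrightarrow> ideal \<C> (\<A> \<union> \<B>) T T (Id \<C> T)"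
proof -
  assume T: "T \<in> \<T>"
  have "{L \<in> \<T>. loc L} \<subseteq> gen \<C> (\<A> \<union> \<B>)" using T_AB gen_base[of "\<A> \<union> \<B>"] by blast
  then have "T \<in> gen \<C> (\<A> \<union> \<B>)" using gen_gen subcategory_loc_ideal[OF T_facts(4) T] by blast
  then show ?thesis by (simp add: gen_def)
qed

text \<open>A class \<open>\<epsilon>\<close> dies on \<open>T0\<close>: on the part in
  \<open>\<A>\<close> by the condition on \<open>N\<close>, and on the part in \<open>\<B>\<close>
  because the maps to \<open>M\<close> factor through \<open>\<I>\<close>. So
  \<open>\<epsilon>\<close> is the push of \<open>\<delta>\<close> along a morphism from
  \<open>T1\<close> to \<open>N\<close>, and the same case distinction with the conditions exchanged
  shows that it vanishes.\<close>

lemma Ext_X_Y: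
  assumes M: "M \<in> X" and N: "N \<in> Y"
  shows "Ext \<C> M N = {0}"
proof -
  have MU: "M \<in> U" using M X_sub_U by blast
  have NU: "N \<in> U" using N cy_partition.X_sub_U[OF partition_sym] by blast
  obtain T1 T0 x y \<delta> where t: "T1 \<in> \<T>" "T0 \<in> \<T>" "etriangle \<C> T1 T0 M x y \<delta>" using T_resolution by blast
  note d = etriangleD[OF t(3)]
  have pull0: "pull \<C> g \<epsilon> = 0" if "ideal \<C> (\<A> \<union> \<B>) T M g" "\<epsilon> \<in> Ext \<C> M N" for g T \<epsilon>
    using that
  proof (induction rule: ideal.induct)
    case ideal_zero
    then show ?case using pull_zero_Hom by blast
  next
    case (ideal_comp Z g h)
    have "pull \<C> h \<epsilon> = 0"
    proof (cases "Z \<in> \<A>")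
      case True
      then have "Ext \<C> Z N = {0}" using N Ext_sym[of N Z] by (simp add: side_def)
      then show ?thesis using pull_in_Ext[OF ideal_comp(3,4)] by simp
    next
      case False
      then have "factors \<C> \<I> Z M h" using M ideal_comp by (auto simp: side_def)
      then obtain W k l where k: "W \<in> \<I>" "k \<in> Hom \<C> Z W" "l \<in> Hom \<C> W M" "h = l \<cdot> k" unfolding factors_def by blast
      have "pull \<C> l \<epsilon> = 0" using pull_in_Ext[OF k(3) ideal_comp(4)] U_left[OF NU k(1)] by simp
      then show ?thesis using pull_Comp[OF k(3,2) ideal_comp(4)] k pull_zero[OF k(2)] by simp
    qed
    then show ?case using pull_Comp[OF ideal_comp(3,2,4)] pull_zero[OF ideal_comp(2)] by simp
  next
    case (ideal_add f f')
    then show ?case using pull_add_Hom[of f T M f' \<epsilon> N] ideal_Hom by simp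
  qed
  have push0: "push \<C> f \<epsilon> = 0" if "ideal \<C> (\<A> \<union> \<B>) T N f" "\<epsilon> \<in> Ext \<C> M T" for f T \<epsilon>
    using that
  proof (induction rule: ideal.induct)
    case ideal_zero
    then show ?case using push_zero_Hom by blast
  next
    case (ideal_comp Z g h)
    have g: "push \<C> g \<epsilon> \<in> Ext \<C> M Z" using push_in_Ext[OF ideal_comp(2,4)] .
    have "push \<C> h (push \<C> g \<epsilon>) = 0"
    proof (cases "Z \<in> \<B>")
      case True
      then have "push \<C> g \<epsilon> = 0" using g M by (simp add: side_def)
      then show ?thesis using push_zero[OF ideal_comp(3)] by simp
    next
      case False
      then have "factors \<C> \<I> Z N h" using N ideal_comp by (auto simp: side_def)
      then obtain W k l where k: "W \<in> \<I>" "k \<in> Hom \<C> Z W" "l \<in> Hom \<C> W N" "h = l \<cdot> k" unfolding factors_def by blast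
      have "push \<C> k (push \<C> g \<epsilon>) = 0" using push_in_Ext[OF k(2) g] U_right[OF MU k(1)] by simp
      then show ?thesis using push_Comp[OF k(2,3) g] k push_zero[OF k(3)] by simp
    qed
    then show ?case using push_Comp[OF ideal_comp(2,3,4)] by simp
  next
    case (ideal_add f f')
    then show ?case using push_add_Hom[of f T N f' \<epsilon> M] ideal_Hom by simp
  qed
  have "\<epsilon> = 0" if e: "\<epsilon> \<in> Ext \<C> M N" for \<epsilon>
  proof -
    have "ideal \<C> (\<A> \<union> \<B>) T0 M y" using ideal_left[OF T_ideal[OF t(2)] d(2)] Comp_Id_right[OF d(2)] by simp
    then have "pull \<C> y \<epsilon> = 0" using pull0 e by blast
    then obtain f where f: "f \<in> Hom \<C> T1 N" "\<epsilon> = push \<C> f \<delta>" using pull_kernel[OF t(3) e] by blast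
    have "ideal \<C> (\<A> \<union> \<B>) T1 N f" using ideal_left[OF T_ideal[OF t(1)] f(1)] Comp_Id_right[OF f(1)] by simp
    then show ?thesis using push0[OF _ d(3)] f(2) by simp
  qed
  then show ?thesis using Ext_zero by blast
qed

text \<open>An object on both sides has no extensions with \<open>\<A>\<close> and
  \<open>\<B>\<close>, hence lies in \<open>\<T>\<close>. Its local summands lie in
  \<open>\<A>\<close> or \<open>\<B>\<close> and can be tested against themselves: their identities
  factor through \<open>\<I>\<close>.\<close>

lemma X_Y_core: "X \<inter> Y = \<I>"
proof
  show "\<I> \<subseteq> X \<inter> Y" using A_sub_X I_A cy_partition.A_sub_X[OF partition_sym] I_B by blast
  have sub: "subcategory \<C> X" "subcategory \<C> Y" using side_subcategory by auto
  show "X \<inter> Y \<subseteq> \<I>"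
  proof
    fix M assume M: "M \<in> X \<inter> Y"
    then have "Ext \<C> M Z = {0}" if "Z \<in> \<A> \<union> \<B>" for Z using that by (auto simp: side_def)
    then have "Ext \<C> M T = {0}" if "T \<in> \<T>" for T
      using that T_ideal Ext_gen_right[of "\<A> \<union> \<B>" M T] by (simp add: gen_def)
    then have MT: "M \<in> \<T>" using T_facts(3) by (auto simp: perp_def)
    from T_facts(4) MT have "M \<in> X \<inter> Y \<longrightarrow> M \<in> \<I>"
    proof (induction rule: KS_induct)
      case (loc N)
      show ?case
      proof
        assume N: "N \<in> X \<inter> Y"
        have "factors \<C> \<I> N N (Id \<C> N)" using N T_AB[OF loc] Id_in_Hom[of N] by (auto simp: side_def)
        then show "N \<in> \<I>" using factors_Id_in[OF I_subcategory] by blast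
      qed
    next
      case (zero Z)
      then show ?case using subcategoryD(1)[OF I_subcategory] by blast
    next
      case (dsum D A B)
      then show ?case using subcategoryD(2)[OF I_subcategory dsum(1)] subcategoryD(3,4)[OF sub(1) dsum(1)]
        subcategoryD(3,4)[OF sub(2) dsum(1)] by blast
    qed
    then show "M \<in> \<I>" using M by blast
  qed
qed

text \<open>The cone of \<open>\<tau>\<close> modulo \<open>\<I>\<close>. With
  \<open>\<iota>\<close> a left \<open>\<I>\<close>-approximation, the pair
  \<open>(\<iota>, \<tau>)\<close> is the first map of a triangle, and every morphism from
  \<open>A1\<close> to \<open>\<B>\<close>, as it factors through \<open>\<I>\<close>, extends along
  it. The structure maps are listed because \<open>U_gen\<close> compares \<open>s\<close> with
  \<open>\<tau>\<close>.\<close>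

lemma cone_in_side:
  assumes A1: "A1 \<in> \<A>" and A0: "A0 \<in> \<A>" and \<tau>: "\<tau> \<in> Hom \<C> A1 A0"
  shows "\<exists>Z W M \<iota> s r r' k k' \<delta>. Z \<in> \<I> \<and> W \<in> \<A> \<and> M \<in> X \<and> \<iota> \<in> Hom \<C> A1 Z \<and> s \<in> Hom \<C> A1 W \<and>
    r \<in> Hom \<C> W A0 \<and> k \<in> Hom \<C> Z W \<and> k' \<in> Hom \<C> A0 W \<and>
    r \<cdot> s = \<tau> \<and> s = k \<cdot> \<iota> + k' \<cdot> \<tau> \<and> etriangle \<C> A1 W M s r' \<delta>"
proof -
  obtain N Z \<iota> \<pi> \<eta> where Z: "N \<in> U" "Z \<in> \<I>" "etriangle \<C> A1 Z N \<iota> \<pi> \<eta>" using shift_up by blast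
  note z = etriangleD[OF Z(3)]
  obtain W k k' q r where bp: "biproduct \<C> Z A0 W k k' q r" using ex_biproduct by blast
  note b = bp[unfolded biproduct_def]
  \<comment> \<open>The homotopy pushout produces a difference, so it is applied to
    \<open>- \<tau>\<close>.\<close>
  obtain M h \<delta> where M: "etriangle \<C> A1 W M (k \<cdot> \<iota> - k' \<cdot> (- \<tau>)) h \<delta>"
    using homotopy_pushout[OF Z(3) Hom_minus[OF \<tau>] bp] by blast
  let ?s = "k \<cdot> \<iota> + k' \<cdot> \<tau>"
  have s: "k \<cdot> \<iota> - k' \<cdot> (- \<tau>) = ?s" using Comp_minus_right[of \<tau> A1 A0 k' W] \<tau> b by simp
  have M: "etriangle \<C> A1 W M ?s h \<delta>" using M unfolding s .
  have hh: "k \<cdot> \<iota> \<in> Hom \<C> A1 W" "k' \<cdot> \<tau> \<in> Hom \<C> A1 W" "r \<in> Hom \<C> W A0" "q \<in> Hom \<C> W Z"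
    using b z \<tau> Comp_in_Hom by blast+
  have rs: "r \<cdot> ?s = \<tau>"
    using Comp_add_right[OF hh(1,2,3)] cancel_zero[of r k Z W A0 \<iota> A1] cancel_Id[of r k' A0 W \<tau> A1] b z \<tau> by simp
  have qs: "q \<cdot> ?s = \<iota>"
    using Comp_add_right[OF hh(1,2,4)] cancel_Id[of q k Z W \<iota> A1] cancel_zero[of q k' A0 W Z \<tau> A1] b z \<tau> by simp
  have "is_dsum \<C> W Z A0" using bp by (auto simp: is_dsum_def)
  then have W: "W \<in> \<A>" using subcategoryD(2)[OF A_sub, of W Z A0] Z(2) I_A A0 by blast
  have "M \<in> X"
    unfolding side_def
  proof (intro CollectI ballI conjI)
    fix B assume B: "B \<in> \<B>"
    show "Ext \<C> M B = {0}"
    proof (rule Ext_cone[OF M])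
      show "Ext \<C> W B = {0}" using rigidD[OF T_facts(2)] W B A_T B_T by blast
      fix f assume f: "f \<in> Hom \<C> A1 B"
      obtain g where g: "g \<in> Hom \<C> Z B" "g \<cdot> \<iota> = f" using factors_extend[OF Z(3,1) factors_AB[OF A1 B f]] by blast
      then have "(g \<cdot> q) \<cdot> ?s = f" using Comp_assoc[OF Hom_add[OF hh(1,2)] hh(4) g(1)] qs by simp
      then show "\<exists>g\<in>Hom \<C> W B. g \<cdot> ?s = f" using Comp_in_Hom[OF hh(4) g(1)] by blast
    qed
    fix f assume f: "f \<in> Hom \<C> B M"
    have "Ext \<C> B A1 = {0}" using rigidD[OF T_facts(2)] A1 B A_T B_T by blast
    then obtain g where g: "g \<in> Hom \<C> B W" "h \<cdot> g = f" using Ext_cocone_lift[OF M _ f] by blast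
    then show "factors \<C> \<I> B M f"
      using factors_left[OF factors_BA[OF W B g(1)] etriangleD(2)[OF M]] by simp
  qed
  then have "Z \<in> \<I> \<and> W \<in> \<A> \<and> M \<in> X \<and> \<iota> \<in> Hom \<C> A1 Z \<and> ?s \<in> Hom \<C> A1 W \<and>
    r \<in> Hom \<C> W A0 \<and> k \<in> Hom \<C> Z W \<and> k' \<in> Hom \<C> A0 W \<and>
    r \<cdot> ?s = \<tau> \<and> ?s = k \<cdot> \<iota> + k' \<cdot> \<tau> \<and> etriangle \<C> A1 W M ?s h \<delta>"
    using Z W z b rs M Hom_add[OF hh(1,2)] by simp
  then show ?thesis by blast
qed

text \<open>
  The presentation \<open>\<tau>\<close> of \<open>M\<close> by objects of \<open>\<T>\<close> is diagonal modulo \<open>\<I>\<close>; adding a left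
  \<open>\<I>\<close>-approximation of its source makes the diagonal part \<open>\<sigma>\<close> an inflation, and \<open>\<sigma>\<close> and \<open>\<tau>\<close>
  factor through each other.
\<close>

lemma U_gen:
  assumes M: "M \<in> U"
  shows "M \<in> gen \<C> (X \<union> Y)"
proof -
  obtain T1 T0 \<tau> \<pi> \<delta> where t: "T1 \<in> \<T>" "T0 \<in> \<T>" "etriangle \<C> T1 T0 M \<tau> \<pi> \<delta>" using T_resolution by blast
  note d = etriangleD[OF t(3)]
  obtain A1 B1 where T1: "A1 \<in> \<A>" "B1 \<in> \<B>" "is_dsum \<C> T1 A1 B1" using KS_split[OF T_facts(4) A_sub B_sub T_AB t(1)] by blast
  obtain A0 B0 where T0: "A0 \<in> \<A>" "B0 \<in> \<B>" "is_dsum \<C> T0 A0 B0" using KS_split[OF T_facts(4) A_sub B_sub T_AB t(2)] by blast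
  obtain i1 j1 p1 q1 where bp1: "biproduct \<C> A1 B1 T1 i1 j1 p1 q1" using T1 by (auto simp: is_dsum_def)
  obtain i0 j0 p0 q0 where bp0: "biproduct \<C> A0 B0 T0 i0 j0 p0 q0" using T0 by (auto simp: is_dsum_def)
  note b1 = bp1[unfolded biproduct_def] and b0 = bp0[unfolded biproduct_def]
  have ti: "\<tau> \<cdot> i1 \<in> Hom \<C> A1 T0" "\<tau> \<cdot> j1 \<in> Hom \<C> B1 T0" using d b1 Comp_in_Hom by blast+
  have comps: "p0 \<cdot> (\<tau> \<cdot> i1) \<in> Hom \<C> A1 A0" "q0 \<cdot> (\<tau> \<cdot> j1) \<in> Hom \<C> B1 B0"
    "q0 \<cdot> (\<tau> \<cdot> i1) \<in> Hom \<C> A1 B0" "p0 \<cdot> (\<tau> \<cdot> j1) \<in> Hom \<C> B1 A0" using ti b0 Comp_in_Hom by blast+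
  obtain ZA WA MA \<iota>A sA rA rA' kA kA' \<delta>A where A: "ZA \<in> \<I>" "WA \<in> \<A>" "MA \<in> X" "\<iota>A \<in> Hom \<C> A1 ZA" "sA \<in> Hom \<C> A1 WA"
    "rA \<in> Hom \<C> WA A0" "kA \<in> Hom \<C> ZA WA" "kA' \<in> Hom \<C> A0 WA" "rA \<cdot> sA = p0 \<cdot> (\<tau> \<cdot> i1)"
    "sA = kA \<cdot> \<iota>A + kA' \<cdot> (p0 \<cdot> (\<tau> \<cdot> i1))" "etriangle \<C> A1 WA MA sA rA' \<delta>A"
    using cone_in_side[OF T1(1) T0(1) comps(1)] by (elim exE conjE)
  obtain ZB WB MB \<iota>B sB rB rB' kB kB' \<delta>B where B: "ZB \<in> \<I>" "WB \<in> \<B>" "MB \<in> Y" "\<iota>B \<in> Hom \<C> B1 ZB" "sB \<in> Hom \<C> B1 WB"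
    "rB \<in> Hom \<C> WB B0" "kB \<in> Hom \<C> ZB WB" "kB' \<in> Hom \<C> B0 WB" "rB \<cdot> sB = q0 \<cdot> (\<tau> \<cdot> j1)"
    "sB = kB \<cdot> \<iota>B + kB' \<cdot> (q0 \<cdot> (\<tau> \<cdot> j1))" "etriangle \<C> B1 WB MB sB rB' \<delta>B"
    using cy_partition.cone_in_side[OF partition_sym T1(2) T0(2) comps(2)] by (elim exE conjE)
  obtain W m m' n n' where bpW: "biproduct \<C> WA WB W m m' n n'" using ex_biproduct by blast
  note w = bpW[unfolded biproduct_def]
  obtain N l l' r r' where bpN: "biproduct \<C> MA MB N l l' r r'" using ex_biproduct by blast
  let ?\<sigma> = "m \<cdot> sA \<cdot> p1 + m' \<cdot> sB \<cdot> q1"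
  have msA: "m \<cdot> sA \<cdot> p1 = m \<cdot> (sA \<cdot> p1)" "m' \<cdot> sB \<cdot> q1 = m' \<cdot> (sB \<cdot> q1)"
    using Comp_assoc[of p1 T1 A1 sA WA m W] Comp_assoc[of q1 T1 B1 sB WB m' W] b1 w A B by auto
  have "is_dsum \<C> N MA MB" using bpN by (auto simp: is_dsum_def)
  then have NXY: "N \<in> gen \<C> (X \<union> Y)"
    using subcategoryD(2)[OF gen_subcategory[of "X \<union> Y"], of N MA MB] A(3) B(3) gen_base[of "X \<union> Y"] by blast
  have XYU: "gen \<C> (X \<union> Y) \<subseteq> U"
    using gen_subset[OF perp_subcategory, of "X \<union> Y" \<I>] X_sub_U cy_partition.X_sub_U[OF partition_sym] by blast
  have NU: "N \<in> U" using NXY XYU by blast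
  have "push \<C> i1 (pull \<C> r \<delta>A) + push \<C> j1 (pull \<C> r' \<delta>B) \<in> Ext \<C> N T1"
    using bpN b1 etriangleD(3)[OF A(11)] etriangleD(3)[OF B(11)] unfolding biproduct_def
    by (intro Ext_add push_in_Ext[of _ A1 T1] push_in_Ext[of _ B1 T1] pull_in_Ext[of _ N MA] pull_in_Ext[of _ N MB]) auto
  then obtain y2 \<delta>2 where t2: "etriangle \<C> T1 W N ?\<sigma> y2 \<delta>2"
    using realize_dsum[OF A(11) B(11) bp1 bpW bpN] unfolding etriangle_def by blast
  note d2 = etriangleD[OF t2]
  \<comment> \<open>Extension along \<open>\<tau>\<close> and along \<open>\<sigma>\<close> is
    treated uniformly: the extendable morphisms are stable under sums, differences and left
    composition, and they include those factoring through \<open>\<I>\<close> because both cones lie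
    in \<open>U\<close>.\<close>
  define ext where "ext x Z D f \<longleftrightarrow> (\<exists>g\<in>Hom \<C> Z D. g \<cdot> x = f)" for x Z D f
  have ext_add: "ext x Z D (f + f')" if "x \<in> Hom \<C> T1 Z" "ext x Z D f" "ext x Z D f'" for x Z D f f'
    using that Comp_add_left[OF that(1)] Hom_add unfolding ext_def by metis
  have ext_diff: "ext x Z D (f - f')" if "x \<in> Hom \<C> T1 Z" "ext x Z D f" "ext x Z D f'" for x Z D f f'
    using that Comp_diff_left[OF that(1)] Hom_diff unfolding ext_def by metis
  have ext_comp: "ext x Z E (h \<cdot> f)" if "x \<in> Hom \<C> T1 Z" "ext x Z D f" "h \<in> Hom \<C> D E" for x Z D E f h
  proof -
    obtain g where g: "g \<in> Hom \<C> Z D" "g \<cdot> x = f" using \<open>ext x Z D f\<close> unfolding ext_def by blast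
    then have "(h \<cdot> g) \<cdot> x = h \<cdot> f" using Comp_assoc[OF that(1) g(1) that(3)] by simp
    then show ?thesis using Comp_in_Hom[OF g(1) that(3)] unfolding ext_def by blast
  qed
  have offA: "factors \<C> \<I> T1 B0 (q0 \<cdot> (\<tau> \<cdot> i1) \<cdot> p1)"
    using factors_right[OF factors_AB[OF T1(1) T0(2) comps(3)]] b1 by blast
  have offB: "factors \<C> \<I> T1 A0 (p0 \<cdot> (\<tau> \<cdot> j1) \<cdot> q1)"
    using factors_right[OF factors_BA[OF T0(1) T1(2) comps(4)]] b1 by blast
  have ext_\<tau>: "ext \<tau> T0 D f" if "factors \<C> \<I> T1 D f" for D f
    using factors_extend[OF t(3) M that] by (simp add: ext_def)
  have ext_\<sigma>: "ext ?\<sigma> W D f" if "factors \<C> \<I> T1 D f" for D f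
    using factors_extend[OF t2 NU that] by (simp add: ext_def)
  have \<tau>split: "\<tau> \<cdot> i1 \<cdot> p1 + \<tau> \<cdot> j1 \<cdot> q1 = \<tau>"
    using Comp_add_right[of "i1 \<cdot> p1" T1 T1 "j1 \<cdot> q1" \<tau> T0] Comp_assoc[of p1 T1 A1 i1 T1 \<tau> T0]
      Comp_assoc[of q1 T1 B1 j1 T1 \<tau> T0] b1 d Comp_Id_right[OF d(1)] Comp_in_Hom[of p1 T1 A1 i1 T1] Comp_in_Hom[of q1 T1 B1 j1 T1] by simp
  have g1: "\<tau> \<cdot> i1 \<cdot> p1 \<in> Hom \<C> T1 T0" "\<tau> \<cdot> j1 \<cdot> q1 \<in> Hom \<C> T1 T0" using ti b1 Comp_in_Hom by blast+
  have p0\<tau>: "p0 \<cdot> \<tau> = p0 \<cdot> (\<tau> \<cdot> i1) \<cdot> p1 + p0 \<cdot> (\<tau> \<cdot> j1) \<cdot> q1"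
    using Comp_add_right[OF g1, of p0 A0] \<tau>split Comp_assoc[of p1 T1 A1 "\<tau> \<cdot> i1" T0 p0 A0]
      Comp_assoc[of q1 T1 B1 "\<tau> \<cdot> j1" T0 p0 A0] b0 b1 ti by simp
  have q0\<tau>: "q0 \<cdot> \<tau> = q0 \<cdot> (\<tau> \<cdot> i1) \<cdot> p1 + q0 \<cdot> (\<tau> \<cdot> j1) \<cdot> q1"
    using Comp_add_right[OF g1, of q0 B0] \<tau>split Comp_assoc[of p1 T1 A1 "\<tau> \<cdot> i1" T0 q0 B0]
      Comp_assoc[of q1 T1 B1 "\<tau> \<cdot> j1" T0 q0 B0] b0 b1 ti by simp
  have id_\<tau>: "ext \<tau> T0 T0 \<tau>" unfolding ext_def using Id_in_Hom Comp_Id_left[OF d(1)] by blast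
  have id_\<sigma>: "ext ?\<sigma> W W ?\<sigma>" unfolding ext_def using Id_in_Hom Comp_Id_left[OF d2(1)] by blast
  have sAB: "sA \<cdot> p1 \<in> Hom \<C> T1 WA" "sB \<cdot> q1 \<in> Hom \<C> T1 WB" using A B b1 Comp_in_Hom by blast+
  have ms: "m \<cdot> (sA \<cdot> p1) \<in> Hom \<C> T1 W" "m' \<cdot> (sB \<cdot> q1) \<in> Hom \<C> T1 W" using sAB w Comp_in_Hom by blast+
  have n\<sigma>: "n \<cdot> ?\<sigma> = sA \<cdot> p1" "n' \<cdot> ?\<sigma> = sB \<cdot> q1"
    using Comp_add_right[OF ms, of n WA] Comp_add_right[OF ms, of n' WB] msA
      cancel_Id[of n m WA W "sA \<cdot> p1" T1] cancel_zero[of n m' WB W WA "sB \<cdot> q1" T1]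
      cancel_zero[of n' m WA W WB "sA \<cdot> p1" T1] cancel_Id[of n' m' WB W "sB \<cdot> q1" T1] sAB w by auto
  \<comment> \<open>\<open>sA\<close> is a morphism through \<open>\<I>\<close> plus the diagonal
    entry of \<open>\<tau>\<close> composed with \<open>kA'\<close>. After composition with
    \<open>p1\<close> the diagonal entry is \<open>p0 \<cdot> \<tau>\<close> minus an off-diagonal
    term, which factors through \<open>\<I>\<close>. The same holds for \<open>sB\<close>.\<close>
  have ext_\<tau>_\<sigma>: "ext \<tau> T0 W ?\<sigma>"
  proof -
    have "ext \<tau> T0 A0 (p0 \<cdot> \<tau> - p0 \<cdot> (\<tau> \<cdot> j1) \<cdot> q1)" using ext_diff[OF d(1) ext_comp[OF d(1) id_\<tau>] ext_\<tau>[OF offB]] b0 by blast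
    then have 1: "ext \<tau> T0 WA (kA' \<cdot> (p0 \<cdot> (\<tau> \<cdot> i1) \<cdot> p1))" using ext_comp[OF d(1) _ A(8)] p0\<tau> by simp
    have "ext \<tau> T0 B0 (q0 \<cdot> \<tau> - q0 \<cdot> (\<tau> \<cdot> i1) \<cdot> p1)" using ext_diff[OF d(1) ext_comp[OF d(1) id_\<tau>] ext_\<tau>[OF offA]] b0 by blast
    then have 2: "ext \<tau> T0 WB (kB' \<cdot> (q0 \<cdot> (\<tau> \<cdot> j1) \<cdot> q1))" using ext_comp[OF d(1) _ B(8)] q0\<tau> by simp
    have h: "kA \<cdot> \<iota>A \<in> Hom \<C> A1 WA" "kA' \<cdot> (p0 \<cdot> (\<tau> \<cdot> i1)) \<in> Hom \<C> A1 WA"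
      "kB \<cdot> \<iota>B \<in> Hom \<C> B1 WB" "kB' \<cdot> (q0 \<cdot> (\<tau> \<cdot> j1)) \<in> Hom \<C> B1 WB" using A B comps Comp_in_Hom by blast+
    have "factors \<C> \<I> A1 WA (kA \<cdot> \<iota>A)" "factors \<C> \<I> B1 WB (kB \<cdot> \<iota>B)" using A B unfolding factors_def by blast+
    then have 3: "ext \<tau> T0 WA (kA \<cdot> \<iota>A \<cdot> p1)" "ext \<tau> T0 WB (kB \<cdot> \<iota>B \<cdot> q1)" using ext_\<tau> factors_right b1 by blast+
    have "sA \<cdot> p1 = kA \<cdot> \<iota>A \<cdot> p1 + kA' \<cdot> (p0 \<cdot> (\<tau> \<cdot> i1) \<cdot> p1)"
      using Comp_add_left[of p1 T1 A1 _ WA, OF _ h(1,2)] A(10) b1 Comp_assoc[of p1 T1 A1 "p0 \<cdot> (\<tau> \<cdot> i1)" A0 kA' WA] comps A(8) by simp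
    moreover have "sB \<cdot> q1 = kB \<cdot> \<iota>B \<cdot> q1 + kB' \<cdot> (q0 \<cdot> (\<tau> \<cdot> j1) \<cdot> q1)"
      using Comp_add_left[of q1 T1 B1 _ WB, OF _ h(3,4)] B(10) b1 Comp_assoc[of q1 T1 B1 "q0 \<cdot> (\<tau> \<cdot> j1)" B0 kB' WB] comps B(8) by simp
    ultimately have "ext \<tau> T0 WA (sA \<cdot> p1)" "ext \<tau> T0 WB (sB \<cdot> q1)" using ext_add[OF d(1)] 1 2 3 by auto
    then have "ext \<tau> T0 W (m \<cdot> (sA \<cdot> p1) + m' \<cdot> (sB \<cdot> q1))" using ext_add[OF d(1)] ext_comp[OF d(1)] w by blast
    then show ?thesis using msA by simp
  qed
  have ext_\<sigma>_\<tau>: "ext ?\<sigma> W T0 \<tau>"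
  proof -
    have "ext ?\<sigma> W WA (sA \<cdot> p1)" "ext ?\<sigma> W WB (sB \<cdot> q1)" using ext_comp[OF d2(1) id_\<sigma>, of n WA] ext_comp[OF d2(1) id_\<sigma>, of n' WB] n\<sigma> w by auto
    then have "ext ?\<sigma> W A0 (rA \<cdot> (sA \<cdot> p1))" "ext ?\<sigma> W B0 (rB \<cdot> (sB \<cdot> q1))" using ext_comp[OF d2(1)] A(6) B(6) by blast+
    moreover have "rA \<cdot> (sA \<cdot> p1) = p0 \<cdot> (\<tau> \<cdot> i1) \<cdot> p1" "rB \<cdot> (sB \<cdot> q1) = q0 \<cdot> (\<tau> \<cdot> j1) \<cdot> q1"
      using Comp_assoc[of p1 T1 A1 sA WA rA A0] Comp_assoc[of q1 T1 B1 sB WB rB B0] A B b1 by auto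
    ultimately have "ext ?\<sigma> W A0 (p0 \<cdot> \<tau>)" "ext ?\<sigma> W B0 (q0 \<cdot> \<tau>)"
      using ext_add[OF d2(1)] ext_\<sigma>[OF offA] ext_\<sigma>[OF offB] p0\<tau> q0\<tau> by (simp_all add: add.commute)
    then have "ext ?\<sigma> W T0 (i0 \<cdot> (p0 \<cdot> \<tau>) + j0 \<cdot> (q0 \<cdot> \<tau>))" using ext_add[OF d2(1)] ext_comp[OF d2(1)] b0 by blast
    moreover have "i0 \<cdot> (p0 \<cdot> \<tau>) + j0 \<cdot> (q0 \<cdot> \<tau>) = \<tau>"
      using Comp_add_left[OF d(1), of "i0 \<cdot> p0" T0 "j0 \<cdot> q0"] Comp_assoc[OF d(1), of p0 A0 i0 T0] Comp_assoc[OF d(1), of q0 B0 j0 T0]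
        b0 Comp_Id_left[OF d(1)] Comp_in_Hom[of p0 T0 A0 i0 T0] Comp_in_Hom[of q0 T0 B0 j0 T0] by simp
    ultimately show ?thesis by simp
  qed
  \<comment> \<open>As \<open>\<tau>\<close> and \<open>\<sigma>\<close> factor through each other,
    (ET3) gives \<open>c\<close> and \<open>c'\<close> between the cones that pull the two classes
    back to each other. Then \<open>Id - c' \<cdot> c\<close> kills \<open>\<delta>\<close> and
    lifts to \<open>T0\<close>, so \<open>M\<close> lies in what \<open>T0\<close> and
    \<open>N\<close> generate.\<close>
  obtain \<beta> where \<beta>: "\<beta> \<in> Hom \<C> T0 W" "\<beta> \<cdot> \<tau> = ?\<sigma>" using ext_\<tau>_\<sigma> unfolding ext_def by blast
  obtain \<gamma> where \<gamma>: "\<gamma> \<in> Hom \<C> W T0" "\<gamma> \<cdot> ?\<sigma> = \<tau>" using ext_\<sigma>_\<tau> unfolding ext_def by blast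
  have "\<beta> \<cdot> \<tau> = ?\<sigma> \<cdot> Id \<C> T1" "\<gamma> \<cdot> ?\<sigma> = \<tau> \<cdot> Id \<C> T1" using \<beta> \<gamma> Comp_Id_right[OF d(1)] Comp_Id_right[OF d2(1)] by auto
  then obtain c c' where c: "c \<in> Hom \<C> M N" "push \<C> (Id \<C> T1) \<delta> = pull \<C> c \<delta>2" "c' \<in> Hom \<C> N M" "push \<C> (Id \<C> T1) \<delta>2 = pull \<C> c' \<delta>"
    using ET3[OF t(3) t2 Id_in_Hom \<beta>(1)] ET3[OF t2 t(3) Id_in_Hom \<gamma>(1)] by blast
  have cc: "c' \<cdot> c \<in> Hom \<C> M M" using Comp_in_Hom[OF c(1,3)] .
  have "pull \<C> (c' \<cdot> c) \<delta> = \<delta>" using pull_Comp[OF c(3,1) d(3)] c push_Id[OF d(3)] push_Id[OF d2(3)] by simp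
  then have "pull \<C> (Id \<C> M - c' \<cdot> c) \<delta> = 0" using pull_diff_Hom[OF Id_in_Hom cc d(3)] pull_Id[OF d(3)] by simp
  then obtain v where v: "v \<in> Hom \<C> M T0" "\<pi> \<cdot> v = Id \<C> M - c' \<cdot> c" using lift_iff[OF t(3) Hom_diff[OF Id_in_Hom cc]] by blast
  have "ideal \<C> {T0, N} M M (\<pi> \<cdot> v + c' \<cdot> c)" using v(1) d(2) c(1,3) by (intro ideal_add ideal_comp) auto
  then have "M \<in> gen \<C> {T0, N}" using v(2) by (simp add: gen_def)
  moreover have "T0 \<in> gen \<C> (X \<union> Y)"
    using subcategoryD(2)[OF gen_subcategory[of "X \<union> Y"] T0(3)] T0(1,2) A_sub_X cy_partition.A_sub_X[OF partition_sym] gen_base[of "X \<union> Y"] by blast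
  ultimately show ?thesis using gen_gen[of "{T0, N}" "X \<union> Y"] NXY by blast
qed

lemma cotorsion_from_partition: "cotorsion_pair \<C> X Y"
proof -
  have "M \<in> X \<or> M \<in> Y" if M: "M \<in> U" "loc M" for M
  proof -
    obtain Z where "Z \<in> X \<union> Y" "retract \<C> M Z" using loc_gen[OF M(2) U_gen[OF M(1)]] by blast
    then show ?thesis using retract_in[OF side_subcategory] by blast
  qed
  then have "cy_decomposition \<C> \<I> X Y"
    using X_sub_U cy_partition.X_sub_U[OF partition_sym] Ext_X_Y X_Y_core
    by (intro cy_decomposition.intro cy_decomposition_axioms.intro cy_core_axioms side_subcategory) blast+
  then show ?thesis by (rule cy_decomposition.cotorsion_pair)
qed

end

section \<open>Two-Calabi-Yau categories and cluster tilting objects\<close>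

context extriangulated_category
begin

lemma projective_iff: "projective \<C> P \<longleftrightarrow> (\<forall>W. Ext \<C> P W = {0})"
proof
  assume P: "projective \<C> P"
  have "\<epsilon> = 0" if e: "\<epsilon> \<in> Ext \<C> P W" for \<epsilon> W
  proof -
    obtain B x y where t: "etriangle \<C> W B P x y \<epsilon>" using ex_etriangle[OF e] by blast
    then have "\<exists>g\<in>Hom \<C> P B. y \<cdot> g = Id \<C> P" using P Id_in_Hom[of P] unfolding projective_def by blast
    then show ?thesis using lift_iff[OF t Id_in_Hom] pull_Id[OF e] by simp
  qed
  then show "\<forall>W. Ext \<C> P W = {0}" using Ext_zero by blast
next
  assume P: "\<forall>W. Ext \<C> P W = {0}"
  show "projective \<C> P"
    unfolding projective_def
  proof (intro allI impI ballI)
    fix A B C x y \<delta> f assume t: "etriangle \<C> A B C x y \<delta>" and f: "f \<in> Hom \<C> P C"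
    show "\<exists>g\<in>Hom \<C> P B. y \<cdot> g = f" using lift_iff[OF t f] pull_in_Ext[OF f etriangleD(3)[OF t]] P by simp
  qed
qed

lemma injective_opp: "injective \<C> J \<longleftrightarrow> projective (opp \<C>) J"
  unfolding injective_def projective_def by (simp add: etriangle_opp_eta) meson

lemma injective_iff: "injective \<C> J \<longleftrightarrow> (\<forall>W. Ext \<C> W J = {0})"
  using extriangulated_category.projective_iff[OF extriangulated_category_opp, of J] by (simp add: injective_opp)

end

text \<open>Separate from the Calabi-Yau condition, so that stability under \<open>opp\<close> is
  available without dualizing the pairing.\<close>

locale hom_finite_extriangulated_category = linear_extriangulated_category +
  assumes Hom_fin: "finite_dimensional (scaleH \<C>) (Hom \<C> A B)"
begin

sublocale VH: vector_space "scaleH \<C>"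
  by (rule vector_space_H)

lemma linear_opp: "linear_extriangulated_category (opp \<C>)"
  by (intro linear_extriangulated_category.intro linear_extriangulated_category_axioms.intro extriangulated_category_opp)
    (simp_all add: vector_space_H vector_space_E Hom_subspace Ext_subspace Comp_scale_left Comp_scale_right
      push_scale_Hom push_scale_Ext pull_scale_Hom pull_scale_Ext)

lemma hom_finite_opp: "hom_finite_extriangulated_category (opp \<C>)"
  by (intro hom_finite_extriangulated_category.intro hom_finite_extriangulated_category_axioms.intro linear_opp)
    (simp add: Hom_fin)

lemma Hom_scale: "f \<in> Hom \<C> A B \<Longrightarrow> scaleH \<C> r f \<in> Hom \<C> A B"
  using VH.subspace_scale[OF Hom_subspace] .

lemma Hom_basis: "\<exists>F. finite F \<and> F \<subseteq> Hom \<C> A B \<and> Hom \<C> A B = VH.span F"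
  using Hom_fin[of A B] VH.span_superset unfolding finite_dimensional_def by metis

text \<open>\<open>B\<close> is the direct sum of the sources of the morphisms in \<open>P\<close>,
  which are the components of \<open>f\<close>.\<close>

lemma ex_right_approx_finite:
  assumes "finite P" "\<And>g h. (g, h) \<in> P \<Longrightarrow> g \<in> G \<and> h \<in> Hom \<C> g M"
  shows "\<exists>B\<in>gen \<C> G. \<exists>f\<in>Hom \<C> B M. \<forall>(g, h)\<in>P. \<exists>k\<in>Hom \<C> g B. f \<cdot> k = h"
  using assms
proof (induction P rule: finite_induct)
  case empty
  obtain Z where "zero_object \<C> Z" using ex_zero_object by blast
  then show ?case using subcategoryD(1)[OF gen_subcategory] Hom_zero by fastforce
next
  case (insert gh P)
  obtain g0 h0 where gh: "gh = (g0, h0)" by (cases gh)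
  have gh0: "g0 \<in> G" "h0 \<in> Hom \<C> g0 M" using insert.prems[of g0 h0] gh by auto
  have "g \<in> G \<and> h \<in> Hom \<C> g M" if "(g, h) \<in> P" for g h using insert.prems[of g h] that by simp
  from insert.IH[OF this]
  obtain B f where B: "B \<in> gen \<C> G" "f \<in> Hom \<C> B M" "\<forall>(g, h)\<in>P. \<exists>k\<in>Hom \<C> g B. f \<cdot> k = h" by blast
  obtain S i j p q where bp: "biproduct \<C> B g0 S i j p q" using ex_biproduct by blast
  note b = bp[unfolded biproduct_def]
  have "is_dsum \<C> S B g0" using bp by (auto simp: is_dsum_def)
  moreover have "g0 \<in> gen \<C> G" using gen_base[of G] gh0 by blast
  ultimately have S: "S \<in> gen \<C> G" using subcategoryD(2)[OF gen_subcategory] B(1) by blast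
  have h: "f \<cdot> p \<in> Hom \<C> S M" "h0 \<cdot> q \<in> Hom \<C> S M" using B gh0 b Comp_in_Hom by blast+
  let ?f = "f \<cdot> p + h0 \<cdot> q"
  have fi: "?f \<cdot> i = f" "?f \<cdot> j = h0"
    using Comp_add_left[OF _ h, of i B] Comp_add_left[OF _ h, of j g0] Comp_assoc[of i B S p B f M] Comp_assoc[of i B S q g0 h0 M]
      Comp_assoc[of j g0 S p B f M] Comp_assoc[of j g0 S q g0 h0 M] b B gh0 Comp_Id_right[OF B(2)] Comp_Id_right[OF gh0(2)]
      Comp_zero_right[OF B(2)] Comp_zero_right[OF gh0(2)] by auto
  have "\<exists>k\<in>Hom \<C> g S. ?f \<cdot> k = h" if gP: "(g, h) \<in> insert gh P" for g h
  proof (cases "(g, h) = gh")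
    case True
    then show ?thesis using fi(2) b gh by blast
  next
    case False
    then have "(g, h) \<in> P" using gP by simp
    then obtain k where k: "k \<in> Hom \<C> g B" "f \<cdot> k = h" using B(3) by fast
    then have "?f \<cdot> (i \<cdot> k) = h" using Comp_assoc[OF k(1) _ Hom_add[OF h], of i] fi b by simp
    then show ?thesis using k b Comp_in_Hom by blast
  qed
  then have "\<forall>(g, h)\<in>insert gh P. \<exists>k\<in>Hom \<C> g S. ?f \<cdot> k = h" by auto
  then show ?case using S Hom_add[OF h] by blast
qed

text \<open>With finite spanning sets of the spaces \<open>Hom \<C> g M\<close> for
  \<open>P\<close>, lifts exist for linear combinations, then for all morphisms in the ideal of
  \<open>G\<close>, hence for all morphisms from objects of \<open>gen \<C> G\<close>.\<close>

lemma right_approx_gen: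
  assumes G: "finite G"
  shows "\<exists>B f. right_approx \<C> (gen \<C> G) M B f"
proof -
  obtain F where F: "\<And>g. finite (F g) \<and> F g \<subseteq> Hom \<C> g M \<and> Hom \<C> g M = VH.span (F g)" using Hom_basis[of _ M] by metis
  have fin: "finite (SIGMA g:G. F g)" using G F by blast
  have "g \<in> G \<and> h \<in> Hom \<C> g M" if "(g, h) \<in> (SIGMA g:G. F g)" for g h using that F by auto
  from ex_right_approx_finite[OF fin this]
  obtain B f where B: "B \<in> gen \<C> G" "f \<in> Hom \<C> B M" "\<forall>(g, h)\<in>(SIGMA g:G. F g). \<exists>k\<in>Hom \<C> g B. f \<cdot> k = h" by blast
  have all: "\<exists>k\<in>Hom \<C> g B. f \<cdot> k = h" if g: "g \<in> G" and h: "h \<in> Hom \<C> g M" for g h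
  proof -
    have "h \<in> VH.span (F g)" using F h by blast
    then show ?thesis
    proof (induction rule: VH.span_induct_alt)
      case base
      then show ?case using Hom_zero Comp_zero_right[OF B(2)] by blast
    next
      case (step c x y)
      have "(g, x) \<in> (SIGMA g:G. F g)" using step g by blast
      then have "\<exists>l\<in>Hom \<C> g B. f \<cdot> l = x" using B(3) by auto
      then obtain k l where kl: "l \<in> Hom \<C> g B" "f \<cdot> l = x" "k \<in> Hom \<C> g B" "f \<cdot> k = y" using step by blast
      have "f \<cdot> (scaleH \<C> c l + k) = scaleH \<C> c x + y"
        using Comp_add_right[OF Hom_scale[OF kl(1)] kl(3) B(2)] Comp_scale_right[OF kl(1) B(2)] kl by simp
      then show ?case using Hom_add[OF Hom_scale[OF kl(1)] kl(3)] by blast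
    qed
  qed
  have lift: "ideal \<C> G D M h \<Longrightarrow> \<exists>k\<in>Hom \<C> D B. f \<cdot> k = h" for D h
  proof (induction rule: ideal.induct)
    case ideal_zero
    then show ?case using Hom_zero Comp_zero_right[OF B(2)] by blast
  next
    case (ideal_comp Z g h)
    then obtain k where k: "k \<in> Hom \<C> Z B" "f \<cdot> k = h" using all by blast
    then show ?case using Comp_assoc[OF ideal_comp(2) k(1) B(2)] Comp_in_Hom[OF ideal_comp(2) k(1)] by auto
  next
    case (ideal_add f1 f2)
    then obtain k1 k2 where "k1 \<in> Hom \<C> D B" "f \<cdot> k1 = f1" "k2 \<in> Hom \<C> D B" "f \<cdot> k2 = f2" by blast
    then show ?case using Comp_add_right[of k1 D B k2 f M] B(2) Hom_add by blast
  qed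
  have "\<exists>k\<in>Hom \<C> D B. f \<cdot> k = h" if D: "D \<in> gen \<C> G" and h: "h \<in> Hom \<C> D M" for D h
  proof -
    have "ideal \<C> G D D (Id \<C> D)" using D by (simp add: gen_def)
    then have "ideal \<C> G D M h" using ideal_left[of G D D "Id \<C> D" h M] h Comp_Id_right[OF h] by simp
    then show ?thesis by (rule lift)
  qed
  then have "right_approx \<C> (gen \<C> G) M B f" using B(1,2) by (simp add: right_approx_def)
  then show ?thesis by blast
qed

lemma left_approx_gen: "finite G \<Longrightarrow> \<exists>B f. left_approx \<C> (gen \<C> G) M B f"
  using hom_finite_extriangulated_category.right_approx_gen[OF hom_finite_opp, of G M]
  by (simp add: right_approx_def left_approx_def)

end

context two_calabi_yau_category
begin

lemma hom_finite: "hom_finite_extriangulated_category \<C>"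
  by (intro hom_finite_extriangulated_category.intro hom_finite_extriangulated_category_axioms.intro
    linear_extriangulated_category_axioms Hom_finite)

text \<open>Injectivity of \<open>\<Phi>\<close> makes the pairing nondegenerate in its first
  argument, and bifunctoriality with an identity in one variable gives both transposition
  rules.\<close>

lemma two_cy_cy_category:
  assumes KS: "krull_schmidt \<C>" and ep: "enough_projectives \<C>" and ei: "enough_injectives \<C>"
  shows "cy_category \<C>"
proof -
  obtain \<Phi> :: "'o \<Rightarrow> 'o \<Rightarrow> 'e \<Rightarrow> 'e \<Rightarrow> 'k" where
    \<Phi>: "\<forall>A B. bij_betw (\<Phi> A B) (Ext \<C> A B) (dual_space (scaleE \<C>) (Ext \<C> B A))"
      "\<forall>A B. \<forall>\<delta>\<in>Ext \<C> A B. \<forall>\<delta>'\<in>Ext \<C> A B. \<forall>\<epsilon>\<in>Ext \<C> B A. \<Phi> A B (\<delta> + \<delta>') \<epsilon> = \<Phi> A B \<delta> \<epsilon> + \<Phi> A B \<delta>' \<epsilon>"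
      "\<forall>A A' B B'. \<forall>a\<in>Hom \<C> A' A. \<forall>b\<in>Hom \<C> B B'. \<forall>\<delta>\<in>Ext \<C> A B. \<forall>\<epsilon>\<in>Ext \<C> B' A'.
         \<Phi> A' B' (push \<C> b (pull \<C> a \<delta>)) \<epsilon> = \<Phi> A B \<delta> (push \<C> a (pull \<C> b \<epsilon>))"
    using duality by (elim exE conjE) (rule that)
  have bij: "bij_betw (\<Phi> A B) (Ext \<C> A B) (dual_space (scaleE \<C>) (Ext \<C> B A))" for A B
    using \<Phi>(1) by blast
  have add: "\<Phi> A B (\<delta> + \<delta>') \<epsilon> = \<Phi> A B \<delta> \<epsilon> + \<Phi> A B \<delta>' \<epsilon>"
    if "\<delta> \<in> Ext \<C> A B" "\<delta>' \<in> Ext \<C> A B" "\<epsilon> \<in> Ext \<C> B A" for A B \<delta> \<delta>' \<epsilon>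
    using \<Phi>(2) that by blast
  have nat: "\<Phi> A' B' (push \<C> b (pull \<C> a \<delta>)) \<epsilon> = \<Phi> A B \<delta> (push \<C> a (pull \<C> b \<epsilon>))"
    if "a \<in> Hom \<C> A' A" "b \<in> Hom \<C> B B'" "\<delta> \<in> Ext \<C> A B" "\<epsilon> \<in> Ext \<C> B' A'" for A A' B B' a b \<delta> \<epsilon>
    using \<Phi>(3) that by blast
  have dual: "\<Phi> A B \<delta> \<in> dual_space (scaleE \<C>) (Ext \<C> B A)" if "\<delta> \<in> Ext \<C> A B" for A B \<delta>
    using bij_betwE[OF bij] that by blast
  have zero: "\<Phi> A B \<delta> 0 = 0" if d: "\<delta> \<in> Ext \<C> A B" for A B \<delta>
    using dual[OF d] Ext_zero[of B A] unfolding dual_space_def by force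
  \<comment> \<open>Functionals are functions on the whole ambient group. Agreement with the
    functional of \<open>0\<close> is therefore also checked outside \<open>Ext \<C> B A\<close>,
    where both vanish by the convention in \<open>dual_space\<close>.\<close>
  have nondeg: "\<delta> = 0" if d: "\<delta> \<in> Ext \<C> A B" and z: "\<And>\<epsilon>. \<epsilon> \<in> Ext \<C> B A \<Longrightarrow> \<Phi> A B \<delta> \<epsilon> = 0" for A B \<delta>
  proof -
    have "\<Phi> A B \<delta> \<epsilon> = \<Phi> A B 0 \<epsilon>" for \<epsilon>
    proof (cases "\<epsilon> \<in> Ext \<C> B A")
      case True
      then have "\<Phi> A B 0 \<epsilon> = 0" using add[OF Ext_zero Ext_zero True] by (simp only: add_0_left add_cancel_right_right)
      then show ?thesis using z True by simp
    next
      case False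
      then show ?thesis using dual[OF d] dual[OF Ext_zero, of A B] by (simp add: dual_space_def)
    qed
    then have "\<Phi> A B \<delta> = \<Phi> A B 0" by blast
    then show ?thesis using bij_betw_imp_inj_on[OF bij] d Ext_zero by (meson inj_onD)
  qed
  show ?thesis
  proof (intro cy_category.intro cy_category_axioms.intro extriangulated_category_axioms)
    show "krull_schmidt_category \<C>"
      by (intro krull_schmidt_category.intro krull_schmidt_category_axioms.intro additive_category_axioms KS)
  next
    fix A B assume "Ext \<C> A B = {0}"
    then have "\<delta> = 0" if "\<delta> \<in> Ext \<C> B A" for \<delta> using nondeg[OF that] zero[OF that] by simp
    then show "Ext \<C> B A = {0}" using Ext_zero by blast
  next
    fix y X T W \<omega> assume y: "y \<in> Hom \<C> X T" and z: "\<And>\<epsilon>. \<epsilon> \<in> Ext \<C> T W \<Longrightarrow> pull \<C> y \<epsilon> = 0" and w: "\<omega> \<in> Ext \<C> W X"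
    show "push \<C> y \<omega> = 0"
    proof (rule nondeg[OF push_in_Ext[OF y w]])
      fix \<epsilon> assume e: "\<epsilon> \<in> Ext \<C> T W"
      show "\<Phi> W T (push \<C> y \<omega>) \<epsilon> = 0"
        using nat[OF Id_in_Hom y w e] pull_Id[OF w] z[OF e] push_zero[OF Id_in_Hom] zero[OF w] by simp
    qed
  next
    fix y X T W \<omega> assume y: "y \<in> Hom \<C> X T" and z: "\<And>\<epsilon>. \<epsilon> \<in> Ext \<C> W X \<Longrightarrow> push \<C> y \<epsilon> = 0" and w: "\<omega> \<in> Ext \<C> T W"
    show "pull \<C> y \<omega> = 0"
    proof (rule nondeg[OF pull_in_Ext[OF y w]])
      fix \<epsilon> assume e: "\<epsilon> \<in> Ext \<C> W X"
      show "\<Phi> X W (pull \<C> y \<omega>) \<epsilon> = 0"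
        using nat[OF y Id_in_Hom w e] push_Id[OF pull_in_Ext[OF y w]] pull_Id[OF e] z[OF e] zero[OF w] by simp
    qed
  next
    fix G M assume "finite (G :: 'o set)"
    then show "\<exists>B f. right_approx \<C> (gen \<C> G) M B f" "\<exists>B f. left_approx \<C> (gen \<C> G) M B f"
      using hom_finite_extriangulated_category.right_approx_gen[OF hom_finite]
        hom_finite_extriangulated_category.left_approx_gen[OF hom_finite] by blast+
  next
    fix M show "\<exists>A P x y \<delta>. (\<forall>W. Ext \<C> P W = {0}) \<and> etriangle \<C> A P M x y \<delta>"
      using ep unfolding enough_projectives_def projective_iff by blast
    show "\<exists>J C x y \<delta>. (\<forall>W. Ext \<C> W J = {0}) \<and> etriangle \<C> M J C x y \<delta>"
      using ei unfolding enough_injectives_def injective_iff by blast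
  qed
qed

end

context cy_category
begin

lemma add_closure_base: "S \<subseteq> add_closure \<C> S"
proof
  fix M assume M: "M \<in> S"
  obtain Z where Z: "zero_object \<C> Z" using ex_zero_object by blast
  have d: "is_dsum \<C> M M Z" using is_dsum_zero[OF Z iso_mor_Id] .
  then have "is_dsum_list \<C> M [M]" using Z by auto
  then show "M \<in> add_closure \<C> S" using M d unfolding add_closure_def by (intro CollectI exI[of _ "[M]"]) auto
qed

lemma add_closure_zero: "zero_object \<C> Z \<Longrightarrow> Z \<in> add_closure \<C> S"
  using is_dsum_zero[OF _ iso_mor_Id, of Z Z] unfolding add_closure_def by (intro CollectI exI[of _ "[]"]) auto

lemma add_closure_gen: "add_closure \<C> S \<subseteq> gen \<C> S"
proof
  fix A assume "A \<in> add_closure \<C> S"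
  then obtain Bs D B where A: "set Bs \<subseteq> S" "is_dsum_list \<C> D Bs" "is_dsum \<C> D A B" by (auto simp: add_closure_def)
  have "is_dsum_list \<C> D Bs \<Longrightarrow> set Bs \<subseteq> S \<Longrightarrow> D \<in> gen \<C> S" for D
  proof (induction Bs arbitrary: D)
    case Nil
    then show ?case using subcategoryD(1)[OF gen_subcategory] by simp
  next
    case (Cons M Bs)
    then obtain D' where D': "is_dsum_list \<C> D' Bs" "is_dsum \<C> D M D'" by auto
    then show ?case using Cons subcategoryD(2)[OF gen_subcategory D'(2)] gen_base[of S] by auto
  qed
  then show "A \<in> gen \<C> S" using A subcategoryD(3)[OF gen_subcategory] by blast
qed

lemma cluster_tilting_fin_tilting:
  assumes "cluster_tilting_object \<C> T"
  shows "fin_tilting \<C> (add_obj \<C> T)" "add_obj \<C> T = gen \<C> {T}"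
proof -
  have c: "subcategory \<C> (add_obj \<C> T)" "\<And>M. M \<in> add_obj \<C> T \<longleftrightarrow> Ext_vanish \<C> {M} (add_obj \<C> T)"
    using assms unfolding cluster_tilting_object_def cluster_tilting_def by auto
  show *: "add_obj \<C> T = gen \<C> {T}"
    using add_closure_gen[of "{T}"] gen_subset[OF c(1) add_closure_base] by blast
  then have "fin_gen \<C> (add_obj \<C> T)" unfolding fin_gen_def by (intro exI[of _ "{T}"]) simp
  moreover have "rigid \<C> (add_obj \<C> T)" using c(2) unfolding rigid_def Ext_vanish_def by blast
  moreover have "perp \<C> (add_obj \<C> T) \<subseteq> add_obj \<C> T" using c(2) unfolding perp_def Ext_vanish_def by blast
  ultimately show "fin_tilting \<C> (add_obj \<C> T)" by (simp add: fin_tilting_def)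
qed

lemma Proj_eq_ProjInj: "ProjInj \<C> = Proj \<C>"
proof -
  have "injective \<C> P" if "projective \<C> P" for P
    unfolding injective_iff
  proof
    fix W show "Ext \<C> W P = {0}" using that Ext_sym[of P W] by (simp add: projective_iff)
  qed
  then show ?thesis by (auto simp: ProjInj_def Proj_def Inj_def)
qed

end

section \<open>Radicals and Nakayama's lemma\<close>

text \<open>Signs and scalars are absorbed into the morphisms that make up the elements of
  \<open>X\<close>, so sums are all that is added.\<close>

inductive_set add_hull :: "'a::ab_group_add set \<Rightarrow> 'a set" for X where
  add_hull_zero: "0 \<in> add_hull X"
| add_hull_base: "x \<in> X \<Longrightarrow> x \<in> add_hull X"
| add_hull_add: "x \<in> add_hull X \<Longrightarrow> y \<in> add_hull X \<Longrightarrow> x + y \<in> add_hull X"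

lemma add_hull_mono: "X \<subseteq> Y \<Longrightarrow> add_hull X \<subseteq> add_hull Y"
proof
  fix x assume "X \<subseteq> Y" "x \<in> add_hull X"
  from this(2,1) show "x \<in> add_hull Y" by (induction rule: add_hull.induct) (auto intro: add_hull.intros)
qed

context additive_category
begin

lemma radicalD: "f \<in> radical \<C> A B \<Longrightarrow> f \<in> Hom \<C> A B"
  "f \<in> radical \<C> A B \<Longrightarrow> g \<in> Hom \<C> B A \<Longrightarrow> iso_mor \<C> A A (Id \<C> A - g \<cdot> f)"
  by (auto simp: radical_def)

text \<open>If \<open>u\<close> is inverse to \<open>Id - a \<cdot> b\<close>, then
  \<open>Id + b \<cdot> u \<cdot> a\<close> is inverse to \<open>Id - b \<cdot> a\<close>. This
  makes the radical, defined through one side, self-dual.\<close>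

lemma jacobson_swap:
  assumes a: "a \<in> Hom \<C> A B" and b: "b \<in> Hom \<C> B A" and iso: "iso_mor \<C> B B (Id \<C> B - a \<cdot> b)"
  shows "iso_mor \<C> A A (Id \<C> A - b \<cdot> a)"
proof -
  let ?x = "Id \<C> B - a \<cdot> b" and ?y = "Id \<C> A - b \<cdot> a"
  obtain u where u: "u \<in> Hom \<C> B B" "u \<cdot> ?x = Id \<C> B" "?x \<cdot> u = Id \<C> B" using iso by (auto simp: iso_mor_def)
  have h: "a \<cdot> b \<in> Hom \<C> B B" "b \<cdot> a \<in> Hom \<C> A A" "?x \<in> Hom \<C> B B" "?y \<in> Hom \<C> A A" "u \<cdot> a \<in> Hom \<C> A B" "b \<cdot> (u \<cdot> a) \<in> Hom \<C> A A"
    using a b u by (blast intro: hom_intros)+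
  have yb: "?y \<cdot> b = b \<cdot> ?x"
    using Comp_diff_left[OF b Id_in_Hom h(2)] Comp_diff_right[OF Id_in_Hom h(1) b] Comp_assoc[OF b a b] Comp_Id_left[OF b] Comp_Id_right[OF b] by simp
  have ay: "a \<cdot> ?y = ?x \<cdot> a"
    using Comp_diff_left[OF a Id_in_Hom h(1)] Comp_diff_right[OF Id_in_Hom h(2) a] Comp_assoc[OF a b a] Comp_Id_left[OF a] Comp_Id_right[OF a] by simp
  have "?y \<cdot> (b \<cdot> (u \<cdot> a)) = (b \<cdot> ?x) \<cdot> (u \<cdot> a)" using Comp_assoc[OF h(5) b h(4)] yb by simp
  also have "\<dots> = b \<cdot> (?x \<cdot> (u \<cdot> a))" using Comp_assoc[OF h(5,3) b] by simp
  also have "?x \<cdot> (u \<cdot> a) = a" using cancel_Id[OF u(3,1) h(3) a] .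
  finally have 1: "?y \<cdot> (b \<cdot> (u \<cdot> a)) = b \<cdot> a" .
  have bu: "b \<cdot> u \<in> Hom \<C> B A" using b u Comp_in_Hom by blast
  have "(b \<cdot> (u \<cdot> a)) \<cdot> ?y = b \<cdot> (u \<cdot> (a \<cdot> ?y))" using Comp_assoc[OF h(4,5) b] Comp_assoc[OF h(4) a u(1)] by simp
  also have "\<dots> = b \<cdot> a" using ay cancel_Id[OF u(2) h(3) u(1) a] by simp
  finally have 2: "(b \<cdot> (u \<cdot> a)) \<cdot> ?y = b \<cdot> a" .
  let ?v = "Id \<C> A + b \<cdot> (u \<cdot> a)"
  have v: "?v \<in> Hom \<C> A A" using Hom_add[OF Id_in_Hom h(6)] .
  have "?y \<cdot> ?v = Id \<C> A" using Comp_add_right[OF Id_in_Hom h(6,4)] 1 Comp_Id_right[OF h(4)] by simp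
  moreover have "?v \<cdot> ?y = Id \<C> A" using Comp_add_left[OF h(4) Id_in_Hom h(6)] 2 Comp_Id_left[OF h(4)] by simp
  ultimately show ?thesis unfolding iso_mor_def using h v by blast
qed

lemma radical_opp: "radical (opp \<C>) A B = radical \<C> B A"
proof (intro set_eqI iffI)
  fix f assume f: "f \<in> radical (opp \<C>) A B"
  then have "f \<in> Hom \<C> B A" "\<And>g. g \<in> Hom \<C> A B \<Longrightarrow> iso_mor \<C> A A (Id \<C> A - f \<cdot> g)" by (auto simp: radical_def)
  then show "f \<in> radical \<C> B A" using jacobson_swap[of f B A] by (auto simp: radical_def)
next
  fix f assume f: "f \<in> radical \<C> B A"
  then have "f \<in> Hom \<C> B A" "\<And>g. g \<in> Hom \<C> A B \<Longrightarrow> iso_mor \<C> B B (Id \<C> B - g \<cdot> f)" by (auto simp: radical_def)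
  then show "f \<in> radical (opp \<C>) A B" using jacobson_swap[of _ A B f] by (auto simp: radical_def)
qed

lemma radical_left:
  assumes f: "f \<in> radical \<C> A B" and h: "h \<in> Hom \<C> B D"
  shows "h \<cdot> f \<in> radical \<C> A D"
  unfolding radical_def
proof (intro CollectI conjI ballI)
  note fh = radicalD(1)[OF f]
  show "h \<cdot> f \<in> Hom \<C> A D" using Comp_in_Hom[OF fh h] .
  fix g assume g: "g \<in> Hom \<C> D A"
  show "iso_mor \<C> A A (Id \<C> A - g \<cdot> (h \<cdot> f))"
    using radicalD(2)[OF f Comp_in_Hom[OF h g]] Comp_assoc[OF fh h g] by simp
qed

lemma radical_right: "f \<in> radical \<C> A B \<Longrightarrow> k \<in> Hom \<C> D A \<Longrightarrow> f \<cdot> k \<in> radical \<C> D B"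
  using additive_category.radical_left[OF additive_category_opp, of f B A k D] by (simp add: radical_opp)

lemma radical_zero: "0 \<in> radical \<C> A B"
  unfolding radical_def using Hom_zero iso_mor_Id[of A] Comp_zero_right by fastforce

text \<open>With \<open>w\<close> the inverse of \<open>u = Id - g \<cdot> f\<close>, one has
  \<open>Id - g \<cdot> (f + f') = u \<cdot> (Id - (w \<cdot> g) \<cdot> f')\<close>, a composite of
  isomorphisms.\<close>

lemma radical_add:
  assumes f: "f \<in> radical \<C> A B" and f': "f' \<in> radical \<C> A B"
  shows "f + f' \<in> radical \<C> A B"
  unfolding radical_def
proof (intro CollectI conjI ballI)
  note h = radicalD(1)[OF f] radicalD(1)[OF f']
  show "f + f' \<in> Hom \<C> A B" using Hom_add h by blast
  fix g assume g: "g \<in> Hom \<C> B A"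
  let ?u = "Id \<C> A - g \<cdot> f"
  have iu: "iso_mor \<C> A A ?u" using radicalD(2)[OF f g] .
  then obtain w where w: "w \<in> Hom \<C> A A" "w \<cdot> ?u = Id \<C> A" "?u \<cdot> w = Id \<C> A" and u: "?u \<in> Hom \<C> A A" by (auto simp: iso_mor_def)
  have gf: "g \<cdot> f \<in> Hom \<C> A A" "g \<cdot> f' \<in> Hom \<C> A A" "w \<cdot> g \<in> Hom \<C> B A" using h g w Comp_in_Hom by blast+
  have wgf: "(w \<cdot> g) \<cdot> f' \<in> Hom \<C> A A" using gf h Comp_in_Hom by blast
  have "?u \<cdot> ((w \<cdot> g) \<cdot> f') = g \<cdot> f'" using Comp_assoc[OF h(2) g w(1)] cancel_Id[OF w(3) w(1) u gf(2)] by simp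
  then have "?u \<cdot> (Id \<C> A - (w \<cdot> g) \<cdot> f') = ?u - g \<cdot> f'"
    using Comp_diff_right[OF Id_in_Hom wgf u] Comp_Id_right[OF u] by simp
  also have "\<dots> = Id \<C> A - g \<cdot> (f + f')" using Comp_add_right[OF h g] by (simp add: algebra_simps)
  finally show "iso_mor \<C> A A (Id \<C> A - g \<cdot> (f + f'))"
    using iso_mor_comp[OF radicalD(2)[OF f' gf(3)] iu] by simp
qed

lemma loc_diff_iso:
  assumes "loc A" "x \<in> Hom \<C> A A" "\<not> iso_mor \<C> A A x"
  shows "iso_mor \<C> A A (Id \<C> A - x)"
proof -
  have "iso_mor \<C> A A (x + (Id \<C> A - x))" using iso_mor_Id by simp
  then show ?thesis using assms Hom_diff[OF Id_in_Hom assms(2)] unfolding local_endomorphism_ring_def by blast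
qed

lemma iso_comp_retract:
  assumes "g \<in> Hom \<C> A Z" "h \<in> Hom \<C> Z A" "iso_mor \<C> A A (h \<cdot> g)"
  shows "retract \<C> A Z"
proof -
  obtain k where k: "k \<in> Hom \<C> A A" "k \<cdot> (h \<cdot> g) = Id \<C> A" using assms(3) by (auto simp: iso_mor_def)
  then have "(k \<cdot> h) \<cdot> g = Id \<C> A" using Comp_assoc[OF assms(1,2) k(1)] by simp
  then show ?thesis unfolding retract_def using assms(1) Comp_in_Hom[OF assms(2) k(1)] by blast
qed

text \<open>If \<open>g \<cdot> f\<close> were invertible, \<open>A\<close> would be a retract of
  \<open>Z\<close>; so it is not, and locality makes \<open>Id - g \<cdot> f\<close>
  invertible.\<close>

lemma radical_from_loc:
  assumes A: "loc A" and r: "\<not> retract \<C> A Z" and f: "f \<in> Hom \<C> A Z"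
  shows "f \<in> radical \<C> A Z"
  unfolding radical_def
proof (intro CollectI conjI ballI f)
  fix g assume "g \<in> Hom \<C> Z A"
  then show "iso_mor \<C> A A (Id \<C> A - g \<cdot> f)" using loc_diff_iso[OF A] iso_comp_retract[OF f] r Comp_in_Hom[OF f] by blast
qed

lemma radical_to_loc: "loc B \<Longrightarrow> \<not> retract \<C> B Z \<Longrightarrow> f \<in> Hom \<C> Z B \<Longrightarrow> f \<in> radical \<C> Z B"
  using additive_category.radical_from_loc[OF additive_category_opp, of B Z f] by (simp add: radical_opp)

text \<open>
  Nakayama's lemma for the functor \<open>Hom(x, -)\<close> on a set \<open>B\<close> of objects: remove the elements of a
  finite generating set \<open>Z\<close> one by one.
\<close>

lemma nakayama:
  assumes "finite Z"
    and "\<And>y z. (y, z) \<in> Z \<Longrightarrow> y \<in> B \<and> z \<in> Hom \<C> x y"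
    and P0: "\<And>y. y \<in> B \<Longrightarrow> P y \<subseteq> Hom \<C> x y" "\<And>y. y \<in> B \<Longrightarrow> 0 \<in> P y"
      "\<And>y p p'. y \<in> B \<Longrightarrow> p \<in> P y \<Longrightarrow> p' \<in> P y \<Longrightarrow> p + p' \<in> P y"
    and P1: "\<And>y y' p h. y \<in> B \<Longrightarrow> y' \<in> B \<Longrightarrow> p \<in> P y \<Longrightarrow> h \<in> Hom \<C> y y' \<Longrightarrow> h \<cdot> p \<in> P y'"
    and rad: "\<And>y f. y \<in> B \<Longrightarrow> f \<in> Hom \<C> x y \<Longrightarrow>
      f \<in> add_hull (P y \<union> {j \<cdot> g | y' j g. y' \<in> B \<and> g \<in> Hom \<C> x y' \<and> j \<in> radical \<C> y' y})"
    and "\<And>y f. y \<in> B \<Longrightarrow> f \<in> Hom \<C> x y \<Longrightarrow>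
      f \<in> add_hull (P y \<union> {h \<cdot> z | y' z h. (y', z) \<in> Z \<and> h \<in> Hom \<C> y' y})"
    and "y \<in> B"
  shows "Hom \<C> x y \<subseteq> P y"
  using assms(1,2,8,9)
proof (induction Z arbitrary: y rule: finite_induct)
  case empty
  have "f \<in> P y" if "f \<in> add_hull (P y)" for f
    using that by (induction rule: add_hull.induct) (use P0 empty.prems(3) in auto)
  then show ?case using empty.prems(2)[OF empty.prems(3)] by simp blast
next
  case (insert yz Z)
  obtain y0 z0 where yz: "yz = (y0, z0)" by (cases yz)
  have y0: "y0 \<in> B" "z0 \<in> Hom \<C> x y0" using insert.prems(1)[of y0 z0] yz by auto
  \<comment> \<open>The submodule spanned by \<open>P\<close> and the generators other than
    \<open>z0\<close>.\<close>
  define M where "M y = add_hull (P y \<union> {h \<cdot> z | y' z h. (y', z) \<in> Z \<and> h \<in> Hom \<C> y' y})" for y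
  have Z: "y' \<in> B \<and> z \<in> Hom \<C> x y'" if "(y', z) \<in> Z" for y' z using insert.prems(1)[of y' z] that by simp
  have M_left: "h \<cdot> m \<in> M y'" and M_Hom: "m \<in> Hom \<C> x y"
    if "m \<in> M y" "y \<in> B" "y' \<in> B" "h \<in> Hom \<C> y y'" for m y y' h
  proof -
    have "h \<cdot> m \<in> M y' \<and> m \<in> Hom \<C> x y"
      using that(1) unfolding M_def
    proof (induction rule: add_hull.induct)
      case add_hull_zero
      then show ?case using Comp_zero_right[OF that(4)] Hom_zero add_hull.add_hull_zero by simp
    next
      case (add_hull_base m)
      then consider "m \<in> P y" | y2 z k where "m = k \<cdot> z" "(y2, z) \<in> Z" "k \<in> Hom \<C> y2 y" by blast
      then show ?case
      proof cases
        case 1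
        then show ?thesis using P1[OF that(2,3) 1 that(4)] P0(1)[OF that(2)] by (auto intro: add_hull.add_hull_base)
      next
        case 2
        have "h \<cdot> m = (h \<cdot> k) \<cdot> z" using Comp_assoc[of z x y2 k y h y'] 2 Z that(4) by simp
        moreover have "h \<cdot> k \<in> Hom \<C> y2 y'" using Comp_in_Hom[OF 2(3) that(4)] .
        ultimately have "h \<cdot> m \<in> P y' \<union> {h \<cdot> z | y2 z h. (y2, z) \<in> Z \<and> h \<in> Hom \<C> y2 y'}" using 2(2) by blast
        then show ?thesis using Comp_in_Hom[of z x y2 k y] 2 Z by (auto intro: add_hull.add_hull_base)
      qed
    next
      case (add_hull_add m m')
      then show ?case using Comp_add_right[of m x y m' h y'] that(4) Hom_add by (auto intro: add_hull.add_hull_add)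
    qed
    then show "h \<cdot> m \<in> M y'" "m \<in> Hom \<C> x y" by auto
  qed
  have M0: "0 \<in> M y" "m \<in> M y \<Longrightarrow> m' \<in> M y \<Longrightarrow> m + m' \<in> M y" "p \<in> P y \<Longrightarrow> p \<in> M y" for m m' p y
    unfolding M_def by (auto intro: add_hull.intros)
  \<comment> \<open>Membership in \<open>M y0\<close> up to a radical multiple of \<open>z0\<close>.
    A radical morphism into \<open>y0\<close> brings every morphism from \<open>x\<close> into this
    form, because the coefficient of \<open>z0\<close> becomes radical.\<close>
  let ?E = "\<lambda>f. \<exists>u\<in>M y0. \<exists>r\<in>radical \<C> y0 y0. f = u + r \<cdot> z0"
  have E0: "?E u" if "u \<in> M y0" for u
  proof -
    have "u = u + 0 \<cdot> z0" using Comp_zero_left[OF y0(2)] by simp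
    then show ?thesis using that radical_zero by blast
  qed
  have E_add: "?E (f + f')" if f: "?E f" and f': "?E f'" for f f'
  proof -
    obtain u r u' r' where e: "u \<in> M y0" "r \<in> radical \<C> y0 y0" "f = u + r \<cdot> z0" "u' \<in> M y0" "r' \<in> radical \<C> y0 y0" "f' = u' + r' \<cdot> z0"
      using f f' by blast
    have "f + f' = (u + u') + (r + r') \<cdot> z0"
      using Comp_add_left[OF y0(2) radicalD(1)[OF e(2)] radicalD(1)[OF e(5)]] e by (simp add: algebra_simps)
    then show ?thesis using M0(2)[OF e(1,4)] radical_add[OF e(2,5)] by blast
  qed
  have A: "?E (j \<cdot> m)" if m: "m \<in> Hom \<C> x y" and y: "y \<in> B" and j: "j \<in> radical \<C> y y0" for j m y
  proof -
    note jh = radicalD(1)[OF j]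
    have "?E (j \<cdot> m) \<and> m \<in> Hom \<C> x y"
      using insert.prems(2)[OF y m]
    proof (induction rule: add_hull.induct)
      case add_hull_zero
      show ?case using E0[OF M0(1)] Comp_zero_right[OF jh] Hom_zero by simp
    next
      case (add_hull_base m)
      then consider "m \<in> P y" | y2 z k where "m = k \<cdot> z" "(y2, z) \<in> Z" "k \<in> Hom \<C> y2 y" | k where "m = k \<cdot> z0" "k \<in> Hom \<C> y0 y"
        using yz by blast
      then show ?case
      proof cases
        case 1
        then have "?E (j \<cdot> m)" using E0[OF M0(3)[OF P1[OF y y0(1) 1 jh]]] by blast
        then show ?thesis using 1 P0(1)[OF y] by blast
      next
        case 2
        then have "m \<in> M y" unfolding M_def by (blast intro: add_hull.add_hull_base)
        then show ?thesis using E0[OF M_left[OF _ y y0(1) jh]] M_Hom[OF _ y y0(1) jh] by blast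
      next
        case 3
        have "j \<cdot> m = 0 + (j \<cdot> k) \<cdot> z0" using Comp_assoc[OF y0(2) 3(2) jh] 3(1) by simp
        moreover have "j \<cdot> k \<in> radical \<C> y0 y0" using radical_right[OF j 3(2)] .
        ultimately have "?E (j \<cdot> m)" using M0(1) by blast
        then show ?thesis using Comp_in_Hom[OF y0(2) 3(2)] 3(1) by simp
      qed
    next
      case (add_hull_add m m')
      then have "j \<cdot> (m + m') = j \<cdot> m + j \<cdot> m'" using Comp_add_right[of m x y m' j y0] jh by blast
      then show ?case using E_add[of "j \<cdot> m" "j \<cdot> m'"] add_hull_add Hom_add by presburger
    qed
    then show ?thesis by blast
  qed
  have "?E f" if "f \<in> add_hull (P y0 \<union> {j \<cdot> g | y' j g. y' \<in> B \<and> g \<in> Hom \<C> x y' \<and> j \<in> radical \<C> y' y0})" for f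
    using that
  proof (induction rule: add_hull.induct)
    case add_hull_zero
    show ?case using E0[OF M0(1)] .
  next
    case (add_hull_base f)
    then show ?case using E0[OF M0(3)] A by blast
  next
    case (add_hull_add f f')
    show ?case using E_add[OF add_hull_add.IH] .
  qed
  \<comment> \<open>\<open>Id - r\<close> is invertible for radical \<open>r\<close>, so the
    equation for \<open>z0\<close> places it in \<open>M y0\<close>: this generator is
    redundant.\<close>
  from this[OF rad[OF y0]] obtain u r where u: "u \<in> M y0" "r \<in> radical \<C> y0 y0" "z0 = u + r \<cdot> z0" by blast
  note rh = radicalD(1)[OF u(2)]
  have "iso_mor \<C> y0 y0 (Id \<C> y0 - r)" using radicalD(2)[OF u(2) Id_in_Hom] Comp_Id_left[OF rh] by simp
  then obtain w where w: "w \<in> Hom \<C> y0 y0" "w \<cdot> (Id \<C> y0 - r) = Id \<C> y0" by (auto simp: iso_mor_def)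
  have "(Id \<C> y0 - r) \<cdot> z0 = z0 - r \<cdot> z0" using Comp_diff_left[OF y0(2) Id_in_Hom rh] Comp_Id_left[OF y0(2)] by simp
  also have "\<dots> = u" using u(3) by (simp add: algebra_simps)
  finally have "z0 = w \<cdot> u"
    using cancel_Id[OF w(2) Hom_diff[OF Id_in_Hom rh] w(1) y0(2)] by simp
  then have z0: "z0 \<in> M y0" using M_left[OF u(1) y0(1) y0(1) w(1)] by simp
  have gens: "f \<in> M y" if y: "y \<in> B" and f: "f \<in> Hom \<C> x y" for y f
    using insert.prems(2)[OF y f]
  proof (induction rule: add_hull.induct)
    case add_hull_zero
    show ?case using M0(1) .
  next
    case (add_hull_base m)
    then consider "m \<in> P y" | y2 z k where "m = k \<cdot> z" "(y2, z) \<in> Z" "k \<in> Hom \<C> y2 y" | k where "m = k \<cdot> z0" "k \<in> Hom \<C> y0 y"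
      using yz by blast
    then show ?case
    proof cases
      case 1
      then show ?thesis using M0(3) by blast
    next
      case 2
      then show ?thesis unfolding M_def by (blast intro: add_hull.add_hull_base)
    next
      case 3
      then show ?thesis using M_left[OF z0 y0(1) y 3(2)] by simp
    qed
  next
    case (add_hull_add m m')
    show ?case using M0(2)[OF add_hull_add.IH] .
  qed
  show ?case using insert.IH[OF Z gens[unfolded M_def] insert.prems(3)] .
qed

end

context hom_finite_extriangulated_category
begin

lemma nakayama_finite:
  assumes B: "finite B"
    and P0: "\<And>y. y \<in> B \<Longrightarrow> P y \<subseteq> Hom \<C> x y" "\<And>y. y \<in> B \<Longrightarrow> 0 \<in> P y"
      "\<And>y p p'. y \<in> B \<Longrightarrow> p \<in> P y \<Longrightarrow> p' \<in> P y \<Longrightarrow> p + p' \<in> P y"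
    and P1: "\<And>y y' p h. y \<in> B \<Longrightarrow> y' \<in> B \<Longrightarrow> p \<in> P y \<Longrightarrow> h \<in> Hom \<C> y y' \<Longrightarrow> h \<cdot> p \<in> P y'"
    and rad: "\<And>y f. y \<in> B \<Longrightarrow> f \<in> Hom \<C> x y \<Longrightarrow>
      f \<in> add_hull (P y \<union> {j \<cdot> g | y' j g. y' \<in> B \<and> g \<in> Hom \<C> x y' \<and> j \<in> radical \<C> y' y})"
    and y: "y \<in> B"
  shows "Hom \<C> x y \<subseteq> P y"
proof -
  obtain F where F: "\<And>y. finite (F y) \<and> F y \<subseteq> Hom \<C> x y \<and> Hom \<C> x y = VH.span (F y)" using Hom_basis[of x] by metis
  have fin: "finite (SIGMA y:B. F y)" using B F by blast
  have F_in: "y \<in> B \<and> z \<in> Hom \<C> x y" if "(y, z) \<in> (SIGMA y:B. F y)" for y z using that F by auto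
  have gens: "f \<in> add_hull (P y \<union> {h \<cdot> z | y' z h. (y', z) \<in> (SIGMA y:B. F y) \<and> h \<in> Hom \<C> y' y})"
    if y: "y \<in> B" and f: "f \<in> Hom \<C> x y" for y f
  proof -
    have "f \<in> VH.span (F y)" using F f by blast
    then show ?thesis
    proof (induction rule: VH.span_induct_alt)
      case base
      show ?case by (rule add_hull_zero)
    next
      case (step c z g)
      have z: "z \<in> Hom \<C> x y" using F step(1) by blast
      have "scaleH \<C> c (Id \<C> y) \<cdot> z = scaleH \<C> c z"
        using Comp_scale_left[OF z Id_in_Hom] Comp_Id_left[OF z] by simp
      then have "scaleH \<C> c z \<in> {h \<cdot> z | y' z h. (y', z) \<in> (SIGMA y:B. F y) \<and> h \<in> Hom \<C> y' y}"
        using step(1) y Hom_scale[OF Id_in_Hom] by (intro CollectI exI[of _ y] exI[of _ z] exI[of _ "scaleH \<C> c (Id \<C> y)"]) auto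
      then show ?case using step(2) by (intro add_hull_add) (auto intro: add_hull_base)
    qed
  qed
  show ?thesis by (rule nakayama[OF fin, where B = B and P = P]) (fact F_in P0 P1 rad gens y)+
qed

text \<open>
  Both one-sided versions of Nakayama's lemma are applied in turn, the first one modulo the
  morphisms which start with a radical morphism within \<open>A\<close>.
\<close>

lemma nakayama_bimodule:
  assumes A: "finite A" and B: "finite B" and I: "subcategory \<C> \<I>"
    and hyp: "\<And>x y f. x \<in> A \<Longrightarrow> y \<in> B \<Longrightarrow> f \<in> Hom \<C> x y \<Longrightarrow>
      f \<in> add_hull ({f. factors \<C> \<I> x y f} \<union> {j \<cdot> g | y' j g. y' \<in> B \<and> g \<in> Hom \<C> x y' \<and> j \<in> radical \<C> y' y} \<union>
        {g \<cdot> j | x' j g. x' \<in> A \<and> j \<in> radical \<C> x x' \<and> g \<in> Hom \<C> x' y})"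
    and xy: "x \<in> A" "y \<in> B" "f \<in> Hom \<C> x y"
  shows "factors \<C> \<I> x y f"
proof -
  have fac0: "factors \<C> \<I> x y 0" for x y using ideal_factors[OF I ideal_zero] .
  have facH: "f \<in> Hom \<C> x y" if "factors \<C> \<I> x y f" for x y f using ideal_Hom[OF factors_ideal[OF that]] .
  define P where "P x y = add_hull ({f. factors \<C> \<I> x y f} \<union> {g \<cdot> j | x' j g. x' \<in> A \<and> j \<in> radical \<C> x x' \<and> g \<in> Hom \<C> x' y})" for x y
  have P: "Hom \<C> x y \<subseteq> P x y" if x: "x \<in> A" and y: "y \<in> B" for x y
  proof (rule nakayama_finite[OF B _ _ _ _ _ y, where P = "P x"])
    fix y assume y: "y \<in> B"
    have Pc: "h \<cdot> p \<in> P x y' \<and> p \<in> Hom \<C> x y" if "p \<in> P x y" "h \<in> Hom \<C> y y'" for p h y'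
      using that(1) unfolding P_def
    proof (induction rule: add_hull.induct)
      case add_hull_zero
      show ?case using Comp_zero_right[OF that(2)] Hom_zero add_hull.add_hull_zero by simp
    next
      case (add_hull_base p)
      then consider "factors \<C> \<I> x y p" | x' j g where "p = g \<cdot> j" "x' \<in> A" "j \<in> radical \<C> x x'" "g \<in> Hom \<C> x' y" by blast
      then show ?case
      proof cases
        case 1
        then show ?thesis using factors_left[OF 1 that(2)] facH by (auto intro: add_hull.add_hull_base)
      next
        case 2
        note jh = radicalD(1)[OF 2(3)]
        have "h \<cdot> p = (h \<cdot> g) \<cdot> j" using Comp_assoc[OF jh 2(4) that(2)] 2(1) by simp
        then have "h \<cdot> p \<in> {f. factors \<C> \<I> x y' f} \<union> {g \<cdot> j | x' j g. x' \<in> A \<and> j \<in> radical \<C> x x' \<and> g \<in> Hom \<C> x' y'}"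
          using 2(2,3) Comp_in_Hom[OF 2(4) that(2)] by blast
        then show ?thesis using Comp_in_Hom[OF jh 2(4)] 2(1) by (auto intro: add_hull.add_hull_base)
      qed
    next
      case (add_hull_add p p')
      then show ?case using Comp_add_right[of p x y p' h y'] that(2) Hom_add by (auto intro: add_hull.add_hull_add)
    qed
    show "P x y \<subseteq> Hom \<C> x y" using Pc[OF _ Id_in_Hom] by blast
    show "p + p' \<in> P x y" if "p \<in> P x y" "p' \<in> P x y" for p p'
      using that unfolding P_def by (auto intro: add_hull.intros)
    show "0 \<in> P x y" unfolding P_def by (rule add_hull_zero)
    show "h \<cdot> p \<in> P x y'" if "p \<in> P x y" "h \<in> Hom \<C> y y'" for y' p h using Pc[OF that] by blast
    fix f assume f: "f \<in> Hom \<C> x y"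
    show "f \<in> add_hull (P x y \<union> {j \<cdot> g | y' j g. y' \<in> B \<and> g \<in> Hom \<C> x y' \<and> j \<in> radical \<C> y' y})"
      using hyp[OF x y f]
    proof (induction rule: add_hull.induct)
      case (add_hull_base f)
      then have "f \<in> P x y \<or> f \<in> {j \<cdot> g | y' j g. y' \<in> B \<and> g \<in> Hom \<C> x y' \<and> j \<in> radical \<C> y' y}"
        unfolding P_def by (blast intro: add_hull.add_hull_base)
      then show ?case by (blast intro: add_hull.add_hull_base)
    qed (blast intro: add_hull.intros)+
  qed
  have "Hom (opp \<C>) y x \<subseteq> {f. factors \<C> \<I> x y f}"
  proof (rule hom_finite_extriangulated_category.nakayama_finite[OF hom_finite_opp A _ _ _ _ _ xy(1), where P = "\<lambda>x. {f. factors \<C> \<I> x y f}"])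
    fix x f assume x: "x \<in> A" and "f \<in> Hom (opp \<C>) y x"
    then have "f \<in> P x y" using P[OF x xy(2)] by auto
    then show "f \<in> add_hull ({f. factors \<C> \<I> x y f} \<union> {j \<cdot>\<^bsub>opp \<C>\<^esub> g | y' j g. y' \<in> A \<and> g \<in> Hom (opp \<C>) y y' \<and> j \<in> radical (opp \<C>) y' x})"
      unfolding P_def radical_opp opp_simps by (rule rev_subsetD) (rule add_hull_mono, blast)
  qed (use fac0 facH factors_add[OF I] factors_right in auto)
  then show ?thesis using xy by auto
qed

end
text \<open>A basis of \<open>V\<close> extends to one of \<open>W\<close>, which is finite because
  \<open>W\<close> lies in the span of a finite set; the dimensions leave no room for further
  elements. An inequality is assumed because \<open>irr_dim\<close> is a truncated difference of
  natural numbers.\<close>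

lemma (in vector_space) subspace_dim_diff_zero:
  assumes V: "subspace V" and W: "subspace W" "V \<subseteq> W" "W \<subseteq> span F" "finite F" and d: "dim W \<le> dim V"
  shows "W \<subseteq> V"
proof -
  obtain B where B: "B \<subseteq> V" "independent B" "V \<subseteq> span B" "card B = dim V" using basis_exists[of V] by blast
  obtain B' where B': "B \<subseteq> B'" "B' \<subseteq> W" "independent B'" "W \<subseteq> span B'"
    using maximal_independent_subset_extend[of B W] B W(2) by blast
  have "finite B'" using independent_span_bound[OF W(4) B'(3)] B'(2) W(3) by blast
  moreover have "card B' = dim W" using basis_card_eq_dim[OF B'(2,4,3)] .
  ultimately have "B = B'" using card_seteq[of B' B] B'(1) B(4) d by simp
  then have "W \<subseteq> span B" using B'(4) by simp
  then show ?thesis using span_minimal[OF B(1) V] by blast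
qed

context hom_finite_extriangulated_category
begin

lemma radical_subspace: "VH.subspace (radical \<C> A B)"
proof (rule VH.subspaceI)
  fix f r assume f: "f \<in> radical \<C> A B"
  note fh = radicalD(1)[OF f]
  have "f \<cdot> scaleH \<C> r (Id \<C> A) = scaleH \<C> r f" using Comp_scale_right[OF Id_in_Hom fh] Comp_Id_right[OF fh] by simp
  then show "scaleH \<C> r f \<in> radical \<C> A B" using radical_right[OF f Hom_scale[OF Id_in_Hom]] by metis
qed (simp_all add: radical_zero radical_add)

lemma radical2_subset: "radical2 \<C> S A B \<subseteq> radical \<C> A B"
  unfolding radical2_def
  by (rule VH.span_minimal[OF _ radical_subspace]) (use radical_left radicalD(1) in blast)

lemma irr_dim_zeroD:
  assumes "irr_dim \<C> S A B = 0"
  shows "radical \<C> A B = radical2 \<C> S A B"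
proof -
  obtain F where F: "finite F" "Hom \<C> A B = VH.span F" using Hom_basis by blast
  have "radical \<C> A B \<subseteq> VH.span F" using F radicalD(1) by blast
  then have "radical \<C> A B \<subseteq> radical2 \<C> S A B"
    using VH.subspace_dim_diff_zero[OF _ radical_subspace radical2_subset _ F(1)] assms
    by (simp add: irr_dim_def radical2_def VH.subspace_span)
  then show ?thesis using radical2_subset by blast
qed

end

section \<open>Arrows of quivers and morphisms modulo \<open>\<I>\<close>\<close>

locale cy_quiver = hom_finite_extriangulated_category \<C> + cy_core \<C> \<I>
  for \<C> :: "('k::field, 'o, 'm::ab_group_add, 'e::ab_group_add) extri_data" (structure) and \<I>
begin

lemma radical_from_factors:
  assumes A: "loc A" "A \<notin> \<I>" and f: "factors \<C> \<I> A B f"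
  shows "\<exists>Z\<in>\<I>. \<exists>g\<in>radical \<C> A Z. \<exists>h\<in>Hom \<C> Z B. f = h \<cdot> g"
  using f radical_from_loc[OF A(1)] retract_in[OF I_subcategory] A(2) unfolding factors_def by metis

lemma radical_to_factors:
  assumes B: "loc B" "B \<notin> \<I>" and f: "factors \<C> \<I> A B f"
  shows "\<exists>Z\<in>\<I>. \<exists>g\<in>Hom \<C> A Z. \<exists>h\<in>radical \<C> Z B. f = h \<cdot> g"
  using f radical_to_loc[OF B(1)] retract_in[OF I_subcategory] B(2) unfolding factors_def by metis

text \<open>A factorization through \<open>\<I>\<close> between local objects outside
  \<open>\<I>\<close> has both factors in the radical, because neither end is a retract of an object
  of \<open>\<I>\<close>.\<close>

lemma irr_dim_factors:
  assumes A: "loc A" "A \<notin> \<I>" and B: "loc B" "B \<notin> \<I>" and S: "\<I> \<subseteq> S"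
    and f: "\<And>f. f \<in> Hom \<C> A B \<Longrightarrow> factors \<C> \<I> A B f"
  shows "irr_dim \<C> S A B = 0"
proof -
  have "radical \<C> A B \<subseteq> radical2 \<C> S A B"
  proof
    fix f assume "f \<in> radical \<C> A B"
    then have "factors \<C> \<I> A B f" using assms radicalD(1) by blast
    then obtain Z g h where Z: "Z \<in> \<I>" "g \<in> Hom \<C> A Z" "h \<in> Hom \<C> Z B" "f = h \<cdot> g" unfolding factors_def by blast
    have "g \<in> radical \<C> A Z" using radical_from_loc[OF A(1) _ Z(2)] retract_in[OF I_subcategory Z(1)] A(2) by blast
    moreover have "h \<in> radical \<C> Z B" using radical_to_loc[OF B(1) _ Z(3)] retract_in[OF I_subcategory Z(1)] B(2) by blast
    ultimately show "f \<in> radical2 \<C> S A B" unfolding radical2_def using Z S by (intro VH.span_base) blast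
  qed
  then have "radical \<C> A B = radical2 \<C> S A B" using radical2_subset by blast
  then show ?thesis by (simp add: irr_dim_def)
qed

text \<open>A composite through a local object \<open>L\<close> outside \<open>P\<close> can be
  rerouted through \<open>\<I> \<subseteq> P\<close>. When morphisms from \<open>A\<close> to
  \<open>L\<close> factor through \<open>\<I>\<close>, the new first factor is radical because
  \<open>A\<close> is local and outside \<open>\<I>\<close>, and the new second factor is radical as
  a composite with a radical one; dually for \<open>B\<close>. So arrows may be counted in the
  smaller subcategory.\<close>

lemma radical2_restrict:
  assumes P: "P \<subseteq> \<T>" "\<I> \<subseteq> P" and T: "subcategory \<C> \<T>"
    and L: "\<And>L. L \<in> \<T> \<Longrightarrow> loc L \<Longrightarrow> L \<in> P \<or>
      (loc A \<and> A \<notin> \<I> \<and> (\<forall>f\<in>Hom \<C> A L. factors \<C> \<I> A L f)) \<or> (loc B \<and> B \<notin> \<I> \<and> (\<forall>f\<in>Hom \<C> L B. factors \<C> \<I> L B f))"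
  shows "radical2 \<C> P A B = radical2 \<C> \<T> A B"
proof
  let ?G = "\<lambda>S. {g \<cdot> f | g f. \<exists>M\<in>S. f \<in> radical \<C> A M \<and> g \<in> radical \<C> M B}"
  show "radical2 \<C> P A B \<subseteq> radical2 \<C> \<T> A B" unfolding radical2_def using P(1) by (intro VH.span_mono) blast
  have one: "g \<cdot> (k \<cdot> f) \<in> VH.span (?G P)"
    if f: "f \<in> radical \<C> A M" and g: "g \<in> radical \<C> M B" and k: "ideal \<C> {L \<in> \<T>. loc L} M M k" for f g M k
    using k
  proof (induction rule: ideal.induct)
    case ideal_zero
    show ?case using Comp_zero_left[OF radicalD(1)[OF f]] Comp_zero_right[OF radicalD(1)[OF g]] VH.span_zero by simp
  next
    case (ideal_comp L k h)
    have kf: "k \<cdot> f \<in> radical \<C> A L" using radical_left[OF f ideal_comp(2)] .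
    have gh: "g \<cdot> h \<in> radical \<C> L B" using radical_right[OF g ideal_comp(3)] .
    have e: "g \<cdot> (h \<cdot> k \<cdot> f) = (g \<cdot> h) \<cdot> (k \<cdot> f)"
      using Comp_assoc[OF radicalD(1)[OF f] ideal_comp(2,3)] Comp_assoc[OF radicalD(1)[OF kf] ideal_comp(3) radicalD(1)[OF g]] by simp
    consider "L \<in> P" | "loc A" "A \<notin> \<I>" "factors \<C> \<I> A L (k \<cdot> f)" | "loc B" "B \<notin> \<I>" "factors \<C> \<I> L B (g \<cdot> h)"
      using L[of L] ideal_comp(1) radicalD(1)[OF kf] radicalD(1)[OF gh] by blast
    then have "(g \<cdot> h) \<cdot> (k \<cdot> f) \<in> ?G P"
    proof cases
      case 1
      then show ?thesis using kf gh by blast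
    next
      case 2
      obtain Z u v where Z: "Z \<in> \<I>" "u \<in> radical \<C> A Z" "v \<in> Hom \<C> Z L" "k \<cdot> f = v \<cdot> u" using radical_from_factors[OF 2] by blast
      have "(g \<cdot> h) \<cdot> (k \<cdot> f) = ((g \<cdot> h) \<cdot> v) \<cdot> u" using Comp_assoc[OF radicalD(1)[OF Z(2)] Z(3) radicalD(1)[OF gh]] Z(4) by simp
      then show ?thesis using Z(1,2) radical_right[OF gh Z(3)] P(2) by blast
    next
      case 3
      obtain Z u v where Z: "Z \<in> \<I>" "u \<in> Hom \<C> L Z" "v \<in> radical \<C> Z B" "g \<cdot> h = v \<cdot> u" using radical_to_factors[OF 3] by blast
      have "(g \<cdot> h) \<cdot> (k \<cdot> f) = v \<cdot> (u \<cdot> (k \<cdot> f))" using Comp_assoc[OF radicalD(1)[OF kf] Z(2) radicalD(1)[OF Z(3)]] Z(4) by simp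
      then show ?thesis using Z(1,3) radical_left[OF kf Z(2)] P(2) by blast
    qed
    then show ?case unfolding e by (rule VH.span_base)
  next
    case (ideal_add k k')
    have h: "k \<in> Hom \<C> M M" "k' \<in> Hom \<C> M M" using ideal_add(1,2) ideal_Hom by auto
    note fh = radicalD(1)[OF f] and gh = radicalD(1)[OF g]
    have "g \<cdot> ((k + k') \<cdot> f) = g \<cdot> (k \<cdot> f) + g \<cdot> (k' \<cdot> f)"
      using Comp_add_left[OF fh h] Comp_add_right[OF Comp_in_Hom[OF fh h(1)] Comp_in_Hom[OF fh h(2)] gh] by simp
    then show ?case using VH.span_add[OF ideal_add.IH] by simp
  qed
  show "radical2 \<C> \<T> A B \<subseteq> radical2 \<C> P A B"
    unfolding radical2_def
  proof (rule VH.span_minimal[OF _ VH.subspace_span], rule subsetI)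
    fix w assume "w \<in> ?G \<T>"
    then obtain g f M where w: "w = g \<cdot> f" "M \<in> \<T>" "f \<in> radical \<C> A M" "g \<in> radical \<C> M B" by blast
    have "ideal \<C> {L \<in> \<T>. loc L} M M (Id \<C> M)" using subcategory_loc_ideal[OF T w(2)] by (simp add: gen_def)
    then show "w \<in> VH.span (?G P)" using one[OF w(3,4), of "Id \<C> M"] Comp_Id_left[OF radicalD(1)[OF w(3)]] w(1) by simp
  qed
qed

text \<open>Objects of \<open>A\<close> and \<open>B\<close> are not isomorphic, so all morphisms
  between them are radical; without arrows they are combinations of composites of two radical
  morphisms. The object in between splits into generators: one in \<open>\<I>\<close> gives a
  factorization, one in \<open>A\<close> a radical first factor within \<open>A\<close>, one in
  \<open>B\<close> a radical second factor within \<open>B\<close>. This is the hypothesis of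
  \<open>nakayama_bimodule\<close>.\<close>

lemma factors_of_irr_dim:
  assumes H: "finite H" "\<forall>L\<in>H. loc L" and AB: "A \<subseteq> H" "B \<subseteq> H" "H \<subseteq> A \<union> B \<union> \<I>"
    and r: "\<And>x y. x \<in> A \<Longrightarrow> y \<in> B \<Longrightarrow> \<not> isomorphic \<C> x y"
    and irr: "\<And>x y. x \<in> A \<Longrightarrow> y \<in> B \<Longrightarrow> irr_dim \<C> (gen \<C> H) x y = 0"
    and xy: "x \<in> A" "y \<in> B" "f \<in> Hom \<C> x y"
  shows "factors \<C> \<I> x y f"
proof (rule nakayama_bimodule[OF _ _ I_subcategory _ xy])
  show "finite A" "finite B" using finite_subset[OF AB(1) H(1)] finite_subset[OF AB(2) H(1)] by auto
  fix x y f assume x: "x \<in> A" and y: "y \<in> B" and f: "f \<in> Hom \<C> x y"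
  let ?X = "{f. factors \<C> \<I> x y f} \<union> {j \<cdot> g | y' j g. y' \<in> B \<and> g \<in> Hom \<C> x y' \<and> j \<in> radical \<C> y' y} \<union>
    {g \<cdot> j | x' j g. x' \<in> A \<and> j \<in> radical \<C> x x' \<and> g \<in> Hom \<C> x' y}"
  let ?G = "{g \<cdot> f | g f. \<exists>M\<in>gen \<C> H. f \<in> radical \<C> x M \<and> g \<in> radical \<C> M y}"
  have lx: "loc x" and ly: "loc y" using x y AB H(2) by auto
  have "\<not> retract \<C> x y" using r[OF x y] retract_loc_isomorphic[OF _ ly zero_object_not_loc[OF lx]] by blast
  then have "f \<in> radical \<C> x y" using radical_from_loc[OF lx _ f] by blast
  then have "f \<in> VH.span ?G" using irr_dim_zeroD[OF irr[OF x y]] by (simp add: radical2_def)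
  then show "f \<in> add_hull ?X"
  proof (induction rule: VH.span_induct_alt)
    case base
    show ?case by (rule add_hull_zero)
  next
    case (step c w v)
    obtain g f M where w: "w = g \<cdot> f" "M \<in> gen \<C> H" "f \<in> radical \<C> x M" "g \<in> radical \<C> M y" using step(1) by blast
    note fh = radicalD(1)[OF w(3)] and gh = radicalD(1)[OF w(4)]
    have one: "scaleH \<C> c (g \<cdot> (k \<cdot> f)) \<in> add_hull ?X" if "ideal \<C> H M M k" for k
      using that
    proof (induction rule: ideal.induct)
      case ideal_zero
      show ?case using Comp_zero_left[OF fh] Comp_zero_right[OF gh] add_hull_zero by simp
    next
      case (ideal_comp L k h)
      let ?g = "scaleH \<C> c (g \<cdot> h)"
      have kf: "k \<cdot> f \<in> radical \<C> x L" using radical_left[OF w(3) ideal_comp(2)] .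
      have gr: "g \<cdot> h \<in> radical \<C> L y" using radical_right[OF w(4) ideal_comp(3)] .
      then have gr': "?g \<in> radical \<C> L y" using VH.subspace_scale[OF radical_subspace] by blast
      note h = radicalD(1)[OF kf] radicalD(1)[OF gr']
      have "g \<cdot> (h \<cdot> k \<cdot> f) = (g \<cdot> h) \<cdot> (k \<cdot> f)"
        using Comp_assoc[OF fh ideal_comp(2,3)] Comp_assoc[OF h(1) ideal_comp(3) gh] by simp
      then have e: "scaleH \<C> c (g \<cdot> (h \<cdot> k \<cdot> f)) = ?g \<cdot> (k \<cdot> f)"
        using Comp_scale_left[OF h(1) radicalD(1)[OF gr]] by simp
      consider "L \<in> \<I>" | "L \<in> A" | "L \<in> B" using ideal_comp(1) AB(3) by blast
      then have "?g \<cdot> (k \<cdot> f) \<in> ?X"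
      proof cases
        case 1
        then show ?thesis using h unfolding factors_def by blast
      next
        case 2
        then show ?thesis using h kf by blast
      next
        case 3
        then show ?thesis using h gr' by blast
      qed
      then show ?case unfolding e by (rule add_hull_base)
    next
      case (ideal_add k k')
      have h: "k \<in> Hom \<C> M M" "k' \<in> Hom \<C> M M" using ideal_add(1,2) ideal_Hom by auto
      have "g \<cdot> ((k + k') \<cdot> f) = g \<cdot> (k \<cdot> f) + g \<cdot> (k' \<cdot> f)"
        using Comp_add_left[OF fh h] Comp_add_right[OF Comp_in_Hom[OF fh h(1)] Comp_in_Hom[OF fh h(2)] gh] by simp
      then show ?case using add_hull_add[OF ideal_add.IH] by (simp add: VH.scale_right_distrib)
    qed
    have "ideal \<C> H M M (Id \<C> M)" using w(2) by (simp add: gen_def)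
    then have "scaleH \<C> c w \<in> add_hull ?X" using one[of "Id \<C> M"] Comp_Id_left[OF fh] w(1) by simp
    then show ?case using step(2) by (rule add_hull_add)
  qed
qed

lemma factors_gen:
  assumes GH: "\<And>x y f. x \<in> G \<Longrightarrow> y \<in> H \<Longrightarrow> f \<in> Hom \<C> x y \<Longrightarrow> factors \<C> \<I> x y f"
    and A: "A \<in> gen \<C> G" and B: "B \<in> gen \<C> H" and f: "f \<in> Hom \<C> A B"
  shows "factors \<C> \<I> A B f"
proof -
  have 1: "factors \<C> \<I> x B f" if x: "x \<in> G" and f: "f \<in> Hom \<C> x B" for x f
  proof -
    have "factors \<C> \<I> x B (k \<cdot> f)" if "ideal \<C> H B B k" for k
      using that
    proof (induction rule: ideal.induct)
      case ideal_zero
      show ?case using Comp_zero_left[OF f] ideal_factors[OF I_subcategory ideal.ideal_zero] by simp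
    next
      case (ideal_comp Z g h)
      have "factors \<C> \<I> x B (h \<cdot> (g \<cdot> f))" using factors_left[OF GH[OF x ideal_comp(1) Comp_in_Hom[OF f ideal_comp(2)]] ideal_comp(3)] .
      then show ?case using Comp_assoc[OF f ideal_comp(2,3)] by simp
    next
      case (ideal_add k k')
      then show ?case using Comp_add_left[of f x B k B k'] f ideal_Hom factors_add[OF I_subcategory] by simp
    qed
    from this[of "Id \<C> B"] show ?thesis using B Comp_Id_left[OF f] by (simp add: gen_def)
  qed
  have "factors \<C> \<I> A B (f \<cdot> k)" if "ideal \<C> G A A k" for k
    using that
  proof (induction rule: ideal.induct)
    case ideal_zero
    show ?case using Comp_zero_right[OF f] ideal_factors[OF I_subcategory ideal.ideal_zero] by simp
  next
    case (ideal_comp Z g h)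
    have "factors \<C> \<I> A B ((f \<cdot> h) \<cdot> g)" using factors_right[OF 1[OF ideal_comp(1) Comp_in_Hom[OF ideal_comp(3) f]] ideal_comp(2)] .
    then show ?case using Comp_assoc[OF ideal_comp(2,3) f] by simp
  next
    case (ideal_add k k')
    then show ?case using Comp_add_right[of k A A k' f B] f ideal_Hom factors_add[OF I_subcategory] by simp
  qed
  from this[of "Id \<C> A"] show ?thesis using A Comp_Id_right[OF f] by (simp add: gen_def)
qed

end

section \<open>Complete pairs as separated partitions\<close>

text \<open>The form taken by a gluing of components with coefficient set \<open>V\<close>, written
  in terms of \<open>Q\<close> itself in order to avoid the sum in \<open>glue\<close>.\<close>

definition restrict_quiver :: "'v ice_quiver \<Rightarrow> 'v set \<Rightarrow> 'v set \<Rightarrow> 'v ice_quiver" where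
  "restrict_quiver Q V E = \<lparr>exch = E, frozen = V,
     arr = (\<lambda>i j. if i \<in> E \<union> V \<and> j \<in> E \<union> V \<and> \<not> (i \<in> V \<and> j \<in> V) then arr Q i j else 0)\<rparr>"

definition separated :: "'v ice_quiver \<Rightarrow> 'v set \<Rightarrow> 'v set \<Rightarrow> bool" where
  "separated Q E E' \<longleftrightarrow> (\<forall>i\<in>E. \<forall>j\<in>E'. arr Q i j = 0 \<and> arr Q j i = 0)"

locale freezing =
  fixes Q :: "'v ice_quiver" and W :: "'v set"
  assumes disjoint: "exch Q \<inter> frozen Q = {}"
    and support: "arr Q i j \<noteq> 0 \<Longrightarrow> i \<in> vertices Q \<and> j \<in> vertices Q"
    and W_exch: "W \<subseteq> exch Q"
begin

abbreviation "V \<equiv> frozen Q \<union> W"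
abbreviation "X \<equiv> exch Q - W"
abbreviation "Qf \<equiv> freeze Q W"
abbreviation "R \<equiv> {(i, j). i \<in> X \<and> j \<in> X \<and> (arr Qf i j \<noteq> 0 \<or> arr Qf j i \<noteq> 0)}"

lemma Qf_simps: "exch Qf = X" "frozen Qf = V" "arr Qf i j = (if i \<in> V \<and> j \<in> V then 0 else arr Q i j)"
  by (simp_all add: freeze_def)

lemma X_V: "X \<inter> V = {}"
  using disjoint W_exch by auto

lemma arr_Qf: "arr Qf i j \<noteq> 0 \<Longrightarrow> i \<in> X \<union> V \<and> j \<in> X \<union> V \<and> (i \<in> X \<or> j \<in> X)"
  using support[of i j] by (auto simp: Qf_simps vertices_def split: if_splits)

lemma arr_Qf_X: "i \<in> X \<or> j \<in> X \<Longrightarrow> arr Qf i j = arr Q i j"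
  using X_V by (auto simp: Qf_simps)

lemma component: "K \<in> exch_components Qf \<longleftrightarrow> (\<exists>i\<in>X. K = R\<^sup>* `` {i})"
  by (auto simp: exch_components_def quotient_def Qf_simps(1))

lemma sym_R: "sym (R\<^sup>*)"
  by (rule sym_rtrancl) (auto simp: sym_def)

lemma component_sub: assumes "K \<in> exch_components Qf" shows "K \<subseteq> X"
proof
  fix j assume j: "j \<in> K"
  obtain i where i: "i \<in> X" "K = R\<^sup>* `` {i}" using assms component by blast
  then have "(i, j) \<in> R\<^sup>*" using j by simp
  then show "j \<in> X" by (induction rule: rtrancl_induct) (use i in auto)
qed

lemma component_eq:
  assumes K: "K \<in> exch_components Qf" and i: "i \<in> K"
  shows "K = R\<^sup>* `` {i}"
proof -
  obtain k where k: "K = R\<^sup>* `` {k}" using K component by blast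
  then have ki: "(k, i) \<in> R\<^sup>*" using i by simp
  then have ik: "(i, k) \<in> R\<^sup>*" using sym_R by (meson symD)
  show ?thesis using k ki ik rtrancl_trans by fast
qed

lemma component_closed:
  assumes K: "K \<in> exch_components Qf" and i: "i \<in> K" and j: "j \<in> X" "arr Qf i j \<noteq> 0 \<or> arr Qf j i \<noteq> 0"
  shows "j \<in> K"
proof -
  have "(i, j) \<in> R" using component_sub[OF K] i j by blast
  then show ?thesis using component_eq[OF K i] by blast
qed

lemma component_at_simps:
  "exch (component_at Qf K) = K"
  "frozen (component_at Qf K) = {v \<in> V. \<exists>i\<in>K. arr Qf i v \<noteq> 0 \<or> arr Qf v i \<noteq> 0}"
  "arr (component_at Qf K) i j =
    (if i \<in> K \<union> frozen (component_at Qf K) \<and> j \<in> K \<union> frozen (component_at Qf K) then arr Qf i j else 0)"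
  by (simp_all add: component_at_def Let_def Qf_simps)

lemma arr_component_at:
  assumes K: "K \<in> exch_components Qf" and nz: "arr (component_at Qf K) i j \<noteq> 0"
  shows "arr Qf i j \<noteq> 0 \<and> (i \<in> K \<or> i \<in> V) \<and> (j \<in> K \<or> j \<in> V)"
  using nz by (auto simp: component_at_simps(3) component_at_simps(2) split: if_splits)

lemma arr_component_at_in:
  assumes K: "K \<in> exch_components Qf" and nz: "arr Qf i j \<noteq> 0" and ij: "i \<in> K \<or> j \<in> K"
  shows "arr (component_at Qf K) i j = arr Qf i j" "i \<in> K \<union> V" "j \<in> K \<union> V"
proof -
  have "i \<in> K \<union> frozen (component_at Qf K) \<and> j \<in> K \<union> frozen (component_at Qf K)"
    using ij
  proof
    assume i: "i \<in> K"
    have "j \<in> X \<or> j \<in> V" using arr_Qf[OF nz] by blast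
    then show ?thesis using i nz component_closed[OF K i] by (auto simp: component_at_simps(2))
  next
    assume j: "j \<in> K"
    have "i \<in> X \<or> i \<in> V" using arr_Qf[OF nz] by blast
    then show ?thesis using j nz component_closed[OF K j] by (auto simp: component_at_simps(2))
  qed
  then show "arr (component_at Qf K) i j = arr Qf i j" "i \<in> K \<union> V" "j \<in> K \<union> V"
    by (auto simp: component_at_simps(3) component_at_simps(2))
qed

text \<open>An arrow occurring in the sum has an exchangeable end, and only the connected component
  of that end contributes, so the sum has at most one term. Components are closed under arrows
  between exchangeable vertices, so their union is separated from the rest.\<close>

lemma glue_eq:
  assumes P: "P \<subseteq> indecomposable_components Qf"
  shows "(\<Union>p\<in>P. exch p) \<subseteq> X" "separated Q (\<Union>p\<in>P. exch p) (X - (\<Union>p\<in>P. exch p))"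
    "glue V P = restrict_quiver Q V (\<Union>p\<in>P. exch p)"
proof -
  obtain Ks where Ks: "Ks \<subseteq> exch_components Qf" "P = component_at Qf ` Ks"
    using P unfolding indecomposable_components_def by (meson subset_imageE)
  let ?E = "\<Union>p\<in>P. exch p"
  have E: "?E = \<Union>Ks" using Ks(2) by (auto simp: component_at_simps(1))
  show EX: "?E \<subseteq> X" unfolding E using Ks(1) component_sub by blast
  have closed: "j \<in> ?E" if "i \<in> ?E" "j \<in> X" "arr Qf i j \<noteq> 0 \<or> arr Qf j i \<noteq> 0" for i j
    using that component_closed Ks(1) unfolding E by blast
  show "separated Q ?E (X - ?E)"
    unfolding separated_def
  proof (intro ballI)
    fix i j assume i: "i \<in> ?E" and j: "j \<in> X - ?E"
    then have "arr Qf i j = 0 \<and> arr Qf j i = 0" using closed[OF i] by blast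
    then show "arr Q i j = 0 \<and> arr Q j i = 0" using arr_Qf_X[of i j] arr_Qf_X[of j i] j by auto
  qed
  have fro: "V \<union> (\<Union>p\<in>P. frozen p) = V" using Ks(2) by (auto simp: component_at_simps(2))
  have "(\<Sum>p | p \<in> P \<and> arr p i j \<noteq> 0. arr p i j) =
      (if i \<in> ?E \<union> V \<and> j \<in> ?E \<union> V \<and> \<not> (i \<in> V \<and> j \<in> V) then arr Q i j else 0)" for i j
  proof (cases "arr Qf i j \<noteq> 0 \<and> (i \<in> ?E \<or> j \<in> ?E)")
    case True
    then obtain k where k: "k = i \<or> k = j" "k \<in> ?E" by blast
    then obtain K where K: "K \<in> Ks" "k \<in> K" unfolding E by blast
    have Kc: "K \<in> exch_components Qf" using K Ks(1) by blast
    have ij: "i \<in> K \<or> j \<in> K" using k K by blast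
    note in' = arr_component_at_in[OF Kc conjunct1[OF True] ij]
    have uniq: "K' = K" if K': "K' \<in> Ks" "arr (component_at Qf K') i j \<noteq> 0" for K'
    proof -
      have K'c: "K' \<in> exch_components Qf" using K' Ks(1) by blast
      have "k \<in> K' \<or> k \<in> V" using arr_component_at[OF K'c K'(2)] k by blast
      moreover have "k \<notin> V" using k(2) EX X_V by blast
      ultimately show ?thesis using component_eq[OF Kc K(2)] component_eq[OF K'c, of k] by blast
    qed
    have "{p. p \<in> P \<and> arr p i j \<noteq> 0} = {component_at Qf K}"
    proof (intro equalityI subsetI)
      fix p assume "p \<in> {p. p \<in> P \<and> arr p i j \<noteq> 0}"
      then obtain K' where "K' \<in> Ks" "p = component_at Qf K'" "arr (component_at Qf K') i j \<noteq> 0" using Ks(2) by blast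
      then show "p \<in> {component_at Qf K}" using uniq by blast
    next
      fix p assume "p \<in> {component_at Qf K}"
      then show "p \<in> {p. p \<in> P \<and> arr p i j \<noteq> 0}" using in'(1) True K(1) Ks(2) by simp
    qed
    then have s: "(\<Sum>p | p \<in> P \<and> arr p i j \<noteq> 0. arr p i j) = arr Qf i j" using in'(1) by simp
    have nV: "i \<in> X \<or> j \<in> X" using arr_Qf[of i j] True by blast
    have "K \<subseteq> ?E" using K unfolding E by blast
    then have "i \<in> ?E \<union> V \<and> j \<in> ?E \<union> V \<and> \<not> (i \<in> V \<and> j \<in> V)" using in'(2,3) nV X_V by blast
    then show ?thesis using s arr_Qf_X[OF nV] by simp
  next
    case False
    have "arr p i j = 0" if p: "p \<in> P" for p
    proof (rule ccontr)
      assume nz: "arr p i j \<noteq> 0"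
      obtain K where K: "K \<in> Ks" "p = component_at Qf K" using p Ks(2) by blast
      then have Kc: "K \<in> exch_components Qf" using Ks(1) by blast
      have a: "arr Qf i j \<noteq> 0 \<and> (i \<in> K \<or> i \<in> V) \<and> (j \<in> K \<or> j \<in> V)" using arr_component_at[OF Kc] nz K(2) by blast
      then have "i \<in> K \<or> j \<in> K" using arr_Qf[of i j] X_V by blast
      then show False using a False K(1) unfolding E by blast
    qed
    then have "(\<Sum>p | p \<in> P \<and> arr p i j \<noteq> 0. arr p i j) = 0" by (intro sum.neutral) simp
    moreover have r0: "(if i \<in> ?E \<union> V \<and> j \<in> ?E \<union> V \<and> \<not> (i \<in> V \<and> j \<in> V) then arr Q i j else 0) = 0"
    proof (cases "i \<in> ?E \<union> V \<and> j \<in> ?E \<union> V \<and> \<not> (i \<in> V \<and> j \<in> V)")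
      case True
      then have "i \<in> ?E \<or> j \<in> ?E" by blast
      then have "arr Qf i j = 0" using False by blast
      moreover have "i \<in> X \<or> j \<in> X" using \<open>i \<in> ?E \<or> j \<in> ?E\<close> EX by blast
      ultimately show ?thesis using arr_Qf_X[of i j] by simp
    next
      case False
      then show ?thesis by (rule if_not_P)
    qed
    ultimately show ?thesis by (simp only:)
  qed
  then show "glue V P = restrict_quiver Q V ?E"
    unfolding glue_def restrict_quiver_def using fro by (simp add: fun_eq_iff)
qed

text \<open>Separation makes \<open>E\<close> closed under being joined by an arrow, so it is the
  union of the connected components that it contains.\<close>

lemma ex_components:
  assumes E: "E \<subseteq> X" "separated Q E (X - E)"
  shows "\<exists>P\<subseteq>indecomposable_components Qf. (\<Union>p\<in>P. exch p) = E"
proof -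
  let ?Ks = "{K \<in> exch_components Qf. K \<subseteq> E}"
  have "i \<in> \<Union>?Ks" if i: "i \<in> E" for i
  proof -
    have "R\<^sup>* `` {i} \<subseteq> E"
    proof
      fix j assume "j \<in> R\<^sup>* `` {i}"
      then have "(i, j) \<in> R\<^sup>*" by simp
      then show "j \<in> E"
      proof (induction rule: rtrancl_induct)
        case (step y z)
        have nz: "arr Q y z \<noteq> 0 \<or> arr Q z y \<noteq> 0" and z: "z \<in> X"
          using step(2) arr_Qf_X[of y z] arr_Qf_X[of z y] by auto
        show ?case
        proof (rule ccontr)
          assume "z \<notin> E"
          then have "arr Q y z = 0 \<and> arr Q z y = 0" using E(2) step.IH z unfolding separated_def by blast
          then show False using nz by simp
        qed
      qed (rule i)
    qed
    moreover have "R\<^sup>* `` {i} \<in> exch_components Qf" using i E(1) component by blast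
    ultimately show ?thesis by blast
  qed
  then have "\<Union>?Ks = E" by blast
  then have "(\<Union>p\<in>component_at Qf ` ?Ks. exch p) = E" by (simp add: component_at_simps(1))
  moreover have "component_at Qf ` ?Ks \<subseteq> indecomposable_components Qf"
    unfolding indecomposable_components_def by blast
  ultimately show ?thesis by blast
qed

text \<open>A set of components amounts to a set of exchangeable vertices without arrows to the
  others, so a pair of gluings becomes a pair of complementary sets.\<close>

lemma complete_pair_seeds_iff:
  "complete_pair_seeds Q W Q\<^sub>1 Q\<^sub>2 \<longleftrightarrow> (\<exists>E\<^sub>1 E\<^sub>2. E\<^sub>1 \<inter> E\<^sub>2 = {} \<and> E\<^sub>1 \<union> E\<^sub>2 = X \<and> separated Q E\<^sub>1 E\<^sub>2 \<and>
     Q\<^sub>1 = restrict_quiver Q V E\<^sub>1 \<and> Q\<^sub>2 = restrict_quiver Q V E\<^sub>2)"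
proof
  assume "complete_pair_seeds Q W Q\<^sub>1 Q\<^sub>2"
  then obtain P1 P2 where P: "P1 \<subseteq> indecomposable_components Qf" "Q\<^sub>1 = glue V P1"
    "P2 \<subseteq> indecomposable_components Qf" "Q\<^sub>2 = glue V P2"
    and e: "exch Q\<^sub>1 \<inter> exch Q\<^sub>2 = {}" "exch Q = exch Q\<^sub>1 \<union> exch Q\<^sub>2 \<union> W" "(exch Q\<^sub>1 \<union> exch Q\<^sub>2) \<inter> W = {}"
    unfolding complete_pair_seeds_def Let_def by blast
  let ?E1 = "\<Union>p\<in>P1. exch p" and ?E2 = "\<Union>p\<in>P2. exch p"
  have ex: "exch Q\<^sub>1 = ?E1" "exch Q\<^sub>2 = ?E2" using P by (simp_all add: glue_def)
  have d: "?E1 \<inter> ?E2 = {}" "?E1 \<union> ?E2 = X" using e unfolding ex by blast+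
  then have "X - ?E1 = ?E2" by blast
  then have "separated Q ?E1 ?E2" using glue_eq(2)[OF P(1)] by simp
  then show "\<exists>E\<^sub>1 E\<^sub>2. E\<^sub>1 \<inter> E\<^sub>2 = {} \<and> E\<^sub>1 \<union> E\<^sub>2 = X \<and> separated Q E\<^sub>1 E\<^sub>2 \<and>
     Q\<^sub>1 = restrict_quiver Q V E\<^sub>1 \<and> Q\<^sub>2 = restrict_quiver Q V E\<^sub>2"
    using d glue_eq(3)[OF P(1)] glue_eq(3)[OF P(3)] P(2,4) by blast
next
  assume "\<exists>E\<^sub>1 E\<^sub>2. E\<^sub>1 \<inter> E\<^sub>2 = {} \<and> E\<^sub>1 \<union> E\<^sub>2 = X \<and> separated Q E\<^sub>1 E\<^sub>2 \<and>
     Q\<^sub>1 = restrict_quiver Q V E\<^sub>1 \<and> Q\<^sub>2 = restrict_quiver Q V E\<^sub>2"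
  then obtain E1 E2 where E: "E1 \<inter> E2 = {}" "E1 \<union> E2 = X" "separated Q E1 E2"
    "Q\<^sub>1 = restrict_quiver Q V E1" "Q\<^sub>2 = restrict_quiver Q V E2" by blast
  have "X - E1 = E2" "X - E2 = E1" "E1 \<subseteq> X" "E2 \<subseteq> X" using E(1,2) by blast+
  moreover have "separated Q E2 E1" using E(3) unfolding separated_def by blast
  ultimately obtain P1 P2 where P: "P1 \<subseteq> indecomposable_components Qf" "(\<Union>p\<in>P1. exch p) = E1"
    "P2 \<subseteq> indecomposable_components Qf" "(\<Union>p\<in>P2. exch p) = E2"
    using ex_components[of E1] ex_components[of E2] E(3) by metis
  have "Q\<^sub>1 = glue V P1" "Q\<^sub>2 = glue V P2" using glue_eq(3)[OF P(1)] glue_eq(3)[OF P(3)] P E by simp_all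
  moreover have "frozen Q \<union> isolated_frozen Qf \<subseteq> V" by (auto simp: isolated_frozen_def Qf_simps(2))
  moreover have "exch Q\<^sub>1 = E1" "exch Q\<^sub>2 = E2" "frozen Q\<^sub>1 = V" "frozen Q\<^sub>2 = V" using E by (simp_all add: restrict_quiver_def)
  moreover have "exch Q = E1 \<union> E2 \<union> W" "(E1 \<union> E2) \<inter> W = {}" using E(2) W_exch by blast+
  ultimately show "complete_pair_seeds Q W Q\<^sub>1 Q\<^sub>2"
    unfolding complete_pair_seeds_def Let_def using P(1,3) E(1) by auto
qed

end

section \<open>The correspondence\<close>

context krull_schmidt_category
begin

lemma iso_class_eq: "iso_class \<C> A = iso_class \<C> B \<longleftrightarrow> isomorphic \<C> A B"
  unfolding iso_class_def using isomorphic_refl isomorphic_sym isomorphic_trans by blast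

lemma isomorphic_rep: "isomorphic \<C> A (rep (iso_class \<C> A))"
  unfolding rep_def iso_class_def using someI[of "\<lambda>M. M \<in> {B. isomorphic \<C> A B}" A] isomorphic_refl by simp

lemma loc_isomorphic:
  assumes A: "loc A" and AB: "isomorphic \<C> A B"
  shows "loc B"
  unfolding loc_iff_indecomposable indecomposable_def
proof (intro conjI allI impI)
  have ind: "indecomposable \<C> A" using A loc_iff_indecomposable by simp
  obtain Z where Z: "zero_object \<C> Z" using ex_zero_object by blast
  obtain f where "iso_mor \<C> B A f" using isomorphic_sym[OF AB] by (auto simp: isomorphic_def)
  then have AZ: "is_dsum \<C> A Z B" using is_dsum_zero[OF Z] is_dsum_sym by blast
  have zero_retract: "zero_object \<C> N" if M: "zero_object \<C> M" and N: "retract \<C> N M" for M N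
  proof -
    obtain i p where ip: "i \<in> Hom \<C> N M" "p \<in> Hom \<C> M N" "p \<cdot> i = Id \<C> N" using N unfolding retract_def by blast
    then show ?thesis
      using zero_object_Hom_from[OF M ip(2)] Comp_zero_left[OF ip(1)] by (simp add: zero_object_def)
  qed
  show "\<not> zero_object \<C> B" using zero_retract[of B A] isomorphic_retract[OF AB] zero_object_not_loc[OF A] by blast
  fix C D assume BCD: "is_dsum \<C> B C D"
  obtain E where E: "is_dsum \<C> E Z C" using ex_dsum by blast
  have "is_dsum \<C> A E D" using is_dsum_assoc[OF AZ BCD E] .
  then have "zero_object \<C> E \<or> zero_object \<C> D" using ind by (simp add: indecomposable_def)
  then show "zero_object \<C> C \<or> zero_object \<C> D" using zero_retract[of E C] is_dsum_retract[OF E] by blast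
qed

lemma ind_loc: "ind \<C> S = {M \<in> S. loc M}"
  by (simp add: ind_def loc_iff_indecomposable)

lemma is_dsum_list_member: "is_dsum_list \<C> S As \<Longrightarrow> A \<in> set As \<Longrightarrow> \<exists>N. is_dsum \<C> S A N"
proof (induction As arbitrary: S)
  case (Cons B Bs)
  then obtain S' where S': "is_dsum_list \<C> S' Bs" "is_dsum \<C> S B S'" by auto
  show ?case
  proof (cases "A = B")
    case True
    then show ?thesis using S' by blast
  next
    case False
    then have "A \<in> set Bs" using Cons.prems(2) by simp
    then obtain N where "is_dsum \<C> S' A N" using Cons.IH[OF S'(1)] by blast
    then have N: "is_dsum \<C> S' N A" by (rule is_dsum_sym)
    obtain D where "is_dsum \<C> D B N" using ex_dsum by blast
    then show ?thesis using is_dsum_sym[OF is_dsum_assoc[OF S'(2) N]] by blast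
  qed
qed simp

text \<open>\<open>ind_summands\<close> asks for a complement, whereas \<open>gen\<close> is about
  retracts. \<open>M\<close> is isomorphic to a term of a Krull-Schmidt decomposition of
  \<open>T\<close>, and the complement of that term is carried over by re-bracketing.\<close>

lemma loc_summand:
  assumes M: "loc M" and T: "M \<in> gen \<C> {T}"
  shows "M \<in> ind_summands \<C> T"
proof -
  obtain As where As: "\<forall>N\<in>set As. loc N" "is_dsum_list \<C> T As" using krull_schmidt by (auto simp: krull_schmidt_def)
  have "is_dsum_list \<C> S As \<Longrightarrow> S \<in> gen \<C> (set As)" for S
  proof (induction As arbitrary: S)
    case Nil
    then show ?case using subcategoryD(1)[OF gen_subcategory] by simp
  next
    case (Cons B Bs)
    then obtain S' where S': "is_dsum_list \<C> S' Bs" "is_dsum \<C> S B S'" by auto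
    have "set Bs \<subseteq> gen \<C> (set (B # Bs))" using gen_base[of "set (B # Bs)"] by auto
    then have "S' \<in> gen \<C> (set (B # Bs))" using gen_gen Cons.IH[OF S'(1)] by blast
    moreover have "B \<in> gen \<C> (set (B # Bs))" using gen_base[of "set (B # Bs)"] by auto
    ultimately show ?case using subcategoryD(2)[OF gen_subcategory S'(2)] by blast
  qed
  then have "M \<in> gen \<C> (set As)" using As(2) T gen_gen[of "{T}" "set As"] by blast
  then obtain A where A: "A \<in> set As" "isomorphic \<C> M A" using gen_loc_isomorphic[OF As(1) _ M] by blast
  obtain N where "is_dsum \<C> T A N" using is_dsum_list_member[OF As(2) A(1)] by blast
  then have N: "is_dsum \<C> T N A" by (rule is_dsum_sym)
  obtain Z where Z: "zero_object \<C> Z" using ex_zero_object by blast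
  obtain f where "iso_mor \<C> M A f" using A(2) by (auto simp: isomorphic_def)
  then have AZ: "is_dsum \<C> A Z M" using is_dsum_sym[OF is_dsum_zero[OF Z]] by blast
  obtain D where "is_dsum \<C> D N Z" using ex_dsum by blast
  then have "is_dsum \<C> T M D" using is_dsum_sym[OF is_dsum_assoc[OF N AZ]] by blast
  then show ?thesis using M unfolding ind_summands_def loc_iff_indecomposable by blast
qed

end

section \<open>Seeds attached to the cluster tilting object\<close>

locale cluster_setting = cy_quiver \<C> \<I>
  for \<C> :: "('k::field, 'o, 'm::ab_group_add, 'e::ab_group_add) extri_data" (structure) and \<I> +
  fixes T :: 'o and \<chi> :: "'o \<Rightarrow> 'f::field_char_0"
  assumes T_tilting: "cluster_tilting_object \<C> T" and I_T: "\<I> \<subseteq> add_obj \<C> T" and Proj_I: "Proj \<C> \<subseteq> \<I>"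
    and chi_iso: "A \<in> add_obj \<C> T \<Longrightarrow> isomorphic \<C> A B \<Longrightarrow> \<chi> A = \<chi> B"
    and chi_inj: "M \<in> ind \<C> (add_obj \<C> T) \<Longrightarrow> N \<in> ind \<C> (add_obj \<C> T) \<Longrightarrow> \<chi> M = \<chi> N \<Longrightarrow> isomorphic \<C> M N"
begin

abbreviation "\<T> \<equiv> add_obj \<C> T"
abbreviation "r M \<equiv> rep (iso_class \<C> M)"
abbreviation "\<Sigma> \<equiv> seed_of \<chi> (tilting_quiver \<C> \<T>)"
abbreviation "iso_stable D \<equiv> \<forall>M\<in>D. \<forall>N. isomorphic \<C> M N \<longrightarrow> N \<in> D"
abbreviation "part \<X> \<equiv> {M \<in> ind \<C> \<T>. M \<in> \<X> \<and> M \<notin> \<I>}"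

lemma T_facts: "fin_tilting \<C> \<T>" "\<T> = gen \<C> {T}" "subcategory \<C> \<T>"
proof -
  show "fin_tilting \<C> \<T>" using cluster_tilting_fin_tilting[OF T_tilting] by blast
  show *: "\<T> = gen \<C> {T}" using cluster_tilting_fin_tilting[OF T_tilting] by blast
  show "subcategory \<C> \<T>" unfolding * by (rule gen_subcategory)
qed

lemma iso_closed: "subcategory \<C> S \<Longrightarrow> M \<in> ind \<C> S \<Longrightarrow> isomorphic \<C> M N \<Longrightarrow> N \<in> ind \<C> S"
  using subcategoryD(5)[of S M N] loc_isomorphic[of M N] unfolding ind_loc by blast

lemma Proj_iso: "M \<in> Proj \<C> \<Longrightarrow> isomorphic \<C> M N \<Longrightarrow> N \<in> Proj \<C>"
  using Ext_retract_left[of M _ N] isomorphic_retract[of N M] isomorphic_sym[of M N]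
  by (simp add: Proj_def projective_iff)

lemma r_iso: "isomorphic \<C> M (r M)" "isomorphic \<C> (r M) M"
  using isomorphic_rep[of M] isomorphic_sym[of M] by auto

lemma chi_r: "M \<in> ind \<C> \<T> \<Longrightarrow> \<chi> (r M) = \<chi> M"
  using chi_iso[of M "r M"] r_iso(1)[of M] by (simp add: ind_def)

lemma chi_mem:
  assumes "M \<in> ind \<C> \<T>" "D \<subseteq> ind \<C> \<T>" "iso_stable D"
  shows "\<chi> M \<in> \<chi> ` D \<longleftrightarrow> M \<in> D"
proof
  assume "\<chi> M \<in> \<chi> ` D"
  then obtain N where "N \<in> D" "\<chi> N = \<chi> M" by auto
  then show "M \<in> D" using chi_inj[of N M] assms by blast
qed simp

text \<open>The vertices of a seed are values of \<open>\<chi>\<close>; here they are read back as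
  objects, which is possible because \<open>\<chi>\<close> separates isomorphism classes. The
  representative \<open>r M\<close> appears since arrows are counted at chosen
  representatives.\<close>

lemma quiver_seed:
  assumes D1: "ind \<C> S1 = D1" and D2: "ind \<C> S2 = D2" and D: "D1 \<subseteq> ind \<C> \<T>" "D2 \<subseteq> ind \<C> \<T>"
    and c2: "iso_stable D2"
  shows "exch (seed_of \<chi> (quiver_of \<C> \<U> S1 S2)) = \<chi> ` D1"
    "frozen (seed_of \<chi> (quiver_of \<C> \<U> S1 S2)) = \<chi> ` D2"
    "M \<in> D1 \<union> D2 \<Longrightarrow> N \<in> D1 \<union> D2 \<Longrightarrow> arr (seed_of \<chi> (quiver_of \<C> \<U> S1 S2)) (\<chi> M) (\<chi> N) =
      (if M \<in> D2 \<and> N \<in> D2 then 0 else irr_dim \<C> \<U> (r M) (r N))"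
    "u \<notin> \<chi> ` (D1 \<union> D2) \<or> v \<notin> \<chi> ` (D1 \<union> D2) \<Longrightarrow> arr (seed_of \<chi> (quiver_of \<C> \<U> S1 S2)) u v = 0"
proof -
  let ?Q = "quiver_of \<C> \<U> S1 S2" and ?f = "\<lambda>c. \<chi> (rep c)"
  have img: "?f ` iso_class \<C> ` D = \<chi> ` D" if "D \<subseteq> ind \<C> \<T>" for D
    unfolding image_image using chi_r that by (intro image_cong) auto
  have ex: "exch ?Q = iso_class \<C> ` D1" "frozen ?Q = iso_class \<C> ` D2"
    by (simp_all add: quiver_of_def ind_classes_def D1 D2)
  then have vert: "vertices ?Q = iso_class \<C> ` (D1 \<union> D2)" by (simp add: vertices_def image_Un)
  have fv: "?f ` vertices ?Q = \<chi> ` (D1 \<union> D2)" unfolding vert using img[of "D1 \<union> D2"] D by simp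
  show "exch (seed_of \<chi> ?Q) = \<chi> ` D1" "frozen (seed_of \<chi> ?Q) = \<chi> ` D2"
    using img[OF D(1)] img[OF D(2)] by (simp_all add: seed_of_def relabel_def ex)
  show "arr (seed_of \<chi> ?Q) u v = 0" if "u \<notin> \<chi> ` (D1 \<union> D2) \<or> v \<notin> \<chi> ` (D1 \<union> D2)"
    unfolding seed_of_def relabel_def fv using that by auto
  have inj: "inj_on ?f (vertices ?Q)"
  proof (rule inj_onI)
    fix c d assume c: "c \<in> vertices ?Q" "d \<in> vertices ?Q" "?f c = ?f d"
    then obtain M N where MN: "M \<in> ind \<C> \<T>" "c = iso_class \<C> M" "N \<in> ind \<C> \<T>" "d = iso_class \<C> N" unfolding vert using D by blast
    then have "\<chi> M = \<chi> N" using c(3) chi_r by simp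
    then show "c = d" using MN chi_inj[of M N] iso_class_eq[of M N] by blast
  qed
  have inv: "inv_into (vertices ?Q) ?f (\<chi> M) = iso_class \<C> M" if M: "M \<in> D1 \<union> D2" for M
  proof -
    have "iso_class \<C> M \<in> vertices ?Q" using M unfolding vert by blast
    moreover have "?f (iso_class \<C> M) = \<chi> M" using chi_r[of M] M D by blast
    ultimately show ?thesis using inv_into_f_f[OF inj, of "iso_class \<C> M"] by simp
  qed
  have mem: "iso_class \<C> M \<in> iso_class \<C> ` D2 \<longleftrightarrow> M \<in> D2" for M
  proof
    assume "iso_class \<C> M \<in> iso_class \<C> ` D2"
    then obtain N where N: "N \<in> D2" "iso_class \<C> N = iso_class \<C> M" by auto
    then show "M \<in> D2" using c2 iso_class_eq[of N M] by blast
  qed simp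
  show "arr (seed_of \<chi> ?Q) (\<chi> M) (\<chi> N) = (if M \<in> D2 \<and> N \<in> D2 then 0 else irr_dim \<C> \<U> (r M) (r N))"
    if MN: "M \<in> D1 \<union> D2" "N \<in> D1 \<union> D2"
  proof -
    have "\<chi> M \<in> \<chi> ` (D1 \<union> D2)" "\<chi> N \<in> \<chi> ` (D1 \<union> D2)" using MN by blast+
    then have "arr (seed_of \<chi> ?Q) (\<chi> M) (\<chi> N) = arr ?Q (iso_class \<C> M) (iso_class \<C> N)"
      unfolding seed_of_def relabel_def fv using inv[OF MN(1)] inv[OF MN(2)] by simp
    also have "\<dots> = (if M \<in> D2 \<and> N \<in> D2 then 0 else irr_dim \<C> \<U> (r M) (r N))"
    proof -
      have "iso_class \<C> M \<in> iso_class \<C> ` D1 \<union> iso_class \<C> ` D2" "iso_class \<C> N \<in> iso_class \<C> ` D1 \<union> iso_class \<C> ` D2"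
        using MN by blast+
      then show ?thesis using mem[of M] mem[of N] by (simp add: quiver_of_def ind_classes_def D1 D2)
    qed
    finally show ?thesis .
  qed
qed

lemma T_ind: "ind \<C> (\<T> - Proj \<C>) = ind \<C> \<T> - Proj \<C>" "ind \<C> (\<T> \<inter> Proj \<C>) = ind \<C> \<T> \<inter> Proj \<C>"
  by (auto simp: ind_def)

lemma ind_T_iso: "M \<in> ind \<C> \<T> \<Longrightarrow> isomorphic \<C> M N \<Longrightarrow> N \<in> ind \<C> \<T>"
  using iso_closed[OF T_facts(3)] .

lemma seed_facts:
  "exch \<Sigma> = \<chi> ` (ind \<C> \<T> - Proj \<C>)" "frozen \<Sigma> = \<chi> ` (ind \<C> \<T> \<inter> Proj \<C>)"
  "M \<in> ind \<C> \<T> \<Longrightarrow> N \<in> ind \<C> \<T> \<Longrightarrow> arr \<Sigma> (\<chi> M) (\<chi> N) =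
    (if M \<in> Proj \<C> \<and> N \<in> Proj \<C> then 0 else irr_dim \<C> \<T> (r M) (r N))"
  "u \<notin> \<chi> ` ind \<C> \<T> \<or> v \<notin> \<chi> ` ind \<C> \<T> \<Longrightarrow> arr \<Sigma> u v = 0"
proof -
  have u: "(ind \<C> \<T> - Proj \<C>) \<union> (ind \<C> \<T> \<inter> Proj \<C>) = ind \<C> \<T>" by blast
  have c: "iso_stable (ind \<C> \<T> \<inter> Proj \<C>)" using ind_T_iso Proj_iso by blast
  note q = quiver_seed[OF T_ind Diff_subset Int_lower1 c, where \<U> = \<T>, folded tilting_quiver_def, unfolded u]
  show "exch \<Sigma> = \<chi> ` (ind \<C> \<T> - Proj \<C>)" "frozen \<Sigma> = \<chi> ` (ind \<C> \<T> \<inter> Proj \<C>)"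
    by (rule q(1)) (rule q(2))
  show "u \<notin> \<chi> ` ind \<C> \<T> \<or> v \<notin> \<chi> ` ind \<C> \<T> \<Longrightarrow> arr \<Sigma> u v = 0"
    by (rule q(4))
  show "M \<in> ind \<C> \<T> \<Longrightarrow> N \<in> ind \<C> \<T> \<Longrightarrow> arr \<Sigma> (\<chi> M) (\<chi> N) =
    (if M \<in> Proj \<C> \<and> N \<in> Proj \<C> then 0 else irr_dim \<C> \<T> (r M) (r N))"
    using q(3)[of M N] by simp
qed

lemma ind_I: "ind \<C> \<I> \<subseteq> ind \<C> \<T>" "ind \<C> \<I> = {M \<in> ind \<C> \<T>. M \<in> \<I>}"
  using I_T by (auto simp: ind_def)

lemma I_iso: "iso_stable (ind \<C> \<I>)"
  using iso_closed[OF I_subcategory] by blast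

lemma part_iso: "subcategory \<C> \<X> \<Longrightarrow> M \<in> part \<X> \<Longrightarrow> isomorphic \<C> M N \<Longrightarrow> N \<in> part \<X>"
  using ind_T_iso[of M N] subcategoryD(5)[of \<X> M N] subcategoryD(5)[OF I_subcategory, of N M] isomorphic_sym[of M N] by blast

lemma tilting_part_eq: "tilting_part \<C> \<T> \<I> \<X> = add_closure \<C> (part \<X>)"
  unfolding tilting_part_def ind_def by (rule arg_cong[where f = "add_closure \<C>"]) blast

lemma ind_tilting_part:
  assumes X: "subcategory \<C> \<X>"
  shows "ind \<C> (tilting_part \<C> \<T> \<I> \<X>) = part \<X>"
proof
  show "part \<X> \<subseteq> ind \<C> (tilting_part \<C> \<T> \<I> \<X>)"
    unfolding tilting_part_eq using add_closure_base[of "part \<X>"] by (auto simp: ind_def)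
  show "ind \<C> (tilting_part \<C> \<T> \<I> \<X>) \<subseteq> part \<X>"
  proof
    fix M assume "M \<in> ind \<C> (tilting_part \<C> \<T> \<I> \<X>)"
    then have M: "loc M" "M \<in> gen \<C> (part \<X>)"
      using add_closure_gen[of "part \<X>"] unfolding tilting_part_eq ind_loc[of "add_closure \<C> _"] by auto
    have "\<forall>L\<in>part \<X>. loc L" by (simp add: ind_loc)
    then obtain L where L: "L \<in> part \<X>" "isomorphic \<C> M L" using gen_loc_isomorphic[OF _ M(2,1)] by blast
    then show "M \<in> part \<X>" using part_iso[OF X L(1) isomorphic_sym] by blast
  qed
qed

lemma part_sum_facts:
  assumes X: "subcategory \<C> \<X>"
  shows "subcategory_sum \<C> (tilting_part \<C> \<T> \<I> \<X>) \<I> \<subseteq> \<T>"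
    "\<I> \<subseteq> subcategory_sum \<C> (tilting_part \<C> \<T> \<I> \<X>) \<I>"
    "part \<X> \<subseteq> subcategory_sum \<C> (tilting_part \<C> \<T> \<I> \<X>) \<I>"
proof -
  obtain Z where Z: "zero_object \<C> Z" using ex_zero_object by blast
  have "part \<X> \<subseteq> \<T>" by (auto simp: ind_def)
  then have U: "add_closure \<C> (part \<X>) \<subseteq> \<T>"
    using add_closure_gen[of "part \<X>"] gen_subset[OF T_facts(3), of "part \<X>"] by blast
  show "subcategory_sum \<C> (tilting_part \<C> \<T> \<I> \<X>) \<I> \<subseteq> \<T>"
  proof
    fix S assume "S \<in> subcategory_sum \<C> (tilting_part \<C> \<T> \<I> \<X>) \<I>"
    then obtain A B where "A \<in> \<T>" "B \<in> \<T>" "is_dsum \<C> S A B"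
      unfolding subcategory_sum_def tilting_part_eq using U I_T by blast
    then show "S \<in> \<T>" using subcategoryD(2)[OF T_facts(3)] by blast
  qed
  have d: "is_dsum \<C> M M Z" "is_dsum \<C> M Z M" for M using is_dsum_zero[OF Z iso_mor_Id, of M] is_dsum_sym[of M M Z] by auto
  show "\<I> \<subseteq> subcategory_sum \<C> (tilting_part \<C> \<T> \<I> \<X>) \<I>"
    unfolding subcategory_sum_def tilting_part_eq using d(2) add_closure_zero[OF Z] by blast
  show "part \<X> \<subseteq> subcategory_sum \<C> (tilting_part \<C> \<T> \<I> \<X>) \<I>"
    unfolding subcategory_sum_def tilting_part_eq
    using d(1) add_closure_base[of "part \<X>"] subcategoryD(1)[OF I_subcategory Z] by blast
qed

text \<open>Morphisms between \<open>part \<X>\<close> and local objects of \<open>\<T>\<close>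
  outside \<open>\<X>\<close> factor through \<open>\<I>\<close>. So
  \<open>radical2_restrict\<close> applies, and the quiver computed in the smaller subcategory has
  the arrows of \<open>\<Sigma>\<close>.\<close>

lemma part_seed:
  assumes X: "subcategory \<C> \<X>"
    and f: "\<And>M L f. M \<in> part \<X> \<Longrightarrow> L \<in> \<T> \<Longrightarrow> loc L \<Longrightarrow> L \<notin> \<X> \<Longrightarrow>
      (\<forall>f\<in>Hom \<C> M L. factors \<C> \<I> M L f) \<and> (\<forall>f\<in>Hom \<C> L M. factors \<C> \<I> L M f)"
  shows "seed_of \<chi> (part_quiver \<C> (tilting_part \<C> \<T> \<I> \<X>) \<I>) = restrict_quiver \<Sigma> (\<chi> ` ind \<C> \<I>) (\<chi> ` part \<X>)"
    (is "?s = ?t")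
proof -
  let ?U = "subcategory_sum \<C> (tilting_part \<C> \<T> \<I> \<X>) \<I>"
  have pT: "part \<X> \<subseteq> ind \<C> \<T>" by blast
  note q = quiver_seed[OF ind_tilting_part[OF X] HOL.refl pT ind_I(1) I_iso, where \<U> = ?U, folded part_quiver_def]
  have irr: "irr_dim \<C> ?U (r M) (r N) = irr_dim \<C> \<T> (r M) (r N)"
    if MN: "M \<in> part \<X> \<union> ind \<C> \<I>" "N \<in> part \<X> \<union> ind \<C> \<I>" "\<not> (M \<in> ind \<C> \<I> \<and> N \<in> ind \<C> \<I>)" for M N
  proof -
    have MN': "r M \<in> part \<X> \<or> r N \<in> part \<X>"
      using MN part_iso[OF X _ r_iso(1), of M] part_iso[OF X _ r_iso(1), of N] by blast
    have cases: "L \<in> ?U \<or> (loc (r M) \<and> r M \<notin> \<I> \<and> (\<forall>f\<in>Hom \<C> (r M) L. factors \<C> \<I> (r M) L f)) \<or>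
        (loc (r N) \<and> r N \<notin> \<I> \<and> (\<forall>f\<in>Hom \<C> L (r N). factors \<C> \<I> L (r N) f))" if L: "L \<in> \<T>" "loc L" for L
    proof (cases "L \<in> \<X> \<or> L \<in> \<I>")
      case True
      then have "L \<in> part \<X> \<union> \<I>" using L by (auto simp: ind_loc)
      then show ?thesis using part_sum_facts[OF X] by blast
    next
      case False
      from MN' show ?thesis
      proof
        assume p: "r M \<in> part \<X>"
        then have "loc (r M) \<and> r M \<notin> \<I>" by (simp add: ind_loc)
        then show ?thesis using f[OF p L] False by blast
      next
        assume p: "r N \<in> part \<X>"
        then have "loc (r N) \<and> r N \<notin> \<I>" by (simp add: ind_loc)
        then show ?thesis using f[OF p L] False by blast
      qed
    qed
    have "radical2 \<C> ?U (r M) (r N) = radical2 \<C> \<T> (r M) (r N)"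
      by (rule radical2_restrict[OF part_sum_facts(1,2)[OF X] T_facts(3) cases])
    then show ?thesis by (simp add: irr_dim_def)
  qed
  have V: "\<chi> M \<in> \<chi> ` ind \<C> \<I> \<longleftrightarrow> M \<in> ind \<C> \<I>" if "M \<in> ind \<C> \<T>" for M
    using chi_mem[OF that ind_I(1) I_iso] .
  have "arr ?s u v = arr ?t u v" for u v
  proof (cases "u \<in> \<chi> ` (part \<X> \<union> ind \<C> \<I>) \<and> v \<in> \<chi> ` (part \<X> \<union> ind \<C> \<I>)")
    case True
    then obtain M N where MN: "M \<in> part \<X> \<union> ind \<C> \<I>" "u = \<chi> M" "N \<in> part \<X> \<union> ind \<C> \<I>" "v = \<chi> N" by blast
    have MT: "M \<in> ind \<C> \<T>" "N \<in> ind \<C> \<T>" using MN ind_I(1) by blast+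
    have uv: "u \<in> \<chi> ` part \<X> \<union> \<chi> ` ind \<C> \<I>" "v \<in> \<chi> ` part \<X> \<union> \<chi> ` ind \<C> \<I>" using True by blast+
    have uV: "u \<in> \<chi> ` ind \<C> \<I> \<longleftrightarrow> M \<in> ind \<C> \<I>" "v \<in> \<chi> ` ind \<C> \<I> \<longleftrightarrow> N \<in> ind \<C> \<I>"
      using V[OF MT(1)] V[OF MT(2)] MN(2,4) by simp_all
    have t: "arr ?t u v = (if M \<in> ind \<C> \<I> \<and> N \<in> ind \<C> \<I> then 0 else arr \<Sigma> u v)"
      using uv uV by (simp add: restrict_quiver_def del: Un_iff)
    show ?thesis
    proof (cases "M \<in> ind \<C> \<I> \<and> N \<in> ind \<C> \<I>")
      case True
      then show ?thesis using q(3)[OF MN(1,3)] t MN(2,4) by simp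
    next
      case False
      then have "\<not> (M \<in> Proj \<C> \<and> N \<in> Proj \<C>)" using Proj_I MT unfolding ind_I(2) by blast
      then have "arr \<Sigma> u v = irr_dim \<C> \<T> (r M) (r N)"
        unfolding MN(2,4) seed_facts(3)[OF MT] by (rule if_not_P)
      moreover have "arr ?s u v = irr_dim \<C> ?U (r M) (r N)" using q(3)[OF MN(1,3)] False MN(2,4) by simp
      ultimately show ?thesis using t irr[OF MN(1,3) False] False by simp
    qed
  next
    case False
    then have n: "u \<notin> \<chi> ` (part \<X> \<union> ind \<C> \<I>) \<or> v \<notin> \<chi> ` (part \<X> \<union> ind \<C> \<I>)" by blast
    then have "arr ?t u v = 0" by (auto simp: restrict_quiver_def)
    then show ?thesis using q(4)[OF n] by simp
  qed
  then have "arr ?s = arr ?t" by blast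
  moreover have "exch ?s = exch ?t" "frozen ?s = frozen ?t" using q(1,2) by (simp_all add: restrict_quiver_def)
  ultimately show ?thesis by (simp add: ice_quiver.equality)
qed

abbreviation "W \<equiv> \<chi> ` {M \<in> ind \<C> \<I>. M \<notin> Proj \<C>}"

lemma freezing: "freezing \<Sigma> W"
proof
  show "exch \<Sigma> \<inter> frozen \<Sigma> = {}"
  proof -
    have "False" if "M \<in> ind \<C> \<T> - Proj \<C>" "N \<in> ind \<C> \<T> \<inter> Proj \<C>" "\<chi> M = \<chi> N" for M N
      using chi_inj[of M N] that Proj_iso[of N M] isomorphic_sym[of M N] by blast
    then show ?thesis unfolding seed_facts(1,2) by blast
  qed
  have v: "vertices \<Sigma> = \<chi> ` ind \<C> \<T>" unfolding vertices_def seed_facts(1,2) by blast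
  show "i \<in> vertices \<Sigma> \<and> j \<in> vertices \<Sigma>" if "arr \<Sigma> i j \<noteq> 0" for i j
    using seed_facts(4)[of i j] that unfolding v by blast
  show "W \<subseteq> exch \<Sigma>" unfolding seed_facts(1) using ind_I(1) by blast
qed

lemma coefficients: "frozen \<Sigma> \<union> W = \<chi> ` ind \<C> \<I>"
proof -
  have "ind \<C> \<T> \<inter> Proj \<C> \<union> {M \<in> ind \<C> \<I>. M \<notin> Proj \<C>} = ind \<C> \<I>" using Proj_I unfolding ind_I(2) by blast
  then show ?thesis unfolding seed_facts(2) image_Un[symmetric] by simp
qed

lemma exch_minus: "exch \<Sigma> - W = \<chi> ` part UNIV"
proof -
  have W: "\<chi> M \<in> W \<longleftrightarrow> M \<in> \<I>" if M: "M \<in> ind \<C> \<T> - Proj \<C>" for M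
  proof -
    have "iso_stable {M \<in> ind \<C> \<I>. M \<notin> Proj \<C>}"
      using I_iso Proj_iso isomorphic_sym by blast
    then have "\<chi> M \<in> W \<longleftrightarrow> M \<in> {M \<in> ind \<C> \<I>. M \<notin> Proj \<C>}"
      using chi_mem[of M "{M \<in> ind \<C> \<I>. M \<notin> Proj \<C>}"] M ind_I(1) by blast
    then show ?thesis using M unfolding ind_I(2) by blast
  qed
  show ?thesis
  proof (intro equalityI subsetI)
    fix u assume "u \<in> exch \<Sigma> - W"
    then obtain M where "M \<in> ind \<C> \<T> - Proj \<C>" "u = \<chi> M" "u \<notin> W" unfolding seed_facts(1) by blast
    then show "u \<in> \<chi> ` part UNIV" using W[of M] by blast
  next
    fix u assume "u \<in> \<chi> ` part UNIV"
    then obtain M where M: "M \<in> ind \<C> \<T>" "M \<notin> \<I>" "u = \<chi> M" by blast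
    then have "M \<in> ind \<C> \<T> - Proj \<C>" using Proj_I by blast
    then have "u \<in> exch \<Sigma>" "\<chi> M \<notin> W" using W[of M] M(2,3) unfolding seed_facts(1) by blast+
    then show "u \<in> exch \<Sigma> - W" unfolding M(3) by (rule DiffI)
  qed
qed

lemma complete_pairs_eq:
  "complete_pairs \<Sigma> (\<chi> ` ind \<C> \<I>) =
    {(rooted_cluster_algebra (restrict_quiver \<Sigma> (\<chi> ` ind \<C> \<I>) E1), rooted_cluster_algebra (restrict_quiver \<Sigma> (\<chi> ` ind \<C> \<I>) E2)) |
      E1 E2. E1 \<inter> E2 = {} \<and> E1 \<union> E2 = \<chi> ` part UNIV \<and> separated \<Sigma> E1 E2}" (is "?L = ?R")
proof -
  have W: "ex' = W" if "ex' \<subseteq> exch \<Sigma>" "\<chi> ` ind \<C> \<I> = frozen \<Sigma> \<union> ex'" for ex'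
    using that freezing.disjoint[OF freezing] freezing.W_exch[OF freezing] coefficients by blast
  have iff: "(\<exists>ex'\<subseteq>exch \<Sigma>. \<chi> ` ind \<C> \<I> = frozen \<Sigma> \<union> ex' \<and> complete_pair_seeds \<Sigma> ex' S1 S2) \<longleftrightarrow> complete_pair_seeds \<Sigma> W S1 S2" for S1 S2
  proof
    assume "\<exists>ex'\<subseteq>exch \<Sigma>. \<chi> ` ind \<C> \<I> = frozen \<Sigma> \<union> ex' \<and> complete_pair_seeds \<Sigma> ex' S1 S2"
    then obtain ex' where "ex' \<subseteq> exch \<Sigma>" "\<chi> ` ind \<C> \<I> = frozen \<Sigma> \<union> ex'" "complete_pair_seeds \<Sigma> ex' S1 S2" by blast
    then show "complete_pair_seeds \<Sigma> W S1 S2" using W by simp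
  next
    assume "complete_pair_seeds \<Sigma> W S1 S2"
    then show "\<exists>ex'\<subseteq>exch \<Sigma>. \<chi> ` ind \<C> \<I> = frozen \<Sigma> \<union> ex' \<and> complete_pair_seeds \<Sigma> ex' S1 S2"
      using freezing.W_exch[OF freezing] coefficients by (intro exI[of _ W]) simp
  qed
  note cps = freezing.complete_pair_seeds_iff[OF freezing, unfolded coefficients exch_minus]
  have "?L = {(rooted_cluster_algebra S1, rooted_cluster_algebra S2) | S1 S2. complete_pair_seeds \<Sigma> W S1 S2}"
    unfolding complete_pairs_def iff by (rule HOL.refl)
  also have "\<dots> = ?R"
  proof (intro equalityI subsetI)
    fix z assume "z \<in> {(rooted_cluster_algebra S1, rooted_cluster_algebra S2) | S1 S2. complete_pair_seeds \<Sigma> W S1 S2}"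
    then obtain S1 S2 where z: "z = (rooted_cluster_algebra S1, rooted_cluster_algebra S2)" "complete_pair_seeds \<Sigma> W S1 S2" by blast
    obtain E1 E2 where E: "E1 \<inter> E2 = {}" "E1 \<union> E2 = \<chi> ` part UNIV" "separated \<Sigma> E1 E2"
      "S1 = restrict_quiver \<Sigma> (\<chi> ` ind \<C> \<I>) E1" "S2 = restrict_quiver \<Sigma> (\<chi> ` ind \<C> \<I>) E2"
      using z(2) unfolding cps by (elim exE conjE)
    show "z \<in> ?R"
      unfolding mem_Collect_eq by (intro exI conjI, unfold z(1) E(4,5), rule HOL.refl) (fact E(1-3))+
  next
    fix z assume "z \<in> ?R"
    then obtain E1 E2 where E: "z = (rooted_cluster_algebra (restrict_quiver \<Sigma> (\<chi> ` ind \<C> \<I>) E1), rooted_cluster_algebra (restrict_quiver \<Sigma> (\<chi> ` ind \<C> \<I>) E2))"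
      "E1 \<inter> E2 = {}" "E1 \<union> E2 = \<chi> ` part UNIV" "separated \<Sigma> E1 E2"
      unfolding mem_Collect_eq by (elim exE conjE)
    show "z \<in> {(rooted_cluster_algebra S1, rooted_cluster_algebra S2) | S1 S2. complete_pair_seeds \<Sigma> W S1 S2}"
      unfolding mem_Collect_eq cps by (intro exI conjI, rule E(1)) (fact E(2-4) HOL.refl)+
  qed
  finally show ?thesis .
qed

lemma cotorsion_parts:
  assumes "cotorsion_pair \<C> \<X> \<Y>" "core \<X> \<Y> = \<I>"
  shows "cy_cotorsion_tilting \<C> \<I> \<X> \<Y> \<T>"
  using assms T_facts(1) I_T
  by (intro cy_cotorsion_tilting.intro cy_cotorsion.intro cy_core_axioms cy_cotorsion_axioms.intro cy_cotorsion_tilting_axioms.intro)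
    (simp_all add: core_def)

lemma subalgebra_pair_eq:
  assumes "cotorsion_pair \<C> \<X> \<Y>" "core \<X> \<Y> = \<I>"
  shows "subalgebra_pair \<C> \<chi> \<T> \<I> (\<X>, \<Y>) =
    (rooted_cluster_algebra (restrict_quiver \<Sigma> (\<chi> ` ind \<C> \<I>) (\<chi> ` part \<X>)),
     rooted_cluster_algebra (restrict_quiver \<Sigma> (\<chi> ` ind \<C> \<I>) (\<chi> ` part \<Y>)))"
proof -
  interpret c: cy_cotorsion_tilting \<C> \<I> \<X> \<Y> \<T> using cotorsion_parts[OF assms] .
  have "seed_of \<chi> (part_quiver \<C> (tilting_part \<C> \<T> \<I> \<X>) \<I>) = restrict_quiver \<Sigma> (\<chi> ` ind \<C> \<I>) (\<chi> ` part \<X>)"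
  proof (rule part_seed[OF c.XY(1)])
    fix M L assume M: "M \<in> part \<X>" and L: "L \<in> \<T>" "loc L" "L \<notin> \<X>"
    then have "L \<in> \<Y>" "M \<in> \<X>" using c.T_loc[OF L(1,2)] by blast+
    then show "(\<forall>f\<in>Hom \<C> M L. factors \<C> \<I> M L f) \<and> (\<forall>f\<in>Hom \<C> L M. factors \<C> \<I> L M f)"
      using c.factors_XY[of M L] c.factors_YX[of L M] by blast
  qed
  moreover have "seed_of \<chi> (part_quiver \<C> (tilting_part \<C> \<T> \<I> \<Y>) \<I>) = restrict_quiver \<Sigma> (\<chi> ` ind \<C> \<I>) (\<chi> ` part \<Y>)"
  proof (rule part_seed[OF c.XY(2)])
    fix M L assume M: "M \<in> part \<Y>" and L: "L \<in> \<T>" "loc L" "L \<notin> \<Y>"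
    then have "L \<in> \<X>" "M \<in> \<Y>" using c.T_loc[OF L(1,2)] by blast+
    then show "(\<forall>f\<in>Hom \<C> M L. factors \<C> \<I> M L f) \<and> (\<forall>f\<in>Hom \<C> L M. factors \<C> \<I> L M f)"
      using c.factors_XY[of L M] c.factors_YX[of M L] by blast
  qed
  ultimately show ?thesis by (simp add: subalgebra_pair_def)
qed

lemma part_inj:
  assumes "subcategory \<C> \<X>" "subcategory \<C> \<X>'" "\<chi> ` part \<X> = \<chi> ` part \<X>'"
  shows "part \<X> = part \<X>'"
proof -
  have "part \<X> \<subseteq> part \<X>'" if X: "subcategory \<C> \<X>'" and sub: "\<chi> ` part \<X> \<subseteq> \<chi> ` part \<X>'" for \<X> \<X>'
  proof
    fix M assume M: "M \<in> part \<X>"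
    then have m: "\<chi> M \<in> \<chi> ` part \<X>'" and MT: "M \<in> ind \<C> \<T>" using sub by blast+
    have pT: "part \<X>' \<subseteq> ind \<C> \<T>" by blast
    have "iso_stable (part \<X>')" using part_iso[OF X] by blast
    then show "M \<in> part \<X>'" using chi_mem[OF MT pT] m by blast
  qed
  from this[OF assms(2)] this[OF assms(1)] show ?thesis using assms(3) by (intro equalityI) simp_all
qed

lemma T_inter_eq_gen:
  assumes "subcategory \<C> \<Y>" "\<I> \<subseteq> \<Y>"
  shows "\<T> \<inter> \<Y> = gen \<C> (part \<Y> \<union> ind \<C> \<I>)"
proof -
  have "subcategory \<C> (\<T> \<inter> \<Y>)"
  proof (rule subcategoryI)
    show "Z \<in> \<T> \<inter> \<Y>" if "zero_object \<C> Z" for Z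
      using subcategoryD(1)[OF T_facts(3) that] subcategoryD(1)[OF assms(1) that] by simp
    show "S \<in> \<T> \<inter> \<Y>" if "is_dsum \<C> S A B" "A \<in> \<T> \<inter> \<Y>" "B \<in> \<T> \<inter> \<Y>" for S A B
      using subcategoryD(2)[OF T_facts(3) that(1)] subcategoryD(2)[OF assms(1) that(1)] that(2,3) by simp
    show "A \<in> \<T> \<inter> \<Y> \<and> B \<in> \<T> \<inter> \<Y>" if "is_dsum \<C> S A B" "S \<in> \<T> \<inter> \<Y>" for S A B
      using subcategoryD(3,4)[OF T_facts(3) that(1)] subcategoryD(3,4)[OF assms(1) that(1)] that(2) by simp
  qed
  then have eq: "\<T> \<inter> \<Y> = gen \<C> {L \<in> \<T> \<inter> \<Y>. loc L}" by (rule subcategory_eq_gen)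
  have l: "{L \<in> \<T> \<inter> \<Y>. loc L} = part \<Y> \<union> ind \<C> \<I>" 
    using assms(2) I_T by (auto simp: ind_loc)
  show ?thesis using eq unfolding l .
qed

text \<open>A rooted cluster algebra contains its seed, so equal images have equal exchangeable
  variables. Those of the second component determine \<open>part \<Y>\<close>, from which both
  members of the pair are reconstructed.\<close>

lemma pair_inj:
  assumes "cotorsion_pair \<C> \<X> \<Y>" "core \<X> \<Y> = \<I>" "cotorsion_pair \<C> \<X>' \<Y>'" "core \<X>' \<Y>' = \<I>"
    and "subalgebra_pair \<C> \<chi> \<T> \<I> (\<X>, \<Y>) = subalgebra_pair \<C> \<chi> \<T> \<I> (\<X>', \<Y>')"
  shows "\<X> = \<X>' \<and> \<Y> = \<Y>'"
proof -
  interpret c: cy_cotorsion_tilting \<C> \<I> \<X> \<Y> \<T> using cotorsion_parts[OF assms(1,2)] .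
  interpret d: cy_cotorsion_tilting \<C> \<I> \<X>' \<Y>' \<T> using cotorsion_parts[OF assms(3,4)] .
  have "\<chi> ` part \<Y> = \<chi> ` part \<Y>'"
    using assms(5) unfolding subalgebra_pair_eq[OF assms(1,2)] subalgebra_pair_eq[OF assms(3,4)]
    by (simp add: rooted_cluster_algebra_def restrict_quiver_def)
  then have "part \<Y> = part \<Y>'" by (rule part_inj[OF c.XY(2) d.XY(2)])
  then have "\<T> \<inter> \<Y> = \<T> \<inter> \<Y>'" using T_inter_eq_gen[OF c.XY(2,6)] T_inter_eq_gen[OF d.XY(2,6)] by simp
  then have X: "\<X> = \<X>'" using c.X_characterization d.X_characterization by simp
  moreover have "M \<in> \<Y> \<longleftrightarrow> M \<in> \<Y>'" for M
    unfolding c.Y_characterization[of M] d.Y_characterization[of M] X ..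
  then have "\<Y> = \<Y>'" by (rule set_eqI)
  ultimately show ?thesis by blast
qed

lemma pair_image:
  assumes "cotorsion_pair \<C> \<X> \<Y>" "core \<X> \<Y> = \<I>"
  shows "subalgebra_pair \<C> \<chi> \<T> \<I> (\<X>, \<Y>) \<in> complete_pairs \<Sigma> (\<chi> ` ind \<C> \<I>)"
proof -
  interpret c: cy_cotorsion_tilting \<C> \<I> \<X> \<Y> \<T> using cotorsion_parts[OF assms] .
  have d: "part \<X> \<inter> part \<Y> = {}" using c.core by blast
  have "\<chi> ` part \<X> \<inter> \<chi> ` part \<Y> = {}"
  proof -
    have "False" if M: "M \<in> part \<X>" and N: "N \<in> part \<Y>" and e: "\<chi> M = \<chi> N" for M N
    proof -
      have "isomorphic \<C> M N" using chi_inj[of M N] M N e by blast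
      then have "N \<in> part \<X>" by (rule part_iso[OF c.XY(1) M])
      then show False using N d by blast
    qed
    then show ?thesis by blast
  qed
  moreover have "part \<X> \<union> part \<Y> = part UNIV" using c.T_loc by (auto simp: ind_loc)
  then have "\<chi> ` part \<X> \<union> \<chi> ` part \<Y> = \<chi> ` part UNIV" by (simp add: image_Un[symmetric])
  moreover have "separated \<Sigma> (\<chi> ` part \<X>) (\<chi> ` part \<Y>)"
    unfolding separated_def
  proof (intro ballI)
    fix i j assume "i \<in> \<chi> ` part \<X>" "j \<in> \<chi> ` part \<Y>"
    then obtain M N where M: "M \<in> part \<X>" "i = \<chi> M" and N: "N \<in> part \<Y>" "j = \<chi> N" by blast
    have rM: "r M \<in> part \<X>" "r N \<in> part \<Y>" using part_iso[OF c.XY(1) M(1) r_iso(1)] part_iso[OF c.XY(2) N(1) r_iso(1)] by auto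
    then have l: "loc (r M)" "r M \<notin> \<I>" "loc (r N)" "r N \<notin> \<I>" "r M \<in> \<X>" "r N \<in> \<Y>" by (auto simp: ind_loc)
    have "irr_dim \<C> \<T> (r M) (r N) = 0" "irr_dim \<C> \<T> (r N) (r M) = 0"
      using irr_dim_factors[OF l(1,2,3,4) I_T] irr_dim_factors[OF l(3,4,1,2) I_T] c.factors_XY[OF l(5,6)] c.factors_YX[OF l(6,5)] by blast+
    then show "arr \<Sigma> i j = 0 \<and> arr \<Sigma> j i = 0"
      using seed_facts(3)[of M N] seed_facts(3)[of N M] M N by simp
  qed
  ultimately show ?thesis unfolding complete_pairs_eq subalgebra_pair_eq[OF assms] by blast
qed

lemma pair_surj:
  assumes E: "E1 \<inter> E2 = {}" "E1 \<union> E2 = \<chi> ` part UNIV" "separated \<Sigma> E1 E2"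
  shows "\<exists>\<X> \<Y>. cotorsion_pair \<C> \<X> \<Y> \<and> core \<X> \<Y> = \<I> \<and> \<chi> ` part \<X> = E1 \<and> \<chi> ` part \<Y> = E2"
proof -
  let ?P = "\<lambda>E. {M \<in> part UNIV. \<chi> M \<in> E}"
  have AB: "?P E1 \<inter> ?P E2 = {}" "?P E1 \<union> ?P E2 = part UNIV" using E(1,2) by blast+
  have img: "\<chi> ` {M \<in> D. \<chi> M \<in> E} = E" if "E \<subseteq> \<chi> ` D" for D E using that by blast
  have "E1 \<subseteq> \<chi> ` part UNIV" "E2 \<subseteq> \<chi> ` part UNIV" unfolding E(2)[symmetric] by (rule Un_upper1 Un_upper2)+
  then have chiA: "\<chi> ` ?P E1 = E1" "\<chi> ` ?P E2 = E2" by (simp_all only: img)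
  obtain H0 where H0: "finite H0" "\<forall>L\<in>H0. loc L" "\<T> = gen \<C> H0"
    using gen_loc_finite[of "{T}"] T_facts(2) by auto
  \<comment> \<open>Passing to representatives makes \<open>r x = x\<close> on \<open>H\<close>, so
    that the arrows of \<open>\<Sigma>\<close> between these objects are the numbers
    \<open>irr_dim \<C> \<T> x y\<close>.\<close>
  define H where "H = r ` H0"
  have fin: "finite H" using H0(1) by (simp add: H_def)
  have Hloc: "\<forall>L\<in>H. loc L" using H0(2) loc_isomorphic[OF _ r_iso(1)] unfolding H_def by blast
  have Hr: "r L = L" if L: "L \<in> H" for L
  proof -
    obtain K where "L = r K" using L unfolding H_def by blast
    moreover have "iso_class \<C> (r K) = iso_class \<C> K" using iso_class_eq r_iso(2) by blast
    ultimately show ?thesis by simp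
  qed
  have HT: "H \<subseteq> \<T>" unfolding H_def using H0(3) gen_base[of H0] subcategoryD(5)[OF T_facts(3) r_iso(1)] by blast
  have "H0 \<subseteq> gen \<C> H" unfolding H_def using gen_base[of "r ` H0"] subcategoryD(5)[OF gen_subcategory r_iso(2)] by blast
  then have TH: "\<T> = gen \<C> H" using H0(3) gen_gen[of H0 H] gen_subset[OF T_facts(3) HT] by blast
  have irr: "irr_dim \<C> \<T> x y = 0" "irr_dim \<C> \<T> y x = 0" "\<not> isomorphic \<C> x y" "\<not> isomorphic \<C> y x"
    if x: "x \<in> H \<inter> ?P E1" and y: "y \<in> H \<inter> ?P E2" for x y
  proof -
    have xy: "x \<in> ind \<C> \<T>" "y \<in> ind \<C> \<T>" "x \<notin> Proj \<C>" "r x = x" "r y = y" using x y Proj_I Hr by auto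
    have "arr \<Sigma> (\<chi> x) (\<chi> y) = 0 \<and> arr \<Sigma> (\<chi> y) (\<chi> x) = 0" using E(3) x y unfolding separated_def by blast
    then show "irr_dim \<C> \<T> x y = 0" "irr_dim \<C> \<T> y x = 0"
      using seed_facts(3)[OF xy(1,2)] seed_facts(3)[OF xy(2,1)] xy(3-5) by simp_all
    have "\<chi> x \<noteq> \<chi> y" using x y E(1) by auto
    then show "\<not> isomorphic \<C> x y" "\<not> isomorphic \<C> y x" using chi_iso[of x y] chi_iso[of y x] xy by (auto simp: ind_def)
  qed
  have irrH: "irr_dim \<C> (gen \<C> H) x y = 0" "irr_dim \<C> (gen \<C> H) y x = 0" if "x \<in> H \<inter> ?P E1" "y \<in> H \<inter> ?P E2" for x y
    unfolding TH[symmetric] by (rule irr(1)[OF that], rule irr(2)[OF that])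
  have HAB: "H \<subseteq> (H \<inter> ?P E1) \<union> (H \<inter> ?P E2) \<union> \<I>"
  proof
    fix L assume L: "L \<in> H"
    then have "L \<in> \<I> \<or> L \<in> part UNIV" using HT Hloc by (auto simp: ind_loc)
    then show "L \<in> (H \<inter> ?P E1) \<union> (H \<inter> ?P E2) \<union> \<I>" using L AB(2) by blast
  qed
  then have HBA: "H \<subseteq> (H \<inter> ?P E2) \<union> (H \<inter> ?P E1) \<union> \<I>" by blast
  have facAB: "factors \<C> \<I> x y f" if "x \<in> H \<inter> ?P E1" "y \<in> H \<inter> ?P E2" "f \<in> Hom \<C> x y" for x y f
    by (rule factors_of_irr_dim[OF fin Hloc Int_lower1 Int_lower1 HAB irr(3) irrH(1) that])
  have facBA: "factors \<C> \<I> y x f" if "x \<in> H \<inter> ?P E1" "y \<in> H \<inter> ?P E2" "f \<in> Hom \<C> y x" for x y f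
    by (rule factors_of_irr_dim[OF fin Hloc Int_lower1 Int_lower1 HBA irr(4) irrH(2) that(2,1,3)])
  define A where "A = gen \<C> ((H \<inter> ?P E1) \<union> \<I>)"
  define B where "B = gen \<C> ((H \<inter> ?P E2) \<union> \<I>)"
  have facI: "factors \<C> \<I> x y f" if xy: "x \<in> \<I> \<or> y \<in> \<I>" and f: "f \<in> Hom \<C> x y" for x y f
    using xy
  proof
    assume "x \<in> \<I>"
    then show ?thesis unfolding factors_def using f Id_in_Hom[of x] Comp_Id_right[OF f] by metis
  next
    assume "y \<in> \<I>"
    then show ?thesis unfolding factors_def using f Id_in_Hom[of y] Comp_Id_left[OF f] by metis
  qed
  have ind_gen: "M \<in> gen \<C> ((H \<inter> ?P E) \<union> \<I>)" if M: "M \<in> ?P E" for M E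
  proof -
    have MT: "M \<in> \<T>" "loc M" "M \<in> part UNIV" using M by (auto simp: ind_loc)
    then obtain L where L: "L \<in> H" "isomorphic \<C> M L" using gen_loc_isomorphic[OF Hloc _ MT(2)] TH by blast
    have "\<chi> L = \<chi> M" using chi_iso[OF MT(1) L(2)] by simp
    moreover have "L \<in> part UNIV" using part_iso[OF UNIV_subcategory MT(3) L(2)] .
    ultimately have "L \<in> (H \<inter> ?P E) \<union> \<I>" using M L(1) by simp
    then have "L \<in> gen \<C> ((H \<inter> ?P E) \<union> \<I>)" using gen_base[of "(H \<inter> ?P E) \<union> \<I>"] by blast
    then show ?thesis using subcategoryD(5)[OF gen_subcategory isomorphic_sym[OF L(2)]] by blast
  qed
  interpret p: cy_partition \<C> \<I> \<T> A B
  proof (intro cy_partition.intro cy_partition_axioms.intro cy_core_axioms T_facts(1))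
    show "subcategory \<C> A" "subcategory \<C> B" unfolding A_def B_def by (rule gen_subcategory)+
    show IA: "\<I> \<subseteq> A" and IB: "\<I> \<subseteq> B"
      unfolding A_def B_def using gen_base[of "(H \<inter> ?P E1) \<union> \<I>"] gen_base[of "(H \<inter> ?P E2) \<union> \<I>"] by blast+
    have "(H \<inter> ?P E) \<union> \<I> \<subseteq> \<T>" for E using HT I_T by blast
    note sub = gen_subset[OF T_facts(3) this]
    show "A \<subseteq> \<T>" "B \<subseteq> \<T>" unfolding A_def B_def by (rule sub)+
    show "M \<in> A \<or> M \<in> B" if "M \<in> \<T>" "loc M" for M
    proof (cases "M \<in> \<I>")
      case True
      then show ?thesis using IA by blast
    next
      case False
      then have "M \<in> ?P E1 \<or> M \<in> ?P E2" using that AB(2) by (auto simp: ind_loc)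
      then show ?thesis unfolding A_def B_def using ind_gen by blast
    qed
    show "factors \<C> \<I> M N f" if "M \<in> A" "N \<in> B" "f \<in> Hom \<C> M N" for M N f
    proof (rule factors_gen[OF _ that(1)[unfolded A_def] that(2)[unfolded B_def] that(3)])
      fix x y f assume "x \<in> (H \<inter> ?P E1) \<union> \<I>" "y \<in> (H \<inter> ?P E2) \<union> \<I>" "f \<in> Hom \<C> x y"
      then show "factors \<C> \<I> x y f" using facAB[of x y f] facI[of x y f] by blast
    qed
    show "factors \<C> \<I> N M f" if "M \<in> A" "N \<in> B" "f \<in> Hom \<C> N M" for M N f
    proof (rule factors_gen[OF _ that(2)[unfolded B_def] that(1)[unfolded A_def] that(3)])
      fix y x f assume "y \<in> (H \<inter> ?P E2) \<union> \<I>" "x \<in> (H \<inter> ?P E1) \<union> \<I>" "f \<in> Hom \<C> y x"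
      then show "factors \<C> \<I> y x f" using facBA[of x y f] facI[of y x f] by blast
    qed
  qed
  let ?X = "side \<C> \<I> B" and ?Y = "side \<C> \<I> A"
  have AX: "A \<subseteq> ?X" and BY: "B \<subseteq> ?Y"
    using p.A_sub_X cy_partition.A_sub_X[OF p.partition_sym] by auto
  \<comment> \<open>An object of \<open>D\<close> on the \<open>side\<close> formed with
    \<open>D\<close> has its identity factoring through \<open>\<I>\<close>. This keeps the
    indecomposables of one half out of the side formed with that half.\<close>
  have no: "M \<in> \<I>" if "M \<in> D" "M \<in> side \<C> \<I> D" for M D
    using that factors_Id_in[OF I_subcategory, of M] Id_in_Hom[of M] unfolding side_def by blast
  have PA: "?P E1 \<subseteq> A" and PB: "?P E2 \<subseteq> B" unfolding A_def B_def using ind_gen by blast+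
  have "part ?X = ?P E1"
  proof (intro equalityI subsetI)
    fix M assume M: "M \<in> part ?X"
    then have "M \<notin> ?P E2" using no[of M B] PB by blast
    moreover have "M \<in> part UNIV" using M by blast
    ultimately show "M \<in> ?P E1" using AB(2) by blast
  next
    fix M assume M: "M \<in> ?P E1"
    then have "M \<in> ?X" using PA AX by blast
    then show "M \<in> part ?X" using M by blast
  qed
  moreover have "part ?Y = ?P E2"
  proof (intro equalityI subsetI)
    fix M assume M: "M \<in> part ?Y"
    then have "M \<notin> ?P E1" using no[of M A] PA by blast
    moreover have "M \<in> part UNIV" using M by blast
    ultimately show "M \<in> ?P E2" using AB(2) by blast
  next
    fix M assume M: "M \<in> ?P E2"
    then have "M \<in> ?Y" using PB BY by blast
    then show "M \<in> part ?Y" using M by blast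
  qed
  ultimately have "cotorsion_pair \<C> ?X ?Y \<and> core ?X ?Y = \<I> \<and> \<chi> ` part ?X = E1 \<and> \<chi> ` part ?Y = E2"
    using p.cotorsion_from_partition p.X_Y_core chiA by (simp add: core_def)
  then show ?thesis by blast
qed

lemma cotorsion_pairs_bij:
  "bij_betw (subalgebra_pair \<C> \<chi> \<T> \<I>) {(\<X>, \<Y>). cotorsion_pair \<C> \<X> \<Y> \<and> core \<X> \<Y> = \<I>}
    (complete_pairs \<Sigma> (\<chi> ` ind \<C> \<I>))"
  unfolding bij_betw_def
proof
  show "inj_on (subalgebra_pair \<C> \<chi> \<T> \<I>) {(\<X>, \<Y>). cotorsion_pair \<C> \<X> \<Y> \<and> core \<X> \<Y> = \<I>}"
  proof (rule inj_onI)
    fix p p' assume p: "p \<in> {(\<X>, \<Y>). cotorsion_pair \<C> \<X> \<Y> \<and> core \<X> \<Y> = \<I>}"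
      "p' \<in> {(\<X>, \<Y>). cotorsion_pair \<C> \<X> \<Y> \<and> core \<X> \<Y> = \<I>}"
      "subalgebra_pair \<C> \<chi> \<T> \<I> p = subalgebra_pair \<C> \<chi> \<T> \<I> p'"
    then show "p = p'" using pair_inj[of "fst p" "snd p" "fst p'" "snd p'"] by (simp add: case_prod_beta prod_eq_iff)
  qed
  show "subalgebra_pair \<C> \<chi> \<T> \<I> ` {(\<X>, \<Y>). cotorsion_pair \<C> \<X> \<Y> \<and> core \<X> \<Y> = \<I>} = complete_pairs \<Sigma> (\<chi> ` ind \<C> \<I>)"
  proof (intro equalityI subsetI)
    fix q assume "q \<in> subalgebra_pair \<C> \<chi> \<T> \<I> ` {(\<X>, \<Y>). cotorsion_pair \<C> \<X> \<Y> \<and> core \<X> \<Y> = \<I>}"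
    then show "q \<in> complete_pairs \<Sigma> (\<chi> ` ind \<C> \<I>)" using pair_image by force
  next
    fix q assume "q \<in> complete_pairs \<Sigma> (\<chi> ` ind \<C> \<I>)"
    then obtain E1 E2 where E: "E1 \<inter> E2 = {}" "E1 \<union> E2 = \<chi> ` part UNIV" "separated \<Sigma> E1 E2"
      "q = (rooted_cluster_algebra (restrict_quiver \<Sigma> (\<chi> ` ind \<C> \<I>) E1), rooted_cluster_algebra (restrict_quiver \<Sigma> (\<chi> ` ind \<C> \<I>) E2))"
      unfolding complete_pairs_eq by blast
    obtain \<X> \<Y> where XY: "cotorsion_pair \<C> \<X> \<Y>" "core \<X> \<Y> = \<I>" "\<chi> ` part \<X> = E1" "\<chi> ` part \<Y> = E2"
      using pair_surj[OF E(1-3)] by blast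
    then have "q = subalgebra_pair \<C> \<chi> \<T> \<I> (\<X>, \<Y>)" using E(4) subalgebra_pair_eq[OF XY(1,2)] by simp
    then show "q \<in> subalgebra_pair \<C> \<chi> \<T> \<I> ` {(\<X>, \<Y>). cotorsion_pair \<C> \<X> \<Y> \<and> core \<X> \<Y> = \<I>}" using XY(1,2) by blast
  qed
qed

end

theorem theorem5p4:
  fixes \<C> :: "('k::field, 'o, 'm::ab_group_add, 'e::ab_group_add) extri_data"
    and T :: 'o
    and \<T> \<I> :: "'o set"
    and \<chi> :: "'o \<Rightarrow> 'f::field_char_0"
    and \<Sigma> :: "'f seed"
  assumes "two_calabi_yau_category \<C>"
    and "krull_schmidt \<C>"
    and "enough_projectives \<C>"
    and "enough_injectives \<C>"
    and "cluster_structure \<C>"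
    and "cluster_tilting_object \<C> T"
    and "\<not> zero_object \<C> T"
    and "\<T> = add_obj \<C> T"
    and "cluster_map \<C> T \<chi>"
    and "\<Sigma> = seed_of \<chi> (tilting_quiver \<C> \<T>)"
    and "subcategory \<C> \<I>"
    and "rigid \<C> \<I>"
    and "\<I> \<subseteq> \<T>"
    and "Proj \<C> \<subseteq> \<I>"
  shows "bij_betw (subalgebra_pair \<C> \<chi> \<T> \<I>)
           {(\<X>, \<Y>). cotorsion_pair \<C> \<X> \<Y> \<and> core \<X> \<Y> = \<I>}
           (complete_pairs \<Sigma> (\<chi> ` ind \<C> \<I>)) \<and>
         bij_betw (subalgebra_pair \<C> \<chi> \<T> (ProjInj \<C>))
           {(\<X>, \<Y>). t_structure \<C> \<X> \<Y>}
           (complete_pairs \<Sigma> (\<chi> ` ind \<C> (ProjInj \<C>)))"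
proof -
  interpret cy_category \<C>
    using two_calabi_yau_category.two_cy_cy_category[OF assms(1-4)] .
  have hom: "hom_finite_extriangulated_category \<C>" using two_calabi_yau_category.hom_finite[OF assms(1)] .
  note ct = cluster_tilting_fin_tilting[OF assms(6)]
  have \<chi>_iso: "\<chi> A = \<chi> B" if A: "A \<in> add_obj \<C> T" and AB: "isomorphic \<C> A B" for A B
  proof -
    have "A \<in> reachable_objects \<C>" using A assms(6) unfolding reachable_objects_def by blast
    then show ?thesis using assms(9) AB unfolding cluster_map_def Let_def by blast
  qed
  have \<chi>_inj: "isomorphic \<C> M N" if "M \<in> ind \<C> (add_obj \<C> T)" "N \<in> ind \<C> (add_obj \<C> T)" "\<chi> M = \<chi> N" for M N
  proof -
    have "M \<in> ind_summands \<C> T" "N \<in> ind_summands \<C> T" using that(1,2) loc_summand unfolding ind_loc ct(2) by auto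
    then show ?thesis using assms(6,9) that(3) unfolding cluster_map_def Let_def by blast
  qed
  \<comment> \<open>Stated for an arbitrary core, to serve both for \<open>\<I>\<close> and for the
    projective-injectives.\<close>
  have main: "bij_betw (subalgebra_pair \<C> \<chi> \<T> \<J>) {(\<X>, \<Y>). cotorsion_pair \<C> \<X> \<Y> \<and> core \<X> \<Y> = \<J>}
      (complete_pairs \<Sigma> (\<chi> ` ind \<C> \<J>))"
    if J: "subcategory \<C> \<J>" "rigid \<C> \<J>" "\<J> \<subseteq> \<T>" "Proj \<C> \<subseteq> \<J>" for \<J>
  proof -
    have "\<J> \<subseteq> gen \<C> {T}" using J(3) ct(2) assms(8) by simp
    then obtain G where "finite G" "\<J> = gen \<C> G" using gen_subcategory_finite[of "{T}" \<J>] J(1) by auto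
    then have fin: "fin_gen \<C> \<J>" unfolding fin_gen_def by (intro exI[of _ G]) simp
    have core: "cy_core \<C> \<J>"
    proof (intro cy_core.intro cy_core_axioms.intro cy_category_axioms fin J(2))
      show "P \<in> \<J>" if "\<forall>W. Ext \<C> P W = {0}" for P
        using that J(4) projective_iff[of P] by (auto simp: Proj_def)
    qed
    have "cluster_setting \<C> \<J> T \<chi>"
    proof (intro cluster_setting.intro cluster_setting_axioms.intro cy_quiver.intro hom core assms(6) J(4))
      show "\<J> \<subseteq> add_obj \<C> T" using J(3) assms(8) by simp
    qed (fact \<chi>_iso \<chi>_inj)+
    from cluster_setting.cotorsion_pairs_bij[OF this] show ?thesis using assms(8,10) by simp
  qed
  \<comment> \<open>As a perpendicular subcategory, \<open>ProjInj \<C>\<close> is closed under sums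
    and summands, and it is rigid because all extensions from its objects vanish.\<close>
  have e: "ProjInj \<C> = perp \<C> UNIV" unfolding Proj_eq_ProjInj by (simp add: Proj_def projective_iff perp_def)
  have "subcategory \<C> (ProjInj \<C>)" unfolding e by (rule perp_subcategory)
  moreover have "rigid \<C> (ProjInj \<C>)" unfolding e by (simp add: rigid_def Ext_vanish_def perp_def)
  moreover have "ProjInj \<C> \<subseteq> \<T>" "Proj \<C> \<subseteq> ProjInj \<C>" using assms(13,14) unfolding Proj_eq_ProjInj by blast+
  ultimately have "bij_betw (subalgebra_pair \<C> \<chi> \<T> (ProjInj \<C>)) {(\<X>, \<Y>). t_structure \<C> \<X> \<Y>}
      (complete_pairs \<Sigma> (\<chi> ` ind \<C> (ProjInj \<C>)))"
    using main[of "ProjInj \<C>"] by (simp add: t_structure_def)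
  then show ?thesis using main[OF assms(11-14)] by blast
qed

end
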